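(* Let $u$ be the solution of $$P(\partial_t)u-\Delta u=f\ \text{in }\Omega\times(0,T],\qquad u=0\ \text{on }\partial\Omega\times(0,T],\qquad u(0)=v,$$ and assume that $u$ is sufficiently smooth. Let $K\in\mathbb N$, $\tau=T/K$, $t_n=n\tau$, and let $\{U^n\}\subset X_h$ be the solution of the fully discrete scheme, for $n=0,\dots,K-1$, $$P_0(U^{n+1},\chi)+\gamma(\nabla U^{n+1},\nabla\chi)=\sum_{j=0}^{n-1}(P_j-P_{j+1})(U^{n-j},\chi)+P_n(U^0,\chi)+\gamma(F^{n+1},\chi)\quad\forall\chi\in X_h,$$ where $F^{n+1}=f(\cdot,t_{n+1})$, with $U^0\in X_h$ such that $\|U^0-v\|_{L^2(\Omega)}\le Ch^2\|v\|_{\dot H^2(\Omega)}$. Then there holds, for $1\le n\le K$, $$\|u(t_n)-U^n\|_{L^2(\Omega)}\le C\Bigl(h^2\bigl(\|v\|_{H^2(\Omega)}+\|f\|_{L^\infty(0,T;L^2(\Omega))}+\max_{0<t\le t_n}\|u_t\|_{\dot H^2(\Omega)}\bigr)+\tau^{2-\alpha}\max_{0<t\le t_n}\|u_{tt}(t)\|_{L^2(\Omega)}\Bigr).$$ Here $C$ denotes a generic constant, which may differ at different occurrences, but is always independent of the mesh size $h$ and the time step size $\tau$.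
   Context: $\Omega\subset\mathbb R^d$ ($d\in\{1,2,3\}$) is a bounded convex polygonal (polyhedral) domain, $T>0$ is fixed, $m\ge 0$ is an integer, $0<\alpha_m\le\dots\le\alpha_1<\alpha<1$, $b_i>0$ for $i=1,\dots,m$. For $0<\beta<1$ the Caputo derivative is $\partial_t^\beta u(t)=\frac1{\Gamma(1-\beta)}\int_0^t(t-s)^{-\beta}\frac{d}{ds}u(s)\,ds$, and $P(\partial_t)=\partial_t^\alpha+\sum_{i=1}^m b_i\partial_t^{\alpha_i}$. $\dot H^2(\Omega)=H^2(\Omega)\cap H_0^1(\Omega)$ with norm $\|v\|_{\dot H^2(\Omega)}=\|\Delta v\|_{L^2(\Omega)}$; $(\cdot,\cdot)$ is the $L^2(\Omega)$ inner product. $\{\mathcal T_h\}_{0<h<1}$ is a shape regular, quasi-uniform family of partitions of $\Omega$ into $d$-simplexes with maximum diameter $h$; $X_h=\{\chi\in H_0^1(\Omega):\chi|_{S}\text{ is linear for all simplexes }S\in\mathcal T_h\}$. For $0<\beta<1$ and integers $j\ge0$, $d_{\beta,j}=(j+1)^{1-\beta}-j^{1-\beta}$. The coefficients of the scheme are $$P_j=d_{\alpha,j}+\sum_{i=1}^m\frac{\Gamma(2-\alpha)\,b_i\,d_{\alpha_i,j}\,\tau^{\alpha-\alpha_i}}{\Gamma(2-\alpha_i)},\qquad \gamma=\Gamma(2-\alpha)\tau^\alpha .$$ *)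

theory Defs
  imports "HOL-Analysis.Analysis" "HOL-Probability.Essential_Supremum"
begin

section \<open>The Hilbert space of square integrable functions\<close>

definition sq_integrable :: "(real^'n \<Rightarrow> real) \<Rightarrow> bool" where
  "sq_integrable f \<longleftrightarrow> f \<in> borel_measurable lborel \<and> integrable lborel (\<lambda>x. (f x)\<^sup>2)"

lemma sq_integrable_mult:
  assumes "sq_integrable f" "sq_integrable g"
  shows "integrable lborel (\<lambda>x. f x * g x)"
proof (rule Bochner_Integration.integrable_bound)
  show "integrable lborel (\<lambda>x. (f x)\<^sup>2 + (g x)\<^sup>2)"
    using assms by (auto simp: sq_integrable_def)
  show "(\<lambda>x. f x * g x) \<in> borel_measurable lborel"
    using assms by (auto simp: sq_integrable_def)
  show "AE x in lborel. norm (f x * g x) \<le> norm ((f x)\<^sup>2 + (g x)\<^sup>2)"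
  proof (rule AE_I2)
    fix x
    have "0 \<le> (\<bar>f x\<bar> - \<bar>g x\<bar>)\<^sup>2" by simp
    then have "2 * (\<bar>f x\<bar> * \<bar>g x\<bar>) \<le> (f x)\<^sup>2 + (g x)\<^sup>2"
      by (simp add: power2_diff)
    moreover have "0 \<le> \<bar>f x\<bar> * \<bar>g x\<bar>" by simp
    ultimately show "norm (f x * g x) \<le> norm ((f x)\<^sup>2 + (g x)\<^sup>2)"
      unfolding real_norm_def abs_mult by linarith
  qed
qed

lemma sq_integrable_zero: "sq_integrable (\<lambda>x::real^'n::finite. 0)"
  by (simp add: sq_integrable_def)

lemma sq_integrable_add:
  assumes "sq_integrable f" "sq_integrable g"
  shows "sq_integrable (\<lambda>x. f x + g x)"
  using assms sq_integrable_mult[OF assms]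
  by (auto simp: sq_integrable_def power2_sum mult.assoc)

lemma sq_integrable_scale:
  assumes "sq_integrable f"
  shows "sq_integrable (\<lambda>x. c * f x)"
  using assms by (auto simp: sq_integrable_def power_mult_distrib)

quotient_type (overloaded) 'n L2 = "real^'n::finite \<Rightarrow> real" /
  partial: "\<lambda>f g. sq_integrable f \<and> sq_integrable g \<and> (AE x in lborel. f x = g x)"
proof (rule part_equivpI)
  show "\<exists>f::real^'n \<Rightarrow> real. sq_integrable f \<and> sq_integrable f \<and> (AE x in lborel. f x = f x)"
    using sq_integrable_zero by auto
  show "symp (\<lambda>f g::real^'n \<Rightarrow> real. sq_integrable f \<and> sq_integrable g \<and> (AE x in lborel. f x = g x))"
    by (rule sympI) (auto elim: AE_mp)
  show "transp (\<lambda>f g::real^'n \<Rightarrow> real. sq_integrable f \<and> sq_integrable g \<and> (AE x in lborel. f x = g x))"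
    by (rule transpI) auto
qed

instantiation L2 :: (finite) real_inner
begin

lift_definition zero_L2 :: "'a L2" is "\<lambda>x. 0"
  by (simp add: sq_integrable_zero)

lift_definition plus_L2 :: "'a L2 \<Rightarrow> 'a L2 \<Rightarrow> 'a L2" is "\<lambda>f g x. f x + g x"
  by (auto intro: sq_integrable_add)

lift_definition scaleR_L2 :: "real \<Rightarrow> 'a L2 \<Rightarrow> 'a L2" is "\<lambda>c f x. c * f x"
  by (auto intro: sq_integrable_scale)

lift_definition inner_L2 :: "'a L2 \<Rightarrow> 'a L2 \<Rightarrow> real" is "\<lambda>f g. LINT x|lborel. f x * g x"
  by (rule integral_cong_AE) (auto simp: sq_integrable_def)

definition uminus_L2 :: "'a L2 \<Rightarrow> 'a L2" where "- u = (- 1) *\<^sub>R (u :: 'a L2)"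
definition minus_L2 :: "'a L2 \<Rightarrow> 'a L2 \<Rightarrow> 'a L2" where "u - w = u + - (w :: 'a L2)"
definition norm_L2 :: "'a L2 \<Rightarrow> real" where "norm u = sqrt (inner u (u :: 'a L2))"
definition sgn_L2 :: "'a L2 \<Rightarrow> 'a L2" where "sgn u = inverse (norm u) *\<^sub>R (u :: 'a L2)"
definition dist_L2 :: "'a L2 \<Rightarrow> 'a L2 \<Rightarrow> real" where "dist u w = norm (u - (w :: 'a L2))"
definition uniformity_L2 :: "('a L2 \<times> 'a L2) filter" where
  "uniformity_L2 = (INF e\<in>{0<..}. principal {(u, w). dist u w < e})"
definition open_L2 :: "'a L2 set \<Rightarrow> bool" where
  "open_L2 S \<longleftrightarrow> (\<forall>u\<in>S. \<forall>\<^sub>F (u', w) in uniformity. u' = u \<longrightarrow> w \<in> S)"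

instance
proof
  fix u v w :: "'a L2" and r s :: real and S :: "'a L2 set"
  show "u + v + w = u + (v + w)"
    by transfer (auto intro: sq_integrable_add simp: add.assoc)
  show "u + v = v + u"
    by transfer (auto intro: sq_integrable_add simp: add.commute)
  show "0 + u = u"
    by transfer auto
  show "- u + u = 0"
    unfolding uminus_L2_def
    by transfer (use sq_integrable_zero in auto)
  show "u - v = u + - v"
    by (simp add: minus_L2_def)
  show "r *\<^sub>R (u + v) = r *\<^sub>R u + r *\<^sub>R v"
    by transfer (auto intro!: sq_integrable_add sq_integrable_scale simp: algebra_simps)
  show "(r + s) *\<^sub>R u = r *\<^sub>R u + s *\<^sub>R u"
    by transfer (auto intro!: sq_integrable_add sq_integrable_scale simp flip: distrib_right)
  show "r *\<^sub>R s *\<^sub>R u = (r * s) *\<^sub>R u"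
    by transfer (auto intro!: sq_integrable_scale simp: mult.assoc simp flip: mult.assoc)
  show "1 *\<^sub>R u = u"
    by transfer auto
  show "dist u v = norm (u - v)"
    by (simp add: dist_L2_def)
  show "sgn u = inverse (norm u) *\<^sub>R u"
    by (simp add: sgn_L2_def)
  show "uniformity = (INF e\<in>{0<..}. principal {(u :: 'a L2, w). dist u w < e})"
    by (simp add: uniformity_L2_def)
  show "open S \<longleftrightarrow> (\<forall>u\<in>S. \<forall>\<^sub>F (u', w) in uniformity. u' = u \<longrightarrow> w \<in> S)"
    by (simp add: open_L2_def)
  show "inner u v = inner v u"
    by transfer (simp add: mult.commute)
  show "inner (u + v) w = inner u w + inner v w"
    by transfer (simp add: distrib_right sq_integrable_mult)
  show "inner (r *\<^sub>R u) v = r * inner u v"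
    by transfer (simp add: mult.assoc)
  show "0 \<le> inner u u"
    by transfer (auto intro: integral_nonneg_AE)
  show "norm u = sqrt (inner u u)"
    by (simp add: norm_L2_def)
  show "inner u u = 0 \<longleftrightarrow> u = 0"
  proof transfer
    fix f :: "real^'a \<Rightarrow> real"
    assume "sq_integrable f \<and> sq_integrable f \<and> (AE x in lborel. f x = f x)"
    then have f: "sq_integrable f" by simp
    have "(LINT x|lborel. f x * f x) = 0 \<longleftrightarrow> (AE x in lborel. f x * f x = 0)"
      by (rule integral_nonneg_eq_0_iff_AE) (use sq_integrable_mult[OF f f] in auto)
    then show "((LINT x|lborel. f x * f x) = 0) \<longleftrightarrow>
        (sq_integrable f \<and> sq_integrable (\<lambda>x::real^'a. 0::real) \<and> (AE x in lborel. f x = 0))"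
      using f sq_integrable_zero[where 'n = 'a] by simp
  qed
qed

end

text \<open>
  A function in \<open>L\<^sup>2(\<Omega>)\<close> is identified with its extension by zero, so that \<open>norm\<close> and
  \<open>inner\<close> on \<open>L2_on \<Omega>\<close> are the norm and the inner product of \<open>L\<^sup>2(\<Omega>)\<close>.
\<close>

definition L2_on :: "(real^'n) set \<Rightarrow> 'n::finite L2 set" where
  "L2_on \<Omega> = {u. AE x in lborel. x \<notin> \<Omega> \<longrightarrow> rep_L2 u x = 0}"


section \<open>Sobolev spaces\<close>

definition pderiv_dir :: "'n \<Rightarrow> (real^'n \<Rightarrow> real) \<Rightarrow> real^'n \<Rightarrow> real" where
  "pderiv_dir i \<phi> x = frechet_derivative \<phi> (at x) (axis i 1)"

primrec C_diff :: "nat \<Rightarrow> (real^'n::finite \<Rightarrow> real) \<Rightarrow> bool" where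
  "C_diff 0 \<phi> \<longleftrightarrow> continuous_on UNIV \<phi>"
| "C_diff (Suc k) \<phi> \<longleftrightarrow> (\<forall>x. \<phi> differentiable (at x)) \<and> (\<forall>i. C_diff k (pderiv_dir i \<phi>))"

definition test_functions :: "(real^'n::finite) set \<Rightarrow> (real^'n \<Rightarrow> real) set" where
  "test_functions \<Omega> = {\<phi>. (\<forall>k. C_diff k \<phi>) \<and>
     compact (closure {x. \<phi> x \<noteq> 0}) \<and> closure {x. \<phi> x \<noteq> 0} \<subseteq> \<Omega>}"

text \<open>
  Test functions and their derivatives are square integrable, so \<open>abs_L2\<close> below is always
  applied inside the domain of the quotient.
\<close>

definition is_weak_deriv :: "(real^'n) set \<Rightarrow> 'n \<Rightarrow> 'n::finite L2 \<Rightarrow> 'n L2 \<Rightarrow> bool" where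
  "is_weak_deriv \<Omega> i u g \<longleftrightarrow> g \<in> L2_on \<Omega> \<and>
     (\<forall>\<phi>\<in>test_functions \<Omega>. inner u (abs_L2 (pderiv_dir i \<phi>)) = - inner g (abs_L2 \<phi>))"

definition weak_deriv :: "(real^'n) set \<Rightarrow> 'n \<Rightarrow> 'n::finite L2 \<Rightarrow> 'n L2" where
  "weak_deriv \<Omega> i u = (THE g. is_weak_deriv \<Omega> i u g)"

definition H1 :: "(real^'n) set \<Rightarrow> 'n::finite L2 set" where
  "H1 \<Omega> = {u \<in> L2_on \<Omega>. \<forall>i. \<exists>g. is_weak_deriv \<Omega> i u g}"

definition H1_norm :: "(real^'n) set \<Rightarrow> 'n::finite L2 \<Rightarrow> real" where
  "H1_norm \<Omega> u = sqrt ((norm u)\<^sup>2 + (\<Sum>i\<in>UNIV. (norm (weak_deriv \<Omega> i u))\<^sup>2))"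

definition H10 :: "(real^'n) set \<Rightarrow> 'n::finite L2 set" where
  "H10 \<Omega> = {u \<in> H1 \<Omega>. \<forall>\<epsilon>>0. \<exists>\<phi>\<in>test_functions \<Omega>. H1_norm \<Omega> (u - abs_L2 \<phi>) < \<epsilon>}"

definition H2 :: "(real^'n) set \<Rightarrow> 'n::finite L2 set" where
  "H2 \<Omega> = {u \<in> H1 \<Omega>. \<forall>i. weak_deriv \<Omega> i u \<in> H1 \<Omega>}"

definition H2_norm :: "(real^'n) set \<Rightarrow> 'n::finite L2 \<Rightarrow> real" where
  "H2_norm \<Omega> u = sqrt ((norm u)\<^sup>2 + (\<Sum>i\<in>UNIV. (norm (weak_deriv \<Omega> i u))\<^sup>2)
     + (\<Sum>i\<in>UNIV. \<Sum>j\<in>UNIV. (norm (weak_deriv \<Omega> j (weak_deriv \<Omega> i u)))\<^sup>2))"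

definition grad_inner :: "(real^'n) set \<Rightarrow> 'n::finite L2 \<Rightarrow> 'n L2 \<Rightarrow> real" where
  "grad_inner \<Omega> u w = (\<Sum>i\<in>UNIV. inner (weak_deriv \<Omega> i u) (weak_deriv \<Omega> i w))"

definition laplacian :: "(real^'n) set \<Rightarrow> 'n::finite L2 \<Rightarrow> 'n L2" where
  "laplacian \<Omega> u = (\<Sum>i\<in>UNIV. weak_deriv \<Omega> i (weak_deriv \<Omega> i u))"

definition Hdot2 :: "(real^'n) set \<Rightarrow> 'n::finite L2 set" where
  "Hdot2 \<Omega> = H2 \<Omega> \<inter> H10 \<Omega>"

definition Hdot2_norm :: "(real^'n) set \<Rightarrow> 'n::finite L2 \<Rightarrow> real" where
  "Hdot2_norm \<Omega> u = norm (laplacian \<Omega> u)"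


section \<open>Domain and finite element spaces\<close>

definition convex_polyhedral_domain :: "(real^'n::finite) set \<Rightarrow> bool" where
  "convex_polyhedral_domain \<Omega> \<longleftrightarrow>
     open \<Omega> \<and> \<Omega> \<noteq> {} \<and> convex \<Omega> \<and> bounded \<Omega> \<and> polytope (closure \<Omega>)"

text \<open>
  The library predicate \<open>triangulation\<close> says that the mesh is finite, consists of simplices and
  is conforming: two of its simplices meet in a (possibly empty) common face.  The index set
  \<open>H\<close> of mesh sizes is a parameter, since a mesh of maximum diameter \<open>h\<close> cannot exist for
  every \<open>h \<in> (0,1)\<close> if \<open>\<Omega>\<close> has diameter smaller than 1.
\<close>

definition simplicial_partition :: "(real^'n::finite) set \<Rightarrow> (real^'n) set set \<Rightarrow> bool" where
  "simplicial_partition \<Omega> \<T> \<longleftrightarrow>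
     triangulation \<T> \<and> (\<forall>S\<in>\<T>. (int CARD('n)) simplex S) \<and> \<Union>\<T> = closure \<Omega>"

definition shape_regular :: "real set \<Rightarrow> (real \<Rightarrow> (real^'n::finite) set set) \<Rightarrow> bool" where
  "shape_regular H \<T> \<longleftrightarrow>
     (\<exists>\<sigma>>0. \<forall>h\<in>H. \<forall>S\<in>\<T> h. \<exists>x. ball x (\<sigma> * diameter S) \<subseteq> S)"

definition quasi_uniform :: "real set \<Rightarrow> (real \<Rightarrow> (real^'n::finite) set set) \<Rightarrow> bool" where
  "quasi_uniform H \<T> \<longleftrightarrow> (\<exists>c>0. \<forall>h\<in>H. \<forall>S\<in>\<T> h. c * h \<le> diameter S)"

definition mesh_family ::
  "(real^'n::finite) set \<Rightarrow> real set \<Rightarrow> (real \<Rightarrow> (real^'n) set set) \<Rightarrow> bool" where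
  "mesh_family \<Omega> H \<T> \<longleftrightarrow> H \<subseteq> {0<..<1} \<and>
     (\<forall>h\<in>H. simplicial_partition \<Omega> (\<T> h) \<and> Max (diameter ` \<T> h) = h) \<and>
     shape_regular H \<T> \<and> quasi_uniform H \<T>"

definition fe_space :: "(real^'n) set \<Rightarrow> (real^'n) set set \<Rightarrow> 'n::finite L2 set" where
  "fe_space \<Omega> \<T> = {w \<in> H10 \<Omega>. \<forall>S\<in>\<T>. \<exists>a c.
     AE x in lborel. x \<in> S \<longrightarrow> rep_L2 w x = inner a x + c}"



section \<open>The multi-term time-fractional problem\<close>

definition caputo :: "real \<Rightarrow> (real \<Rightarrow> 'b::real_normed_vector) \<Rightarrow> real \<Rightarrow> 'b" where
  "caputo \<beta> u t = (1 / Gamma (1 - \<beta>)) *\<^sub>R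
     integral {0..t} (\<lambda>s. (t - s) powr (- \<beta>) *\<^sub>R vector_derivative u (at s))"

definition multi_caputo :: "real \<Rightarrow> nat \<Rightarrow> (nat \<Rightarrow> real) \<Rightarrow> (nat \<Rightarrow> real) \<Rightarrow>
    (real \<Rightarrow> 'b::real_normed_vector) \<Rightarrow> real \<Rightarrow> 'b" where
  "multi_caputo \<alpha> m a b u t = caputo \<alpha> u t + (\<Sum>i=1..m. b i *\<^sub>R caputo (a i) u t)"

definition order_params :: "real \<Rightarrow> nat \<Rightarrow> (nat \<Rightarrow> real) \<Rightarrow> (nat \<Rightarrow> real) \<Rightarrow> bool" where
  "order_params \<alpha> m a b \<longleftrightarrow> 0 < \<alpha> \<and> \<alpha> < 1 \<and>
     (\<forall>i\<in>{1..m}. 0 < a i \<and> a i < \<alpha> \<and> 0 < b i) \<and>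
     (\<forall>i j. 1 \<le> i \<and> i \<le> j \<and> j \<le> m \<longrightarrow> a j \<le> a i)"

definition time_deriv :: "real \<Rightarrow> (real \<Rightarrow> 'b::real_normed_vector) \<Rightarrow> real \<Rightarrow> 'b" where
  "time_deriv T u t = vector_derivative u (at t within {0..T})"

text \<open>
  \<open>u \<in> C([0,T]; Hdot2) \<inter> C\<^sup>1((0,T]; Hdot2) \<inter> C\<^sup>2((0,T]; L\<^sup>2)\<close>.  As the norm of \<open>Hdot2\<close> is
  \<open>\<parallel>\<Delta> \<cdot>\<parallel>\<close>, continuity and differentiability with values in \<open>Hdot2\<close> are expressed by applying the
  Laplacian.  No uniform bound near \<open>t = 0\<close> is required here: the suprema in the error estimate
  are extended reals.
\<close>

definition sufficiently_smooth ::
  "(real^'n) set \<Rightarrow> real \<Rightarrow> (real \<Rightarrow> 'n::finite L2) \<Rightarrow> bool" where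
  "sufficiently_smooth \<Omega> T u \<longleftrightarrow>
     (\<forall>t\<in>{0..T}. u t \<in> Hdot2 \<Omega>) \<and>
     continuous_on {0..T} u \<and> continuous_on {0..T} (\<lambda>t. laplacian \<Omega> (u t)) \<and>
     (\<forall>t\<in>{0<..T}. time_deriv T u t \<in> Hdot2 \<Omega> \<and>
        (u has_vector_derivative time_deriv T u t) (at t within {0..T}) \<and>
        ((\<lambda>s. laplacian \<Omega> (u s)) has_vector_derivative laplacian \<Omega> (time_deriv T u t))
           (at t within {0..T}) \<and>
        (time_deriv T u has_vector_derivative time_deriv T (time_deriv T u) t)
           (at t within {0..T})) \<and>
     continuous_on {0<..T} (\<lambda>t. laplacian \<Omega> (time_deriv T u t)) \<and>
     continuous_on {0<..T} (time_deriv T (time_deriv T u))"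

definition is_solution ::
  "(real^'n) set \<Rightarrow> real \<Rightarrow> real \<Rightarrow> nat \<Rightarrow> (nat \<Rightarrow> real) \<Rightarrow> (nat \<Rightarrow> real) \<Rightarrow>
   'n::finite L2 \<Rightarrow> (real \<Rightarrow> 'n L2) \<Rightarrow> (real \<Rightarrow> 'n L2) \<Rightarrow> bool" where
  "is_solution \<Omega> T \<alpha> m a b v f u \<longleftrightarrow>
     (\<forall>t\<in>{0<..T}. u t \<in> Hdot2 \<Omega> \<and> f t \<in> L2_on \<Omega> \<and>
        multi_caputo \<alpha> m a b u t - laplacian \<Omega> (u t) = f t) \<and>
     u 0 = v"

definition d_coeff :: "real \<Rightarrow> nat \<Rightarrow> real" where
  "d_coeff \<beta> j = (real j + 1) powr (1 - \<beta>) - real j powr (1 - \<beta>)"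

definition P_coeff ::
  "real \<Rightarrow> nat \<Rightarrow> (nat \<Rightarrow> real) \<Rightarrow> (nat \<Rightarrow> real) \<Rightarrow> real \<Rightarrow> nat \<Rightarrow> real" where
  "P_coeff \<alpha> m a b \<tau> j = d_coeff \<alpha> j +
     (\<Sum>i=1..m. Gamma (2 - \<alpha>) * b i * d_coeff (a i) j * \<tau> powr (\<alpha> - a i) / Gamma (2 - a i))"

definition gamma_coeff :: "real \<Rightarrow> real \<Rightarrow> real" where
  "gamma_coeff \<alpha> \<tau> = Gamma (2 - \<alpha>) * \<tau> powr \<alpha>"

definition is_discrete_solution ::
  "(real^'n) set \<Rightarrow> (real^'n) set set \<Rightarrow> real \<Rightarrow> nat \<Rightarrow> (nat \<Rightarrow> real) \<Rightarrow> (nat \<Rightarrow> real) \<Rightarrow>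
   real \<Rightarrow> nat \<Rightarrow> (real \<Rightarrow> 'n::finite L2) \<Rightarrow> (nat \<Rightarrow> 'n L2) \<Rightarrow> bool" where
  "is_discrete_solution \<Omega> \<T> \<alpha> m a b \<tau> K f U \<longleftrightarrow>
     (\<forall>n\<le>K. U n \<in> fe_space \<Omega> \<T>) \<and>
     (\<forall>n<K. \<forall>w\<in>fe_space \<Omega> \<T>.
        P_coeff \<alpha> m a b \<tau> 0 * inner (U (n + 1)) w
          + gamma_coeff \<alpha> \<tau> * grad_inner \<Omega> (U (n + 1)) w
        = (\<Sum>j<n. (P_coeff \<alpha> m a b \<tau> j - P_coeff \<alpha> m a b \<tau> (j + 1)) * inner (U (n - j)) w)
          + P_coeff \<alpha> m a b \<tau> n * inner (U 0) w
          + gamma_coeff \<alpha> \<tau> * inner (f (real (n + 1) * \<tau>)) w)"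

definition Linf_L2_norm :: "real \<Rightarrow> (real \<Rightarrow> 'b::real_normed_vector) \<Rightarrow> ennreal" where
  "Linf_L2_norm T f = esssup (restrict_space lborel {0<..<T}) (\<lambda>t. ennreal (norm (f t)))"

end

theory Submission
  imports Defs "HOL-Computational_Algebra.Polynomial"
begin

text \<open>
  In space, everything rests on one estimate: if \<open>w \<in> H10 \<Omega>\<close> is orthogonal to the finite element space
  with respect to \<open>grad_inner\<close>, then \<open>\<parallel>w\<parallel> \<le> C h \<parallel>\<nabla>w\<parallel>\<close>. By duality it suffices to find, for a test
  function \<open>\<theta>\<close>, a smooth \<open>\<psi>\<close> with \<open>\<Delta>\<psi> \<approx> - \<theta>\<close> on \<open>\<Omega>\<close>, \<open>\<psi> \<approx> 0\<close> on the boundary and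
  \<open>\<parallel>D\<^sup>2 \<psi>\<parallel> \<le> C \<parallel>\<theta>\<parallel>\<close>, and to interpolate \<open>\<psi>\<close> at the nodes. Such a \<open>\<psi>\<close> is obtained without elliptic
  regularity theory, as the mollification of a bounded solution of the finite difference Dirichlet
  problem on a slightly larger smooth set \<open>{\<rho> > 0}\<close>, where \<open>\<rho>\<close> is concave. The bound on \<open>D\<^sup>2 \<psi>\<close> comes from
  integrating \<open>|D\<^sup>2 \<psi>|\<^sup>2 - (\<Delta>\<psi>)\<^sup>2\<close> by parts twice against a cutoff that is a function of \<open>\<rho>\<close>:
  concavity gives the main term the right sign. Using the estimate twice, the Ritz projection satisfies
  \<open>\<parallel>u - R u\<parallel> \<le> C h\<^sup>2 \<parallel>\<Delta>u\<parallel>\<close>.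

  In time, on every mesh interval but the last, the truncation error of the L1 formula is integrated by
  parts against the kernel, which leaves \<open>M \<tau>\<^sup>2\<close> times the increment of \<open>(t - s) powr (-\<alpha>)\<close>; the sum
  telescopes to \<open>M \<tau> powr (2 - \<alpha>)\<close>. As the weights \<open>P\<^sub>j\<close> decrease, the scheme amplifies the residual by at most
  \<open>1 / P\<^sub>n\<close>, which is of order \<open>\<tau> powr (-\<alpha>)\<close>.
\<close>

section \<open>The space of square integrable functions\<close>

text \<open>The delicate point is a Hessian bound with a constant that depends neither on the domain
  nor on the accuracy \<eta>, although the weight must vanish at the boundary of {\<rho> > 0}. The
  weight \<rho> itself would be ideal, but cut off at 0 it has a kink. It is replaced by a function
  \<open>h0\<close> of \<rho> that behaves like \<open>u powr (1 + p)\<close>. The price is a term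
  with the second derivative \<open>h2\<close>, which sees only derivatives along the level sets of
  \<rho>; it can be integrated by parts once more without differentiating \<open>h2\<close>. This
  frees a factor of the solution itself, whose linear decay towards {\<rho> = 0}, provided by a
  barrier, compensates the size of \<open>h2\<close>. What remains is made small by the parameter
  \<nu> of Cauchy's inequality and then by \<omega>, the bound for \<open>b\<close>, while the
  constants multiplying them are fixed beforehand. Only the factor 8192 = 2 * 4096 is left, where
  1/4096 is the least value of the weight on \<Omega>. The interpolation error needs nothing but the
  square integral of the Hessian, simplex by simplex; this is where dimension at most 3 enters. The
  constant 512 of the duality estimate is the square root of 32 * 8192.\<close>

lemma sq_integrable_rep [simp]: "sq_integrable (rep_L2 u)"
  using Quotient3_rep_reflp[OF Quotient3_L2, of u] by simp

lemma abs_rep_L2 [simp]: "abs_L2 (rep_L2 u) = u"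
  using Quotient3_abs_rep[OF Quotient3_L2] .

lemma rep_abs_L2: "sq_integrable f \<Longrightarrow> AE x in lborel. rep_L2 (abs_L2 f) x = f x"
  using Quotient3_rep_abs[OF Quotient3_L2, of f] by simp

lemma abs_L2_cong:
  assumes "sq_integrable f" "sq_integrable g" "AE x in lborel. f x = g x"
  shows "abs_L2 f = abs_L2 g"
  using Quotient3_rel_abs[OF Quotient3_L2, of f g] assms by simp

lemma sq_integrable_measurable: "sq_integrable f \<Longrightarrow> f \<in> borel_measurable lborel"
  by (simp add: sq_integrable_def)

lemma rep_L2_measurable [measurable]: "rep_L2 u \<in> borel_measurable borel"
  using sq_integrable_measurable[OF sq_integrable_rep, of u] by simp

lemma plus_abs_L2: "sq_integrable f \<Longrightarrow> sq_integrable g \<Longrightarrow> abs_L2 f + abs_L2 g = abs_L2 (\<lambda>x. f x + g x)"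
  by (rule plus_L2.abs_eq) auto

lemma scaleR_abs_L2: "sq_integrable f \<Longrightarrow> c *\<^sub>R abs_L2 f = abs_L2 (\<lambda>x. c * f x)"
  by (rule scaleR_L2.abs_eq) auto

lemma sq_integrable_diff:
  "sq_integrable f \<Longrightarrow> sq_integrable g \<Longrightarrow> sq_integrable (\<lambda>x. f x - g x)"
  using sq_integrable_add[of f "\<lambda>x. (-1) * g x"] sq_integrable_scale[of g "-1"] by simp

lemma minus_abs_L2: "sq_integrable f \<Longrightarrow> sq_integrable g \<Longrightarrow> abs_L2 f - abs_L2 g = abs_L2 (\<lambda>x. f x - g x)"
  using plus_abs_L2[of f "\<lambda>x. (-1) * g x"] scaleR_abs_L2[of g "-1"] sq_integrable_scale[of g "-1"]
  by (simp add: diff_conv_add_uminus del: add_uminus_conv_diff)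

lemma inner_abs_L2: "sq_integrable f \<Longrightarrow> sq_integrable g \<Longrightarrow> inner (abs_L2 f) (abs_L2 g) = (LBINT x. f x * g x)"
  by (rule inner_L2.abs_eq) auto

lemma norm_abs_L2: "sq_integrable f \<Longrightarrow> (norm (abs_L2 f))\<^sup>2 = (LBINT x. (f x)^2)"
  by (simp only: power2_norm_eq_inner inner_abs_L2) (simp add: power2_eq_square)

lemma inner_abs_right:
  assumes "sq_integrable g"
  shows "inner u (abs_L2 g) = (LBINT x. rep_L2 u x * g x)"
  using inner_abs_L2[OF sq_integrable_rep[of u] assms] by simp

lemma sq_integrable_sum:
  "(\<And>i. i \<in> I \<Longrightarrow> sq_integrable (f i)) \<Longrightarrow> sq_integrable (\<lambda>x. \<Sum>i\<in>I. f i x)"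
  by (induction I rule: infinite_finite_induct) (auto intro: sq_integrable_add sq_integrable_zero)

lemma sum_abs_L2:
  "(\<And>i. i \<in> I \<Longrightarrow> sq_integrable (f i)) \<Longrightarrow> (\<Sum>i\<in>I. abs_L2 (f i)) = abs_L2 (\<lambda>x. \<Sum>i\<in>I. f i x)"
  by (induction I rule: infinite_finite_induct)
     (auto simp: zero_L2_def plus_abs_L2 sq_integrable_sum)

lemma L2_on_zero [simp]: "0 \<in> L2_on \<Omega>"
  using rep_abs_L2[OF sq_integrable_zero] unfolding L2_on_def zero_L2_def by (auto elim: AE_mp)

lemma rep_plus_L2: "AE x in lborel. rep_L2 (u + w) x = rep_L2 u x + rep_L2 w x"
  using rep_abs_L2[of "\<lambda>x. rep_L2 u x + rep_L2 w x"] plus_abs_L2[of "rep_L2 u" "rep_L2 w"]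
    sq_integrable_add[of "rep_L2 u" "rep_L2 w"] by simp

lemma rep_scaleR_L2: "AE x in lborel. rep_L2 (c *\<^sub>R u) x = c * rep_L2 u x"
  using rep_abs_L2[of "\<lambda>x. c * rep_L2 u x"] scaleR_abs_L2[of "rep_L2 u" c]
    sq_integrable_scale[of "rep_L2 u" c] by simp

lemma L2_on_subspace: "subspace (L2_on \<Omega>)"
proof (rule subspaceI)
  show "u + w \<in> L2_on \<Omega>" if "u \<in> L2_on \<Omega>" "w \<in> L2_on \<Omega>" for u w
    using that rep_plus_L2[of u w] unfolding L2_on_def mem_Collect_eq by eventually_elim auto
  show "c *\<^sub>R u \<in> L2_on \<Omega>" if "u \<in> L2_on \<Omega>" for c u
    using that rep_scaleR_L2[of c u] unfolding L2_on_def mem_Collect_eq by eventually_elim auto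
qed simp

lemma abs_L2_in_L2_on:
  assumes "sq_integrable f" "\<And>x. x \<notin> \<Omega> \<Longrightarrow> f x = 0"
  shows "abs_L2 f \<in> L2_on \<Omega>"
  using rep_abs_L2[OF assms(1)] unfolding L2_on_def mem_Collect_eq
  by eventually_elim (auto simp: assms(2))

lemma integrable_bounded_support:
  fixes f :: "'a::euclidean_space \<Rightarrow> real"
  assumes "f \<in> borel_measurable borel" "\<And>x. \<bar>f x\<bar> \<le> B" "\<And>x. f x \<noteq> 0 \<Longrightarrow> norm x \<le> R"
  shows "integrable lborel f"
proof (rule Bochner_Integration.integrable_bound)
  show "integrable lborel (\<lambda>x::'a. B * indicator (cball 0 R) x)"
    using emeasure_lborel_cball_finite[of "0::'a" R] by simp
  show "f \<in> borel_measurable lborel" using assms(1) by simp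
  show "AE x in lborel. norm (f x) \<le> norm (B * indicator (cball 0 R) x)"
  proof (rule AE_I2)
    fix x
    have "0 \<le> B" using assms(2)[of x] by linarith
    then show "norm (f x) \<le> norm (B * indicator (cball 0 R) x)"
      using assms(2)[of x] assms(3)[of x] by (cases "f x = 0") (auto simp: indicator_def)
  qed
qed

lemma sq_integrable_bounded_support:
  assumes "f \<in> borel_measurable borel" "\<And>x. \<bar>f x\<bar> \<le> B" "\<And>x. f x \<noteq> 0 \<Longrightarrow> norm x \<le> R"
  shows "sq_integrable f"
  unfolding sq_integrable_def
proof
  have "\<bar>(f x)\<^sup>2\<bar> \<le> B^2" for x
    using power_mono[OF assms(2)[of x], of 2] by simp
  then show "integrable lborel (\<lambda>x. (f x)^2)"
    using assms by (intro integrable_bounded_support[where B = "B^2" and R = R]) auto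
qed (use assms in simp)

text \<open>Minkowski's inequality for absolute values: replacing \<open>f n\<close> by its absolute
  value does not change the norm, so the triangle inequality of the inner product space applies. It
  feeds the Riesz-Fischer argument.\<close>

lemma L2_sum_bound:
  fixes f :: "nat \<Rightarrow> real^'n \<Rightarrow> real"
  assumes "\<And>n. sq_integrable (f n)" "\<And>n. norm (abs_L2 (f n)) \<le> c n"
  shows "(LBINT x. (\<Sum>n<N. \<bar>f n x\<bar>)^2) \<le> (\<Sum>n<N. c n)^2"
proof -
  have a: "sq_integrable (\<lambda>x. \<bar>f n x\<bar>)" for n
    using assms(1)[of n] by (auto simp: sq_integrable_def)
  have b: "norm (abs_L2 (\<lambda>x. \<bar>f n x\<bar>)) = norm (abs_L2 (f n))" for n
  proof -
    have "(norm (abs_L2 (\<lambda>x. \<bar>f n x\<bar>)))^2 = (norm (abs_L2 (f n)))^2"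
      by (simp add: norm_abs_L2 a assms(1))
    then show ?thesis by simp
  qed
  have "(LBINT x. (\<Sum>n<N. \<bar>f n x\<bar>)^2) = (norm (\<Sum>n<N. abs_L2 (\<lambda>x. \<bar>f n x\<bar>)))^2"
    by (subst sum_abs_L2) (auto simp: a norm_abs_L2 sq_integrable_sum)
  also have "\<dots> \<le> (\<Sum>n<N. c n)^2"
  proof (rule power_mono)
    show "norm (\<Sum>n<N. abs_L2 (\<lambda>x. \<bar>f n x\<bar>)) \<le> (\<Sum>n<N. c n)"
      by (rule order_trans[OF norm_sum]) (auto intro!: sum_mono simp: b assms(2))
  qed simp
  finally show ?thesis .
qed

lemma nn_integral_sq:
  "sq_integrable f \<Longrightarrow> (\<integral>\<^sup>+x. ennreal ((f x)^2) \<partial>lborel) = ennreal ((norm (abs_L2 f))^2)"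
  by (subst nn_integral_eq_integral) (auto simp: norm_abs_L2 sq_integrable_def)

text \<open>The partial sums of the absolute increments are bounded in square mean by the geometric
  series, so monotone convergence makes their supremum finite almost everywhere; at such points the
  telescoping series of increments converges absolutely.\<close>

lemma AE_convergent_of_summable_L2:
  fixes f :: "nat \<Rightarrow> real^'n \<Rightarrow> real"
  assumes f: "\<And>n. sq_integrable (f n)"
    and c: "\<And>n. norm (abs_L2 (\<lambda>x. f (Suc n) x - f n x)) \<le> (1/2)^n"
  shows "AE x in lborel. convergent (\<lambda>n. f n x)"
proof -
  define d where "d = (\<lambda>n x. f (Suc n) x - f n x)"
  have d: "sq_integrable (d n)" for n unfolding d_def using f by (intro sq_integrable_diff)
  have dm [measurable]: "d n \<in> borel_measurable lborel" for n
    using d sq_integrable_measurable by blast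
  define u where "u = (\<lambda>N x. ennreal ((\<Sum>n<N. \<bar>d n x\<bar>)^2))"
  have um [measurable]: "u N \<in> borel_measurable lborel" for N
    unfolding u_def by measurable
  have geo: "(\<Sum>n<N. (1/2)^n :: real) \<le> 2" for N
    by (subst sum_gp_strict) simp_all
  have int: "(\<integral>\<^sup>+x. u N x \<partial>lborel) \<le> ennreal 4" for N
  proof -
    have s: "sq_integrable (\<lambda>x. \<Sum>n<N. \<bar>d n x\<bar>)"
      by (intro sq_integrable_sum) (use d in \<open>auto simp: sq_integrable_def\<close>)
    have "(\<integral>\<^sup>+x. u N x \<partial>lborel) = ennreal (LBINT x. (\<Sum>n<N. \<bar>d n x\<bar>)^2)"
      unfolding u_def nn_integral_sq[OF s] by (simp add: norm_abs_L2[OF s])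
    also have "\<dots> \<le> ennreal ((\<Sum>n<N. (1/2)^n)^2)"
      using c by (intro ennreal_leI L2_sum_bound d) (simp add: d_def)
    also have "\<dots> \<le> ennreal (2^2)"
      by (intro ennreal_leI power_mono geo sum_nonneg) simp
    finally show ?thesis by simp
  qed
  have inc: "incseq u"
    unfolding u_def
    by (intro incseq_SucI le_funI ennreal_leI power_mono) (auto intro: sum_nonneg)
  have "(\<integral>\<^sup>+x. (SUP N. u N x) \<partial>lborel) = (SUP N. \<integral>\<^sup>+x. u N x \<partial>lborel)"
    by (rule nn_integral_monotone_convergence_SUP[OF inc]) auto
  also have "\<dots> \<le> ennreal 4" by (intro SUP_least int)
  also have "\<dots> < \<infinity>" by simp
  finally have "(\<integral>\<^sup>+x. (SUP N. u N x) \<partial>lborel) \<noteq> \<infinity>" by simp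
  then have "AE x in lborel. (SUP N. u N x) \<noteq> \<infinity>"
    by (intro nn_integral_PInf_AE) auto
  then show ?thesis
  proof eventually_elim
    case (elim x)
    then obtain B where B: "(SUP N. u N x) = ennreal B" "0 \<le> B"
      by (cases "SUP N. u N x") auto
    have "(\<Sum>n<N. \<bar>d n x\<bar>) \<le> sqrt B" for N
    proof -
      have "u N x \<le> ennreal B" using B by (metis SUP_upper UNIV_I)
      then have "(\<Sum>n<N. \<bar>d n x\<bar>)^2 \<le> B" using B(2) by (simp add: u_def)
      then show ?thesis by (rule real_le_rsqrt)
    qed
    then have "summable (\<lambda>n. \<bar>d n x\<bar>)"
      by (intro bounded_imp_summable[where B = "sqrt B"])
         (auto simp: lessThan_Suc_atMost[symmetric] simp del: sum.lessThan_Suc)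
    then have "summable (\<lambda>n. d n x)" by (rule summable_rabs_cancel)
    then have "convergent (\<lambda>N. \<Sum>n<N. d n x)" by (simp add: summable_iff_convergent)
    then have "convergent (\<lambda>N. f N x - f 0 x)" by (simp add: d_def sum_lessThan_telescope[of "\<lambda>n. f n x"])
    then show ?case by (simp only: convergent_diff_const_right_iff)
  qed
qed

text \<open>Riesz-Fischer: a fast subsequence converges almost everywhere, Fatou's lemma turns the
  pointwise limit into an \<open>L2\<close> limit, and the Cauchy property carries it to the whole
  sequence. Completeness is called for by the vector-valued time integrals and by the extension of
  the Lipschitz function u' to time 0.\<close>

instance L2 :: (finite) banach
proof
  fix X :: "nat \<Rightarrow> 'a L2"
  assume X: "Cauchy X"
  then have "\<forall>n. \<exists>N. \<forall>i\<ge>N. \<forall>j\<ge>N. norm (X i - X j) < (1/2)^n"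
    unfolding Cauchy_iff by (metis zero_less_divide_1_iff zero_less_numeral zero_less_power)
  then obtain N where N: "\<And>n i j. i \<ge> N n \<Longrightarrow> j \<ge> N n \<Longrightarrow> norm (X i - X j) < (1/2)^n"
    by metis
  \<comment> \<open>The sum dominates every \<open>N k\<close> with \<open>k \<le> n\<close>, and
    the summand \<open>n\<close> makes the selection strictly increasing.\<close>
  define s where "s = (\<lambda>n. (\<Sum>k\<le>n. N k) + n)"
  have sN: "N k \<le> s n" if "k \<le> n" for k n
    using that member_le_sum[of k "{..n}" N] unfolding s_def by auto
  define f where "f = (\<lambda>n. rep_L2 (X (s n)))"
  have f: "sq_integrable (f n)" for n by (simp add: f_def)
  have [measurable]: "f n \<in> borel_measurable lborel" for n using f sq_integrable_measurable by blast
  have Xf: "X (s n) = abs_L2 (f n)" for n by (simp add: f_def)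
  have "norm (abs_L2 (\<lambda>x. f (Suc n) x - f n x)) \<le> (1/2)^n" for n
    using N[of n "s (Suc n)" "s n"] sN[of n "Suc n"] sN[of n n] by (simp add: minus_abs_L2[symmetric] f Xf)
  then have conv: "AE x in lborel. convergent (\<lambda>n. f n x)"
    by (rule AE_convergent_of_summable_L2[OF f])
  define g where "g = (\<lambda>x. lim (\<lambda>n. f n x))"
  have [measurable]: "g \<in> borel_measurable lborel" unfolding g_def by measurable
  have fatou: "(\<integral>\<^sup>+x. ennreal ((f m x - g x)^2) \<partial>lborel) \<le> ennreal (((1/2)^m)^2)" for m
  proof -
    have "(\<integral>\<^sup>+x. ennreal ((f m x - g x)^2) \<partial>lborel)
        = (\<integral>\<^sup>+x. liminf (\<lambda>k. ennreal ((f m x - f k x)^2)) \<partial>lborel)"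
    proof (rule nn_integral_cong_AE, use conv in eventually_elim)
      case (elim x)
      then have "(\<lambda>k. f k x) \<longlonglongrightarrow> g x" unfolding g_def by (simp add: convergent_LIMSEQ_iff)
      then have "(\<lambda>k. ennreal ((f m x - f k x)^2)) \<longlonglongrightarrow> ennreal ((f m x - g x)^2)"
        by (intro tendsto_intros)
      then show ?case by (rule lim_imp_Liminf[OF trivial_limit_sequentially, symmetric])
    qed
    also have "\<dots> \<le> liminf (\<lambda>k. \<integral>\<^sup>+x. ennreal ((f m x - f k x)^2) \<partial>lborel)"
      by (rule nn_integral_liminf) measurable
    also have "\<dots> \<le> ennreal (((1/2)^m)^2)"
    proof (rule Liminf_le)
      show "\<forall>\<^sub>F k in sequentially. (\<integral>\<^sup>+x. ennreal ((f m x - f k x)^2) \<partial>lborel) \<le> ennreal (((1/2)^m)^2)"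
        using eventually_ge_at_top[of m]
      proof eventually_elim
        case (elim k)
        have "norm (X (s m) - X (s k)) \<le> (1/2)^m"
          using N[of m "s m" "s k"] sN[of m m] sN[of m k] elim by simp
        then show ?case
          by (simp add: nn_integral_sq sq_integrable_diff f Xf minus_abs_L2 power_mono del: power_divide)
      qed
    qed simp
    finally show ?thesis .
  qed
  have diff: "sq_integrable (\<lambda>x. f m x - g x)" for m
    unfolding sq_integrable_def
  proof
    show "integrable lborel (\<lambda>x. (f m x - g x)^2)"
      using le_less_trans[OF fatou[of m] ennreal_less_top]
      by (intro integrableI_bounded) auto
  qed measurable
  have g: "sq_integrable g"
    using sq_integrable_diff[OF f[of 0] diff[of 0]] by simp
  have dist: "norm (X (s m) - abs_L2 g) \<le> (1/2)^m" for m
  proof -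
    have "ennreal ((norm (X (s m) - abs_L2 g))^2) \<le> ennreal (((1/2)^m)^2)"
      using fatou[of m] by (simp add: Xf minus_abs_L2 f g nn_integral_sq diff del: power_divide)
    then have "(norm (X (s m) - abs_L2 g))^2 \<le> ((1/2)^m)^2" by (simp del: power_divide)
    then show ?thesis by (rule power2_le_imp_le) simp
  qed
  have "(\<lambda>m. X (s m)) \<longlonglongrightarrow> abs_L2 g"
  proof (rule Lim_null[THEN iffD2], rule Lim_null_comparison)
    show "\<forall>\<^sub>F m in sequentially. norm (X (s m) - abs_L2 g) \<le> (1/2)^m"
      using dist by simp
    show "(\<lambda>m. (1/2::real)^m) \<longlonglongrightarrow> 0" by (rule LIMSEQ_power_zero) simp
  qed
  moreover have "strict_mono s"
    by (rule strict_mono_Suc_iff[THEN iffD2]) (simp add: s_def)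
  ultimately have "X \<longlonglongrightarrow> abs_L2 g"
    using Cauchy_converges_subseq[OF X, of s "abs_L2 g"] by (simp add: comp_def)
  then show "convergent X" by (rule convergentI)
qed

section \<open>Partial derivatives and smooth functions\<close>

abbreviation pd :: "'n \<Rightarrow> (real^'n \<Rightarrow> real) \<Rightarrow> real^'n::finite \<Rightarrow> real" where
  "pd \<equiv> pderiv_dir"

lemma pderiv_dir_eqI: "(f has_derivative f') (at x) \<Longrightarrow> pd i f x = f' (axis i 1)"
  unfolding pderiv_dir_def using frechet_derivative_at by metis

lemma has_derivative_pderiv:
  assumes "f differentiable (at x)"
  shows "(f has_derivative (\<lambda>h. \<Sum>i\<in>UNIV. h $ i * pd i f x)) (at x)"
proof -
  let ?D = "frechet_derivative f (at x)"
  have D: "(f has_derivative ?D) (at x)" using assms frechet_derivative_works by blast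
  have "?D h = (\<Sum>i\<in>UNIV. h $ i * pd i f x)" for h
  proof -
    have "?D h = ?D (\<Sum>i\<in>UNIV. h $ i *\<^sub>R axis i 1)"
      by (metis (no_types, lifting) basis_expansion scalar_mult_eq_scaleR sum.cong)
    also have "\<dots> = (\<Sum>i\<in>UNIV. h $ i *\<^sub>R ?D (axis i 1))"
      using has_derivative_linear[OF D] by (simp add: linear_sum linear_scale)
    finally show ?thesis by (simp add: pderiv_dir_def)
  qed
  then show ?thesis using D by (metis (no_types, lifting) ext)
qed

lemma has_real_derivative_line:
  fixes f :: "real^'n \<Rightarrow> real"
  assumes "f differentiable (at (x + t *\<^sub>R v))"
  shows "((\<lambda>t. f (x + t *\<^sub>R v)) has_real_derivative (\<Sum>i\<in>UNIV. v $ i * pd i f (x + t *\<^sub>R v))) (at t)"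
proof -
  have "((\<lambda>t. f (x + t *\<^sub>R v)) has_derivative
      (\<lambda>h. \<Sum>i\<in>UNIV. (h *\<^sub>R v) $ i * pd i f (x + t *\<^sub>R v))) (at t)"
    by (rule has_derivative_compose[where f = "\<lambda>t. x + t *\<^sub>R v" and g = f, OF _ has_derivative_pderiv[OF assms]])
       (auto intro!: derivative_eq_intros)
  moreover have "(\<lambda>h. \<Sum>i\<in>UNIV. (h *\<^sub>R v) $ i * pd i f (x + t *\<^sub>R v))
      = (*) (\<Sum>i\<in>UNIV. v $ i * pd i f (x + t *\<^sub>R v))"
    by (rule ext) (simp add: sum_distrib_left mult_ac)
  ultimately show ?thesis by (simp add: has_field_derivative_def)
qed

lemma has_real_derivative_axis:
  fixes f :: "real^'n \<Rightarrow> real"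
  assumes "f differentiable (at (x + t *\<^sub>R axis i 1))"
  shows "((\<lambda>t. f (x + t *\<^sub>R axis i 1)) has_real_derivative pd i f (x + t *\<^sub>R axis i 1)) (at t)"
  using has_real_derivative_line[OF assms]
  by (simp add: axis_def if_distrib[of "\<lambda>z. z * _"] cong: if_cong)

lemma C_diff_differentiable: "C_diff (Suc k) f \<Longrightarrow> f differentiable (at x)"
  by simp

lemma C_diff_SucD: "C_diff (Suc k) f \<Longrightarrow> C_diff k f"
proof (induction k arbitrary: f)
  case 0
  then show ?case by (auto simp: continuous_on_eq_continuous_at intro: differentiable_imp_continuous_within)
qed auto

lemma C_diff_mono: "C_diff k f \<Longrightarrow> j \<le> k \<Longrightarrow> C_diff j f"
  by (induction k) (auto simp: le_Suc_eq dest: C_diff_SucD simp del: C_diff.simps(2))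

lemma C_diff_continuous: "C_diff k f \<Longrightarrow> continuous_on S f"
  using C_diff_mono[of k f 0] continuous_on_subset by auto

lemma C_diff_pderiv: "C_diff (Suc k) f \<Longrightarrow> C_diff k (pd i f)"
  by simp

lemma C_diff_measurable: "C_diff k f \<Longrightarrow> f \<in> borel_measurable borel"
  using C_diff_continuous borel_measurable_continuous_onI by blast

lemma pderiv_dir_const [simp]: "pd i (\<lambda>x. c) = (\<lambda>x. 0)"
  by (rule ext, rule pderiv_dir_eqI[of _ "\<lambda>_. 0"]) simp

lemma pderiv_dir_add:
  assumes "f differentiable (at x)" "g differentiable (at x)"
  shows "pd i (\<lambda>x. f x + g x) x = pd i f x + pd i g x"
  by (rule pderiv_dir_eqI[OF has_derivative_add[OF has_derivative_pderiv has_derivative_pderiv], THEN trans])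
     (use assms in \<open>auto simp: axis_def if_distrib[of "\<lambda>z. z * _"] cong: if_cong\<close>)

lemma pderiv_dir_cmult:
  "f differentiable (at x) \<Longrightarrow> pd i (\<lambda>x. c * f x) x = c * pd i f x"
  by (rule pderiv_dir_eqI[OF has_derivative_mult_right[OF has_derivative_pderiv], THEN trans])
     (auto simp: axis_def if_distrib[of "\<lambda>z. z * _"] cong: if_cong)

lemma pderiv_dir_diff:
  assumes "f differentiable (at x)" "g differentiable (at x)"
  shows "pd i (\<lambda>x. f x - g x) x = pd i f x - pd i g x"
  by (rule pderiv_dir_eqI[OF has_derivative_diff[OF has_derivative_pderiv has_derivative_pderiv], THEN trans])
     (use assms in \<open>auto simp: axis_def if_distrib[of "\<lambda>z. z * _"] cong: if_cong\<close>)

lemma pderiv_dir_mult: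
  assumes "f differentiable (at x)" "g differentiable (at x)"
  shows "pd i (\<lambda>x. f x * g x) x = f x * pd i g x + pd i f x * g x"
  by (rule pderiv_dir_eqI[OF has_derivative_mult[OF has_derivative_pderiv has_derivative_pderiv], THEN trans])
     (use assms in \<open>auto simp: axis_def if_distrib[of "\<lambda>z. z * _"] cong: if_cong\<close>)

lemma pderiv_dir_compose:
  assumes "(h has_real_derivative h') (at (p x))" "p differentiable (at x)"
  shows "pd i (\<lambda>x. h (p x)) x = h' * pd i p x"
proof -
  have "((\<lambda>x. h (p x)) has_derivative (\<lambda>v. h' * (\<Sum>i\<in>UNIV. v $ i * pd i p x))) (at x)"
    by (rule has_derivative_compose[OF has_derivative_pderiv[OF assms(2)]
          assms(1)[unfolded has_field_derivative_def]])
  from pderiv_dir_eqI[OF this, of i] show ?thesis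
    by (simp add: axis_def if_distrib[of "\<lambda>z. z * _"] cong: if_cong)
qed

lemma pderiv_dir_inner: "pd i (\<lambda>x. inner a x) = (\<lambda>x. a $ i)"
proof
  fix x
  have "((\<lambda>x. inner a x) has_derivative (\<lambda>h. inner a h)) (at x)"
    by (auto intro!: derivative_eq_intros)
  from pderiv_dir_eqI[OF this, of i] show "pd i (\<lambda>x. inner a x) x = a $ i"
    by (simp add: inner_axis)
qed

lemma C_diff_const [intro]: "C_diff k (\<lambda>x. c)"
  by (induction k arbitrary: c) auto

lemma C_diff_inner [intro]: "C_diff k (\<lambda>x. inner a x)"
  by (cases k) (auto simp: pderiv_dir_inner intro!: continuous_intros derivative_intros C_diff_const
     simp: differentiable_def intro: bounded_linear_inner_right bounded_linear_imp_has_derivative)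

lemma C_diff_add [intro]: "C_diff k f \<Longrightarrow> C_diff k g \<Longrightarrow> C_diff k (\<lambda>x. f x + g x)"
proof (induction k arbitrary: f g)
  case 0 then show ?case by (auto intro: continuous_on_add)
next
  case (Suc k)
  have "pd i (\<lambda>x. f x + g x) = (\<lambda>x. pd i f x + pd i g x)" for i
    using Suc.prems by (intro ext pderiv_dir_add) auto
  then show ?case using Suc by (auto intro: differentiable_add)
qed

lemma C_diff_mult [intro]: "C_diff k f \<Longrightarrow> C_diff k g \<Longrightarrow> C_diff k (\<lambda>x. f x * g x)"
proof (induction k arbitrary: f g)
  case 0 then show ?case by (auto intro: continuous_on_mult)
next
  case (Suc k)
  have "pd i (\<lambda>x. f x * g x) = (\<lambda>x. f x * pd i g x + pd i f x * g x)" for i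
    using Suc.prems by (intro ext pderiv_dir_mult) auto
  moreover have "C_diff k (\<lambda>x. f x * pd i g x + pd i f x * g x)" for i
    using Suc.prems C_diff_SucD by (intro C_diff_add Suc.IH) auto
  ultimately show ?case using Suc.prems by (auto intro: differentiable_mult)
qed

lemma C_diff_cmult [intro]: "C_diff k f \<Longrightarrow> C_diff k (\<lambda>x. c * f x)"
  by (intro C_diff_mult C_diff_const)

lemma C_diff_diff [intro]: "C_diff k f \<Longrightarrow> C_diff k g \<Longrightarrow> C_diff k (\<lambda>x. f x - g x)"
  using C_diff_add[of k f "\<lambda>x. (-1) * g x"] C_diff_cmult[of k g "-1"] by simp

lemma C_diff_sum [intro]: "(\<And>j. j \<in> J \<Longrightarrow> C_diff k (f j)) \<Longrightarrow> C_diff k (\<lambda>x. \<Sum>j\<in>J. f j x)"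
  by (induction J rule: infinite_finite_induct) auto

text \<open>The family \<open>h\<close> lists the successive derivatives of the outer function. A
  partial derivative of the composite is the composite with the shifted family times
  \<open>pd i p\<close>; hence the induction on \<open>k\<close> over all families.\<close>

lemma C_diff_compose:
  assumes "\<And>j t. j < k \<Longrightarrow> (h j has_real_derivative h (Suc j) t) (at t)"
    "continuous_on UNIV (h k)" "C_diff k p"
  shows "C_diff k (\<lambda>x. h 0 (p x))"
  using assms
proof (induction k arbitrary: h)
  case 0 then show ?case by (auto intro: continuous_on_compose2)
next
  case (Suc k)
  have d: "(h 0 has_real_derivative h 1 t) (at t)" for t using Suc.prems(1)[of 0] by simp
  have pd: "p differentiable (at x)" for x using Suc.prems(3) by simp
  have "C_diff k (\<lambda>x. h 1 (p x))"
    using Suc.IH[of "\<lambda>j. h (Suc j)"] Suc.prems C_diff_SucD[of k p] by auto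
  then have "C_diff k (\<lambda>x. h 1 (p x) * pd i p x)" for i
    using Suc.prems(3) by (intro C_diff_mult) auto
  moreover have "pd i (\<lambda>x. h 0 (p x)) = (\<lambda>x. h 1 (p x) * pd i p x)" for i
    using pderiv_dir_compose[OF d pd] by auto
  moreover have "(\<lambda>x. h 0 (p x)) differentiable (at x)" for x
    using has_derivative_compose[OF has_derivative_pderiv[OF pd] d[unfolded has_field_derivative_def]]
    unfolding differentiable_def by blast
  ultimately show ?case by simp
qed

lemma C_diff_sum_differentiable:
  "(\<And>j. j \<in> J \<Longrightarrow> f j differentiable (at x)) \<Longrightarrow> (\<lambda>x. \<Sum>j\<in>J. f j x) differentiable (at x)"
  by (induction J rule: infinite_finite_induct) (auto intro: differentiable_add)

lemma pderiv_dir_sum: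
  assumes "\<And>j. j \<in> J \<Longrightarrow> f j differentiable (at x)"
  shows "pd i (\<lambda>x. \<Sum>j\<in>J. f j x) x = (\<Sum>j\<in>J. pd i (f j) x)"
  using assms by (induction J rule: infinite_finite_induct)
    (auto simp: pderiv_dir_add C_diff_sum_differentiable)

text \<open>The mean value theorem is applied twice: in direction \<open>i\<close> to the increment
  of \<open>f\<close> in direction \<open>j\<close>, then in direction \<open>j\<close> to
  \<open>pd i f\<close>.\<close>

lemma second_difference_mvt:
  fixes f :: "real^'n \<Rightarrow> real"
  assumes "C_diff 2 f" "h > 0"
  shows "\<exists>y. norm (y - x) \<le> 2 * h \<and>
     f (x + h *\<^sub>R axis i 1 + h *\<^sub>R axis j 1) - f (x + h *\<^sub>R axis i 1) - f (x + h *\<^sub>R axis j 1) + f x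
       = h^2 * pd j (pd i f) y"
proof -
  have C: "C_diff (Suc 1) f" using assms(1) by (simp add: numeral_2_eq_2)
  have d1: "f differentiable (at y)" for y using C by simp
  have d2: "pd i f differentiable (at y)" for y using C by simp
  let ?g = "\<lambda>s. f ((x + h *\<^sub>R axis j 1) + s *\<^sub>R axis i 1) - f (x + s *\<^sub>R axis i 1)"
  have "\<exists>s>0. s < h \<and> ?g h - ?g 0 =
      (h - 0) * (pd i f ((x + h *\<^sub>R axis j 1) + s *\<^sub>R axis i 1) - pd i f (x + s *\<^sub>R axis i 1))"
    by (rule MVT2[where f = ?g, OF assms(2)]) (intro DERIV_diff has_real_derivative_axis d1)
  then obtain s where s: "0 < s" "s < h" "?g h - ?g 0 =
      (h - 0) * (pd i f ((x + h *\<^sub>R axis j 1) + s *\<^sub>R axis i 1) - pd i f (x + s *\<^sub>R axis i 1))"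
    by blast
  let ?k = "\<lambda>t. pd i f ((x + s *\<^sub>R axis i 1) + t *\<^sub>R axis j 1)"
  have "\<exists>t>0. t < h \<and> ?k h - ?k 0 =
      (h - 0) * pd j (pd i f) ((x + s *\<^sub>R axis i 1) + t *\<^sub>R axis j 1)"
    by (rule MVT2[where f = ?k, OF assms(2)]) (intro has_real_derivative_axis d2)
  then obtain t where t: "0 < t" "t < h" "?k h - ?k 0 =
      (h - 0) * pd j (pd i f) ((x + s *\<^sub>R axis i 1) + t *\<^sub>R axis j 1)"
    by blast
  show ?thesis
  proof (intro exI conjI)
    let ?y = "(x + s *\<^sub>R axis i 1) + t *\<^sub>R axis j 1"
    have "norm (?y - x) \<le> norm (s *\<^sub>R (axis i 1 :: real^'n)) + norm (t *\<^sub>R (axis j 1 :: real^'n))"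
      by (rule order_trans[OF _ norm_triangle_ineq]) (simp add: algebra_simps)
    also have "\<dots> \<le> 2 * h" using s t by simp
    finally show "norm (?y - x) \<le> 2 * h" .
    have "?g h - ?g 0 = h * (?k h - ?k 0)" using s(3) by (simp add: algebra_simps)
    then show "f (x + h *\<^sub>R axis i 1 + h *\<^sub>R axis j 1) - f (x + h *\<^sub>R axis i 1) - f (x + h *\<^sub>R axis j 1) + f x
       = h^2 * pd j (pd i f) ?y"
      using t(3) by (simp add: algebra_simps power2_eq_square)
  qed
qed

text \<open>Schwarz's theorem. The mixed second difference is symmetric in \<open>i\<close> and
  \<open>j\<close>, so the two mean value points carry equal values of the two mixed derivatives;
  both points tend to \<open>x\<close>.\<close>

lemma pderiv_dir_commute:
  fixes f :: "real^'n \<Rightarrow> real"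
  assumes "C_diff 2 f"
  shows "pd i (pd j f) x = pd j (pd i f) x"
proof -
  define h where "h = (\<lambda>n. 1 / real (Suc n))"
  have h: "h n > 0" for n by (simp add: h_def)
  have h0: "h \<longlonglongrightarrow> 0" unfolding h_def using LIMSEQ_inverse_real_of_nat by (simp add: inverse_eq_divide)
  obtain y where y: "\<And>n. norm (y n - x) \<le> 2 * h n" "\<And>n. f (x + h n *\<^sub>R axis i 1 + h n *\<^sub>R axis j 1)
     - f (x + h n *\<^sub>R axis i 1) - f (x + h n *\<^sub>R axis j 1) + f x = (h n)^2 * pd j (pd i f) (y n)"
    using second_difference_mvt[OF assms h, where x = x and i = i and j = j] by metis
  obtain z where z: "\<And>n. norm (z n - x) \<le> 2 * h n" "\<And>n. f (x + h n *\<^sub>R axis j 1 + h n *\<^sub>R axis i 1)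
     - f (x + h n *\<^sub>R axis j 1) - f (x + h n *\<^sub>R axis i 1) + f x = (h n)^2 * pd i (pd j f) (z n)"
    using second_difference_mvt[OF assms h, where x = x and i = j and j = i] by metis
  have eq: "pd j (pd i f) (y n) = pd i (pd j f) (z n)" for n
  proof -
    have "x + h n *\<^sub>R axis j 1 + h n *\<^sub>R axis i 1 = x + h n *\<^sub>R axis i 1 + h n *\<^sub>R axis j 1" by simp
    then have "(h n)^2 * pd j (pd i f) (y n) = (h n)^2 * pd i (pd j f) (z n)"
      using y(2)[of n] z(2)[of n] by (simp only:)
    then show ?thesis using h[of n] by simp
  qed
  have lim: "w \<longlonglongrightarrow> x" if "\<And>n. norm (w n - x) \<le> 2 * h n" for w
  proof (rule Lim_null[THEN iffD2], rule Lim_null_comparison)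
    show "\<forall>\<^sub>F n in sequentially. norm (w n - x) \<le> 2 * h n" using that by simp
    show "(\<lambda>n. 2 * h n) \<longlonglongrightarrow> 0" using tendsto_mult_left[OF h0, of 2] by simp
  qed
  have cont: "isCont (pd k (pd l f)) x" for k l
    using assms by (simp add: numeral_2_eq_2 continuous_on_eq_continuous_at)
  have "(\<lambda>n. pd j (pd i f) (y n)) \<longlonglongrightarrow> pd j (pd i f) x"
    using isCont_tendsto_compose[OF cont lim[OF y(1)]] .
  moreover have "(\<lambda>n. pd j (pd i f) (y n)) \<longlonglongrightarrow> pd i (pd j f) x"
    unfolding eq using isCont_tendsto_compose[OF cont lim[OF z(1)]] .
  ultimately show ?thesis by (rule LIMSEQ_unique[symmetric])
qed

section \<open>Integration by parts\<close>

lemma bounded_support_bound: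
  fixes f :: "real^'n \<Rightarrow> real"
  assumes "continuous_on UNIV f" "\<And>x. f x \<noteq> 0 \<Longrightarrow> norm x \<le> R"
  obtains B where "B > 0" "\<And>x. \<bar>f x\<bar> \<le> B"
proof -
  have "bounded (f ` cball 0 R)"
    by (intro compact_imp_bounded compact_continuous_image) (use assms(1) continuous_on_subset in auto)
  then obtain B where B: "B > 0" "\<And>x. x \<in> cball 0 R \<Longrightarrow> \<bar>f x\<bar> \<le> B"
    unfolding bounded_pos by auto
  have "\<bar>f x\<bar> \<le> B" for x using B assms(2)[of x] by (cases "f x = 0") auto
  then show ?thesis using that B(1) by blast
qed

lemma continuous_bounded_support_integrable:
  fixes f :: "real^'n \<Rightarrow> real"
  assumes "continuous_on UNIV f" "\<And>x. f x \<noteq> 0 \<Longrightarrow> norm x \<le> R"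
  shows "integrable lborel f"
  using bounded_support_bound[OF assms] integrable_bounded_support[of f _ R]
    borel_measurable_continuous_onI[OF assms(1)] assms(2) by metis

lemma continuous_bounded_support_sq_integrable:
  fixes f :: "real^'n \<Rightarrow> real"
  assumes "continuous_on UNIV f" "\<And>x. f x \<noteq> 0 \<Longrightarrow> norm x \<le> R"
  shows "sq_integrable f"
  using bounded_support_bound[OF assms] sq_integrable_bounded_support[of f _ R]
    borel_measurable_continuous_onI[OF assms(1)] assms(2) by metis

lemma pderiv_dir_zero_outside:
  fixes f :: "real^'n \<Rightarrow> real"
  assumes "\<And>x. f x \<noteq> 0 \<Longrightarrow> norm x \<le> R" "pd i f x \<noteq> 0"
  shows "norm x \<le> R"
proof (rule ccontr)
  assume n: "\<not> norm x \<le> R"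
  have "(f has_derivative (\<lambda>h. 0)) (at x)"
  proof (rule has_derivative_transform_within_open[of "\<lambda>x. 0"])
    show "open (- cball (0::real^'n) R)" by (simp add: open_Compl)
    show "x \<in> - cball 0 R" using n by simp
    show "0 = f y" if "y \<in> - cball 0 R" for y using that assms(1)[of y] by auto
  qed simp
  then have "pd i f x = 0" by (rule pderiv_dir_eqI)
  then show False using assms(2) by simp
qed

lemma integral_lborel_affine:
  fixes f :: "'a::euclidean_space \<Rightarrow> real"
  assumes "integrable lborel f" "c \<noteq> 0"
  shows "integrable lborel (\<lambda>x. f (t + c *\<^sub>R x))"
    "(LBINT x. f x) = \<bar>c\<bar> ^ DIM('a) * (LBINT x. f (t + c *\<^sub>R x))"
proof -
  have m: "f \<in> borel_measurable borel" using assms(1) by simp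
  have i: "integrable (density (distr lborel borel (\<lambda>x. t + c *\<^sub>R x)) (\<lambda>_. \<bar>c\<bar>^DIM('a))) f"
    using assms(1) lborel_affine[OF assms(2), of t] by simp
  then have "integrable lborel (\<lambda>x. \<bar>c\<bar>^DIM('a) * f (t + c *\<^sub>R x))"
    using m by (simp add: integrable_density integrable_distr_eq)
  then show "integrable lborel (\<lambda>x. f (t + c *\<^sub>R x))" using assms(2) by simp
  have "(LBINT x. f x) = integral\<^sup>L (density (distr lborel borel (\<lambda>x. t + c *\<^sub>R x)) (\<lambda>_. \<bar>c\<bar>^DIM('a))) f"
    using lborel_affine[OF assms(2), of t] by simp
  also have "\<dots> = \<bar>c\<bar> ^ DIM('a) * (LBINT x. f (t + c *\<^sub>R x))"
    using m by (simp add: integral_density integral_distr)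
  finally show "(LBINT x. f x) = \<bar>c\<bar> ^ DIM('a) * (LBINT x. f (t + c *\<^sub>R x))" .
qed

lemma integral_translate:
  fixes f :: "'a::euclidean_space \<Rightarrow> real"
  assumes "integrable lborel f"
  shows "integrable lborel (\<lambda>x. f (x + t))"
    "(LBINT x. f (x + t)) = (LBINT x. f x)"
  using integral_lborel_affine[OF assms, of 1 t] by (simp_all add: add.commute)

lemma mvt_axis_bound:
  fixes f :: "real^'n \<Rightarrow> real"
  assumes "\<And>x. f differentiable (at x)" "\<And>x. \<bar>pd i f x\<bar> \<le> B" "h > 0"
  shows "\<bar>(f (x + h *\<^sub>R axis i 1) - f x) / h\<bar> \<le> B"
proof -
  have "\<exists>s>0. s < h \<and> f (x + h *\<^sub>R axis i 1) - f (x + 0 *\<^sub>R axis i 1) = (h - 0) * pd i f (x + s *\<^sub>R axis i 1)"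
    by (rule MVT2[where f = "\<lambda>t. f (x + t *\<^sub>R axis i 1)", OF assms(3)]) (intro has_real_derivative_axis assms(1))
  then obtain s where "f (x + h *\<^sub>R axis i 1) - f (x + 0 *\<^sub>R axis i 1) = (h - 0) * pd i f (x + s *\<^sub>R axis i 1)"
    by blast
  then show ?thesis using assms(2,3) by simp
qed

text \<open>Translation invariance makes the integral of every difference quotient vanish, and
  dominated convergence passes to the derivative. The dominating function lives on a ball of radius
  \<open>R + 1\<close> because the steps are at most 1.\<close>

theorem integral_pderiv_zero:
  fixes f :: "real^'n \<Rightarrow> real"
  assumes "C_diff 1 f" "\<And>x. f x \<noteq> 0 \<Longrightarrow> norm x \<le> R"
  shows "(LBINT x. pd i f x) = 0"
proof -
  define h where "h = (\<lambda>n. 1 / real (Suc n))"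
  have h: "0 < h n" "h n \<le> 1" for n by (auto simp: h_def)
  have h0: "h \<longlonglongrightarrow> 0" unfolding h_def using LIMSEQ_inverse_real_of_nat by (simp add: inverse_eq_divide)
  have df: "f differentiable (at x)" for x using assms(1) by simp
  have cp: "continuous_on UNIV (pd i f)" using assms(1) by simp
  have cf: "continuous_on UNIV f" using assms(1) C_diff_continuous by blast
  obtain B where B: "B > 0" "\<And>x. \<bar>pd i f x\<bar> \<le> B"
    using bounded_support_bound[OF cp pderiv_dir_zero_outside[where f = f and R = R and i = i]] assms(2) by blast
  have fint: "integrable lborel f"
    by (rule continuous_bounded_support_integrable[OF cf assms(2)])
  let ?q = "\<lambda>n x. (f (x + h n *\<^sub>R axis i 1) - f x) / h n"
  have zero: "(LBINT x. ?q n x) = 0" for n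
    by (simp add: integral_translate fint)
  have "(\<lambda>n. LBINT x. ?q n x) \<longlonglongrightarrow> (LBINT x. pd i f x)"
  proof (rule integral_dominated_convergence[where w = "\<lambda>x. B * indicator (cball 0 (R + 1)) x"])
    show "pd i f \<in> borel_measurable lborel" using cp borel_measurable_continuous_onI by auto
    show "?q n \<in> borel_measurable lborel" for n
      using borel_measurable_continuous_onI[OF cf] by measurable
    show "integrable lborel (\<lambda>x::real^'n. B * indicator (cball 0 (R + 1)) x)"
      using emeasure_lborel_cball_finite[of "0::real^'n" "R+1"] by simp
    show "AE x in lborel. (\<lambda>n. ?q n x) \<longlonglongrightarrow> pd i f x"
    proof (rule AE_I2)
      fix x
      have "((\<lambda>t. (f (x + t *\<^sub>R axis i 1) - f x) / t) \<longlongrightarrow> pd i f x) (at 0)"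
        using has_real_derivative_axis[OF df, where x = x and t = 0 and i = i] by (simp add: DERIV_def)
      then show "(\<lambda>n. ?q n x) \<longlonglongrightarrow> pd i f x"
        by (rule filterlim_compose) (use h0 h(1)[THEN less_imp_neq] in \<open>auto simp: filterlim_at intro!: always_eventually\<close>)
    qed
    show "AE x in lborel. norm (?q n x) \<le> B * indicator (cball 0 (R + 1)) x" for n
    proof (rule AE_I2)
      fix x
      show "norm (?q n x) \<le> B * indicator (cball 0 (R + 1)) x"
      proof (cases "norm x \<le> R + 1")
        case True then show ?thesis using mvt_axis_bound[OF df B(2) h(1)] by simp
      next
        case False
        have "norm x \<le> norm (x + h n *\<^sub>R axis i 1) + norm (h n *\<^sub>R (axis i 1 :: real^'n))"
          using norm_triangle_ineq4[of "x + h n *\<^sub>R axis i 1" "h n *\<^sub>R axis i 1"] by simp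
        then have "norm (x + h n *\<^sub>R axis i 1) > R" using False h[of n] by simp
        then have "f (x + h n *\<^sub>R axis i 1) = 0" "f x = 0" using assms(2) False by (force, force)
        then show ?thesis using B(1) by simp
      qed
    qed
  qed
  then show ?thesis unfolding zero using LIMSEQ_unique tendsto_const by blast
qed

text \<open>Bounded support is asked of the products, so that one factor may be any function smooth
  on the whole space while the other one provides the support.\<close>

theorem integral_by_parts:
  fixes f g :: "real^'n \<Rightarrow> real"
  assumes "C_diff 1 f" "C_diff 1 g" "\<And>x. f x * g x \<noteq> 0 \<Longrightarrow> norm x \<le> R"
    "\<And>x. f x * pd i g x \<noteq> 0 \<Longrightarrow> norm x \<le> R"
  shows "(LBINT x. f x * pd i g x) = - (LBINT x. pd i f x * g x)"
proof -
  have df: "f differentiable (at x)" "g differentiable (at x)" for x using assms(1,2) by simp_all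
  have eq: "pd i (\<lambda>x. f x * g x) = (\<lambda>x. f x * pd i g x + pd i f x * g x)"
    using pderiv_dir_mult[OF df] by auto
  have C: "C_diff 1 (\<lambda>x. f x * g x)" by (intro C_diff_mult assms)
  have "(LBINT x. f x * pd i g x + pd i f x * g x) = 0"
    using integral_pderiv_zero[OF C assms(3), of i] eq by simp
  moreover have i1: "integrable lborel (\<lambda>x. f x * pd i g x)"
    using assms(1,2) by (intro continuous_bounded_support_integrable[OF _ assms(4)] continuous_on_mult)
      (auto intro: C_diff_continuous[OF assms(1)])
  moreover have "integrable lborel (\<lambda>x. f x * pd i g x + pd i f x * g x)"
    unfolding eq[symmetric]
    by (rule continuous_bounded_support_integrable[OF _ pderiv_dir_zero_outside[OF assms(3)]])
       (use C C_diff_pderiv[of 0] in simp)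
  then have "integrable lborel (\<lambda>x. (f x * pd i g x + pd i f x * g x) - f x * pd i g x)"
    using i1 by (rule Bochner_Integration.integrable_diff)
  then have "integrable lborel (\<lambda>x. pd i f x * g x)" by simp
  ultimately show ?thesis by simp
qed

section \<open>Mollifiers\<close>

text \<open>Products of exp (-1/t) with polynomials in 1/t are closed under differentiation: with x
  = 1/t, the derivative multiplies by x^2 and replaces \<open>p\<close> by
  \<open>p - pderiv p\<close>, which is \<open>bump_step\<close>. Its iterates supply the family of
  derivatives for \<open>C_diff_compose\<close>.\<close>

definition exp_bump :: "real poly \<Rightarrow> real \<Rightarrow> real" where
  "exp_bump p t = (if t > 0 then poly p (1 / t) * exp (- (1 / t)) else 0)"

definition bump_step :: "real poly \<Rightarrow> real poly" where
  "bump_step p = [:0, 0, 1:] * (p - pderiv p)"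

lemma poly_over_exp_tendsto_0: "((\<lambda>x::real. poly p x * exp (- x)) \<longlongrightarrow> 0) at_top"
proof (induction p)
  case 0 show ?case by simp
next
  case (pCons a p)
  have *: "((\<lambda>x. (poly q x * exp (-x))) \<longlongrightarrow> 0) at_top \<Longrightarrow> True" for q :: "real poly" by simp
  have "((\<lambda>x::real. \<Sum>i\<le>degree (pCons a p). coeff (pCons a p) i * (x ^ i / exp x)) \<longlongrightarrow> (\<Sum>i\<le>degree (pCons a p). coeff (pCons a p) i * 0)) at_top"
    by (intro tendsto_sum tendsto_mult tendsto_const tendsto_power_div_exp_0)
  then show ?case by (simp add: poly_altdef exp_minus divide_inverse sum_distrib_right mult.assoc)
qed

lemma exp_bump_deriv: "(exp_bump p has_real_derivative exp_bump (bump_step p) t) (at t)"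
proof (cases t "0::real" rule: linorder_cases)
  case less
  have "((\<lambda>t. 0) has_real_derivative exp_bump (bump_step p) t) (at t)"
    using less by (simp add: exp_bump_def)
  then show ?thesis
    by (rule has_field_derivative_transform_within_open[where S = "{..<0}"])
       (use less in \<open>auto simp: exp_bump_def\<close>)
next
  case greater
  have "((\<lambda>t. poly p (1 / t) * exp (- (1 / t))) has_real_derivative exp_bump (bump_step p) t) (at t)"
    using greater
    by (auto intro!: derivative_eq_intros simp: exp_bump_def bump_step_def field_simps power2_eq_square)
  then show ?thesis
    by (rule has_field_derivative_transform_within_open[where S = "{0<..}"])
       (use greater in \<open>auto simp: exp_bump_def\<close>)
next
  case equal
  have right: "((\<lambda>h. exp_bump p h / h) \<longlongrightarrow> 0) (at_right 0)"
  proof (rule Lim_transform_eventually)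
    have "((\<lambda>h. poly ([:0,1:] * p) (1 / h) * exp (- (1 / h))) \<longlongrightarrow> 0) (at_right 0)"
      by (rule filterlim_compose[OF poly_over_exp_tendsto_0])
         (use filterlim_inverse_at_top_right in \<open>simp add: inverse_eq_divide\<close>)
    then show "((\<lambda>h. poly ([:0,1:] * p) (1 / h) * exp (- (1 / h))) \<longlongrightarrow> 0) (at_right (0::real))" .
    show "\<forall>\<^sub>F h in at_right 0. poly ([:0,1:] * p) (1 / h) * exp (- (1 / h)) = exp_bump p h / h"
      unfolding eventually_at_right_field by (intro exI[of _ 1]) (auto simp: exp_bump_def)
  qed
  have left: "((\<lambda>h. exp_bump p h / h) \<longlongrightarrow> 0) (at_left 0)"
  proof (rule Lim_transform_eventually)
    show "((\<lambda>h. 0::real) \<longlongrightarrow> 0) (at_left (0::real))" by simp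
    show "\<forall>\<^sub>F h in at_left 0. 0 = exp_bump p h / h"
      unfolding eventually_at_left_field by (intro exI[of _ "-1"]) (auto simp: exp_bump_def)
  qed
  have "((\<lambda>h. (exp_bump p (0 + h) - exp_bump p 0) / h) \<longlongrightarrow> 0) (at 0)"
    using left right by (simp add: filterlim_at_split exp_bump_def[of p 0])
  then show ?thesis using equal by (simp add: DERIV_def exp_bump_def[of _ 0])
qed

definition bump :: "real \<Rightarrow> real^'n \<Rightarrow> real" where
  "bump r x = exp_bump 1 (1 - inner x x / r^2)"

lemma C_diff_norm_square: "C_diff k (\<lambda>x::real^'n. inner x x)"
proof -
  have "(\<lambda>x::real^'n. inner x x) = (\<lambda>x. \<Sum>i\<in>UNIV. inner (axis i 1) x * inner (axis i 1) x)"
  proof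
    fix x :: "real^'n"
    show "inner x x = (\<Sum>i\<in>UNIV. inner (axis i 1) x * inner (axis i 1) x)"
      by (subst inner_vec_def) (simp add: inner_axis')
  qed
  then show ?thesis by (simp only:) (intro C_diff_sum C_diff_mult C_diff_inner)
qed

lemma C_diff_bump: "C_diff k (bump r)"
proof -
  have "C_diff k (\<lambda>x::real^'n. (\<lambda>j. exp_bump ((bump_step ^^ j) 1)) 0 (1 - (1 / r^2) * inner x x))"
  proof (rule C_diff_compose[where h = "\<lambda>j. exp_bump ((bump_step ^^ j) 1)"])
    show "(exp_bump ((bump_step ^^ j) 1) has_real_derivative exp_bump ((bump_step ^^ Suc j) 1) t) (at t)" for j t
      using exp_bump_deriv by simp
    show "continuous_on UNIV (exp_bump ((bump_step ^^ k) 1))"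
      using exp_bump_deriv by (meson DERIV_continuous_on has_field_derivative_at_within)
    show "C_diff k (\<lambda>x::real^'n. 1 - (1 / r^2) * inner x x)"
      by (intro C_diff_diff C_diff_const C_diff_cmult C_diff_norm_square)
  qed
  then show ?thesis by (simp add: bump_def[abs_def])
qed

lemma bump_nonneg: "bump r x \<ge> 0"
  by (simp add: bump_def exp_bump_def)

lemma bump_support: "r > 0 \<Longrightarrow> bump r x \<noteq> 0 \<Longrightarrow> norm x < r"
  by (auto simp: bump_def exp_bump_def dot_square_norm divide_less_eq split: if_splits
      intro: power2_less_imp_less)

lemma bump_pos: "r > 0 \<Longrightarrow> norm x < r \<Longrightarrow> bump r x > 0"
  by (simp add: bump_def exp_bump_def dot_square_norm divide_less_eq power_strict_mono)

definition kern :: "real \<Rightarrow> real^'n \<Rightarrow> real" where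
  "kern r x = (1 / (LINT y|lborel. bump r (y::real^'n))) * bump r x"

lemma bump_integrable: "r > 0 \<Longrightarrow> integrable lborel (bump r :: real^'n \<Rightarrow> real)"
  using bump_support
  by (intro continuous_bounded_support_integrable[where R = r] C_diff_continuous[OF C_diff_bump[of 0]]) force

lemma bump_integral_pos:
  assumes "r > 0"
  shows "(LINT y|lborel. bump r (y::real^'n)) > 0"
proof -
  have "(LINT y|lborel. bump r (y::real^'n)) \<ge> 0"
    using bump_nonneg by (intro integral_nonneg_AE) auto
  moreover have "(LINT y|lborel. bump r (y::real^'n)) \<noteq> 0"
  proof
    assume "(LINT y|lborel. bump r (y::real^'n)) = 0"
    then have "AE y in lborel. bump r (y::real^'n) = 0"
      using integral_nonneg_eq_0_iff_AE[OF bump_integrable[OF assms]] bump_nonneg by auto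
    then have "AE y in lborel. y \<notin> ball (0::real^'n) r"
      by eventually_elim (use bump_pos[OF assms] in force)
    then have "emeasure lborel (ball (0::real^'n) r) = 0"
      by (subst (asm) AE_iff_measurable[where N = "ball 0 r"]) auto
    then show False
      using assms content_ball_pos[of r "0::real^'n"]
      by (simp add: measure_def)
  qed
  ultimately show ?thesis by simp
qed

lemma C_diff_kern: "C_diff k (kern r)"
  unfolding kern_def[abs_def] by (intro C_diff_cmult C_diff_bump)

lemma kern_nonneg: "kern r x \<ge> 0"
proof -
  have "(LINT y|lborel. bump r (y::real^'n)) \<ge> 0"
    using bump_nonneg by (intro integral_nonneg_AE) auto
  then show ?thesis by (simp add: kern_def bump_nonneg)
qed

lemma kern_support: "r > 0 \<Longrightarrow> kern r x \<noteq> 0 \<Longrightarrow> norm x < r"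
  using bump_support by (auto simp: kern_def)

lemma kern_support_le: "r > 0 \<Longrightarrow> kern r x \<noteq> 0 \<Longrightarrow> norm x \<le> r"
  using kern_support by force

lemma kern_integrable: "r > 0 \<Longrightarrow> integrable lborel (kern r)"
  unfolding kern_def[abs_def] by (intro integrable_mult_right bump_integrable)

lemma kern_integral: "r > 0 \<Longrightarrow> (LINT y|lborel. kern r (y::real^'n)) = 1"
  unfolding kern_def using bump_integral_pos[where 'n = 'n and r = r] by simp

lemma uniform_continuity_bounded_support:
  fixes f :: "real^'n \<Rightarrow> real"
  assumes "continuous_on UNIV f" "\<And>x. f x \<noteq> 0 \<Longrightarrow> norm x \<le> R" "e > 0"
  obtains d where "d > 0" "\<And>x y. dist x y < d \<Longrightarrow> \<bar>f x - f y\<bar> < e"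
proof -
  have "uniformly_continuous_on (cball 0 (R + 1)) f"
    using assms(1) continuous_on_subset by (intro compact_uniformly_continuous) auto
  then obtain d where d: "d > 0" "\<And>x y. x \<in> cball 0 (R+1) \<Longrightarrow> y \<in> cball 0 (R+1) \<Longrightarrow> dist x y < d \<Longrightarrow> \<bar>f x - f y\<bar> < e"
    unfolding uniformly_continuous_on_def using assms(3) by (metis dist_commute dist_real_def)
  have "\<bar>f x - f y\<bar> < e" if "dist x y < min d 1" for x y
  proof (cases "norm x \<le> R + 1 \<and> norm y \<le> R + 1")
    case True then show ?thesis using d that by auto
  next
    case False
    have "norm x \<le> norm y + dist x y" "norm y \<le> norm x + dist x y"
      using norm_triangle_sub[of x y] norm_triangle_sub[of y x] by (simp_all add: dist_norm norm_minus_commute)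
    then have "norm x > R" "norm y > R" using False that by auto
    then have "f x = 0" "f y = 0" using assms(2) by force+
    then show ?thesis using assms(3) by simp
  qed
  then show ?thesis using that[of "min d 1"] d(1) by simp
qed

lemma norm_component_sum_bound:
  fixes v :: "real^'n"
  assumes "\<And>i. \<bar>c i\<bar> \<le> e"
  shows "\<bar>\<Sum>i\<in>UNIV. v $ i * c i\<bar> \<le> real CARD('n) * e * norm v"
proof -
  have "\<bar>\<Sum>i\<in>UNIV. v $ i * c i\<bar> \<le> (\<Sum>i\<in>UNIV. \<bar>v $ i * c i\<bar>)" by (rule sum_abs)
  also have "\<dots> \<le> (\<Sum>i\<in>(UNIV::'n set). norm v * e)"
    using assms by (intro sum_mono) (auto simp: abs_mult intro!: mult_mono component_le_norm_cart)
  finally show ?thesis by (simp add: mult_ac)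
qed

text \<open>The remainder is small uniformly in \<open>x\<close>. In
  \<open>conv_has_derivative\<close> one bound therefore serves all integration points, and
  differentiation passes under the integral sign.\<close>

lemma uniform_differentiability:
  fixes k :: "real^'n \<Rightarrow> real"
  assumes "C_diff 1 k" "\<And>x. k x \<noteq> 0 \<Longrightarrow> norm x \<le> R" "e > 0"
  obtains d where "d > 0"
    "\<And>x h. norm h < d \<Longrightarrow> \<bar>k (x + h) - k x - (\<Sum>i\<in>UNIV. h $ i * pd i k x)\<bar> \<le> e * norm h"
proof -
  have dk: "k differentiable (at x)" for x using assms(1) by simp
  define e' where "e' = e / real CARD('n)"
  have e': "e' > 0" using assms(3) by (simp add: e'_def)
  have "\<exists>d>0. \<forall>x y. dist x y < d \<longrightarrow> \<bar>pd i k x - pd i k y\<bar> < e'" for i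
  proof (rule uniform_continuity_bounded_support[where f = "pd i k" and R = R and e = e'])
    show "continuous_on UNIV (pd i k)" using assms(1) by simp
    show "norm x \<le> R" if "pd i k x \<noteq> 0" for x
      using pderiv_dir_zero_outside[OF assms(2) that] .
  qed (use e' in auto)
  then obtain D where D: "\<And>i. D i > 0" "\<And>i x y. dist x y < D i \<Longrightarrow> \<bar>pd i k x - pd i k y\<bar> < e'"
    by metis
  define d where "d = Min (range D)"
  have d: "d > 0" "d \<le> D i" for i unfolding d_def using D(1) by auto
  have "\<bar>k (x + h) - k x - (\<Sum>i\<in>UNIV. h $ i * pd i k x)\<bar> \<le> e * norm h" if h: "norm h < d" for x h
  proof -
    have "\<exists>s>0. s < 1 \<and> k (x + 1 *\<^sub>R h) - k (x + 0 *\<^sub>R h) = (1 - 0) * (\<Sum>i\<in>UNIV. h $ i * pd i k (x + s *\<^sub>R h))"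
      by (rule MVT2[where f = "\<lambda>t. k (x + t *\<^sub>R h)"]) (auto intro: has_real_derivative_line dk)
    then obtain s where s: "0 < s" "s < 1" "k (x + h) - k x = (\<Sum>i\<in>UNIV. h $ i * pd i k (x + s *\<^sub>R h))"
      by auto
    have "dist (x + s *\<^sub>R h) x < d"
      using s h mult_left_le_one_le[of "norm h" s] by (simp add: dist_norm)
    then have b: "\<bar>pd i k (x + s *\<^sub>R h) - pd i k x\<bar> \<le> e'" for i
      using D(2) d(2) by (metis less_le_trans less_imp_le)
    have "k (x + h) - k x - (\<Sum>i\<in>UNIV. h $ i * pd i k x)
        = (\<Sum>i\<in>UNIV. h $ i * (pd i k (x + s *\<^sub>R h) - pd i k x))"
      unfolding s(3) by (simp add: sum_subtractf right_diff_distrib)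
    then show ?thesis
      using norm_component_sum_bound[OF b, of h] by (simp add: e'_def)
  qed
  then show ?thesis using that d(1) by blast
qed

definition conv :: "(real^'n \<Rightarrow> real) \<Rightarrow> (real^'n \<Rightarrow> real) \<Rightarrow> real^'n \<Rightarrow> real" where
  "conv u k x = (LINT y|lborel. u y * k (x - y))"

lemma conv_integrable:
  fixes k u :: "real^'n \<Rightarrow> real"
  assumes "integrable lborel u" "continuous_on UNIV k" "\<And>x. k x \<noteq> 0 \<Longrightarrow> norm x \<le> R"
  shows "integrable lborel (\<lambda>y. u y * k (x - y))"
proof -
  obtain B where B: "B > 0" "\<And>x. \<bar>k x\<bar> \<le> B" using bounded_support_bound[OF assms(2,3)] by blast
  show ?thesis
  proof (rule Bochner_Integration.integrable_bound[where f = "\<lambda>y. B * u y"])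
    show "integrable lborel (\<lambda>y. B * u y)" using assms(1) by simp
    have "k \<in> borel_measurable borel" using assms(2) borel_measurable_continuous_onI by blast
    then show "(\<lambda>y. u y * k (x - y)) \<in> borel_measurable lborel" using assms(1) by measurable
    show "AE y in lborel. norm (u y * k (x - y)) \<le> norm (B * u y)"
    proof (rule AE_I2)
      fix y
      show "norm (u y * k (x - y)) \<le> norm (B * u y)"
        using mult_left_mono[OF B(2)[of "x - y"], of "\<bar>u y\<bar>"] B(1) by (simp add: abs_mult mult.commute)
    qed
  qed
qed

lemma conv_uniform_bound:
  fixes k u :: "real^'n \<Rightarrow> real"
  assumes "integrable lborel u" "integrable lborel (\<lambda>y. u y * g y)" "\<And>y. \<bar>g y\<bar> \<le> e"
  shows "\<bar>LINT y|lborel. u y * g y\<bar> \<le> e * (LINT y|lborel. \<bar>u y\<bar>)"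
proof -
  have "\<bar>LINT y|lborel. u y * g y\<bar> \<le> (LINT y|lborel. \<bar>u y * g y\<bar>)"
    by (rule integral_abs_bound)
  also have "\<dots> \<le> (LINT y|lborel. e * \<bar>u y\<bar>)"
  proof (rule integral_mono)
    show "integrable lborel (\<lambda>y. \<bar>u y * g y\<bar>)" "integrable lborel (\<lambda>y. e * \<bar>u y\<bar>)"
      using assms(1,2) by auto
    show "\<bar>u y * g y\<bar> \<le> e * \<bar>u y\<bar>" for y
      using mult_right_mono[OF assms(3), of "\<bar>u y\<bar>" y] by (simp add: abs_mult mult.commute)
  qed
  finally show ?thesis by simp
qed

lemma conv_continuous:
  fixes k u :: "real^'n \<Rightarrow> real"
  assumes "integrable lborel u" "continuous_on UNIV k" "\<And>x. k x \<noteq> 0 \<Longrightarrow> norm x \<le> R"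
  shows "continuous_on UNIV (conv u k)"
  unfolding continuous_on_iff
proof (intro ballI allI impI)
  fix x and e :: real assume e: "e > 0"
  define I where "I = (LINT y|lborel. \<bar>u y\<bar>)"
  have I: "I \<ge> 0" by (simp add: I_def)
  have e': "e / (I + 1) > 0" by (rule divide_pos_pos[OF e]) (use I in linarith)
  obtain d where d: "d > 0" "\<And>x y. dist x y < d \<Longrightarrow> \<bar>k x - k y\<bar> < e / (I + 1)"
    using uniform_continuity_bounded_support[OF assms(2,3) e'] by blast
  show "\<exists>d>0. \<forall>x'\<in>UNIV. dist x' x < d \<longrightarrow> dist (conv u k x') (conv u k x) < e"
  proof (intro exI[of _ d] conjI ballI impI, rule d(1))
    fix x' assume x': "dist x' x < d"
    have eq: "conv u k x' - conv u k x = (LINT y|lborel. u y * (k (x' - y) - k (x - y)))"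
      unfolding conv_def right_diff_distrib using conv_integrable[OF assms]
      by (intro Bochner_Integration.integral_diff[symmetric]) auto
    have "\<bar>LINT y|lborel. u y * (k (x' - y) - k (x - y))\<bar> \<le> e / (I + 1) * I"
    proof (rule conv_uniform_bound[OF assms(1), folded I_def])
      show "integrable lborel (\<lambda>y. u y * (k (x' - y) - k (x - y)))"
        unfolding right_diff_distrib using conv_integrable[OF assms] by auto
      show "\<bar>k (x' - y) - k (x - y)\<bar> \<le> e / (I + 1)" for y
        using d(2)[of "x' - y" "x - y"] x' by (simp add: dist_norm)
    qed
    also have "\<dots> < e" using e I by (simp add: field_simps)
    finally show "dist (conv u k x') (conv u k x) < e" by (simp add: dist_real_def eq)
  qed
qed

lemma conv_has_derivative:
  fixes k u :: "real^'n \<Rightarrow> real"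
  assumes u: "integrable lborel u" and k: "C_diff 1 k" "\<And>x. k x \<noteq> 0 \<Longrightarrow> norm x \<le> R"
  shows "(conv u k has_derivative (\<lambda>h. \<Sum>i\<in>UNIV. h $ i * conv u (pd i k) x)) (at x)"
  unfolding has_derivative_at_alt
proof (intro conjI allI impI)
  show "bounded_linear (\<lambda>h. \<Sum>i\<in>UNIV. h $ i * conv u (pd i k) x)"
    by (intro bounded_linear_sum bounded_linear_mult_const bounded_linear_vec_nth)
  fix e :: real assume e: "e > 0"
  define I where "I = (LINT y|lborel. \<bar>u y\<bar>)"
  have I: "I \<ge> 0" by (simp add: I_def)
  have ck: "continuous_on UNIV k" using C_diff_continuous[OF k(1)] .
  have cd: "continuous_on UNIV (pd i k)" for i using k(1) by simp
  have int: "integrable lborel (\<lambda>y. u y * k (z - y))"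
     "integrable lborel (\<lambda>y. u y * pd i k (z - y))" for z i
    using conv_integrable[OF u ck k(2)] conv_integrable[OF u cd pderiv_dir_zero_outside[OF k(2)]] by auto
  have e': "e / (I + 1) > 0" by (rule divide_pos_pos[OF e]) (use I in linarith)
  obtain d where d: "d > 0" "\<And>x h. norm h < d \<Longrightarrow>
      \<bar>k (x + h) - k x - (\<Sum>i\<in>UNIV. h $ i * pd i k x)\<bar> \<le> e / (I + 1) * norm h"
    using uniform_differentiability[OF k e'] by blast
  show "\<exists>d>0. \<forall>y. norm (y - x) < d \<longrightarrow> norm (conv u k y - conv u k x -
      (\<Sum>i\<in>UNIV. (y - x) $ i * conv u (pd i k) x)) \<le> e * norm (y - x)"
  proof (intro exI[of _ d] conjI allI impI, rule d(1))
    fix y assume y: "norm (y - x) < d"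
    let ?g = "\<lambda>z. k (y - z) - k (x - z) - (\<Sum>i\<in>UNIV. (y - x) $ i * pd i k (x - z))"
    have ig: "integrable lborel (\<lambda>z. u z * ?g z)"
    proof -
      have "integrable lborel (\<lambda>z. u z * k (y - z) - u z * k (x - z) -
          (\<Sum>i\<in>UNIV. (y - x) $ i * (u z * pd i k (x - z))))"
        using int by (intro Bochner_Integration.integrable_diff Bochner_Integration.integrable_sum integrable_mult_right) auto
      then show ?thesis by (simp add: algebra_simps sum_distrib_left)
    qed
    have "conv u k y - conv u k x - (\<Sum>i\<in>UNIV. (y - x) $ i * conv u (pd i k) x)
       = (LINT z|lborel. u z * k (y - z) - u z * k (x - z) -
          (\<Sum>i\<in>UNIV. (y - x) $ i * (u z * pd i k (x - z))))"
      unfolding conv_def using int by simp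
    also have "\<dots> = (LINT z|lborel. u z * ?g z)"
      by (simp add: algebra_simps sum_distrib_left)
    finally have eq: "conv u k y - conv u k x - (\<Sum>i\<in>UNIV. (y - x) $ i * conv u (pd i k) x)
       = (LINT z|lborel. u z * ?g z)" .
    have "\<bar>LINT z|lborel. u z * ?g z\<bar> \<le> e / (I + 1) * norm (y - x) * I"
    proof (rule conv_uniform_bound[OF u ig, folded I_def])
      show "\<bar>?g z\<bar> \<le> e / (I + 1) * norm (y - x)" for z
        using d(2)[OF y, of "x - z"] by (simp add: algebra_simps)
    qed
    also have "\<dots> = e * norm (y - x) * (I / (I + 1))" by simp
    also have "\<dots> \<le> e * norm (y - x)"
      using e I by (intro mult_right_le_one_le) auto
    finally show "norm (conv u k y - conv u k x - (\<Sum>i\<in>UNIV. (y - x) $ i * conv u (pd i k) x))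
        \<le> e * norm (y - x)" unfolding eq real_norm_def .
  qed
qed

lemma pderiv_dir_conv:
  fixes k u :: "real^'n \<Rightarrow> real"
  assumes "integrable lborel u" "C_diff 1 k" "\<And>x. k x \<noteq> 0 \<Longrightarrow> norm x \<le> R"
  shows "pd i (conv u k) = conv u (pd i k)"
proof
  fix x
  show "pd i (conv u k) x = conv u (pd i k) x"
    using pderiv_dir_eqI[OF conv_has_derivative[OF assms], of i x]
    by (simp add: axis_def if_distrib[of "\<lambda>z. z * _"] cong: if_cong)
qed

text \<open>All derivatives fall on the kernel, so smoothness is inherited from \<open>k\<close>
  even for a merely integrable \<open>u\<close>.\<close>

lemma C_diff_conv:
  fixes k u :: "real^'n \<Rightarrow> real"
  assumes "integrable lborel u" "C_diff n k" "\<And>x. k x \<noteq> 0 \<Longrightarrow> norm x \<le> R"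
  shows "C_diff n (conv u k)"
  using assms(2,3)
proof (induction n arbitrary: k)
  case 0 then show ?case using conv_continuous[OF assms(1) _ 0(2)] by simp
next
  case (Suc n)
  have k1: "C_diff 1 k" using C_diff_mono[OF Suc.prems(1), of 1] by simp
  have "C_diff n (conv u (pd i k))" for i
    using Suc.prems pderiv_dir_zero_outside[OF Suc.prems(2)] by (intro Suc.IH) auto
  then show ?case
    using conv_has_derivative[OF assms(1) k1 Suc.prems(2)]
    by (auto simp: pderiv_dir_conv[OF assms(1) k1 Suc.prems(2)] differentiable_def)
qed

lemma conv_alt:
  fixes k u :: "real^'n \<Rightarrow> real"
  assumes "integrable lborel (\<lambda>y. u y * k (x - y))"
  shows "integrable lborel (\<lambda>y. u (x - y) * k y)" "conv u k x = (LINT y|lborel. u (x - y) * k y)"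
  using integral_lborel_affine[OF assms, of "-1" x] by (simp_all add: conv_def)

lemma conv_kern_integrable:
  fixes u :: "real^'n \<Rightarrow> real"
  assumes "integrable lborel u" "r > 0"
  shows "integrable lborel (\<lambda>y. u y * kern r (x - y))"
  using conv_integrable[OF assms(1) C_diff_continuous[OF C_diff_kern[of 0]] kern_support_le[OF assms(2)]] .

text \<open>Since \<open>kern\<close> is a probability density supported in a ball, mollification preserves bounds
  that hold on the ball.\<close>

lemma conv_kern_le:
  fixes u :: "real^'n \<Rightarrow> real"
  assumes "integrable lborel u" "r > 0" "\<And>y. norm (x - y) < r \<Longrightarrow> u y \<le> B"
  shows "conv u (kern r) x \<le> B"
proof -
  have i: "integrable lborel (\<lambda>y. u (x - y) * kern r y)" "conv u (kern r) x = (LINT y|lborel. u (x - y) * kern r y)"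
    using conv_alt[OF conv_kern_integrable[OF assms(1,2)]] by auto
  have "(LINT y|lborel. u (x - y) * kern r y) \<le> (LINT y|lborel. B * kern r (y::real^'n))"
  proof (rule integral_mono[OF i(1)])
    show "integrable lborel (\<lambda>y::real^'n. B * kern r y)" by (intro integrable_mult_right kern_integrable assms(2))
    show "u (x - y) * kern r y \<le> B * kern r y" for y
      using kern_support[OF assms(2), of y] kern_nonneg[of r y] assms(3)[of "x - y"]
      by (cases "kern r y = 0") (auto intro: mult_right_mono)
  qed
  then show ?thesis using i(2) kern_integral[OF assms(2), where 'n = 'n] by simp
qed

lemma conv_cmult: "conv (\<lambda>x. c * u x) k x = c * conv u k x"
  by (simp add: conv_def mult.assoc)

text \<open>The one-sided bound is applied to \<open>u\<close> and to its negative. With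
  \<open>e = 0\<close> it says that mollification reproduces locally constant values, with
  \<open>c = 0\<close> that it preserves bounds on the modulus.\<close>

lemma conv_kern_near:
  fixes u :: "real^'n \<Rightarrow> real"
  assumes "integrable lborel u" "r > 0" "\<And>y. norm (x - y) < r \<Longrightarrow> \<bar>u y - c\<bar> \<le> e"
  shows "\<bar>conv u (kern r) x - c\<bar> \<le> e"
proof -
  have "conv u (kern r) x \<le> c + e"
    by (rule conv_kern_le[OF assms(1,2)]) (drule assms(3), linarith)
  moreover have "conv (\<lambda>x. (-1) * u x) (kern r) x \<le> e - c"
  proof (rule conv_kern_le[OF _ assms(2)])
    show "integrable lborel (\<lambda>x. (-1) * u x)" using assms(1) by simp
    show "(-1) * u y \<le> e - c" if "norm (x - y) < r" for y using assms(3)[OF that] by linarith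
  qed
  then have "- conv u (kern r) x \<le> e - c" unfolding conv_cmult by simp
  ultimately show ?thesis by linarith
qed

lemma conv_kern_support:
  assumes "conv u (kern r) x \<noteq> 0" "r > 0"
  shows "\<exists>y. u y \<noteq> 0 \<and> norm (x - y) < r"
proof (rule ccontr)
  assume "\<not> ?thesis"
  then have "u y * kern r (x - y) = 0" for y
    using kern_support[OF assms(2), of "x - y"] by auto
  then have "(\<lambda>y. u y * kern r (x - y)) = (\<lambda>y. 0)" by auto
  then show False using assms(1) by (simp add: conv_def)
qed

section \<open>A weighted second derivative estimate\<close>

lemma sum_antisym_zero:
  fixes E :: "'i::finite \<Rightarrow> 'i \<Rightarrow> real"
  shows "(\<Sum>i\<in>UNIV. \<Sum>j\<in>UNIV. E i j - E j i) = 0"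
  using sum.swap[of "\<lambda>i j. E i j" UNIV UNIV] by (simp add: sum_subtractf)

lemma C_diff_1_rules:
  assumes "C_diff 1 f" "C_diff 1 g"
  shows "pd i (\<lambda>x. f x * g x) x = f x * pd i g x + pd i f x * g x"
    "pd i (\<lambda>x. f x + g x) x = pd i f x + pd i g x"
    "pd i (\<lambda>x. f x - g x) x = pd i f x - pd i g x"
  using assms by (simp_all add: pderiv_dir_mult pderiv_dir_add pderiv_dir_diff)

lemma integral_sum_sum:
  fixes f :: "'i::finite \<Rightarrow> 'i \<Rightarrow> 'a::euclidean_space \<Rightarrow> real"
  assumes "\<And>i j. integrable lborel (f i j)"
  shows "integrable lborel (\<lambda>x. \<Sum>i\<in>UNIV. \<Sum>j\<in>UNIV. f i j x)"
    "(LBINT x. (\<Sum>i\<in>UNIV. \<Sum>j\<in>UNIV. f i j x)) = (\<Sum>i\<in>UNIV. \<Sum>j\<in>UNIV. (LBINT x. f i j x))"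
  using assms by simp_all

definition grad_sq :: "(real^'n \<Rightarrow> real) \<Rightarrow> real^'n \<Rightarrow> real" where
  "grad_sq f x = (\<Sum>i\<in>UNIV. (pd i f x)^2)"

definition hess_sq :: "(real^'n \<Rightarrow> real) \<Rightarrow> real^'n \<Rightarrow> real" where
  "hess_sq f x = (\<Sum>i\<in>UNIV. \<Sum>j\<in>UNIV. (pd j (pd i f) x)^2)"

definition lap :: "(real^'n \<Rightarrow> real) \<Rightarrow> real^'n \<Rightarrow> real" where
  "lap f x = (\<Sum>i\<in>UNIV. pd i (pd i f) x)"

lemma C_diff_grad_sq: "C_diff (Suc k) f \<Longrightarrow> C_diff k (grad_sq f)"
  unfolding grad_sq_def[abs_def] power2_eq_square by (intro C_diff_sum C_diff_mult) auto

lemma C_diff_hess_sq: "C_diff (Suc (Suc k)) f \<Longrightarrow> C_diff k (hess_sq f)"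
  unfolding hess_sq_def[abs_def] power2_eq_square by (intro C_diff_sum C_diff_mult) auto

lemma C_diff_lap: "C_diff (Suc (Suc k)) f \<Longrightarrow> C_diff k (lap f)"
  unfolding lap_def[abs_def] by (intro C_diff_sum) auto

text \<open>Two integrations by parts, written as the vanishing of the integral of one divergence;
  the third derivatives of \<open>e\<close> cancel.\<close>

lemma hessian_identity:
  fixes e t :: "real^'n \<Rightarrow> real"
  assumes e: "C_diff 3 e" and t: "C_diff 2 t" "\<And>x. t x \<noteq> 0 \<Longrightarrow> norm x \<le> R"
  shows "(LBINT x. t x * hess_sq e x) = (LBINT x. t x * (lap e x)^2) +
    (LBINT x. lap t x * grad_sq e x
       - (\<Sum>i\<in>UNIV. \<Sum>j\<in>UNIV. pd j (pd i t) x * pd i e x * pd j e x))"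
proof -
  define p where "p = (\<lambda>i. pd i e)"
  define P where "P = (\<lambda>i j. pd j (p i))"
  define z where "z = (\<lambda>i. pd i t)"
  define Z where "Z = (\<lambda>i j. pd j (z i))"
  have C3: "C_diff (Suc (Suc (Suc 0))) e" using e by (simp only: numeral_3_eq_3)
  have C2: "C_diff (Suc (Suc 0)) t" using t(1) by (simp only: numeral_2_eq_2)
  have p2: "C_diff (Suc 1) (p i)" for i unfolding p_def using C3 C_diff_pderiv by (metis One_nat_def)
  have c: "C_diff 1 (p i)" "C_diff 1 (P i j)" "C_diff 1 (z i)" "C_diff 1 t" for i j
    using C_diff_SucD[OF p2] C_diff_pderiv[OF p2] C_diff_pderiv[OF C2] C_diff_SucD[OF C2]
    by (simp_all only: P_def z_def One_nat_def)
  have cont: "continuous_on UNIV (p i)" "continuous_on UNIV (P i j)" "continuous_on UNIV (z i)"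
    "continuous_on UNIV t" "continuous_on UNIV (pd k (P i j))" "continuous_on UNIV (Z i j)" for i j k
    using C_diff_continuous[OF c(1)] C_diff_continuous[OF c(2)] C_diff_continuous[OF c(3)]
      C_diff_continuous[OF c(4)] C_diff_pderiv[OF c(2)[unfolded One_nat_def]]
      C_diff_pderiv[OF c(3)[unfolded One_nat_def]]
    unfolding Z_def by (simp_all only: C_diff.simps(1))
  have sym: "P i j = P j i" for i j
    using pderiv_dir_commute[of e] C_diff_mono[OF e, of 2] by (auto simp: P_def p_def)
  have sym3: "pd j (P i i) x = pd i (P j i) x" for i j x
  proof -
    have "pd j (P i i) x = pd i (P i j) x"
      unfolding P_def by (rule pderiv_dir_commute) (use p2 in \<open>simp only: numeral_2_eq_2 One_nat_def\<close>)
    then show ?thesis by (simp only: sym[of i j])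
  qed
  have zs: "norm x \<le> R" if "z i x \<noteq> 0" for i x using pderiv_dir_zero_outside[OF t(2)] that by (auto simp: z_def)
  have Zs: "norm x \<le> R" if "Z i j x \<noteq> 0" for i j x using pderiv_dir_zero_outside[OF zs] that by (auto simp: Z_def)
  have Pd: "pd j (p i) = P i j" and Zd: "pd j (z i) = Z i j" and zd: "pd j t = z j" for i j
    by (simp_all add: P_def Z_def z_def)
  \<comment> \<open>The field whose divergence is integrated. The first group produces the weighted
    difference of the squared Hessian and the squared Laplacian, together with terms containing the
    gradient of \<open>t\<close>; the second group trades these for second derivatives of
    \<open>t\<close>.\<close>
  define V where "V = (\<lambda>i j x. t x * (P i j x * p i x - P i i x * p j x) + (z i x * p j x - p i x * z j x) * p i x)"
  have V1: "C_diff 1 (V i j)" for i j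
    unfolding V_def by (intro C_diff_add C_diff_mult C_diff_diff c)
  have Vs: "norm x \<le> R" if "V i j x \<noteq> 0" for i j x
    using that t(2)[of x] zs[of i x] zs[of j x] by (cases "t x = 0 \<and> z i x = 0 \<and> z j x = 0") (auto simp: V_def)
  have dV: "pd j (V i j) x =
      t x * ((P i j x)^2 + pd j (P i j) x * p i x - P i i x * P j j x - pd j (P i i) x * p j x)
      + z j x * (P i j x * p i x - P i i x * p j x)
      + (Z i j x * p j x + z i x * P j j x - P i j x * z j x - p i x * Z j j x) * p i x
      + (z i x * p j x - p i x * z j x) * P i j x" for i j x
  proof -
    have "pd j (V i j) x =
       (t x * ((P i j x * pd j (p i) x + pd j (P i j) x * p i x)
           - (P i i x * pd j (p j) x + pd j (P i i) x * p j x))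
         + pd j t x * (P i j x * p i x - P i i x * p j x)) +
       ((z i x * p j x - p i x * z j x) * pd j (p i) x
        + ((z i x * pd j (p j) x + pd j (z i) x * p j x)
            - (p i x * pd j (z j) x + pd j (p i) x * z j x)) * p i x)"
      unfolding V_def by (simp only: C_diff_1_rules C_diff_add C_diff_mult C_diff_diff c)
    then show ?thesis unfolding Pd Zd zd by (simp add: algebra_simps power2_eq_square)
  qed
  define G where "G = (\<lambda>i j x. t x * ((P i j x)^2 - P i i x * P j j x) + (Z i j x * p i x * p j x - (p i x)\<^sup>2 * Z j j x))"
  \<comment> \<open>All terms of the divergence other than \<open>G\<close>, the third derivatives
    of \<open>e\<close> among them, have the form \<open>E x i j - E x j i\<close> and disappear in
    the double sum.\<close>
  define E where "E = (\<lambda>x i j. z i x * P i j x * p j x + z i x * p i x * P j j x + t x * pd j (P i j) x * p i x)"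
  have "pd j (V i j) x = G i j x + (E x i j - E x j i)" for i j x
    unfolding dV G_def E_def by (simp add: sym[of j i] sym3[of j i] algebra_simps power2_eq_square)
  then have sumV: "(\<Sum>i\<in>UNIV. \<Sum>j\<in>UNIV. pd j (V i j) x) = (\<Sum>i\<in>UNIV. \<Sum>j\<in>UNIV. G i j x)" for x
    using sum_antisym_zero[of "E x"] by (simp add: sum.distrib)
  have iV: "integrable lborel (pd j (V i j))" for i j
    by (rule continuous_bounded_support_integrable[OF _ pderiv_dir_zero_outside[OF Vs]])
       (use V1 in simp)
  have "(LBINT x. (\<Sum>i\<in>UNIV. \<Sum>j\<in>UNIV. G i j x)) = 0"
    unfolding sumV[symmetric] integral_sum_sum(2)[OF iV]
    by (simp add: integral_pderiv_zero[OF V1 Vs])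
  moreover have "(\<Sum>i\<in>UNIV. \<Sum>j\<in>UNIV. G i j x) = t x * hess_sq e x - t x * (lap e x)^2
     - (lap t x * grad_sq e x - (\<Sum>i\<in>UNIV. \<Sum>j\<in>UNIV. Z i j x * p i x * p j x))" for x
  proof -
    have "(\<Sum>i\<in>UNIV. \<Sum>j\<in>UNIV. G i j x) = t x * (\<Sum>i\<in>UNIV. \<Sum>j\<in>UNIV. (P i j x)^2)
       - t x * (\<Sum>i\<in>UNIV. \<Sum>j\<in>UNIV. P i i x * P j j x) + (\<Sum>i\<in>UNIV. \<Sum>j\<in>UNIV. Z i j x * p i x * p j x)
       - (\<Sum>i\<in>UNIV. \<Sum>j\<in>UNIV. (p i x)^2 * Z j j x)"
      by (simp add: G_def sum.distrib sum_subtractf sum_distrib_left algebra_simps)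
    also have "(\<Sum>i\<in>UNIV. \<Sum>j\<in>UNIV. P i i x * P j j x) = (lap e x)^2"
      by (simp add: lap_def P_def p_def power2_eq_square sum_product)
    also have "(\<Sum>i\<in>UNIV. \<Sum>j\<in>UNIV. (p i x)^2 * Z j j x) = lap t x * grad_sq e x"
      unfolding lap_def grad_sq_def Z_def z_def p_def sum_product[symmetric] by (rule mult.commute)
    finally show ?thesis by (simp add: hess_sq_def P_def p_def)
  qed
  moreover have "integrable lborel (\<lambda>x. t x * hess_sq e x)"
    by (rule continuous_bounded_support_integrable[where R = R])
       (use t(2) C_diff_continuous[OF C_diff_hess_sq[of 0 e]] C_diff_mono[OF e, of 2] cont in
         \<open>auto intro!: continuous_on_mult simp: numeral_2_eq_2 simp del: C_diff.simps(2)\<close>)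
  moreover have "integrable lborel (\<lambda>x. t x * (lap e x)^2)"
    by (rule continuous_bounded_support_integrable[where R = R])
       (use t(2) C_diff_continuous[OF C_diff_lap[of 0 e]] C_diff_mono[OF e, of 2] cont in
         \<open>auto intro!: continuous_on_mult continuous_on_power simp: numeral_2_eq_2 simp del: C_diff.simps(2)\<close>)
  moreover have "integrable lborel (\<lambda>x. lap t x * grad_sq e x - (\<Sum>i\<in>UNIV. \<Sum>j\<in>UNIV. Z i j x * p i x * p j x))"
  proof (rule continuous_bounded_support_integrable[where R = R])
    show "continuous_on UNIV (\<lambda>x. lap t x * grad_sq e x - (\<Sum>i\<in>UNIV. \<Sum>j\<in>UNIV. Z i j x * p i x * p j x))"
      unfolding lap_def grad_sq_def
      by (intro continuous_intros cont cont(1)[unfolded p_def] cont(6)[unfolded Z_def z_def])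
    show "norm x \<le> R" if "lap t x * grad_sq e x - (\<Sum>i\<in>UNIV. \<Sum>j\<in>UNIV. Z i j x * p i x * p j x) \<noteq> 0" for x
    proof (rule ccontr)
      assume "\<not> norm x \<le> R"
      then have "Z i j x = 0" for i j using Zs by blast
      then show False using that by (simp add: lap_def Z_def z_def)
    qed
  qed
  ultimately show ?thesis by (simp add: Z_def z_def p_def)
qed

lemma le_half_sum_of_square_le_mult:
  fixes a b y :: real
  assumes "y^2 \<le> a * b" "0 \<le> a" "0 \<le> b"
  shows "y \<le> (a + b) / 2"
proof -
  have "y \<le> sqrt (a * b)" using assms(1) by (rule real_le_rsqrt)
  also have "\<dots> \<le> (a + b) / 2" using arith_geo_mean_sqrt[OF assms(2,3)] .
  finally show ?thesis .
qed

lemma integral_le_bounded_support: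
  fixes f :: "real^'n \<Rightarrow> real"
  assumes "integrable lborel f" "\<And>x. norm x \<le> R \<Longrightarrow> f x \<le> B" "\<And>x. f x \<noteq> 0 \<Longrightarrow> norm x \<le> R"
  shows "(LBINT x. f x) \<le> B * measure lborel (cball (0::real^'n) R)"
proof -
  have i: "integrable lborel (\<lambda>x. B * indicator (cball (0::real^'n) R) x)"
    using emeasure_lborel_cball_finite[of "0::real^'n" R] by simp
  have "(LBINT x. f x) \<le> (LBINT x. B * indicator (cball (0::real^'n) R) x)"
    by (rule integral_mono[OF assms(1) i]) (use assms(2,3) in \<open>force simp: indicator_def\<close>)
  then show ?thesis by simp
qed

lemma power2_mono_abs: "\<bar>a\<bar> \<le> b \<Longrightarrow> a\<^sup>2 \<le> (b::real)^2"
  by (metis abs_ge_zero power2_abs power_mono)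

lemma grad_sq_le:
  assumes "\<And>i. \<bar>pd i f x\<bar> \<le> K"
  shows "grad_sq f (x :: real^'n) \<le> real CARD('n) * K^2"
proof -
  have "grad_sq f x \<le> (\<Sum>i\<in>(UNIV::'n set). K^2)"
    unfolding grad_sq_def by (intro sum_mono power2_mono_abs assms)
  then show ?thesis by simp
qed

lemma grad_sq_nonneg: "grad_sq f x \<ge> 0" and hess_sq_nonneg: "hess_sq f x \<ge> 0"
  by (auto simp: grad_sq_def hess_sq_def intro!: sum_nonneg)

lemma abs_pderiv_le_grad: "\<bar>pd i f x\<bar> \<le> sqrt (grad_sq f x)"
  unfolding grad_sq_def
  by (rule real_le_rsqrt) (simp add: member_le_sum[of i UNIV "\<lambda>i. (pd i f x)^2"])

lemma abs_pderiv2_le_hess: "\<bar>pd j (pd i f) x\<bar> \<le> sqrt (hess_sq f x)"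
proof (rule real_le_rsqrt)
  have "(pd j (pd i f) x)^2 \<le> (\<Sum>j\<in>UNIV. (pd j (pd i f) x)^2)"
    by (rule member_le_sum) auto
  also have "\<dots> \<le> hess_sq f x" unfolding hess_sq_def
    by (rule member_le_sum[of i UNIV "\<lambda>i. \<Sum>j\<in>UNIV. (pd j (pd i f) x)^2"]) (auto intro: sum_nonneg)
  finally show "\<bar>pd j (pd i f) x\<bar>\<^sup>2 \<le> hess_sq f x" by simp
qed

text \<open>Expansion gives six products, each with one factor bounded by \<open>K\<close>, one by
  \<open>r\<close> and one by \<open>y\<close>. Keeping a factor \<open>r\<close>, the gradient of
  \<open>q\<close>, allows pairing with \<open>b1 (q x) * grad_sq q x\<close> later.\<close>

lemma tangential_term_bound:
  fixes a a' ri rj pi pj Pij Pjj K r y :: real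
  assumes "\<bar>a\<bar> \<le> K" "\<bar>a'\<bar> \<le> K" "\<bar>ri\<bar> \<le> r" "\<bar>rj\<bar> \<le> r" "\<bar>ri\<bar> \<le> K" "\<bar>rj\<bar> \<le> K"
    "\<bar>pi\<bar> \<le> y" "\<bar>pj\<bar> \<le> y" "\<bar>Pij\<bar> \<le> y" "\<bar>Pjj\<bar> \<le> y"
  shows "\<bar>a * (ri * pj - rj * pi) + ri * (a * pj + ri * Pjj - a' * pi - rj * Pij)\<bar> \<le> 6 * K * (r * y)"
proof -
  have m: "\<bar>u * (v * w)\<bar> \<le> K * (r * y)" if "\<bar>u\<bar> \<le> K" "\<bar>v\<bar> \<le> r" "\<bar>w\<bar> \<le> y" for u v w :: real
    unfolding abs_mult using that by (intro mult_mono) auto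
  have "a * (ri * pj - rj * pi) + ri * (a * pj + ri * Pjj - a' * pi - rj * Pij)
     = a * (ri * pj) - a * (rj * pi) + a * (ri * pj) + ri * (ri * Pjj) - a' * (ri * pi) - ri * (rj * Pij)"
    by (simp add: algebra_simps)
  moreover have "\<bar>a * (ri * pj)\<bar> \<le> K * (r * y)" "\<bar>a * (rj * pi)\<bar> \<le> K * (r * y)" "\<bar>ri * (ri * Pjj)\<bar> \<le> K * (r * y)"
    "\<bar>a' * (ri * pi)\<bar> \<le> K * (r * y)" "\<bar>ri * (rj * Pij)\<bar> \<le> K * (r * y)"
    using assms by (auto intro!: m)
  ultimately show ?thesis by linarith
qed

text \<open>\<open>q\<close> is a concave defining function of {q > 0}: the negative Hessian is then
  positive semidefinite, hence bounded by its trace, which is \<open>conc\<close>. \<open>h0\<close>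
  to \<open>h3\<close> are the cutoff and its derivatives. The pair \<open>b\<close>,
  \<open>b1\<close> measures the second derivative of the cutoff: \<open>b1\<close> dominates (h2
  u)^2 / h0, yet its primitive \<open>b\<close> stays below the small parameter \<omega>.\<close>

locale weighted_setting =
  fixes q :: "real^'n \<Rightarrow> real" and R K :: real
    and h0 h1 h2 h3 b b1 :: "real \<Rightarrow> real" and \<delta> \<omega> :: real
  assumes q: "C_diff 3 q" and q_support: "\<And>x. q x > 0 \<Longrightarrow> norm x \<le> R" and q_le: "\<And>x. q x \<le> 1"
    and K1: "K \<ge> 1" and q1: "\<And>x i. q x > 0 \<Longrightarrow> \<bar>pd i q x\<bar> \<le> K"
    and q2: "\<And>x i j. q x > 0 \<Longrightarrow> \<bar>pd j (pd i q) x\<bar> \<le> K"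
    and conc: "\<And>x \<xi>. lap q x * (\<Sum>i\<in>UNIV. (\<xi> i)^2) \<le> (\<Sum>i\<in>UNIV. \<Sum>j\<in>UNIV. pd j (pd i q) x * \<xi> i * \<xi> j)"
    and h_deriv: "\<And>u. (h0 has_real_derivative h1 u) (at u)" "\<And>u. (h1 has_real_derivative h2 u) (at u)"
      "\<And>u. (h2 has_real_derivative h3 u) (at u)" "continuous_on UNIV h3"
    and h_zero: "\<And>u. u \<le> \<delta> \<Longrightarrow> h0 u = 0 \<and> h1 u = 0 \<and> h2 u = 0 \<and> b u = 0 \<and> b1 u = 0"
    and \<delta>: "\<delta> > 0"
    and h_nonneg: "\<And>u. h0 u \<ge> 0" "\<And>u. h1 u \<ge> 0" "\<And>u. h2 u \<ge> 0" "\<And>u. b1 u \<ge> 0"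
    and h_le: "\<And>u. u \<le> 1 \<Longrightarrow> h0 u \<le> 1" "\<And>u. u \<le> 1 \<Longrightarrow> (h1 u * u)\<^sup>2 \<le> 36 * h0 u"
      "\<And>u. (h2 u * u)^2 \<le> b1 u * h0 u"
    and b: "\<And>u. (b has_real_derivative b1 u) (at u)" "continuous_on UNIV b1"
      "\<And>u. u \<le> 1 \<Longrightarrow> 0 \<le> b u \<and> b u \<le> \<omega>"
begin

lemma C_compose:
  "C_diff 3 (\<lambda>x. h0 (q x))" "C_diff 2 (\<lambda>x. h1 (q x))" "C_diff 1 (\<lambda>x. h2 (q x))" "C_diff 1 (\<lambda>x. b (q x))"
proof -
  define h where "h = (\<lambda>j::nat. if j = 0 then h0 else if j = 1 then h1 else if j = 2 then h2 else h3)"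
  have h: "(h j has_real_derivative h (Suc j) u) (at u)" if "j < 3" for j u
    using that h_deriv by (auto simp: h_def less_Suc_eq numeral_3_eq_3 numeral_2_eq_2)
  have hc: "continuous_on UNIV (h 3)" "continuous_on UNIV (h 2)"
    using h_deriv(4) DERIV_continuous_on[OF h_deriv(3)] by (auto simp: h_def intro: DERIV_continuous_on has_field_derivative_at_within)
  have "C_diff 3 (\<lambda>x. h 0 (q x))" using C_diff_compose[OF h hc(1) q] .
  then show "C_diff 3 (\<lambda>x. h0 (q x))" by (simp add: h_def)
  have "C_diff 2 (\<lambda>x. h (Suc 0) (q x))"
    by (rule C_diff_compose[where h = "\<lambda>j. h (Suc j)" and k = 2])
       (use h hc C_diff_mono[OF q, of 2] in \<open>auto simp: numeral_3_eq_3 numeral_2_eq_2 simp del: C_diff.simps\<close>)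
  then show "C_diff 2 (\<lambda>x. h1 (q x))" by (simp add: h_def)
  have "C_diff 1 (\<lambda>x. h (Suc (Suc 0)) (q x))"
    by (rule C_diff_compose[where h = "\<lambda>j. h (Suc (Suc j))" and k = 1])
       (use h hc C_diff_mono[OF q, of 1] in \<open>auto simp: numeral_3_eq_3 numeral_2_eq_2 simp del: C_diff.simps\<close>)
  then show "C_diff 1 (\<lambda>x. h2 (q x))" by (simp add: h_def)
  define g where "g = (\<lambda>j::nat. if j = 0 then b else b1)"
  have "C_diff 1 (\<lambda>x. g 0 (q x))"
    by (rule C_diff_compose) (use b C_diff_mono[OF q, of 1] in \<open>auto simp: g_def\<close>)
  then show "C_diff 1 (\<lambda>x. b (q x))" by (simp add: g_def)
qed

lemma support:
  assumes "h0 (q x) \<noteq> 0 \<or> h1 (q x) \<noteq> 0 \<or> h2 (q x) \<noteq> 0 \<or> b (q x) \<noteq> 0 \<or> b1 (q x) \<noteq> 0"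
  shows "q x > \<delta>" "q x > 0" "norm x \<le> R"
proof -
  show "q x > \<delta>" using assms h_zero[of "q x"] by fastforce
  then show "q x > 0" using \<delta> by simp
  then show "norm x \<le> R" by (rule q_support)
qed

lemma q_differentiable: "q differentiable (at x)"
  using C_diff_mono[OF q, of 1] by simp

lemma compose_pderiv:
  "pd i (\<lambda>x. h0 (q x)) = (\<lambda>x. h1 (q x) * pd i q x)"
  "pd i (\<lambda>x. h1 (q x)) = (\<lambda>x. h2 (q x) * pd i q x)"
  "pd i (\<lambda>x. h2 (q x)) = (\<lambda>x. h3 (q x) * pd i q x)"
  "pd i (\<lambda>x. b (q x)) = (\<lambda>x. b1 (q x) * pd i q x)"
  using pderiv_dir_compose[OF h_deriv(1) q_differentiable] pderiv_dir_compose[OF h_deriv(2) q_differentiable]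
    pderiv_dir_compose[OF h_deriv(3) q_differentiable] pderiv_dir_compose[OF b(1) q_differentiable] by auto

lemma C_q: "C_diff 1 (pd i q)" "C_diff 2 (pd i q)" "C_diff 1 (pd j (pd i q))"
proof -
  have "C_diff (Suc (Suc 1)) q" using q by (simp only: numeral_3_eq_3 One_nat_def)
  then have 2: "C_diff (Suc 1) (pd i q)" for i by (rule C_diff_pderiv)
  then show "C_diff 2 (pd i q)" by (simp only: numeral_2_eq_2 One_nat_def)
  show "C_diff 1 (pd i q)" by (rule C_diff_SucD[OF 2])
  show "C_diff 1 (pd j (pd i q))" by (rule C_diff_pderiv[OF 2])
qed

lemma C_q0: "C_diff 1 q" using C_diff_mono[OF q, of 1] by simp

text \<open>\<open>b1 (q x) * pd i q x\<close> is the derivative of \<open>b (q x)\<close>. One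
  integration by parts replaces the possibly large \<open>b1\<close> by \<open>b\<close>, which is
  at most \<omega>, at the price of a second derivative of \<open>q\<close>.\<close>

lemma b_integral:
  "(LBINT x. b1 (q x) * grad_sq q x) \<le> \<omega> * real CARD('n) * K * measure lborel (cball (0::real^'n) R)"
proof -
  have "(LBINT x. b (q x) * pd i (pd i q) x)
     = - (LBINT x. pd i (\<lambda>x. b (q x)) x * pd i q x)" for i
    by (rule integral_by_parts[OF C_compose(4) C_q(1)]) (use support in auto)
  then have ibp: "(LBINT x. b1 (q x) * (pd i q x)^2) = - (LBINT x. b (q x) * pd i (pd i q) x)" for i
    by (simp add: compose_pderiv power2_eq_square mult.assoc)
  have c: "continuous_on UNIV (\<lambda>x. b1 (q x))"
    by (rule continuous_on_compose2[OF b(2) C_diff_continuous[OF q]]) auto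
  have i1: "integrable lborel (\<lambda>x. b1 (q x) * (pd i q x)^2)" for i
    by (rule continuous_bounded_support_integrable[where R = R])
       (use support in \<open>auto intro!: continuous_on_mult continuous_on_power c C_diff_continuous[OF C_q(1)]\<close>)
  have i2: "integrable lborel (\<lambda>x. b (q x) * pd i (pd i q) x)" for i
    by (rule continuous_bounded_support_integrable[where R = R])
       (use support in \<open>auto intro!: continuous_on_mult C_diff_continuous[OF C_compose(4)] C_diff_continuous[OF C_q(3)]\<close>)
  have "(LBINT x. b1 (q x) * grad_sq q x) = (LBINT x. (\<Sum>i\<in>UNIV. b1 (q x) * (pd i q x)^2))"
    by (simp add: grad_sq_def sum_distrib_left)
  also have "\<dots> = (\<Sum>i\<in>UNIV. - (LBINT x. b (q x) * pd i (pd i q) x))"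
    using i1 by (simp add: ibp)
  also have "\<dots> \<le> (\<Sum>i\<in>(UNIV::'n set). \<omega> * K * measure lborel (cball (0::real^'n) R))"
  proof (rule sum_mono)
    fix i :: 'n
    have "(LBINT x. - (b (q x) * pd i (pd i q) x)) \<le> \<omega> * K * measure lborel (cball (0::real^'n) R)"
    proof (rule integral_le_bounded_support)
      show "integrable lborel (\<lambda>x. - (b (q x) * pd i (pd i q) x))" using i2 by simp
      show "norm x \<le> R" if "- (b (q x) * pd i (pd i q) x) \<noteq> 0" for x
        using support that by auto
      show "- (b (q x) * pd i (pd i q) x) \<le> \<omega> * K" for x
      proof (cases "b (q x) = 0")
        case True
        have "0 \<le> \<omega>" using b(3)[of 0] by linarith
        then show ?thesis using True K1 by simp
      next
        case False
        have "\<bar>b (q x) * pd i (pd i q) x\<bar> \<le> \<omega> * K"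
          unfolding abs_mult using False support[of x] b(3)[OF q_le[of x]] q2[of x i i] by (intro mult_mono) auto
        then show ?thesis by linarith
      qed
    qed
    then show "- (LBINT x. b (q x) * pd i (pd i q) x) \<le> \<omega> * K * measure lborel (cball (0::real^'n) R)"
      by simp
  qed
  finally show ?thesis by (simp add: mult_ac)
qed

context
  fixes e :: "real^'n \<Rightarrow> real" and A M :: real
  assumes e: "C_diff 3 e" and eA: "\<And>x. q x > \<delta> \<Longrightarrow> \<bar>e x\<bar> \<le> A * q x" and eM: "\<And>x. q x > \<delta> \<Longrightarrow> \<bar>lap e x\<bar> \<le> M"
    and A0: "A \<ge> 0" and M0: "M \<ge> 0"
begin

lemma C_e: "C_diff 1 e" "C_diff 1 (pd i e)" "C_diff 1 (pd j (pd i e))"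
  using e C_diff_mono[OF e, of 2] C_diff_mono[OF e, of 1]
  by (simp_all only: numeral_3_eq_3 numeral_2_eq_2 One_nat_def C_diff.simps(2)) auto

lemma continuous_parts:
  "continuous_on UNIV e" "continuous_on UNIV (grad_sq e)" "continuous_on UNIV (hess_sq e)" "continuous_on UNIV (lap e)"
  "continuous_on UNIV (pd i e)" "continuous_on UNIV (pd i q)"
  "continuous_on UNIV (\<lambda>x. h0 (q x))" "continuous_on UNIV (\<lambda>x. h1 (q x))" "continuous_on UNIV (\<lambda>x. h2 (q x))"
  "continuous_on UNIV (\<lambda>x. b1 (q x))" "continuous_on UNIV (grad_sq q)"
  "continuous_on UNIV (pd j (pd i e))" "continuous_on UNIV (pd j (pd i q))"
proof -
  have "C_diff (Suc (Suc 0)) e" using C_diff_mono[OF e, of "Suc (Suc 0)"] by simp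
  then show "continuous_on UNIV (hess_sq e)" "continuous_on UNIV (lap e)"
    using C_diff_continuous[OF C_diff_hess_sq] C_diff_continuous[OF C_diff_lap] by blast+
  have "C_diff (Suc 0) e" "C_diff (Suc 0) q" using C_e(1) C_q0 by simp_all
  then show "continuous_on UNIV (grad_sq e)" "continuous_on UNIV (grad_sq q)"
    using C_diff_continuous[OF C_diff_grad_sq] by blast+
  show "continuous_on UNIV (\<lambda>x. b1 (q x))"
    by (rule continuous_on_compose2[OF b(2) C_diff_continuous[OF q]]) auto
qed (rule C_diff_continuous[OF e] C_diff_continuous[OF C_e(2)] C_diff_continuous[OF C_q(1)]
      C_diff_continuous[OF C_compose(1)] C_diff_continuous[OF C_compose(2)] C_diff_continuous[OF C_compose(3)]
      C_diff_continuous[OF C_e(3)] C_diff_continuous[OF C_q(3)])+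

lemma weight_integrable:
  assumes "continuous_on UNIV f"
  shows "integrable lborel (\<lambda>x. h0 (q x) * f x)" "integrable lborel (\<lambda>x. h1 (q x) * f x)" "integrable lborel (\<lambda>x. h2 (q x) * f x)"
    "integrable lborel (\<lambda>x. b1 (q x) * f x)"
  using support by (auto intro!: continuous_bounded_support_integrable[where R = R] continuous_on_mult continuous_parts assms)

text \<open>A Caccioppoli estimate, from testing with \<open>h0 (q x) * e x\<close>. The derivative
  \<open>h1\<close> of the cutoff is paid for by the decay of \<open>e\<close>:
  \<open>e x * h1 (q x)\<close> is at most A (h1 u) u with \<open>u = q x\<close>, whose square is
  at most 36 A^2 h0. Cauchy's inequality absorbs half of the energy and leaves 18 = 36 / 2.\<close>

lemma energy_bound:
  "(LBINT x. h0 (q x) * grad_sq e x)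
    \<le> 2 * (18 * A^2 * (real CARD('n) * K^2) + A * M) * measure lborel (cball (0::real^'n) R)"
proof -
  let ?E = "LBINT x. h0 (q x) * grad_sq e x"
  let ?s = "\<lambda>x. \<Sum>i\<in>UNIV. pd i q x * pd i e x"
  let ?c = "18 * A^2 * (real CARD('n) * K^2) + A * M"
  have c0: "0 \<le> ?c" using A0 M0 by simp
  have "(LBINT x. (h0 (q x) * pd i e x) * pd i e x)
     = - (LBINT x. pd i (\<lambda>x. h0 (q x) * pd i e x) x * e x)" for i
    by (rule integral_by_parts[where R = R])
       (use C_diff_mono[OF C_compose(1), of 1] support in \<open>auto intro!: C_diff_mult C_e simp del: One_nat_def simp: numeral_3_eq_3\<close>)
  moreover have "pd i (\<lambda>x. h0 (q x) * pd i e x) x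
     = h0 (q x) * pd i (pd i e) x + h1 (q x) * pd i q x * pd i e x" for i x
    using C_diff_mono[OF C_compose(1), of 1] by (simp add: C_diff_1_rules(1) C_e compose_pderiv del: One_nat_def)
  ultimately have ibp: "(LBINT x. h0 (q x) * (pd i e x)^2)
     = (LBINT x. - (h0 (q x) * (pd i (pd i e) x * e x) + h1 (q x) * (pd i q x * pd i e x * e x)))" for i
    by (simp add: power2_eq_square algebra_simps flip: Bochner_Integration.integral_minus)
  have i1: "integrable lborel (\<lambda>x. h0 (q x) * (pd i e x)^2)" for i
    by (intro weight_integrable continuous_on_power continuous_parts)
  have i2: "integrable lborel (\<lambda>x. - (h0 (q x) * (pd i (pd i e) x * e x) + h1 (q x) * (pd i q x * pd i e x * e x)))" for i
    by (intro Bochner_Integration.integrable_minus Bochner_Integration.integrable_add weight_integrable continuous_on_mult continuous_parts)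
  have "?E = (LBINT x. (\<Sum>i\<in>UNIV. h0 (q x) * (pd i e x)^2))"
    by (simp add: grad_sq_def sum_distrib_left)
  also have "\<dots> = (\<Sum>i\<in>UNIV. (LBINT x. - (h0 (q x) * (pd i (pd i e) x * e x) + h1 (q x) * (pd i q x * pd i e x * e x))))"
    unfolding ibp[symmetric] using i1 by simp
  also have "\<dots> = (LBINT x. (\<Sum>i\<in>UNIV. - (h0 (q x) * (pd i (pd i e) x * e x) + h1 (q x) * (pd i q x * pd i e x * e x))))"
    using i2 by (intro Bochner_Integration.integral_sum[symmetric]) auto
  also have "\<dots> = (LBINT x. - (h0 (q x) * (lap e x * e x)) - e x * h1 (q x) * ?s x)"
    by (rule Bochner_Integration.integral_cong)
       (simp_all add: lap_def sum_negf sum.distrib sum_subtractf sum_distrib_left sum_distrib_right algebra_simps)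
  finally have E: "?E = (LBINT x. - (h0 (q x) * (lap e x * e x)) - e x * h1 (q x) * ?s x)" .
  have ig: "integrable lborel (\<lambda>x. h0 (q x) * grad_sq e x)" by (intro weight_integrable continuous_parts)
  have iR: "integrable lborel (\<lambda>x. - (h0 (q x) * (lap e x * e x)) - e x * h1 (q x) * ?s x)"
  proof -
    have "integrable lborel (\<lambda>x. - (h0 (q x) * (lap e x * e x)) - h1 (q x) * (e x * ?s x))"
      by (intro Bochner_Integration.integrable_diff Bochner_Integration.integrable_minus weight_integrable
          continuous_on_mult continuous_on_sum continuous_parts)
    then show ?thesis by (simp add: mult_ac)
  qed
  \<comment> \<open>The half of the energy to be absorbed is subtracted inside the integral, so that
    a pointwise bound of the integrand suffices.\<close>
  have "(LBINT x. (- (h0 (q x) * (lap e x * e x)) - e x * h1 (q x) * ?s x) - (1/2) * (h0 (q x) * grad_sq e x))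
      \<le> ?c * measure lborel (cball (0::real^'n) R)"
  proof (rule integral_le_bounded_support)
    show "integrable lborel (\<lambda>x. (- (h0 (q x) * (lap e x * e x)) - e x * h1 (q x) * ?s x) - (1/2) * (h0 (q x) * grad_sq e x))"
      by (rule Bochner_Integration.integrable_diff[OF iR integrable_mult_right[OF ig]])
    show "norm x \<le> R" if "(- (h0 (q x) * (lap e x * e x)) - e x * h1 (q x) * ?s x) - (1/2) * (h0 (q x) * grad_sq e x) \<noteq> 0" for x
      using that support[of x] by (cases "h0 (q x) = 0 \<and> h1 (q x) = 0") auto
    show "(- (h0 (q x) * (lap e x * e x)) - e x * h1 (q x) * ?s x) - (1/2) * (h0 (q x) * grad_sq e x) \<le> ?c" for x
    proof (cases "q x > \<delta>")
      case False
      then show ?thesis using h_zero[of "q x"] c0 by simp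
    next
      case True
      have rp: "q x > 0" using True \<delta> by simp
      have psi: "\<bar>e x\<bar> \<le> A" using eA[OF True] mult_left_mono[OF q_le[of x] A0] by simp
      have "\<bar>lap e x * e x\<bar> \<le> M * A" unfolding abs_mult using eM[OF True] psi M0 by (intro mult_mono) auto
      then have "\<bar>h0 (q x) * (lap e x * e x)\<bar> \<le> 1 * (M * A)"
        unfolding abs_mult[of "h0 (q x)"] using h_le(1)[OF q_le[of x]] h_nonneg(1)[of "q x"] M0 A0 by (intro mult_mono) auto
      then have t1: "- (h0 (q x) * (lap e x * e x)) \<le> A * M" by (simp add: mult.commute)
      have s2: "(?s x)^2 \<le> (real CARD('n) * K^2) * grad_sq e x"
      proof -
        have "(?s x)^2 \<le> grad_sq q x * grad_sq e x"
          unfolding grad_sq_def by (rule Cauchy_Schwarz_ineq_sum)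
        also have "\<dots> \<le> (real CARD('n) * K^2) * grad_sq e x"
          by (intro mult_right_mono grad_sq_le grad_sq_nonneg q1[OF rp])
        finally show ?thesis .
      qed
      have "(e x * h1 (q x))^2 \<le> A^2 * (36 * h0 (q x))"
      proof -
        have "(e x * h1 (q x))^2 \<le> (A * q x * h1 (q x))^2"
          using eA[OF True] h_nonneg(2)[of "q x"] by (intro power2_mono_abs) (auto simp: abs_mult intro: mult_right_mono)
        also have "\<dots> = A^2 * (h1 (q x) * q x)^2" by (simp add: power_mult_distrib mult_ac)
        also have "\<dots> \<le> A^2 * (36 * h0 (q x))" by (intro mult_left_mono h_le(2) q_le) simp
        finally show ?thesis .
      qed
      then have "(e x * h1 (q x))^2 * (?s x)^2 \<le> (A^2 * (36 * h0 (q x))) * ((real CARD('n) * K^2) * grad_sq e x)"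
        using s2 h_nonneg(1)[of "q x"] by (intro mult_mono) auto
      then have "(- (e x * h1 (q x) * ?s x))^2 \<le> (36 * A^2 * (real CARD('n) * K^2)) * (h0 (q x) * grad_sq e x)"
        by (simp add: power_mult_distrib mult_ac)
      then have "- (e x * h1 (q x) * ?s x) \<le> (36 * A^2 * (real CARD('n) * K^2) + h0 (q x) * grad_sq e x) / 2"
        using grad_sq_nonneg[of e x] h_nonneg(1)[of "q x"] by (intro le_half_sum_of_square_le_mult) auto
      then show ?thesis using t1 by simp
    qed
  qed
  then have "?E - (1/2) * ?E \<le> ?c * measure lborel (cball (0::real^'n) R)"
    unfolding E[symmetric] Bochner_Integration.integral_diff[OF iR integrable_mult_right[OF ig]] by simp
  then have "?E \<le> 2 * (?c * measure lborel (cball (0::real^'n) R))" by linarith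
  then show ?thesis by (simp only: mult.assoc)
qed

text \<open>The bracket on the left is the squared gradient of \<open>e\<close> along the level sets
  of \<open>q\<close>, times the squared gradient of \<open>q\<close>. The field \<open>Y\<close> is
  tangential to the level sets, so moving the derivative off \<open>e\<close> does not differentiate
  \<open>h2 (q x)\<close>. The freed factor \<open>e x\<close> later contributes its decay
  \<open>A * q x\<close>.\<close>

lemma tangential_identity:
  defines "S \<equiv> \<lambda>i j x. pd j (pd i q) x * (pd i q x * pd j e x - pd j q x * pd i e x)
      + pd i q x * (pd j (pd i q) x * pd j e x + pd i q x * pd j (pd j e) x
         - pd j (pd j q) x * pd i e x - pd j q x * pd j (pd i e) x)"
  shows "(LBINT x. h2 (q x) * (grad_sq q x * grad_sq e x - (\<Sum>i\<in>UNIV. pd i q x * pd i e x)\<^sup>2))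
     = (LBINT x. h2 (q x) * ((\<Sum>i\<in>UNIV. \<Sum>j\<in>UNIV. S i j x) * - e x))"
proof -
  define r where "r = (\<lambda>i. pd i q)"
  define p where "p = (\<lambda>i. pd i e)"
  define Y where "Y = (\<lambda>i j x. h2 (q x) * (r i x * (r i x * p j x - r j x * p i x)))"
  have c: "C_diff 1 (r i)" "C_diff 1 (p i)" for i using C_q C_e by (simp_all only: r_def p_def)
  have CY: "C_diff 1 (Y i j)" for i j
    unfolding Y_def by (intro C_diff_mult C_diff_diff C_compose c)
  have dY: "pd j (Y i j) x = h2 (q x) * S i j x + h3 (q x) * (r i x * r j x * r i x * p j x - r j x * r i x * r j x * p i x)" for i j x
  proof -
    have "pd j (Y i j) x = h2 (q x) * (r i x * ((r i x * pd j (p j) x + pd j (r i) x * p j x)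
          - (r j x * pd j (p i) x + pd j (r j) x * p i x)) + pd j (r i) x * (r i x * p j x - r j x * p i x))
        + pd j (\<lambda>x. h2 (q x)) x * (r i x * (r i x * p j x - r j x * p i x))"
      unfolding Y_def by (simp only: C_diff_1_rules C_diff_add C_diff_mult C_diff_diff c C_compose)
    then show ?thesis by (simp add: compose_pderiv S_def r_def p_def algebra_simps)
  qed
  \<comment> \<open>Terms with \<open>h3\<close> come only from differentiating
    \<open>h2 (q x)\<close>; their coefficients are antisymmetric in \<open>i\<close> and
    \<open>j\<close>.\<close>
  have sumdY: "(\<Sum>i\<in>UNIV. \<Sum>j\<in>UNIV. pd j (Y i j) x) = h2 (q x) * (\<Sum>i\<in>UNIV. \<Sum>j\<in>UNIV. S i j x)" for x
  proof -
    have "(\<Sum>i\<in>UNIV. \<Sum>j\<in>UNIV. pd j (Y i j) x) = h2 (q x) * (\<Sum>i\<in>UNIV. \<Sum>j\<in>UNIV. S i j x)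
        + h3 (q x) * (\<Sum>i\<in>UNIV. \<Sum>j\<in>UNIV. r i x * r j x * r i x * p j x - r j x * r i x * r j x * p i x)"
      unfolding dY by (simp add: sum.distrib sum_distrib_left)
    then show ?thesis using sum_antisym_zero[of "\<lambda>i j. r i x * r j x * r i x * p j x"] by simp
  qed
  have Ys: "norm x \<le> R" if "Y i j x \<noteq> 0" for i j x
    using that support[of x] by (auto simp: Y_def)
  have ibp: "(LBINT x. Y i j x * p j x) = - (LBINT x. pd j (Y i j) x * e x)" for i j
    unfolding p_def by (rule integral_by_parts[OF CY C_e(1)]) (use Ys in auto)
  have i1: "integrable lborel (\<lambda>x. Y i j x * p j x)" for i j
    by (rule continuous_bounded_support_integrable[where R = R])
       (use Ys in \<open>auto intro!: continuous_on_mult C_diff_continuous[OF CY] C_diff_continuous[OF c(2)]\<close>)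
  have i2: "integrable lborel (\<lambda>x. pd j (Y i j) x * e x)" for i j
    by (rule continuous_bounded_support_integrable[where R = R])
       (use pderiv_dir_zero_outside[OF Ys] CY in \<open>auto intro!: continuous_on_mult continuous_parts\<close>)
  have "(LBINT x. (\<Sum>i\<in>UNIV. \<Sum>j\<in>UNIV. Y i j x * p j x)) = - (LBINT x. (\<Sum>i\<in>UNIV. \<Sum>j\<in>UNIV. pd j (Y i j) x * e x))"
    unfolding integral_sum_sum(2)[OF i1] integral_sum_sum(2)[OF i2] by (simp add: ibp sum_negf)
  moreover have "(\<Sum>i\<in>UNIV. \<Sum>j\<in>UNIV. Y i j x * p j x)
      = h2 (q x) * (grad_sq q x * grad_sq e x - (\<Sum>i\<in>UNIV. pd i q x * pd i e x)\<^sup>2)" for x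
    unfolding Y_def grad_sq_def power2_eq_square sum_product
    by (simp add: r_def p_def sum_distrib_left sum_subtractf algebra_simps)
  moreover have "(\<Sum>i\<in>UNIV. \<Sum>j\<in>UNIV. pd j (Y i j) x * e x) = h2 (q x) * (\<Sum>i\<in>UNIV. \<Sum>j\<in>UNIV. S i j x) * e x" for x
    unfolding sumdY[symmetric] by (simp add: sum_distrib_right)
  ultimately show ?thesis by (simp add: mult.assoc)
qed

text \<open>The Hessian of the weight is \<open>h1\<close> times the Hessian of \<open>q\<close>
  plus \<open>h2\<close> times the square of its gradient. By \<open>conc\<close> the first part has
  a favourable sign in \<open>hessian_identity\<close>; the second is the tangential term. Cauchy's
  inequality with parameter \<nu> splits the latter into a multiple of the Hessian integral to be
  absorbed, the energy, and the integral of \<open>b1\<close>, which \<omega> controls even after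
  division by \<nu>.\<close>

theorem weighted_hessian_estimate:
  assumes \<nu>: "\<nu> > 0"
  defines "n \<equiv> real CARD('n)" and "V \<equiv> measure lborel (cball (0::real^'n) R)"
  defines "C \<equiv> 6 * n^2 * K * A"
  shows "(1 - C * \<nu>) * (LBINT x. h0 (q x) * hess_sq e x) \<le> (LBINT x. h0 (q x) * (lap e x)^2)
     + C * (\<omega> * n * K * V / (2 * \<nu>) + \<nu> * (2 * (18 * A^2 * (n * K^2) + A * M) * V))"
proof -
  define S where "S = (\<lambda>i j x. pd j (pd i q) x * (pd i q x * pd j e x - pd j q x * pd i e x)
      + pd i q x * (pd j (pd i q) x * pd j e x + pd i q x * pd j (pd j e) x
         - pd j (pd j q) x * pd i e x - pd j q x * pd j (pd i e) x))"
  define s where "s = (\<lambda>x. \<Sum>i\<in>UNIV. pd i q x * pd i e x)"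
  let ?t = "\<lambda>x. h0 (q x)"
  have C0: "C \<ge> 0" unfolding C_def n_def using A0 K1 by simp
  have z2: "C_diff 2 ?t" using C_diff_mono[OF C_compose(1), of 2] by simp
  have zs: "norm x \<le> R" if "?t x \<noteq> 0" for x using support that by blast
  have Z: "pd j (pd i ?t) x = h1 (q x) * pd j (pd i q) x + h2 (q x) * pd j q x * pd i q x" for i j x
    using C_diff_mono[OF C_compose(2), of 1] by (simp add: compose_pderiv C_diff_1_rules C_q del: One_nat_def)
  have bad: "lap ?t x * grad_sq e x - (\<Sum>i\<in>UNIV. \<Sum>j\<in>UNIV. pd j (pd i ?t) x * pd i e x * pd j e x)
      \<le> h2 (q x) * (grad_sq q x * grad_sq e x - (s x)\<^sup>2)" for x
  proof -
    have "lap ?t x = h1 (q x) * lap q x + h2 (q x) * grad_sq q x"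
      by (simp add: lap_def Z grad_sq_def power2_eq_square sum.distrib sum_distrib_left mult_ac)
    moreover have "(\<Sum>i\<in>UNIV. \<Sum>j\<in>UNIV. pd j (pd i ?t) x * pd i e x * pd j e x)
        = h1 (q x) * (\<Sum>i\<in>UNIV. \<Sum>j\<in>UNIV. pd j (pd i q) x * pd i e x * pd j e x) + h2 (q x) * (s x)^2"
      by (simp add: Z s_def power2_eq_square sum_product sum.distrib sum_distrib_left algebra_simps)
    moreover have "h1 (q x) * (lap q x * grad_sq e x)
        \<le> h1 (q x) * (\<Sum>i\<in>UNIV. \<Sum>j\<in>UNIV. pd j (pd i q) x * pd i e x * pd j e x)"
      unfolding grad_sq_def by (intro mult_left_mono h_nonneg conc)
    ultimately show ?thesis by (simp add: algebra_simps)
  qed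
  have iS: "integrable lborel (\<lambda>x. h2 (q x) * ((\<Sum>i\<in>UNIV. \<Sum>j\<in>UNIV. S i j x) * - e x))"
    unfolding S_def by (intro weight_integrable continuous_intros continuous_parts)
  \<comment> \<open>The pointwise majorant: h2 q times r y is at most half of b1 r^2 / \<nu> + \<nu>
    h0 y^2, since (h2 q)^2 is at most b1 h0. Here r is the length of the gradient of
    \<open>q\<close>, and y dominates first and second derivatives of \<open>e\<close>.\<close>
  let ?T = "\<lambda>x. C * ((b1 (q x) * grad_sq q x) * (1 / (2 * \<nu>)) + \<nu> * (?t x * grad_sq e x + ?t x * hess_sq e x))"
  have ib: "integrable lborel (\<lambda>x. b1 (q x) * grad_sq q x)"
    and ig: "integrable lborel (\<lambda>x. ?t x * grad_sq e x)" and ih: "integrable lborel (\<lambda>x. ?t x * hess_sq e x)"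
    by (intro weight_integrable continuous_parts)+
  have iT: "integrable lborel ?T"
    by (intro integrable_mult_right Bochner_Integration.integrable_add integrable_mult_left ib ig ih)
  have pw: "h2 (q x) * ((\<Sum>i\<in>UNIV. \<Sum>j\<in>UNIV. S i j x) * - e x) \<le> ?T x" for x
  proof (cases "q x > \<delta>")
    case False
    then show ?thesis using h_zero[of "q x"] by simp
  next
    case True
    then have rp: "q x > 0" using \<delta> by simp
    define r where "r = sqrt (grad_sq q x)"
    define y where "y = sqrt (grad_sq e x) + sqrt (hess_sq e x)"
    have yn: "sqrt (grad_sq e x) \<le> y" "sqrt (hess_sq e x) \<le> y" "y \<ge> 0" "r \<ge> 0"

      unfolding y_def r_def using grad_sq_nonneg[of e x] hess_sq_nonneg[of e x] grad_sq_nonneg[of q x] by simp_all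
    have Sij: "\<bar>S i j x\<bar> \<le> 6 * K * (r * y)" for i j
      unfolding S_def
    proof (rule tangential_term_bound)
      show "\<bar>pd i q x\<bar> \<le> r" "\<bar>pd j q x\<bar> \<le> r" unfolding r_def by (rule abs_pderiv_le_grad)+
      show "\<bar>pd i e x\<bar> \<le> y" "\<bar>pd j e x\<bar> \<le> y"
        using abs_pderiv_le_grad yn(1) order_trans by blast+
      show "\<bar>pd j (pd i e) x\<bar> \<le> y" "\<bar>pd j (pd j e) x\<bar> \<le> y"
        using abs_pderiv2_le_hess yn(2) order_trans by blast+
    qed (use q1[OF rp] q2[OF rp] in auto)
    define \<Sigma> where "\<Sigma> = (\<Sum>i\<in>UNIV. \<Sum>j\<in>UNIV. S i j x)"
    have "\<bar>\<Sigma>\<bar> \<le> (\<Sum>i\<in>UNIV. \<bar>\<Sum>j\<in>UNIV. S i j x\<bar>)" unfolding \<Sigma>_def by (rule sum_abs)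
    moreover have "(\<Sum>i\<in>UNIV. \<bar>\<Sum>j\<in>UNIV. S i j x\<bar>) \<le> (\<Sum>i\<in>(UNIV::'n set). n * (6 * K * (r * y)))"
    proof (rule sum_mono)
      fix i
      have "(\<Sum>j\<in>UNIV. \<bar>S i j x\<bar>) \<le> (\<Sum>j\<in>(UNIV::'n set). 6 * K * (r * y))" by (intro sum_mono Sij)
      then show "\<bar>\<Sum>j\<in>UNIV. S i j x\<bar> \<le> n * (6 * K * (r * y))"
        by (intro order_trans[OF sum_abs]) (simp add: n_def)
    qed
    moreover have "(\<Sum>i\<in>(UNIV::'n set). n * (6 * K * (r * y))) = n^2 * (6 * K * (r * y))"
      by (simp add: n_def power2_eq_square)
    ultimately have SS: "\<bar>\<Sigma>\<bar> \<le> n^2 * (6 * K * (r * y))" by linarith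
    have "\<Sigma> * - e x \<le> \<bar>\<Sigma>\<bar> * \<bar>e x\<bar>" using abs_ge_self[of "\<Sigma> * - e x"] by (simp add: abs_mult)
    then have "h2 (q x) * (\<Sigma> * - e x) \<le> h2 (q x) * (\<bar>\<Sigma>\<bar> * \<bar>e x\<bar>)"
      by (rule mult_left_mono) (rule h_nonneg)
    also have "\<dots> \<le> h2 (q x) * ((n^2 * (6 * K * (r * y))) * (A * q x))"
      using SS eA[OF True] K1 yn by (intro mult_left_mono[OF _ h_nonneg(3)] mult_mono) auto
    also have "\<dots> = C * ((h2 (q x) * q x) * (r * y))" by (simp add: C_def mult_ac)
    also have "(h2 (q x) * q x) * (r * y) \<le> ((b1 (q x) * r^2) * (1 / \<nu>) + \<nu> * (?t x * y^2)) / 2"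
    proof (rule le_half_sum_of_square_le_mult)
      have "((h2 (q x) * q x) * (r * y))^2 = (h2 (q x) * q x)^2 * (r * y)^2" by (simp add: power_mult_distrib)
      also have "\<dots> \<le> (b1 (q x) * ?t x) * (r * y)^2" by (intro mult_right_mono h_le(3)) simp
      also have "\<dots> = ((b1 (q x) * r^2) * (1 / \<nu>)) * (\<nu> * (?t x * y^2))" using \<nu> by (simp add: power_mult_distrib)
      finally show "((h2 (q x) * q x) * (r * y))^2 \<le> ((b1 (q x) * r^2) * (1 / \<nu>)) * (\<nu> * (?t x * y^2))" .
    qed (use \<nu> h_nonneg in auto)
    also have "\<dots> \<le> (b1 (q x) * grad_sq q x) * (1 / (2 * \<nu>)) + \<nu> * (?t x * grad_sq e x + ?t x * hess_sq e x)"
    proof -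
      have "y^2 \<le> 2 * (grad_sq e x + hess_sq e x)"
        unfolding y_def using sum_squares_bound[of "sqrt (grad_sq e x)" "sqrt (hess_sq e x)"] grad_sq_nonneg[of e x] hess_sq_nonneg[of e x]
        by (simp add: power2_sum)
      then have "\<nu> * (?t x * y^2) \<le> \<nu> * (?t x * (2 * (grad_sq e x + hess_sq e x)))"
        using \<nu> h_nonneg by (intro mult_left_mono) auto
      moreover have "r^2 = grad_sq q x" unfolding r_def using grad_sq_nonneg by simp
      ultimately show ?thesis by (simp add: field_simps)
    qed
    finally show ?thesis using C0 unfolding \<Sigma>_def by (simp add: mult_left_mono)
  qed
  have cont2: "continuous_on UNIV (\<lambda>x. grad_sq q x * grad_sq e x - (s x)\<^sup>2)"
    unfolding s_def by (intro continuous_intros continuous_parts)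
  have "(LBINT x. ?t x * hess_sq e x) = (LBINT x. ?t x * (lap e x)^2) +
    (LBINT x. lap ?t x * grad_sq e x
       - (\<Sum>i\<in>UNIV. \<Sum>j\<in>UNIV. pd j (pd i ?t) x * pd i e x * pd j e x))"
    by (rule hessian_identity[OF e z2 zs])
  also have "\<dots> \<le> (LBINT x. ?t x * (lap e x)^2) + (LBINT x. h2 (q x) * (grad_sq q x * grad_sq e x - (s x)\<^sup>2))"
  proof (intro add_left_mono integral_mono bad)
    show "integrable lborel (\<lambda>x. h2 (q x) * (grad_sq q x * grad_sq e x - (s x)\<^sup>2))"
      by (rule weight_integrable(3)[OF cont2])
    have "integrable lborel (\<lambda>x. h1 (q x) * (\<Sum>i\<in>UNIV. \<Sum>j\<in>UNIV. pd i (pd i q) x * (pd j e x)^2 - pd j (pd i q) x * pd i e x * pd j e x)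
      + h2 (q x) * (grad_sq q x * grad_sq e x - (s x)\<^sup>2))"
      by (intro Bochner_Integration.integrable_add weight_integrable cont2 continuous_intros continuous_parts)
    also have "(\<lambda>x. h1 (q x) * (\<Sum>i\<in>UNIV. \<Sum>j\<in>UNIV. pd i (pd i q) x * (pd j e x)^2 - pd j (pd i q) x * pd i e x * pd j e x)
      + h2 (q x) * (grad_sq q x * grad_sq e x - (s x)\<^sup>2)) = (\<lambda>x. lap ?t x * grad_sq e x - (\<Sum>i\<in>UNIV. \<Sum>j\<in>UNIV. pd j (pd i ?t) x * pd i e x * pd j e x))"
      by (rule ext) (simp add: lap_def Z grad_sq_def s_def power2_eq_square sum_product sum.distrib sum_subtractf sum_distrib_left sum_distrib_right algebra_simps)
    finally show "integrable lborel (\<lambda>x. lap ?t x * grad_sq e x - (\<Sum>i\<in>UNIV. \<Sum>j\<in>UNIV. pd j (pd i ?t) x * pd i e x * pd j e x))" .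
  qed
  also have "(LBINT x. h2 (q x) * (grad_sq q x * grad_sq e x - (s x)\<^sup>2)) = (LBINT x. h2 (q x) * ((\<Sum>i\<in>UNIV. \<Sum>j\<in>UNIV. S i j x) * - e x))"
    unfolding S_def s_def by (rule tangential_identity)
  also have "\<dots> \<le> (LBINT x. ?T x)" by (rule integral_mono[OF iS iT pw])
  also have "(LBINT x. ?T x) = C * ((LBINT x. b1 (q x) * grad_sq q x) * (1 / (2 * \<nu>))
     + \<nu> * ((LBINT x. ?t x * grad_sq e x) + (LBINT x. ?t x * hess_sq e x)))"
    using ib ig ih by simp
  also have "\<dots> \<le> C * ((\<omega> * n * K * V) * (1 / (2 * \<nu>)) + \<nu> * ((2 * (18 * A^2 * (n * K^2) + A * M) * V) + (LBINT x. ?t x * hess_sq e x)))"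
    using \<nu> b_integral energy_bound unfolding n_def V_def
    by (intro mult_left_mono[OF _ C0] add_mono mult_left_mono mult_right_mono) auto
  finally show ?thesis by (simp add: algebra_simps)
qed

end

end

section \<open>Construction of the cutoff function\<close>

lemma DERIV_max0_power:
  "((\<lambda>u::real. max 0 (u - d) ^ Suc (Suc k)) has_real_derivative real (Suc (Suc k)) * max 0 (u - d) ^ Suc k) (at u)"
proof (cases u d rule: linorder_cases)
  case less
  have "((\<lambda>u. 0::real) has_real_derivative real (Suc (Suc k)) * max 0 (u - d) ^ Suc k) (at u)"
    using less by simp
  then show ?thesis
    by (rule has_field_derivative_transform_within_open[where S = "{..<d}"]) (use less in auto)
next
  case greater
  have "((\<lambda>u. u - d) has_real_derivative 1) (at u)" by (auto intro!: derivative_eq_intros)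
  from DERIV_power[OF this, of "Suc (Suc k)"]
  have "((\<lambda>u. (u - d) ^ Suc (Suc k)) has_real_derivative real (Suc (Suc k)) * max 0 (u - d) ^ Suc k) (at u)"
    using greater by (simp add: max_def)
  then show ?thesis
    by (rule has_field_derivative_transform_within_open[where S = "{d<..}"]) (use greater in \<open>auto simp: max_def\<close>)
next
  case equal
  have "((\<lambda>h. max 0 h ^ Suc (Suc k) / h) \<longlongrightarrow> 0) (at (0::real))"
  proof (rule Lim_null_comparison[where g = "\<lambda>h. \<bar>h\<bar> ^ Suc k"])
    show "\<forall>\<^sub>F h in at 0. norm (max 0 h ^ Suc (Suc k) / h) \<le> \<bar>h\<bar> ^ Suc k"
    proof (intro always_eventually allI)
      fix h :: real
      show "norm (max 0 h ^ Suc (Suc k) / h) \<le> \<bar>h\<bar> ^ Suc k"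
      proof (cases "h > 0")
        case False
        then have "max 0 h = 0" by simp
        then show ?thesis by (simp only: power_Suc mult_zero_left div_0 norm_zero) (simp flip: power_Suc)
      qed simp
    qed
    have "((\<lambda>h::real. \<bar>h\<bar> ^ Suc k) \<longlongrightarrow> \<bar>0\<bar> ^ Suc k) (at 0)" by (intro tendsto_intros)
    then show "((\<lambda>h::real. \<bar>h\<bar> ^ Suc k) \<longlongrightarrow> 0) (at 0)" by simp
  qed
  then show ?thesis using equal by (simp add: DERIV_def)
qed

text \<open>The half lines \<open>u < d\<close> and \<open>u > 0\<close> overlap and cover
  everything. On the first the function vanishes, so the negative powers of \<open>u\<close> in its
  formula are differentiated only where \<open>u > 0\<close>.\<close>

lemma DERIV_glue:
  fixes f f' :: "real \<Rightarrow> real"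
  assumes "d > 0" "\<And>u. u > 0 \<Longrightarrow> (f has_real_derivative f' u) (at u)" "\<And>u. u \<le> d \<Longrightarrow> f u = 0" "\<And>u. u \<le> d \<Longrightarrow> f' u = 0"
  shows "(f has_real_derivative f' u) (at u)"
proof (cases "u > 0")
  case False
  then have "((\<lambda>u. 0) has_real_derivative f' u) (at u)" using assms(1,4) by simp
  then show ?thesis
    by (rule has_field_derivative_transform_within_open[where S = "{..<d}"]) (use False assms(1,3) in auto)
qed (use assms in auto)

lemma continuous_glue:
  fixes f :: "real \<Rightarrow> real"
  assumes "d > 0" "\<And>u. u > 0 \<Longrightarrow> isCont f u" "\<And>u. u \<le> d \<Longrightarrow> f u = 0"
  shows "continuous_on UNIV f"
  unfolding continuous_on_eq_continuous_at[OF open_UNIV]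
proof
  fix u
  show "isCont f u"
  proof (cases "u > 0")
    case False
    have "\<forall>\<^sub>F v in nhds u. f v = 0"
      using eventually_nhds_in_open[of "{..<d}" u] False assms(1)
      by (auto elim!: eventually_mono intro: assms(3))
    then show ?thesis by (subst isCont_cong[of f "\<lambda>v. 0"]) auto
  qed (use assms in auto)
qed

definition admissible_cutoff where
  "admissible_cutoff d \<omega> h0 h1 h2 h3 b b1 \<longleftrightarrow> d > 0 \<and>
    (\<forall>u::real. (h0 has_real_derivative h1 u) (at u)) \<and> (\<forall>u. (h1 has_real_derivative h2 u) (at u)) \<and>
    (\<forall>u. (h2 has_real_derivative h3 u) (at u)) \<and> continuous_on UNIV h3 \<and>
    (\<forall>u. u \<le> d \<longrightarrow> h0 u = 0 \<and> h1 u = 0 \<and> h2 u = 0 \<and> b u = 0 \<and> b1 u = 0) \<and>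
    (\<forall>u. h0 u \<ge> 0 \<and> h1 u \<ge> 0 \<and> h2 u \<ge> 0 \<and> b1 u \<ge> 0) \<and>
    (\<forall>u. u \<le> 1 \<longrightarrow> h0 u \<le> 1) \<and> (\<forall>u. u \<le> 1 \<longrightarrow> (h1 u * u)\<^sup>2 \<le> 36 * h0 u) \<and> (\<forall>u. (h2 u * u)^2 \<le> b1 u * h0 u) \<and>
    (\<forall>u. (b has_real_derivative b1 u) (at u)) \<and> continuous_on UNIV b1 \<and> (\<forall>u. u \<le> 1 \<longrightarrow> 0 \<le> b u \<and> b u \<le> \<omega>)"

text \<open>The cutoff is \<open>max 0 (u - d) ^ 6 * u powr (p - 5)\<close>, which behaves like \<open>u powr (1 + p)\<close>
  away from \<open>d\<close>; in \<open>b\<close>, the quantities controlling the error are of order \<open>p\<close> and \<open>d powr p\<close>.\<close>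

lemma admissible_cutoff_exists:
  assumes "\<omega> > 0"
  shows "\<exists>d h0 h1 h2 h3 b b1. admissible_cutoff d \<omega> h0 h1 h2 h3 b b1 \<and> d \<le> 1/4 \<and>
    (\<forall>u. 1/2 \<le> u \<longrightarrow> u \<le> 1 \<longrightarrow> h0 u \<ge> 1/4096)"
proof -
  \<comment> \<open>Half of \<omega> is reserved for the term \<open>288 * p * s u\<close> of
    \<open>g\<close>, half for \<open>k * d powr p\<close> with \<open>k \<le> 600\<close>. This
    explains 576 = 2 * 288 here and 1200 = 2 * 600 in \<open>d\<close>.\<close>
  define p where "p = min 1 (\<omega> / 576)"
  have p: "0 < p" "p \<le> 1" "288 * p \<le> \<omega> / 2" using assms by (auto simp: p_def)
  define d where "d = min (1/4) ((\<omega> / 1200) powr (1 / p))"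
  have d: "0 < d" "d \<le> 1/4" using assms by (auto simp: d_def)
  have dp: "600 * d powr p \<le> \<omega> / 2"
  proof -
    have "d powr p \<le> ((\<omega> / 1200) powr (1 / p)) powr p"
      using p d by (intro powr_mono2) (auto simp: d_def)
    also have "\<dots> = \<omega> / 1200" using p assms by (simp add: powr_powr)
    finally show ?thesis by simp
  qed
  define c where "c = p - 5"
  define T where "T = (\<lambda>k u. max 0 (u - d) ^ k :: real)"
  define s where "s = (\<lambda>u::real. u powr p)"
  define w where "w = (\<lambda>u. s u / u ^ 5)"
  define k where "k = 1800 / (4 - p)"
  have k: "0 < k" "k \<le> 600" "k * (4 - p) = 1800" using p by (auto simp: k_def field_simps)
  have T0: "T n u = 0" if "u \<le> d" "n > 0" for n u using that by (simp add: T_def max_def power_0_left)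
  have sd: "(s has_real_derivative p * s u / u) (at u)" if "u > 0" for u
    unfolding s_def using that by (auto intro!: derivative_eq_intros simp: powr_diff)
  have wd: "(w has_real_derivative c * w u / u) (at u)" if "u > 0" for u
    unfolding w_def using that
    by (auto intro!: derivative_eq_intros sd simp: c_def field_simps eval_nat_numeral)
  define w1 where "w1 = (\<lambda>u. w u / u)"
  define w2 where "w2 = (\<lambda>u. w u / u^2)"
  define w3 where "w3 = (\<lambda>u. w u / u^3)"
  define q2 where "q2 = (\<lambda>u::real. 1 / u^2)"
  define q3 where "q3 = (\<lambda>u::real. 1 / u^3)"
  have wd': "(w has_real_derivative c * w1 u) (at u)" "(w1 has_real_derivative (c - 1) * w2 u) (at u)"
    "(w2 has_real_derivative (c - 2) * w3 u) (at u)" "(q2 has_real_derivative - 2 * q3 u) (at u)" if "u > 0" for u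
  proof -
    show "(w has_real_derivative c * w1 u) (at u)" using wd[OF that] by (simp add: w1_def)
    show "(w1 has_real_derivative (c - 1) * w2 u) (at u)" unfolding w1_def w2_def
      using that by (auto intro!: derivative_eq_intros wd simp: field_simps power2_eq_square)
    show "(w2 has_real_derivative (c - 2) * w3 u) (at u)" unfolding w3_def w2_def
      using that by (auto intro!: derivative_eq_intros wd, simp add: field_simps eval_nat_numeral)
    show "(q2 has_real_derivative - 2 * q3 u) (at u)" unfolding q2_def q3_def
      using that by (auto intro!: derivative_eq_intros, simp add: field_simps eval_nat_numeral)
  qed
  have Td: "(T (Suc (Suc n)) has_real_derivative real (Suc (Suc n)) * T (Suc n) u) (at u)" for n u
    unfolding T_def by (rule DERIV_max0_power)
  have Td6: "(T 6 has_real_derivative 6 * T 5 u) (at u)" "(T 5 has_real_derivative 5 * T 4 u) (at u)"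
    "(T 4 has_real_derivative 4 * T 3 u) (at u)" "(T 2 has_real_derivative 2 * T 1 u) (at u)" for u
    using Td[of 4 u] Td[of 3 u] Td[of 2 u] Td[of 0 u] by (simp_all add: eval_nat_numeral)
  have Tc: "isCont (T n) u" for n u unfolding T_def by (intro continuous_intros)
  have wc: "isCont w u" "isCont s u" if "u > 0" for u using DERIV_isCont wd[OF that] sd[OF that] by blast+
  define h0 where "h0 = (\<lambda>u. T 6 u * w u)"
  define h1 where "h1 = (\<lambda>u. 6 * (T 5 u * w u) + c * (T 6 u * w1 u))"
  define h2 where "h2 = (\<lambda>u. 30 * (T 4 u * w u) + 12 * c * (T 5 u * w1 u) + c * (c - 1) * (T 6 u * w2 u))"
  define h3 where "h3 = (\<lambda>u. 120 * (T 3 u * w u) + 90 * c * (T 4 u * w1 u) + 18 * c * (c - 1) * (T 5 u * w2 u)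
     + c * (c - 1) * (c - 2) * (T 6 u * w3 u))"
  \<comment> \<open>The derivative \<open>g'\<close> is dictated by what follows: it is
    \<open>w u\<close> times the bound for the square of \<open>B\<close>, where 288 = 2 * 12^2 and
    1800 = 2 * 30^2. \<open>g\<close> is its primitive; the constant \<open>k * d powr p\<close>
    makes the second part vanish at \<open>u = d\<close> and be nonnegative beyond.\<close>
  define g where "g = (\<lambda>u. 288 * p * s u + k * (d powr p - d^4 * (s u / u^4)))"
  define g' where "g' = (\<lambda>u. 288 * p^2 * (s u / u) + 1800 * d^4 * (s u / u^5))"
  \<comment> \<open>Beyond \<open>d\<close>, the factor ((u - d) / u)^2 is at most 1 and increasing,
    so it adds only a nonnegative term to \<open>b1\<close>. It makes both \<open>b\<close> and
    \<open>b1\<close> vanish at \<open>d\<close>.\<close>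
  define b where "b = (\<lambda>u. T 2 u * q2 u * g u)"
  define b1 where "b1 = (\<lambda>u. (2 * T 1 u * q2 u - 2 * T 2 u * q3 u) * g u + T 2 u * q2 u * g' u)"
  have gd: "(g has_real_derivative g' u) (at u)" if "u > 0" for u
  proof -
    have "(g has_real_derivative (288 * p * (p * s u / u) + k * (0 - d^4 * ((p * s u / u) * u^4 - s u * (4 * u^3)) / (u^4 * u^4)))) (at u)"
      unfolding g_def using that by (auto intro!: derivative_eq_intros sd simp: field_simps)
    moreover have "(288 * p * (p * s u / u) + k * (0 - d^4 * ((p * s u / u) * u^4 - s u * (4 * u^3)) / (u^4 * u^4)))
        = 288 * p^2 * (s u / u) + (k * (4 - p)) * d^4 * (s u / u^5)"
      using that by (simp add: field_simps power2_eq_square eval_nat_numeral)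
    ultimately show ?thesis unfolding g'_def k(3) by simp
  qed
  have d0: "(h0 has_real_derivative h1 u) (at u)" for u
    by (rule DERIV_glue[OF d(1)])
       (auto intro!: derivative_eq_intros Td6 wd' simp: h0_def h1_def T0, (simp add: algebra_simps)?)
  have d1: "(h1 has_real_derivative h2 u) (at u)" for u
    by (rule DERIV_glue[OF d(1)])
       (auto intro!: derivative_eq_intros Td6 wd' simp: h1_def h2_def T0, (simp add: algebra_simps)?)
  have d2: "(h2 has_real_derivative h3 u) (at u)" for u
    by (rule DERIV_glue[OF d(1)])
       (auto intro!: derivative_eq_intros Td6 wd' simp: h2_def h3_def T0, (simp add: algebra_simps)?)
  have c3: "continuous_on UNIV h3"
    by (rule continuous_glue[OF d(1)])
       (auto simp: h3_def T0 w1_def w2_def w3_def intro!: continuous_intros Tc wc)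
  have db: "(b has_real_derivative b1 u) (at u)" for u
    by (rule DERIV_glue[OF d(1)])
       (auto intro!: derivative_eq_intros Td6 wd' gd simp: b_def b1_def T0, (simp add: algebra_simps)?)
  have cb1: "continuous_on UNIV b1"
    by (rule continuous_glue[OF d(1)])
       (auto simp: b1_def T0 g_def g'_def q2_def q3_def intro!: continuous_intros Tc wc)
  have key: "0 \<le> h0 u \<and> 0 \<le> h1 u \<and> 0 \<le> h2 u \<and> 0 \<le> b1 u \<and> (h2 u * u)\<^sup>2 \<le> b1 u * h0 u \<and>
     (u \<le> 1 \<longrightarrow> h0 u \<le> 1 \<and> (h1 u * u)\<^sup>2 \<le> 36 * h0 u \<and> 0 \<le> b u \<and> b u \<le> \<omega>)" for u
  proof (cases "u \<le> d")
    case True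
    then show ?thesis using assms by (simp add: h0_def h1_def h2_def b1_def b_def T0)
  next
    case False
    then have u: "u > d" "u > 0" using d by auto
    define t where "t = u - d"
    have t: "0 < t" "t \<le> u" "d = u - t" using u d by (auto simp: t_def)
    have T: "T n u = t ^ n" for n using u by (simp add: T_def t_def)
    have sp: "s u > 0" using u by (simp add: s_def)
    have wp: "w u > 0" using sp u by (simp add: w_def)
    have sw: "s u = w u * u ^ 5" using u by (simp add: w_def)
    have g0: "g u \<ge> 0"
    proof -
      have "s u / u^4 = u powr (p - 4)" using u by (simp add: s_def powr_diff powr_numeral)
      also have "\<dots> \<le> d powr (p - 4)" using u d p by (intro powr_mono2') auto
      also have "\<dots> = d powr p / d^4" using d by (simp add: powr_diff powr_numeral)
      finally have "d^4 * (s u / u^4) \<le> d powr p" using d by (simp add: field_simps)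
      then show ?thesis unfolding g_def using p sp k by (intro add_nonneg_nonneg mult_nonneg_nonneg) auto
    qed
    have g'0: "g' u \<ge> 0" unfolding g'_def using u sp by simp
    have B0: "h0 u \<ge> 0" using wp t by (simp add: h0_def T)
    have tpow: "t^5 = t^4 * t" "t^6 = t^4 * t^2" "t^6 = t^5 * t" "t^8 = t^2 * t^6" "t^8 = (t^4)^2" "t^10 = (t^5)^2" "t^10 = t^6 * t^4"
      by (simp_all flip: power_add power_mult power_Suc2)
    have b1eq: "h1 u = t^5 * w u / u * (6 * u + c * t)"
      unfolding h1_def w1_def T tpow(3) using u by (simp add: field_simps)
    have ct: "0 \<le> 6 * u + c * t" "6 * u + c * t \<le> 6 * u"
    proof -
      have "(p - 5) * t \<ge> - 5 * t" using p t by (intro mult_right_mono) auto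
      then show "0 \<le> 6 * u + c * t" using t u unfolding c_def by linarith
      have "(p - 5) * t \<le> 0" using p t by (intro mult_nonpos_nonneg) auto
      then show "6 * u + c * t \<le> 6 * u" by (simp add: c_def)
    qed
    have B1: "h1 u \<ge> 0" unfolding b1eq using wp t u ct by simp
    \<comment> \<open>The quadratic factor of \<open>h2\<close>, rewritten in \<open>u\<close> and
      \<open>d\<close> to show that it is small: for \<open>d = 0\<close> only
      \<open>p * (1 + p) * u^2\<close> is left, as for the pure power u powr (1 + p).\<close>
    define B where "B = p * (1 + p) * u^2 + 2 * p * (5 - p) * u * d + (5 - p) * (6 - p) * d^2"
    have b2eq: "h2 u = t^4 * w u / u^2 * B"
    proof -
      have "h2 u = t^4 * w u / u^2 * (30 * u^2 + 12 * c * t * u + c * (c - 1) * t^2)"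
        unfolding h2_def w1_def w2_def T tpow(1,2) using u by (simp add: field_simps power2_eq_square)
      also have "30 * u^2 + 12 * c * t * u + c * (c - 1) * t^2 = B"
        unfolding B_def c_def t_def by (simp add: algebra_simps power2_eq_square)
      finally show ?thesis .
    qed
    have Bb: "0 \<le> B" "B \<le> 12 * p * u^2 + 30 * d^2"
    proof -
      have ss: "p * (1 + p) \<le> 2 * p" "2 * p * (5 - p) \<le> 10 * p"
        using mult_left_mono[of p 1 p] p by (simp_all add: algebra_simps)
      show "0 \<le> B" unfolding B_def using p d u by (intro add_nonneg_nonneg mult_nonneg_nonneg) simp_all
      have "p * (1 + p) * u^2 \<le> 2 * p * u^2" using mult_right_mono[OF ss(1), of "u^2"] by (simp add: mult_ac)
      moreover have "2 * p * (5 - p) * u * d \<le> 10 * p * u^2"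
      proof -
        have "2 * p * (5 - p) * (u * d) \<le> (10 * p) * (u * u)"
          by (rule mult_mono[OF ss(2)]) (use p u d in auto)
        then show ?thesis by (simp add: power2_eq_square mult_ac)
      qed
      moreover have "(5 - p) * (6 - p) * d^2 \<le> 5 * 6 * d^2"
        using p by (intro mult_right_mono mult_mono) auto
      ultimately show "B \<le> 12 * p * u^2 + 30 * d^2" unfolding B_def by linarith
    qed
    have B2: "h2 u \<ge> 0" unfolding b2eq using wp t u Bb by simp
    have b1low: "b1 u \<ge> t^2 / u^2 * g' u"
    proof -
      have "2 * t / u^2 - 2 * t^2 / u^3 = 2 * t * d / u^3"
        using u unfolding t(3) by (simp add: field_simps eval_nat_numeral)
      then have "0 \<le> (2 * T 1 u * q2 u - 2 * T 2 u * q3 u) * g u"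
        using g0 t u d by (simp add: T q2_def q3_def)
      then show ?thesis by (simp add: b1_def T q2_def)
    qed
    have B1': "b1 u \<ge> 0" using b1low g'0 t u by (smt (verit) divide_nonneg_nonneg mult_nonneg_nonneg zero_le_power2)
    have main: "(h2 u * u)^2 \<le> b1 u * h0 u"
    proof -
      have "B^2 \<le> (12 * p * u^2 + 30 * d^2)^2" using Bb by (intro power_mono)
      also have "\<dots> \<le> 288 * p^2 * u^4 + 1800 * d^4"
        using sum_squares_bound[of "12 * p * u^2" "30 * d^2"]
        by (simp add: power2_sum power_mult_distrib flip: power_mult)
      finally have "t^8 * (w u)^2 / u^2 * B^2 \<le> t^8 * (w u)^2 / u^2 * (288 * p^2 * u^4 + 1800 * d^4)"
        by (intro mult_left_mono) auto
      moreover have "(h2 u * u)^2 = t^8 * (w u)^2 / u^2 * B^2"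
      proof -
        have "h2 u * u = t^4 * w u / u * B" unfolding b2eq using u by (simp add: field_simps power2_eq_square)
        then show ?thesis unfolding tpow(5) by (simp add: power_mult_distrib power_divide)
      qed
      moreover have "t^8 * (w u)^2 / u^2 * (288 * p^2 * u^4 + 1800 * d^4) = (t^2 / u^2 * g' u) * h0 u"
      proof -
        have "s u / u = w u * u^4" using u by (simp add: sw eval_nat_numeral)
        moreover have "s u / u^5 = w u" by (simp add: w_def)
        ultimately have "g' u = w u * (288 * p^2 * u^4 + 1800 * d^4)" unfolding g'_def by (simp add: algebra_simps)
        then show ?thesis unfolding h0_def T tpow(4) by (simp add: power2_eq_square[of "w u"])
      qed
      moreover have "(t^2 / u^2 * g' u) * h0 u \<le> b1 u * h0 u" by (intro mult_right_mono b1low B0)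
      ultimately show ?thesis by linarith
    qed
    have small: "h0 u \<le> 1 \<and> (h1 u * u)\<^sup>2 \<le> 36 * h0 u \<and> 0 \<le> b u \<and> b u \<le> \<omega>" if u1: "u \<le> 1"
    proof (intro conjI)
      have s1: "s u \<le> 1" using u u1 p by (simp add: s_def powr_le1)
      have us: "u ^ 6 * w u \<le> 1"
      proof -
        have "u ^ 6 * w u = u * s u" using u by (simp add: sw eval_nat_numeral)
        also have "\<dots> \<le> 1 * 1" using u u1 s1 sp by (intro mult_mono) auto
        finally show ?thesis by simp
      qed
      have "t ^ 6 * w u \<le> u ^ 6 * w u" using t wp by (intro mult_right_mono power_mono) auto
      then show "h0 u \<le> 1" using us by (simp add: h0_def T)
      have "(h1 u * u)^2 = t^10 * (w u)^2 * (6 * u + c * t)^2"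
      proof -
        have "h1 u * u = t^5 * w u * (6 * u + c * t)" unfolding b1eq using u by simp
        then show ?thesis unfolding tpow(6) by (simp add: power_mult_distrib)
      qed
      also have "\<dots> \<le> t^10 * (w u)^2 * (6 * u)^2" using ct by (intro mult_left_mono power_mono) auto
      also have "\<dots> = 36 * (t^6 * w u) * (t^4 * u^2 * w u)" unfolding tpow(7) by (simp add: power_mult_distrib power2_eq_square[of "w u"])
      also have "\<dots> \<le> 36 * (t^6 * w u) * 1"
      proof (rule mult_left_mono)
        have "t^4 * u^2 * w u \<le> u^4 * u^2 * w u" using t wp by (intro mult_right_mono power_mono) auto
        also have "\<dots> = u^6 * w u" by (simp flip: power_add)
        finally show "t^4 * u^2 * w u \<le> 1" using us by linarith
      qed (use t wp in simp)
      finally show "(h1 u * u)^2 \<le> 36 * h0 u" by (simp add: h0_def T)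
      show "0 \<le> b u" unfolding b_def T q2_def using g0 by simp
      have gle: "g u \<le> \<omega>"
      proof -
        have "k * (d powr p - d^4 * (s u / u^4)) \<le> k * (d powr p)"
          using k sp u d by (intro mult_left_mono) auto
        also have "\<dots> \<le> 600 * d powr p" using k by (intro mult_right_mono) auto
        finally have "k * (d powr p - d^4 * (s u / u^4)) \<le> \<omega> / 2" using dp by linarith
        moreover have "288 * p * s u \<le> 288 * p * 1" using p s1 by (intro mult_left_mono) auto
        ultimately show ?thesis unfolding g_def using p(3) by linarith
      qed
      have "t^2 / u^2 \<le> 1" using t u by (simp add: power_mono)
      then have "t^2 / u^2 * g u \<le> 1 * g u" using g0 by (intro mult_right_mono)
      then show "b u \<le> \<omega>" unfolding b_def T q2_def using gle by simp
    qed
    show ?thesis using B0 B1 B2 B1' main small by blast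
  qed
  \<comment> \<open>\<open>u \<ge> 1/2\<close> and \<open>d \<le> 1/4\<close> leave
    \<open>u - d \<ge> 1/4\<close>, and the factor \<open>w u\<close> is at least 1 for
    \<open>u \<le> 1\<close>; hence the constant (1/4)^6 = 1/4096.\<close>
  have low: "h0 u \<ge> 1/4096" if "1/2 \<le> u" "u \<le> 1" for u
  proof -
    have u: "u > d" "u > 0" using that d by auto
    have "u powr 5 \<le> u powr p" using that u p by (intro powr_mono') auto
    then have "u ^ 5 \<le> s u" using u by (simp add: s_def powr_numeral)
    then have "1 \<le> w u" using u by (simp add: w_def)
    moreover have "(1/4)^6 \<le> T 6 u" unfolding T_def using that d by (intro power_mono) auto
    moreover have "0 \<le> T 6 u" by (simp add: T_def)
    ultimately have "(1/4)^6 * 1 \<le> T 6 u * w u" by (intro mult_mono) simp_all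
    then show ?thesis by (simp add: h0_def power_divide)
  qed
  have zero: "h0 u = 0 \<and> h1 u = 0 \<and> h2 u = 0 \<and> b u = 0 \<and> b1 u = 0" if "u \<le> d" for u
    using that by (simp add: h0_def h1_def h2_def b1_def b_def T0)
  have "admissible_cutoff d \<omega> h0 h1 h2 h3 b b1"
    unfolding admissible_cutoff_def using d d0 d1 d2 c3 zero key db cb1 by blast
  then show ?thesis using d(2) low by blast
qed

section \<open>Approximate solutions of the Dirichlet problem on polytopes\<close>

definition nbr_sum :: "real \<Rightarrow> (real^'n \<Rightarrow> real) \<Rightarrow> real^'n \<Rightarrow> real" where
  "nbr_sum r p x = (\<Sum>i\<in>UNIV. p (x + r *\<^sub>R axis i 1) + p (x - r *\<^sub>R axis i 1))"

text \<open>A supersolution of the difference analogue of - Laplace w = M. The operator acts on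
  functions of a continuous variable, that is on all translates of the lattice at once, so that
  solutions can be mollified later. The sign condition at the neighbours covers those outside
  \<open>D\<close>, where the solution is 0.\<close>

definition barrier :: "(real^'n) set \<Rightarrow> real \<Rightarrow> real \<Rightarrow> (real^'n \<Rightarrow> real) \<Rightarrow> bool" where
  "barrier D r M w \<longleftrightarrow> w \<in> borel_measurable borel \<and> (\<forall>x\<in>D. 0 \<le> w x \<and>
     (\<forall>i. 0 \<le> w (x + r *\<^sub>R axis i 1) \<and> 0 \<le> w (x - r *\<^sub>R axis i 1)) \<and>
     nbr_sum r w x + r^2 * M \<le> 2 * real CARD('n) * w x)"

lemma nbr_sum_mono:
  assumes "\<And>i. p (x + r *\<^sub>R axis i 1) \<le> \<eta> (x + r *\<^sub>R axis i 1)" "\<And>i. p (x - r *\<^sub>R axis i 1) \<le> \<eta> (x - r *\<^sub>R axis i 1)"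
  shows "nbr_sum r p x \<le> nbr_sum r \<eta> x"
  unfolding nbr_sum_def by (intro sum_mono add_mono assms)

lemma nbr_sum_uminus: "nbr_sum r (\<lambda>x. - p x) x = - nbr_sum r p x"
  by (simp add: nbr_sum_def sum.distrib sum_negf sum_subtractf)

text \<open>Where one of the two barriers attains the minimum, the neighbour sum of the minimum is
  at most that of this barrier. Minima combine bounds that are good near different parts of the
  boundary.\<close>

lemma barrier_min:
  assumes "barrier D r M v" "barrier D r M w"
  shows "barrier D r M (\<lambda>x. min (v x) (w x))"
proof -
  have 1: "nbr_sum r (\<lambda>x. min (v x) (w x)) x \<le> nbr_sum r v x" and 2: "nbr_sum r (\<lambda>x. min (v x) (w x)) x \<le> nbr_sum r w x" for x
    by (rule nbr_sum_mono; simp)+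
  have "nbr_sum r (\<lambda>x. min (v x) (w x)) x + r^2 * M \<le> 2 * real CARD('a) * min (v x) (w x)" if "x \<in> D" for x
    using assms that 1[of x] 2[of x] unfolding barrier_def by (cases "v x \<le> w x") (auto simp: min_def intro: order_trans)
  then show ?thesis using assms unfolding barrier_def by auto
qed

lemma barrier_finite:
  assumes "finite I" "barrier D r M v" "\<And>i. i \<in> I \<Longrightarrow> barrier D r M (w i)"
  shows "\<exists>u. barrier D r M u \<and> (\<forall>x. u x \<le> v x) \<and> (\<forall>i\<in>I. \<forall>x. u x \<le> w i x)"
  using assms
proof (induction I rule: finite_induct)
  case (insert i I)
  then obtain u where u: "barrier D r M u" "\<forall>x. u x \<le> v x" "\<forall>i\<in>I. \<forall>x. u x \<le> w i x" by auto
  show ?case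
    using barrier_min[OF u(1) insert.prems(2)[of i]] u(2,3)
    by (intro exI[of _ "\<lambda>x. min (u x) (w i x)"]) (auto simp: min_le_iff_disj)
qed auto

text \<open>Solution of the difference equation by monotone iteration from a subsolution.\<close>

lemma lattice_solution:
  fixes D :: "(real^'n) set"
  assumes w: "barrier D r M w" and D: "D \<in> sets borel" and g: "g \<in> borel_measurable borel" "\<And>x. \<bar>g x\<bar> \<le> M"
  obtains p where "p \<in> borel_measurable borel" "\<And>x. x \<notin> D \<Longrightarrow> p x = 0" "\<And>x. x \<in> D \<Longrightarrow> \<bar>p x\<bar> \<le> w x"
    "\<And>x. x \<in> D \<Longrightarrow> 2 * real CARD('n) * p x = nbr_sum r p x + r^2 * g x"
proof -
  define N where "N = 2 * real CARD('n)"
  have N: "N > 0" by (simp add: N_def)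
  define T where "T = (\<lambda>p x. if x \<in> D then (nbr_sum r p x + r^2 * g x) / N else 0)"
  \<comment> \<open>The function \<open>- w\<close>, set to 0 outside \<open>D\<close>, is a
    subsolution. The iterates of the monotone map \<open>T\<close> therefore increase from it, and
    they stay below \<open>w\<close>.\<close>
  define p where "p = (\<lambda>k. (T ^^ k) (\<lambda>x. if x \<in> D then - w x else 0))"
  have pS: "p (Suc k) = T (p k)" for k by (simp add: p_def)
  have wm: "w \<in> borel_measurable borel" using w by (simp add: barrier_def)
  have out: "p k x = 0" if "x \<notin> D" for k x using that by (cases k) (auto simp: p_def T_def)
  have meas: "p k \<in> borel_measurable borel" for k
  proof (induction k)
    case 0
    then show ?case unfolding p_def using wm D by (auto intro!: measurable_If_set)
  next
    case (Suc k)
    have [measurable]: "p k \<in> borel_measurable borel" by fact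
    have [measurable]: "g \<in> borel_measurable borel" by fact
    have "(\<lambda>x. (nbr_sum r (p k) x + r^2 * g x) / N) \<in> borel_measurable borel"
      unfolding nbr_sum_def by measurable
    then show ?case unfolding pS T_def using D by (auto intro!: measurable_If_set)
  qed
  have Tmono: "T p x \<le> T \<eta> x" if "\<And>y. p y \<le> \<eta> y" for p \<eta> x
    unfolding T_def using N by (auto intro!: divide_right_mono nbr_sum_mono that)
  have gb: "\<bar>r\<^sup>2 * g x\<bar> \<le> r^2 * M" for x by (simp add: abs_mult g(2) mult_left_mono)
  have upper: "T p x \<le> w x" if "x \<in> D" "\<And>y. y \<in> D \<Longrightarrow> p y \<le> w y" "\<And>y. y \<notin> D \<Longrightarrow> p y = 0" for p x
  proof -
    have le: "p y \<le> w y" if "0 \<le> w y" for y using \<open>\<And>y. y \<in> D \<Longrightarrow> p y \<le> w y\<close> \<open>\<And>y. y \<notin> D \<Longrightarrow> p y = 0\<close> that by (cases "y \<in> D") auto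
    have "nbr_sum r p x \<le> nbr_sum r w x"
      using w \<open>x \<in> D\<close> unfolding barrier_def by (intro nbr_sum_mono le) auto
    moreover have "nbr_sum r w x + r^2 * M \<le> N * w x" using w \<open>x \<in> D\<close> unfolding barrier_def N_def by auto
    ultimately have "nbr_sum r p x + r^2 * g x \<le> N * w x" using gb[of x] by linarith
    then show ?thesis using N \<open>x \<in> D\<close> by (simp add: T_def divide_le_eq mult.commute)
  qed
  have lower0: "p 0 x \<le> p (Suc 0) x" for x
  proof (cases "x \<in> D")
    case True
    have le: "- w y \<le> p 0 y" if "0 \<le> w y" for y using that by (simp add: p_def)
    have "nbr_sum r (\<lambda>y. - w y) x \<le> nbr_sum r (p 0) x"
      using w True unfolding barrier_def by (intro nbr_sum_mono le) auto
    moreover have "nbr_sum r w x + r^2 * M \<le> N * w x" using w True unfolding barrier_def N_def by auto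
    ultimately have "- (N * w x) \<le> nbr_sum r (p 0) x + r^2 * g x" using gb[of x] by (simp add: nbr_sum_uminus)
    then have "- w x \<le> (nbr_sum r (p 0) x + r^2 * g x) / N" using N by (simp add: le_divide_eq mult.commute)
    then show ?thesis using True by (simp add: pS T_def) (simp add: p_def)
  qed (simp add: out)
  have inc: "p k x \<le> p (Suc k) x" for k x
    by (induction k arbitrary: x) (auto simp: lower0, auto simp: pS intro: Tmono)
  have wD: "p k x \<le> w x" if "x \<in> D" for k x
    using that
  proof (induction k arbitrary: x)
    case 0 then show ?case using w by (auto simp: p_def barrier_def)
  next
    case (Suc k) then show ?case unfolding pS by (intro upper out) auto
  qed
  have low: "- w x \<le> p k x" if "x \<in> D" for k x
    using lift_Suc_mono_le[of "\<lambda>k. p k x" 0 k] inc that by (simp add: p_def)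
  define \<Phi> where "\<Phi> = (\<lambda>x. lim (\<lambda>k. p k x))"
  have lim: "(\<lambda>k. p k x) \<longlonglongrightarrow> \<Phi> x" for x
  proof -
    have "convergent (\<lambda>k. p k x)"
    proof (rule Bseq_mono_convergent)
      show "Bseq (\<lambda>k. p k x)"
      proof (rule BseqI'[where K = "\<bar>w x\<bar>"])
        show "norm (p k x) \<le> \<bar>w x\<bar>" for k using wD[of x k] low[of x k] out[of x k] by (cases "x \<in> D") auto
      qed
      show "\<forall>m. \<forall>n\<ge>m. p m x \<le> p n x" using lift_Suc_mono_le[of "\<lambda>k. p k x"] inc by blast
    qed
    then show ?thesis by (simp add: \<Phi>_def convergent_LIMSEQ_iff)
  qed
  show ?thesis
  proof (rule that[of \<Phi>])
    show "\<Phi> \<in> borel_measurable borel" by (rule borel_measurable_LIMSEQ_real[OF lim meas])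
    show "\<Phi> x = 0" if "x \<notin> D" for x using LIMSEQ_unique[OF lim[of x], of 0] out[OF that] by simp
    show "\<bar>\<Phi> x\<bar> \<le> w x" if "x \<in> D" for x
    proof -
      have "\<Phi> x \<le> w x" by (rule LIMSEQ_le_const2[OF lim]) (use wD[OF that] in auto)
      moreover have "- w x \<le> \<Phi> x" by (rule LIMSEQ_le_const[OF lim]) (use low[OF that] in auto)
      ultimately show ?thesis by linarith
    qed
    show "2 * real CARD('n) * \<Phi> x = nbr_sum r \<Phi> x + r^2 * g x" if "x \<in> D" for x
    proof -
      have "(\<lambda>k. N * p (Suc k) x) \<longlonglongrightarrow> N * \<Phi> x" by (rule tendsto_mult_left[OF LIMSEQ_Suc[OF lim]])
      moreover have "(\<lambda>k. nbr_sum r (p k) x + r^2 * g x) \<longlonglongrightarrow> nbr_sum r \<Phi> x + r^2 * g x"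
        unfolding nbr_sum_def by (intro tendsto_intros lim)
      moreover have "N * p (Suc k) x = nbr_sum r (p k) x + r^2 * g x" for k
        using that N by (simp add: pS T_def)
      ultimately have "N * \<Phi> x = nbr_sum r \<Phi> x + r^2 * g x" using LIMSEQ_unique by simp
      then show ?thesis unfolding N_def .
    qed
  qed
qed

text \<open>Taylor expansions in both directions, in which the odd terms of lower order cancel. An
  error of order r^3 is enough, since it will be divided by r^2.\<close>

lemma second_difference_error:
  fixes q :: "real^'n \<Rightarrow> real"
  assumes q: "\<And>k. C_diff k q" and B: "\<And>x. \<bar>pd i (pd i (pd i q)) x\<bar> \<le> B" and r: "r > 0"
  shows "\<bar>q (x + r *\<^sub>R axis i 1) + q (x - r *\<^sub>R axis i 1) - 2 * q x - r\<^sup>2 * pd i (pd i q) x\<bar> \<le> B * r^3"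
proof -
  define Dq where "Dq = (\<lambda>m. (pd i ^^ m) q)"
  have sm: "C_diff k (Dq m)" for k m
    using q by (induction m arbitrary: k) (auto simp: Dq_def C_diff_pderiv simp del: C_diff.simps)
  have dd: "((\<lambda>t. Dq m (x + t *\<^sub>R axis i 1)) has_real_derivative Dq (Suc m) (x + t *\<^sub>R axis i 1)) (at t)" for m t
    using has_real_derivative_axis[OF C_diff_differentiable[OF sm[of "Suc 0"]]] by (simp add: Dq_def)
  have T: "\<exists>t. q (x + s *\<^sub>R axis i 1) = (q x + pd i q x * s + pd i (pd i q) x / 2 * s^2)
      + pd i (pd i (pd i q)) (x + t *\<^sub>R axis i 1) / 6 * s^3" for s
    using Maclaurin_all_le[of "\<lambda>m t. Dq m (x + t *\<^sub>R axis i 1)" "\<lambda>t. q (x + t *\<^sub>R axis i 1)" s 3] dd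
    by (auto simp: Dq_def eval_nat_numeral)
  obtain t1 where t1: "q (x + r *\<^sub>R axis i 1) = (q x + pd i q x * r + pd i (pd i q) x / 2 * r^2)
      + pd i (pd i (pd i q)) (x + t1 *\<^sub>R axis i 1) / 6 * r^3" using T[of r] by blast
  obtain t2 where t2: "q (x + (- r) *\<^sub>R axis i 1) = (q x + pd i q x * (- r) + pd i (pd i q) x / 2 * (- r)^2)
      + pd i (pd i (pd i q)) (x + t2 *\<^sub>R axis i 1) / 6 * (- r)^3" using T[of "- r"] by blast
  define p1 p2 where "p1 = pd i (pd i (pd i q)) (x + t1 *\<^sub>R axis i 1)"
    and "p2 = pd i (pd i (pd i q)) (x + t2 *\<^sub>R axis i 1)"
  have "q (x + r *\<^sub>R axis i 1) + q (x - r *\<^sub>R axis i 1) - 2 * q x - r\<^sup>2 * pd i (pd i q) x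
     = (p1 - p2) / 6 * r^3"
    using t1 t2 unfolding p1_def[symmetric] p2_def[symmetric] by (simp add: field_simps power3_eq_cube)
  moreover have "\<bar>(p1 - p2) / 6\<bar> \<le> B" using B[of "x + t1 *\<^sub>R axis i 1"] B[of "x + t2 *\<^sub>R axis i 1"] unfolding p1_def p2_def by (simp add: abs_le_iff)
  then have "\<bar>(p1 - p2) / 6\<bar> * r^3 \<le> B * r^3" using r by (intro mult_right_mono) auto
  moreover have "\<bar>(p1 - p2) / 6 * r^3\<bar> = \<bar>(p1 - p2) / 6\<bar> * r^3" using r by (simp add: abs_mult)
  ultimately show ?thesis by (simp only:)
qed

lemma lipschitz_of_pderiv_bound:
  fixes f :: "real^'n \<Rightarrow> real"
  assumes f: "\<And>x. f differentiable (at x)" and S: "convex S" "x \<in> S" "y \<in> S" and K: "\<And>z i. z \<in> S \<Longrightarrow> \<bar>pd i f z\<bar> \<le> K"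
  shows "\<bar>f y - f x\<bar> \<le> real CARD('n) * K * norm (y - x)"
proof -
  have "\<exists>t>0. t < 1 \<and> f (x + 1 *\<^sub>R (y - x)) - f (x + 0 *\<^sub>R (y - x)) = (1 - 0) * (\<Sum>i\<in>UNIV. (y - x) $ i * pd i f (x + t *\<^sub>R (y - x)))"
    by (rule MVT2[where f = "\<lambda>t. f (x + t *\<^sub>R (y - x))"]) (simp, intro has_real_derivative_line f)
  then obtain t where t: "0 < t" "t < 1" "f y - f x = (\<Sum>i\<in>UNIV. (y - x) $ i * pd i f (x + t *\<^sub>R (y - x)))"
    by auto
  have "x + t *\<^sub>R (y - x) = (1 - t) *\<^sub>R x + t *\<^sub>R y" by (simp add: algebra_simps)
  then have "x + t *\<^sub>R (y - x) \<in> S" using S t by (auto simp: convex_alt)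
  then have "\<bar>\<Sum>i\<in>UNIV. (y - x) $ i * pd i f (x + t *\<^sub>R (y - x))\<bar> \<le> real CARD('n) * K * norm (y - x)"
    by (intro norm_component_sum_bound K)
  then show ?thesis using t(3) by simp
qed

text \<open>For \<open>s = \<bar>t\<bar>\<close> the left side is exp (-s) * (exp s - 1)^2, and
  \<open>exp s - 1\<close> is at least \<open>s\<close>. This quantifies the convexity of the
  exponentials in \<open>rho\<close> at the scale of the difference step.\<close>

lemma exp_second_difference: "exp t + exp (- t) - 2 \<ge> exp (- \<bar>t\<bar>) * t^2" for t :: real
proof -
  have "exp s + exp (- s) - 2 \<ge> exp (- s) * s^2" if "s \<ge> 0" for s :: real
  proof -
    have "s \<le> exp s - 1" using exp_ge_add_one_self[of s] by linarith
    then have "s^2 \<le> (exp s - 1)^2" using that by (rule power_mono)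
    then have "exp (- s) * s^2 \<le> exp (- s) * (exp s - 1)^2" by simp
    also have "\<dots> = exp s + exp (- s) - 2"
      by (simp add: power2_diff power2_eq_square algebra_simps flip: exp_add)
    finally show ?thesis .
  qed
  from this[of "\<bar>t\<bar>"] show ?thesis by (cases "t \<ge> 0") auto
qed

lemma conv_shift:
  fixes \<phi> k :: "real^'n \<Rightarrow> real"
  assumes "integrable lborel \<phi>" "continuous_on UNIV k" "\<And>x. k x \<noteq> 0 \<Longrightarrow> norm x \<le> R"
  shows "conv \<phi> k (x + v) = (LINT y|lborel. \<phi> (y + v) * k (x - y))"
    "integrable lborel (\<lambda>y. \<phi> (y + v) * k (x - y))"
  using integral_translate[OF conv_integrable[OF assms, of "x + v"], of v] by (simp_all add: conv_def)

lemma continuous_bounded_on_cball: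
  fixes f :: "real^'n \<Rightarrow> real"
  assumes "continuous_on UNIV f"
  shows "\<exists>K. \<forall>x. norm x \<le> R \<longrightarrow> \<bar>f x\<bar> \<le> K"
proof -
  have "bounded (f ` cball 0 R)"
    by (intro compact_imp_bounded compact_continuous_image) (use assms continuous_on_subset in auto)
  then obtain K where K: "\<forall>y\<in>f ` cball 0 R. \<bar>y\<bar> \<le> K" unfolding bounded_iff real_norm_def by blast
  have "\<bar>f x\<bar> \<le> K" if "norm x \<le> R" for x using K that by simp
  then show ?thesis by blast
qed

lemma continuous_family_bounded_on_cball:
  fixes f :: "'j::finite \<Rightarrow> real^'n \<Rightarrow> real"
  assumes "\<And>j. continuous_on UNIV (f j)"
  obtains K where "\<And>j x. norm x \<le> R \<Longrightarrow> \<bar>f j x\<bar> \<le> K"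
proof -
  have "\<forall>j. \<exists>K. \<forall>x. norm x \<le> R \<longrightarrow> \<bar>f j x\<bar> \<le> K" using continuous_bounded_on_cball[OF assms] by blast
  then obtain k where k: "\<And>j x. norm x \<le> R \<Longrightarrow> \<bar>f j x\<bar> \<le> k j" by metis
  have "\<bar>f j x\<bar> \<le> Max (range k)" if "norm x \<le> R" for j x by (rule order_trans[OF k[OF that] Max_ge]) auto
  then show thesis by (rule that)
qed

section \<open>A concave defining function and barriers for a polytope\<close>

locale polytope_domain =
  fixes F :: "((real^'n) \<times> real) set" and \<Omega> :: "(real^'n) set"
  assumes finF: "finite F" and neF: "F \<noteq> {}" and unit: "\<And>f. f \<in> F \<Longrightarrow> norm (fst f) = 1"
    and \<Omega>: "\<Omega> = {x. \<forall>f\<in>F. inner (fst f) x < snd f}" and ne\<Omega>: "\<Omega> \<noteq> {}" and bnd\<Omega>: "bounded \<Omega>"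
begin

definition m where "m = real (card F)"

definition e :: "real \<Rightarrow> (real^'n) \<times> real \<Rightarrow> real^'n \<Rightarrow> real" where "e c f x = exp (c * (inner (fst f) x - snd f))"

text \<open>On the closure of \<Omega> all exponents are nonpositive, and the normalisation 1 / (2
  m) gives values of at least 1/2. A large \<open>c\<close> keeps {rho > 0} within distance ln (2 m)
  / c of every half space. Exponentials of affine functions are convex, so \<open>rho c\<close> is
  smooth and concave.\<close>

definition rho where "rho c x = 1 - (1 / (2 * m)) * (\<Sum>f\<in>F. e c f x)"

lemma m: "m \<ge> 1" "m > 0"
  using finF neF card_gt_0_iff[of F] by (auto simp: m_def)

lemma e_pos: "e c f x > 0" by (simp add: e_def)

lemma C_diff_e: "C_diff k (e c f)"
proof -
  have "C_diff k (\<lambda>x. (\<lambda>j::nat. exp) 0 (c * (inner (fst f) x - snd f)))"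
    by (rule C_diff_compose) (auto intro!: continuous_intros derivative_eq_intros C_diff_cmult C_diff_diff simp del: C_diff.simps)
  then show ?thesis by (simp add: e_def[abs_def])
qed

lemma e_diff: "e c f differentiable (at x)"
  by (rule C_diff_differentiable[OF C_diff_e])

lemma pderiv_e: "pd i (e c f) = (\<lambda>x. c * fst f $ i * e c f x)"
proof
  fix x
  have d: "(\<lambda>x. c * (inner (fst f) x - snd f)) differentiable (at x)"
    by (rule C_diff_differentiable[of 0]) (intro C_diff_cmult C_diff_diff C_diff_inner C_diff_const)
  have i: "(\<lambda>x. inner (fst f) x) differentiable (at x)"
    by (rule C_diff_differentiable[of 0]) (intro C_diff_inner)
  have "pd i (\<lambda>x. c * (inner (fst f) x - snd f)) x = c * fst f $ i"
    using i by (simp add: pderiv_dir_cmult pderiv_dir_diff pderiv_dir_inner)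
  then show "pd i (e c f) x = c * fst f $ i * e c f x"
    unfolding e_def[abs_def] by (subst pderiv_dir_compose[OF DERIV_exp d]) simp
qed

lemma C_diff_rho: "C_diff k (rho c)"
  unfolding rho_def[abs_def] by (intro C_diff_diff C_diff_const C_diff_cmult C_diff_sum C_diff_e)

lemma pderiv_rho: "pd i (rho c) = (\<lambda>x. - (1 / (2 * m)) * (\<Sum>f\<in>F. c * fst f $ i * e c f x))"
proof
  fix x
  show "pd i (rho c) x = - (1 / (2 * m)) * (\<Sum>f\<in>F. c * fst f $ i * e c f x)"
    unfolding rho_def[abs_def]
    by (simp only: pderiv_dir_diff[OF differentiable_const differentiable_mult[OF differentiable_const C_diff_sum_differentiable[OF e_diff]]]
        pderiv_dir_cmult[OF C_diff_sum_differentiable[OF e_diff]] pderiv_dir_sum[OF e_diff] pderiv_dir_const pderiv_e)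
qed

lemma pderiv2_rho: "pd j (pd i (rho c)) x = - (c^2 / (2 * m)) * (\<Sum>f\<in>F. e c f x * (fst f $ i * fst f $ j))"
proof -
  have "pd j (pd i (rho c)) x = - (1 / (2 * m)) * (\<Sum>f\<in>F. c * fst f $ i * (c * fst f $ j * e c f x))"
    unfolding pderiv_rho
    by (simp only: pderiv_dir_cmult[OF C_diff_sum_differentiable[OF differentiable_mult[OF differentiable_const e_diff]]]
        pderiv_dir_sum[OF differentiable_mult[OF differentiable_const e_diff]] pderiv_dir_cmult[OF e_diff] pderiv_e)
  then show ?thesis by (simp add: sum_distrib_left sum_negf power2_eq_square mult_ac)
qed

text \<open>The Hessian is a negative combination of the projections onto the unit normals; each of
  them has trace 1 and, by Cauchy-Schwarz, a quadratic form of at most the squared length.\<close>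

lemma rho_concave: "lap (rho c) x * (\<Sum>i\<in>UNIV. (\<xi> i)^2) \<le> (\<Sum>i\<in>UNIV. \<Sum>j\<in>UNIV. pd j (pd i (rho c)) x * \<xi> i * \<xi> j)"
proof -
  have "(\<Sum>i\<in>UNIV. \<Sum>j\<in>UNIV. pd j (pd i (rho c)) x * \<xi> i * \<xi> j)
     = - (c^2 / (2 * m)) * (\<Sum>f\<in>F. e c f x * (\<Sum>i\<in>UNIV. fst f $ i * \<xi> i)^2)"
  proof -
    have "(\<Sum>i\<in>UNIV. \<Sum>j\<in>UNIV. pd j (pd i (rho c)) x * \<xi> i * \<xi> j)
      = - (c^2 / (2 * m)) * (\<Sum>i\<in>UNIV. \<Sum>j\<in>UNIV. \<Sum>f\<in>F. e c f x * ((fst f $ i * \<xi> i) * (fst f $ j * \<xi> j)))"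
      unfolding pderiv2_rho by (simp add: sum_distrib_left sum_distrib_right sum_negf mult_ac)
    also have "(\<Sum>i\<in>UNIV. \<Sum>j\<in>UNIV. \<Sum>f\<in>F. e c f x * ((fst f $ i * \<xi> i) * (fst f $ j * \<xi> j)))
      = (\<Sum>f\<in>F. \<Sum>i\<in>UNIV. \<Sum>j\<in>UNIV. e c f x * ((fst f $ i * \<xi> i) * (fst f $ j * \<xi> j)))"
      by (subst sum.swap[of _ F UNIV], subst sum.swap[of _ F UNIV]) (rule refl)
    moreover have "(\<Sum>i\<in>UNIV. fst f $ i * \<xi> i)^2 = (\<Sum>i\<in>UNIV. \<Sum>j\<in>UNIV. (fst f $ i * \<xi> i) * (fst f $ j * \<xi> j))" for f :: "(real^'n) \<times> real"
      by (simp only: power2_eq_square sum_product)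
    ultimately show ?thesis by (simp only: sum_distrib_left)
  qed
  moreover have "lap (rho c) x = - (c^2 / (2 * m)) * (\<Sum>f\<in>F. e c f x)"
  proof -
    have "lap (rho c) x = - (c^2 / (2 * m)) * (\<Sum>f\<in>F. e c f x * (\<Sum>i\<in>UNIV. (fst f $ i)^2))"
      unfolding lap_def pderiv2_rho sum_distrib_left[symmetric] by (subst sum.swap) (simp add: sum_distrib_left power2_eq_square)
    moreover have "(\<Sum>i\<in>UNIV. (fst f $ i)^2) = 1" if "f \<in> F" for f
      using unit[OF that] by (simp add: norm_vec_def L2_set_def)
    ultimately show ?thesis by simp
  qed
  moreover have "(\<Sum>f\<in>F. e c f x * (\<Sum>i\<in>UNIV. fst f $ i * \<xi> i)^2) \<le> (\<Sum>f\<in>F. e c f x) * (\<Sum>i\<in>UNIV. (\<xi> i)^2)"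
    unfolding sum_distrib_right
  proof (rule sum_mono)
    fix f assume f: "f \<in> F"
    have "(\<Sum>i\<in>UNIV. fst f $ i * \<xi> i)^2 \<le> (\<Sum>i\<in>UNIV. (fst f $ i)^2) * (\<Sum>i\<in>UNIV. (\<xi> i)^2)"
      by (rule Cauchy_Schwarz_ineq_sum)
    also have "(\<Sum>i\<in>UNIV. (fst f $ i)^2) = 1" using unit[OF f] by (simp add: norm_vec_def L2_set_def)
    finally show "e c f x * (\<Sum>i\<in>UNIV. fst f $ i * \<xi> i)^2 \<le> e c f x * (\<Sum>i\<in>UNIV. (\<xi> i)^2)"
      using e_pos[of c f x] by simp
  qed
  then have "(c^2 / (2 * m)) * (\<Sum>f\<in>F. e c f x * (\<Sum>i\<in>UNIV. fst f $ i * \<xi> i)^2) \<le> (c^2 / (2 * m)) * ((\<Sum>f\<in>F. e c f x) * (\<Sum>i\<in>UNIV. (\<xi> i)^2))"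
    using m by (intro mult_left_mono) auto
  ultimately show ?thesis by simp
qed

lemma rho_le: "rho c x \<le> 1"
  unfolding rho_def using m by (simp add: sum_nonneg e_pos less_imp_le)

lemma closure_le: "x \<in> closure \<Omega> \<Longrightarrow> f \<in> F \<Longrightarrow> inner (fst f) x \<le> snd f"
proof -
  assume x: "x \<in> closure \<Omega>" and f: "f \<in> F"
  have "closure \<Omega> \<subseteq> {x. inner (fst f) x \<le> snd f}"
    by (rule closure_minimal) (use f in \<open>auto simp: \<Omega> closed_halfspace_le less_imp_le\<close>)
  then show ?thesis using x by auto
qed

lemma rho_ge_half:
  assumes "x \<in> closure \<Omega>" "c > 0"
  shows "rho c x \<ge> 1/2"
proof -
  have "(\<Sum>f\<in>F. e c f x) \<le> (\<Sum>f\<in>F. 1)"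
    using closure_le[OF assms(1)] assms(2) by (intro sum_mono) (auto simp: e_def mult_nonneg_nonpos)
  then have "(1 / (2 * m)) * (\<Sum>f\<in>F. e c f x) \<le> (1 / (2 * m)) * m" using m by (intro mult_left_mono) (auto simp: m_def)
  then show ?thesis unfolding rho_def using m by simp
qed

lemma rho_pos_bound:
  assumes "rho c x > 0" "c > 0" "f \<in> F"
  shows "inner (fst f) x - snd f < ln (2 * m) / c"
proof -
  have "(1 / (2 * m)) * (\<Sum>f\<in>F. e c f x) < 1" using assms(1) by (simp add: rho_def)
  then have "(\<Sum>f\<in>F. e c f x) < 2 * m" using m by (simp add: divide_less_eq)
  moreover have "e c f x \<le> (\<Sum>f\<in>F. e c f x)" using assms(3) finF by (intro member_le_sum) (auto simp: e_pos less_imp_le)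
  ultimately have "exp (c * (inner (fst f) x - snd f)) < exp (ln (2 * m))" using m by (simp add: e_def)
  then show ?thesis using assms(2) by (simp add: less_divide_eq mult.commute)
qed

text \<open>A fixed inner point keeps distance \<open>s0\<close> from every hyperplane, so its
  midpoint with a point that violates the constraints by less than \<open>s0\<close> lies in
  \<Omega>. Hence all slightly enlarged polytopes share one bound.\<close>

lemma domain_bound:
  obtains R s0 where "R > 0" "s0 > 0" "\<And>x s. 0 < s \<Longrightarrow> s \<le> s0 \<Longrightarrow> (\<And>f. f \<in> F \<Longrightarrow> inner (fst f) x - snd f < s) \<Longrightarrow> norm x \<le> R"
proof -
  obtain x0 where x0: "x0 \<in> \<Omega>" using ne\<Omega> by auto
  define s0 where "s0 = Min ((\<lambda>f. snd f - inner (fst f) x0) ` F)"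
  have s0: "s0 > 0" "\<And>f. f \<in> F \<Longrightarrow> s0 \<le> snd f - inner (fst f) x0"
    using x0 finF neF by (auto simp: s0_def \<Omega>)
  obtain B where B: "B > 0" "\<And>y. y \<in> \<Omega> \<Longrightarrow> norm y \<le> B" using bnd\<Omega> by (auto simp: bounded_pos)
  have "norm x \<le> 2 * B + norm x0" if "0 < s" "s \<le> s0" "\<And>f. f \<in> F \<Longrightarrow> inner (fst f) x - snd f < s" for x s
  proof -
    let ?y = "(1/2) *\<^sub>R (x0 + x)"
    have "?y \<in> \<Omega>" unfolding \<Omega> mem_Collect_eq
    proof
      fix f assume f: "f \<in> F"
      show "inner (fst f) ?y < snd f" using s0(2)[OF f] that(3)[OF f] that(2) by (simp add: inner_add_right)
    qed
    then have "norm ?y \<le> B" by (rule B(2))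
    moreover have "norm x \<le> norm (2 *\<^sub>R ?y) + norm x0" using norm_triangle_ineq4[of "2 *\<^sub>R ?y" x0] by simp
    ultimately show ?thesis by simp
  qed
  moreover have "2 * B + norm x0 > 0" using B(1) by (simp add: add_pos_nonneg)
  ultimately show ?thesis using that[of "2 * B + norm x0" s0] s0(1) by blast
qed

text \<open>A parabola in the signed distance \<open>snd f - inner (fst f) x\<close>; second
  differences of a quadratic are exact. The shift \<open>s + r\<close> keeps it nonnegative at the
  neighbours of points of \<open>D\<close>. It is small near the hyperplane, which will give the
  boundary values.\<close>

lemma quadratic_barrier:
  assumes f: "f \<in> F" and r: "0 < r" "r \<le> 1" and s: "s > 0" and M: "M \<ge> 0" and D: "\<And>x. x \<in> D \<Longrightarrow> inner (fst f) x - snd f < s"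
    and B: "\<And>x. x \<in> D \<Longrightarrow> snd f - inner (fst f) x \<le> B - 1"
  shows "barrier D r M (\<lambda>x. (M / 2) * (snd f - inner (fst f) x + s + r) * (B - (snd f - inner (fst f) x)))"
proof -
  let ?w = "\<lambda>x. (M / 2) * (snd f - inner (fst f) x + s + r) * (B - (snd f - inner (fst f) x))"
  have ai: "\<bar>fst f $ i\<bar> \<le> 1" for i using component_le_norm_cart[of "fst f" i] unit[OF f] by simp
  have ri: "\<bar>r * fst f $ i\<bar> \<le> r" for i using mult_left_mono[OF ai, of r i] r by (simp add: abs_mult)
  have nn: "0 \<le> ?w y" if "snd f - inner (fst f) y > - s - r" "snd f - inner (fst f) y \<le> B - 1 + r" for y
    using that M r by (intro mult_nonneg_nonneg) auto
  have sq: "(\<Sum>i\<in>UNIV. (fst f $ i)^2) = 1" using unit[OF f] by (simp add: norm_vec_def L2_set_def)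
  have "nbr_sum r ?w x + r^2 * M = 2 * real CARD('n) * ?w x" for x
  proof -
    have "?w (x + r *\<^sub>R axis i 1) + ?w (x - r *\<^sub>R axis i 1) = 2 * ?w x - M * r^2 * (fst f $ i)^2" for i
      by (simp add: inner_add_right inner_diff_right inner_axis field_simps power2_eq_square)
    then have "nbr_sum r ?w x = (\<Sum>i\<in>(UNIV::'n set). 2 * ?w x - M * r^2 * (fst f $ i)^2)"
      by (simp only: nbr_sum_def)
    also have "\<dots> = 2 * real CARD('n) * ?w x - M * r^2 * (\<Sum>i\<in>UNIV. (fst f $ i)^2)"
      by (simp add: sum_subtractf sum_distrib_left)
    finally show ?thesis by (simp add: sq mult.commute)
  qed
  moreover have "?w \<in> borel_measurable borel" by measurable
  moreover have "0 \<le> ?w x" "0 \<le> ?w (x + r *\<^sub>R axis i 1)" "0 \<le> ?w (x - r *\<^sub>R axis i 1)" if "x \<in> D" for x i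
  proof -
    have ex: "inner (fst f) (x + r *\<^sub>R axis i 1) = inner (fst f) x + r * fst f $ i"
      "inner (fst f) (x - r *\<^sub>R axis i 1) = inner (fst f) x - r * fst f $ i"
      by (simp_all add: inner_add_right inner_diff_right inner_axis)
    note bnd = D[OF that] B[OF that] r ri[of i, unfolded abs_le_iff]
    show "0 \<le> ?w x" by (rule nn) (use bnd in linarith)+
    show "0 \<le> ?w (x + r *\<^sub>R axis i 1)" by (rule nn; unfold ex; use bnd in linarith)
    show "0 \<le> ?w (x - r *\<^sub>R axis i 1)" by (rule nn; unfold ex; use bnd in linarith)
  qed
  ultimately show ?thesis unfolding barrier_def by (auto intro: eq_refl)
qed

text \<open>The second differences of \<open>rho\<close>, summed over the directions, are at most -
  exp (-c) c^2 r^2 c1 / (2 m); \<open>A\<close> is the factor that turns this into - M r^2. The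
  shift \<open>K1 * r\<close> preserves the sign at the neighbours. This barrier yields the linear
  decay of the solution towards the zero set of \<open>rho\<close>.\<close>

lemma rho_barrier:
  assumes r: "0 < r" "r \<le> 1" and c: "c > 0" and M: "M \<ge> 0" and c1: "c1 > 0" "\<And>x. x \<in> D \<Longrightarrow> c1 \<le> (\<Sum>f\<in>F. e c f x)"
    and D: "\<And>x. x \<in> D \<Longrightarrow> rho c x > 0"
    and lip: "\<And>x i. x \<in> D \<Longrightarrow> \<bar>rho c (x + r *\<^sub>R axis i 1) - rho c x\<bar> \<le> K1 * r \<and> \<bar>rho c (x - r *\<^sub>R axis i 1) - rho c x\<bar> \<le> K1 * r"
    and K1: "K1 \<ge> 0" and A: "A = M * (2 * m) / (c^2 * exp (- c) * c1)"
  shows "barrier D r M (\<lambda>x. A * (rho c x + K1 * r))"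
proof -
  let ?w = "\<lambda>x. A * (rho c x + K1 * r)"
  have A0: "A \<ge> 0" unfolding A using M m c1 c by simp
  have "nbr_sum r ?w x + r^2 * M \<le> 2 * real CARD('n) * ?w x" if x: "x \<in> D" for x
  proof -
    have ei: "e c f (x + r *\<^sub>R axis i 1) + e c f (x - r *\<^sub>R axis i 1) - 2 * e c f x \<ge> e c f x * (exp (- c) * (c^2 * r^2 * (fst f $ i)^2))"
      if f: "f \<in> F" for f i
    proof -
      let ?t = "c * r * fst f $ i"
      have e1: "e c f (x + r *\<^sub>R axis i 1) = e c f x * exp ?t" "e c f (x - r *\<^sub>R axis i 1) = e c f x * exp (- ?t)"
        by (simp_all add: e_def inner_add_right inner_diff_right inner_axis exp_add[symmetric] algebra_simps)
      have "\<bar>fst f $ i\<bar> \<le> 1" using component_le_norm_cart[of "fst f" i] unit[OF f] by simp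
      then have "\<bar>?t\<bar> \<le> c * (1 * 1)" unfolding abs_mult mult.assoc using c r by (intro mult_mono) auto
      then have "exp (- c) * ?t^2 \<le> exp (- \<bar>?t\<bar>) * ?t^2" by (intro mult_right_mono) auto
      also have "\<dots> \<le> exp ?t + exp (- ?t) - 2" by (rule exp_second_difference)
      finally have "e c f x * (exp (- c) * ?t^2) \<le> e c f x * (exp ?t + exp (- ?t) - 2)"
        using e_pos[of c f x] by (intro mult_left_mono) auto
      then show ?thesis unfolding e1 by (simp add: algebra_simps power_mult_distrib)
    qed
    have si: "(\<Sum>f\<in>F. e c f (x + r *\<^sub>R axis i 1)) + (\<Sum>f\<in>F. e c f (x - r *\<^sub>R axis i 1)) - 2 * (\<Sum>f\<in>F. e c f x)
        \<ge> (exp (- c) * c^2 * r^2) * (\<Sum>f\<in>F. e c f x * (fst f $ i)^2)" for i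
    proof -
      have "(\<Sum>f\<in>F. e c f x * (exp (- c) * (c^2 * r^2 * (fst f $ i)^2)))
         \<le> (\<Sum>f\<in>F. e c f (x + r *\<^sub>R axis i 1) + e c f (x - r *\<^sub>R axis i 1) - 2 * e c f x)"
        by (intro sum_mono ei)
      then show ?thesis by (simp add: sum.distrib sum_subtractf sum_distrib_left mult_ac)
    qed
    have ri: "rho c (x + r *\<^sub>R axis i 1) + rho c (x - r *\<^sub>R axis i 1) - 2 * rho c x
        \<le> - (1 / (2 * m)) * ((exp (- c) * c^2 * r^2) * (\<Sum>f\<in>F. e c f x * (fst f $ i)^2))" for i
    proof -
      have "rho c (x + r *\<^sub>R axis i 1) + rho c (x - r *\<^sub>R axis i 1) - 2 * rho c x
        = - (1 / (2 * m)) * ((\<Sum>f\<in>F. e c f (x + r *\<^sub>R axis i 1)) + (\<Sum>f\<in>F. e c f (x - r *\<^sub>R axis i 1)) - 2 * (\<Sum>f\<in>F. e c f x))"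
        unfolding rho_def by (simp add: algebra_simps diff_divide_distrib add_divide_distrib)
      also have "\<dots> \<le> - (1 / (2 * m)) * ((exp (- c) * c^2 * r^2) * (\<Sum>f\<in>F. e c f x * (fst f $ i)^2))"
        using m by (intro mult_left_mono_neg si) auto
      finally show ?thesis .
    qed
    have "(\<Sum>i\<in>UNIV. rho c (x + r *\<^sub>R axis i 1) + rho c (x - r *\<^sub>R axis i 1) - 2 * rho c x)
       \<le> (\<Sum>i\<in>UNIV. - (1 / (2 * m)) * ((exp (- c) * c^2 * r^2) * (\<Sum>f\<in>F. e c f x * (fst f $ i)^2)))"
      by (intro sum_mono ri)
    also have "\<dots> = - (1 / (2 * m)) * ((exp (- c) * c^2 * r^2) * (\<Sum>f\<in>F. e c f x * (\<Sum>i\<in>UNIV. (fst f $ i)^2)))"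
    proof -
      have "(\<Sum>i\<in>UNIV. \<Sum>f\<in>F. e c f x * (fst f $ i)^2) = (\<Sum>f\<in>F. e c f x * (\<Sum>i\<in>UNIV. (fst f $ i)^2))"
        by (subst sum.swap) (simp only: sum_distrib_left)
      then show ?thesis by (simp only: sum_distrib_left[symmetric])
    qed
    also have "(\<Sum>f\<in>F. e c f x * (\<Sum>i\<in>UNIV. (fst f $ i)^2)) = (\<Sum>f\<in>F. e c f x)"
    proof (rule sum.cong[OF refl])
      fix f assume "f \<in> F"
      then have "(\<Sum>i\<in>UNIV. (fst f $ i)^2) = 1" using unit by (simp add: norm_vec_def L2_set_def)
      then show "e c f x * (\<Sum>i\<in>UNIV. (fst f $ i)^2) = e c f x" by simp
    qed
    also have "- (1 / (2 * m)) * ((exp (- c) * c^2 * r^2) * (\<Sum>f\<in>F. e c f x)) \<le> - (1 / (2 * m)) * ((exp (- c) * c^2 * r^2) * c1)"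
      using m c1(2)[OF x] by (intro mult_left_mono_neg mult_left_mono) auto
    finally have "A * (\<Sum>i\<in>UNIV. rho c (x + r *\<^sub>R axis i 1) + rho c (x - r *\<^sub>R axis i 1) - 2 * rho c x)
       \<le> A * (- (1 / (2 * m)) * ((exp (- c) * c^2 * r^2) * c1))" by (rule mult_left_mono[OF _ A0])
    also have "\<dots> = - (r^2 * M)" unfolding A using m c1(1) c by (simp add: field_simps)
    finally have "A * (\<Sum>i\<in>UNIV. rho c (x + r *\<^sub>R axis i 1) + rho c (x - r *\<^sub>R axis i 1) - 2 * rho c x) \<le> - (r^2 * M)" .
    moreover have "nbr_sum r ?w x = A * (\<Sum>i\<in>UNIV. rho c (x + r *\<^sub>R axis i 1) + rho c (x - r *\<^sub>R axis i 1) - 2 * rho c x)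
       + 2 * real CARD('n) * ?w x"
      unfolding nbr_sum_def by (simp add: sum_distrib_left sum.distrib sum_subtractf algebra_simps)
    ultimately show ?thesis by linarith
  qed
  moreover have "?w \<in> borel_measurable borel"
    using C_diff_measurable[OF C_diff_rho[of 0 c]] by measurable
  moreover have "0 \<le> ?w x" "0 \<le> ?w (x + r *\<^sub>R axis i 1)" "0 \<le> ?w (x - r *\<^sub>R axis i 1)" if "x \<in> D" for x i
    using lip[OF that, of i] D[OF that] A0 K1 r by (auto intro!: mult_nonneg_nonneg simp: abs_le_iff)
  ultimately show ?thesis unfolding barrier_def by auto
qed

end

lemma integral_indicator_le:
  fixes f g :: "real^'n \<Rightarrow> real"
  assumes "integrable lborel g" "f \<in> borel_measurable borel" "S \<in> sets borel" "\<And>x. 0 \<le> f x" "\<And>x. x \<in> S \<Longrightarrow> f x \<le> g x" "\<And>x. 0 \<le> g x"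
  shows "integrable lborel (\<lambda>x. indicator S x * f x)" "(LBINT x. indicator S x * f x) \<le> (LBINT x. g x)"
proof -
  have b: "indicator S x * f x \<le> g x" "0 \<le> indicator S x * f x" for x
    using assms(4,5,6) by (auto simp: indicator_def)
  show i: "integrable lborel (\<lambda>x. indicator S x * f x)"
  proof (rule Bochner_Integration.integrable_bound[OF assms(1)])
    show "(\<lambda>x. indicator S x * f x) \<in> borel_measurable lborel" using assms(2,3) by measurable
    show "AE x in lborel. norm (indicator S x * f x) \<le> norm (g x)"
      using b by (intro AE_I2) (metis abs_of_nonneg order_trans real_norm_def)
  qed
  show "(LBINT x. indicator S x * f x) \<le> (LBINT x. g x)"
    by (rule integral_mono[OF i assms(1) b(1)])
qed

section \<open>Smooth approximate solutions with a uniform Hessian bound\<close>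

context polytope_domain
begin

lemma open_\<Omega>: "open \<Omega>"
proof -
  have "\<Omega> = (\<Inter>f\<in>F. {x. inner (fst f) x < snd f})" unfolding \<Omega> by auto
  then show ?thesis using finF by (simp add: open_INT open_halfspace_lt)
qed

lemma convex_\<Omega>: "convex \<Omega>"
proof -
  have "\<Omega> = (\<Inter>f\<in>F. {x. inner (fst f) x < snd f})" unfolding \<Omega> by auto
  then show ?thesis by (simp add: convex_INT convex_halfspace_lt)
qed

text \<open>The order of choices carries the proof: the enlarged set \<open>D\<close>, and with it
  \<open>A\<close> and \<open>K\<close>; then \<nu>, \<omega> and the cutoff with its \<delta>; then
  the mollification radius \<epsilon>; last the step \<open>r\<close>. Each may depend on all
  earlier ones, because the barriers bound the solution uniformly in the later ones. The factor 8192
  is 2 * 4096: half of the weighted Hessian is absorbed, and the weight is at least 1/4096 on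
  \<Omega>.\<close>

theorem approx_dirichlet:
  fixes \<theta> :: "real^'n \<Rightarrow> real"
  assumes \<theta>: "continuous_on UNIV \<theta>" "\<And>x. \<theta> x \<noteq> 0 \<Longrightarrow> norm x \<le> R\<theta>" and \<eta>: "\<eta> > 0"
  shows "\<exists>q. (\<forall>k. C_diff k q) \<and> (\<forall>x\<in>closure \<Omega> - \<Omega>. \<bar>q x\<bar> \<le> \<eta>) \<and> (\<forall>x\<in>\<Omega>. \<bar>lap q x + \<theta> x\<bar> \<le> \<eta>) \<and>
     integrable lborel (\<lambda>x. indicator \<Omega> x * hess_sq q x) \<and>
     (LBINT x. indicator \<Omega> x * hess_sq q x) \<le> 8192 * (LBINT x. (\<theta> x)^2) + \<eta>"
proof -
  define n where "n = real CARD('n)"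
  have n: "n \<ge> 1" by (simp add: n_def Suc_leI)
  obtain M where M: "M > 0" "\<And>x. \<bar>\<theta> x\<bar> \<le> M" using bounded_support_bound[OF \<theta>] by blast
  have \<theta>int: "integrable lborel \<theta>" and \<theta>sq: "integrable lborel (\<lambda>x. (\<theta> x)^2)"
    using continuous_bounded_support_integrable[OF \<theta>] continuous_bounded_support_sq_integrable[OF \<theta>]
    by (auto simp: sq_integrable_def)
  obtain R s0 where R: "R > 0" "s0 > 0"
    "\<And>x s. 0 < s \<Longrightarrow> s \<le> s0 \<Longrightarrow> (\<And>f. f \<in> F \<Longrightarrow> inner (fst f) x - snd f < s) \<Longrightarrow> norm x \<le> R"
    using domain_bound by blast
  define L where "L = Max ((\<lambda>f. \<bar>snd f\<bar>) ` F)"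
  have L: "\<bar>snd f\<bar> \<le> L" if "f \<in> F" for f unfolding L_def using that finF by simp
  have L0: "L \<ge> 0" using L neF by fastforce
  define B where "B = L + R + 2"
  have B: "B \<ge> 1" using L0 R by (simp add: B_def)
  \<comment> \<open>Width of the enlargement. Through the facet barrier it contributes M * B * s to
    the boundary values, one of three contributions of at most \<eta> / 3.\<close>
  define s where "s = min s0 (\<eta> / (3 * M * B))"
  have s: "s > 0" "s \<le> s0" "M * B * s \<le> \<eta> / 3"
  proof -
    show "s > 0" "s \<le> s0" using R M B \<eta> by (auto simp: s_def)
    have "s \<le> \<eta> / (3 * M * B)" by (simp add: s_def)
    then show "M * B * s \<le> \<eta> / 3" using M B by (simp add: field_simps)
  qed
  define a where "a = ln (2 * m) / s"
  have lnm: "ln (2 * m) > 0" using m by simp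
  have a: "a > 0" "ln (2 * m) / a = s" using lnm s by (auto simp: a_def)
  define t where "t = rho a"
  define D where "D = {x. t x > 0}"
  have Ct: "C_diff k t" for k unfolding t_def by (rule C_diff_rho)
  have ct: "continuous_on UNIV t" using C_diff_continuous[OF Ct[of 0]] .
  have "open D" unfolding D_def using open_Collect_less[OF continuous_on_const ct] by simp
  then have Db: "D \<in> sets borel" by simp
  have Ds: "inner (fst f) x - snd f < s" if "x \<in> D" "f \<in> F" for x f
    using rho_pos_bound[OF _ a(1) that(2), of x] that(1) a(2) by (simp add: D_def t_def)
  have DR: "norm x \<le> R" if "x \<in> D" for x using R(3)[OF s(1,2) Ds[OF that]] .
  have inner_le: "\<bar>inner (fst f) x\<bar> \<le> norm x" if "f \<in> F" for f and x :: "real^'n"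
    using Cauchy_Schwarz_ineq2[of "fst f" x] unit[OF that] by simp
  obtain f0 where f0: "f0 \<in> F" using neF by auto
  define c1 where "c1 = exp (- (a * (R + L)))"
  have c1: "c1 > 0" "c1 \<le> (\<Sum>f\<in>F. e a f x)" if "x \<in> D" for x
  proof -
    show "c1 > 0" by (simp add: c1_def)
    have "- (R + L) \<le> inner (fst f0) x - snd f0" using inner_le[OF f0, of x] L[OF f0] DR[OF that] by linarith
    then have "a * - (R + L) \<le> a * (inner (fst f0) x - snd f0)" using a(1) by (intro mult_left_mono) auto
    then have "c1 \<le> e a f0 x" unfolding c1_def e_def by (simp only: exp_le_cancel_iff mult_minus_right)
    also have "\<dots> \<le> (\<Sum>f\<in>F. e a f x)" using f0 finF by (intro member_le_sum) (auto simp: e_pos less_imp_le)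
    finally show "c1 \<le> (\<Sum>f\<in>F. e a f x)" .
  qed
  have c1p: "c1 > 0" by (simp add: c1_def)
  obtain K where K: "K \<ge> 1" "\<And>x i. norm x \<le> R + 2 \<Longrightarrow> \<bar>pd i t x\<bar> \<le> K"
    "\<And>x i j. norm x \<le> R + 2 \<Longrightarrow> \<bar>pd j (pd i t) x\<bar> \<le> K"
  proof -
    obtain k1 where k1: "\<And>i x. norm x \<le> R + 2 \<Longrightarrow> \<bar>pd i t x\<bar> \<le> k1"
      using continuous_family_bounded_on_cball[where f = "\<lambda>i. pd i t" and R = "R + 2"] Ct[of "Suc 0"] by auto
    obtain k2 where k2: "\<And>i x. norm x \<le> R + 2 \<Longrightarrow> \<bar>pd (snd i) (pd (fst i) t) x\<bar> \<le> k2"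
      using continuous_family_bounded_on_cball[where f = "\<lambda>i. pd (snd i) (pd (fst i) t)" and R = "R + 2"]
        Ct[of "Suc (Suc 0)"] by auto
    show thesis
    proof (rule that[of "max 1 (max k1 k2)"])
      show "\<bar>pd i t x\<bar> \<le> max 1 (max k1 k2)" if "norm x \<le> R + 2" for x i using k1[OF that, of i] by simp
      show "\<bar>pd j (pd i t) x\<bar> \<le> max 1 (max k1 k2)" if "norm x \<le> R + 2" for x i j
        using k2[OF that, of "(i, j)"] by simp
    qed simp
  qed
  define K1 where "K1 = n * K"
  have K1: "K1 \<ge> 1" using mult_mono[OF n K(1)] n by (simp add: K1_def)
  have lip: "\<bar>t y - t x\<bar> \<le> K1 * norm (y - x)" if "norm x \<le> R + 2" "norm y \<le> R + 2" for x y
    unfolding K1_def n_def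
    by (rule lipschitz_of_pderiv_bound[where S = "cball 0 (R + 2)"]) (use that K Ct[of "Suc 0"] in auto)
  define A where "A = M * (2 * m) / (a^2 * exp (- a) * c1)"
  have A0: "A > 0" unfolding A_def using M m a c1p by simp
  \<comment> \<open>Where \<open>t x > \<delta>\<close>, the doubling absorbs the shift
    \<open>K1 * r\<close> of the barrier and the variation of \<open>t\<close> over a mollification
    ball, each at most \<delta> / 4.\<close>
  define A' where "A' = 2 * A"
  define M' where "M' = M + 1"
  define V where "V = measure lborel (cball (0::real^'n) R)"
  have V: "V \<ge> 0" by (simp add: V_def)
  define C where "C = 6 * n^2 * K * A'"
  have C0: "C \<ge> 0" unfolding C_def A'_def using K A0 n by simp
  define E0 where "E0 = 2 * (18 * A'^2 * (n * K^2) + A' * M') * V"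
  have E0: "E0 \<ge> 0" unfolding E0_def A'_def M'_def using A0 M n V by simp
  \<comment> \<open>24576 = 3 * 8192: three errors of size \<mu> will arise, and the final
    multiplication by 8192 turns them into \<eta>.\<close>
  define \<mu> where "\<mu> = \<eta> / 24576"
  have \<mu>: "\<mu> > 0" using \<eta> by (simp add: \<mu>_def)
  \<comment> \<open>The first bound absorbs half of the Hessian term, the second makes the energy
    contribution at most \<mu>. \<omega> can be chosen only afterwards, since it enters divided by
    \<nu>.\<close>
  define \<nu> where "\<nu> = min (1 / (2 * (C + 1))) (\<mu> / ((C + 1) * (E0 + 1)))"
  have \<nu>: "\<nu> > 0" "C * \<nu> \<le> 1/2" "C * (\<nu> * E0) \<le> \<mu>"
  proof -
    show p: "\<nu> > 0" unfolding \<nu>_def using C0 E0 \<mu> by simp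
    have "\<nu> \<le> 1 / (2 * (C + 1))" by (simp add: \<nu>_def)
    then have "(C + 1) * \<nu> \<le> 1/2" using C0 by (simp add: field_simps)
    then show "C * \<nu> \<le> 1/2" using p by (simp add: algebra_simps)
    have "\<nu> \<le> \<mu> / ((C + 1) * (E0 + 1))" by (simp add: \<nu>_def)
    then have "\<nu> * ((C + 1) * (E0 + 1)) \<le> \<mu>" using C0 E0 by (simp add: pos_le_divide_eq)
    moreover have "C * (\<nu> * E0) \<le> \<nu> * ((C + 1) * (E0 + 1))" using C0 E0 p by (simp add: algebra_simps)
    ultimately show "C * (\<nu> * E0) \<le> \<mu>" by linarith
  qed
  define \<omega> where "\<omega> = \<mu> * (2 * \<nu>) / ((C + 1) * (n * K * V + 1))"
  have nKV: "n * K * V \<ge> 0" using n K V by simp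
  have \<omega>: "\<omega> > 0" "C * (\<omega> * n * K * V / (2 * \<nu>)) \<le> \<mu>"
  proof -
    show "\<omega> > 0" unfolding \<omega>_def using \<mu> \<nu> C0 nKV by (intro divide_pos_pos mult_pos_pos) auto
    have "C * (\<omega> * n * K * V / (2 * \<nu>)) = \<mu> * ((C / (C + 1)) * ((n * K * V) / (n * K * V + 1)))"
      unfolding \<omega>_def using \<nu>(1) C0 nKV by (simp add: divide_simps)
    also have "\<dots> \<le> \<mu> * (1 * 1)" using \<mu> C0 nKV by (intro mult_left_mono mult_mono) auto
    finally show "C * (\<omega> * n * K * V / (2 * \<nu>)) \<le> \<mu>" by simp
  qed
  define \<eta>1 where "\<eta>1 = min (min 1 \<eta>) (\<mu> / ((2 * M + 1) * (V + 1)))"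
  have \<eta>1: "\<eta>1 > 0" "\<eta>1 \<le> 1" "\<eta>1 \<le> \<eta>" "\<eta>1 * (2 * M + 1) * V \<le> \<mu>"
  proof -
    show p: "\<eta>1 > 0" "\<eta>1 \<le> 1" "\<eta>1 \<le> \<eta>" unfolding \<eta>1_def using M V \<mu> \<eta> by auto
    have "\<eta>1 \<le> \<mu> / ((2 * M + 1) * (V + 1))" by (simp add: \<eta>1_def)
    then have "\<eta>1 * ((2 * M + 1) * (V + 1)) \<le> \<mu>" using M V by (simp add: pos_le_divide_eq)
    moreover have "\<eta>1 * (2 * M + 1) * V \<le> \<eta>1 * ((2 * M + 1) * (V + 1))" using p M by (simp add: algebra_simps)
    ultimately show "\<eta>1 * (2 * M + 1) * V \<le> \<mu>" by linarith
  qed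
  obtain \<delta> h0 h1 h2 h3 b b1 where adm: "admissible_cutoff \<delta> \<omega> h0 h1 h2 h3 b b1" and \<delta>4: "\<delta> \<le> 1/4"
    and hlow: "\<And>u. 1/2 \<le> u \<Longrightarrow> u \<le> 1 \<Longrightarrow> h0 u \<ge> 1/4096"
    using admissible_cutoff_exists[OF \<omega>(1)] by blast
  have \<delta>: "\<delta> > 0" using adm by (simp add: admissible_cutoff_def)
  obtain du where du: "du > 0" "\<And>x y. dist x y < du \<Longrightarrow> \<bar>\<theta> x - \<theta> y\<bar> < \<eta>1 / 2"
    using uniform_continuity_bounded_support[OF \<theta>, of "\<eta>1 / 2"] \<eta>1(1) by auto
  define \<epsilon> where "\<epsilon> = min (min 1 du) (min (\<delta> / (4 * K1)) (\<eta> / (3 * M * B)))"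
  have \<epsilon>: "\<epsilon> > 0" "\<epsilon> \<le> 1" "\<epsilon> \<le> du" "K1 * \<epsilon> \<le> \<delta> / 4" "M * B * \<epsilon> \<le> \<eta> / 3"
  proof -
    show "\<epsilon> > 0" "\<epsilon> \<le> 1" "\<epsilon> \<le> du" unfolding \<epsilon>_def using du \<delta> K1 \<eta> M B by auto
    have "\<epsilon> \<le> \<delta> / (4 * K1)" "\<epsilon> \<le> \<eta> / (3 * M * B)" by (auto simp: \<epsilon>_def)
    then show "K1 * \<epsilon> \<le> \<delta> / 4" "M * B * \<epsilon> \<le> \<eta> / 3" using K1 M B by (simp_all add: field_simps)
  qed
  define k where "k = (kern \<epsilon> :: real^'n \<Rightarrow> real)"
  have Ck: "C_diff j k" for j unfolding k_def by (rule C_diff_kern)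
  have ks: "norm x \<le> \<epsilon>" if "k x \<noteq> 0" for x using kern_support_le[OF \<epsilon>(1)] that by (simp add: k_def)
  have ks': "norm x < \<epsilon>" if "k x \<noteq> 0" for x using kern_support[OF \<epsilon>(1)] that by (simp add: k_def)
  have ck: "continuous_on UNIV k" using C_diff_continuous[OF Ck[of 0]] .
  let ?k3 = "\<lambda>i. pd i (pd i (pd i k))"
  have k1s: "norm x \<le> \<epsilon>" if "pd i k x \<noteq> 0" for i x using pderiv_dir_zero_outside[OF ks that] .
  have k2s: "norm x \<le> \<epsilon>" if "pd j (pd i k) x \<noteq> 0" for i j x using pderiv_dir_zero_outside[OF k1s that] .
  have k3s: "norm x \<le> \<epsilon>" if "?k3 i x \<noteq> 0" for i x using pderiv_dir_zero_outside[OF k2s that] .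
  have Ck1: "C_diff j (pd i k)" for i j using C_diff_pderiv[OF Ck] .
  have Ck2: "C_diff j (pd i' (pd i k))" for i i' j using C_diff_pderiv[OF Ck1] .
  have Ck3: "C_diff j (?k3 i)" for i j using C_diff_pderiv[OF Ck2] .
  have "\<exists>b. \<forall>x. \<bar>?k3 i x\<bar> \<le> b" for i
    using bounded_support_bound[OF C_diff_continuous[OF Ck3[where j = 0 and i = i]] k3s[where i = i]] by metis
  then obtain bk where bk: "\<And>i x. \<bar>?k3 i x\<bar> \<le> bk i" by metis
  define Bk where "Bk = Max (range bk)"
  have Bk: "\<bar>?k3 i x\<bar> \<le> Bk" for i x unfolding Bk_def by (rule order_trans[OF bk Max_ge]) auto
  have Bk0: "Bk \<ge> 0" using Bk[of undefined 0] by linarith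
  define B3 where "B3 = Bk * ((A * (1 + K1)) * V)"
  have B30: "B3 \<ge> 0" unfolding B3_def using Bk0 A0 K1 V by simp
  \<comment> \<open>The step comes last because the consistency error is governed by
    \<open>B3\<close>, a bound for third derivatives of the mollified solution, which depends on
    \<epsilon>.\<close>
  define r where "r = min (min 1 (\<delta> / (4 * K1))) (min (\<eta> / (3 * M * B)) (\<eta>1 / (2 * (n * B3 + 1))))"
  have r: "r > 0" "r \<le> 1" "K1 * r \<le> \<delta> / 4" "M * B * r \<le> \<eta> / 3" "n * B3 * r \<le> \<eta>1 / 2"
  proof -
    have nB: "n * B3 + 1 > 0" using B30 n by (simp add: add_nonneg_pos)
    show p: "r > 0" "r \<le> 1" unfolding r_def using \<delta> K1 \<eta> M B \<eta>1 nB by auto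
    have "r \<le> \<delta> / (4 * K1)" "r \<le> \<eta> / (3 * M * B)" by (auto simp: r_def)
    then show "K1 * r \<le> \<delta> / 4" "M * B * r \<le> \<eta> / 3" using K1 M B by (simp_all add: field_simps)
    have "r \<le> \<eta>1 / (2 * (n * B3 + 1))" by (auto simp: r_def)
    then have "(n * B3 + 1) * r \<le> \<eta>1 / 2" using nB by (simp add: field_simps)
    then show "n * B3 * r \<le> \<eta>1 / 2" using p by (simp add: algebra_simps)
  qed
  have nbr: "norm (x + r *\<^sub>R axis i 1) \<le> R + 2" "norm (x - r *\<^sub>R axis i 1) \<le> R + 2" if "x \<in> D" for x i
    using DR[OF that] r norm_triangle_ineq[of x "r *\<^sub>R axis i 1"] norm_triangle_ineq4[of x "r *\<^sub>R axis i 1"] by auto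
  let ?w0 = "\<lambda>x. A * (t x + K1 * r)"
  let ?wf = "\<lambda>f x. (M / 2) * (snd f - inner (fst f) x + s + r) * (B - (snd f - inner (fst f) x))"
  have "barrier D r M ?w0" unfolding t_def
  proof (rule rho_barrier[OF r(1,2) a(1) _ c1p c1(2) _ _ _ A_def])
    show "rho a x > 0" if "x \<in> D" for x using that by (simp add: D_def t_def)
    show "\<bar>rho a (x + r *\<^sub>R axis i 1) - rho a x\<bar> \<le> K1 * r \<and> \<bar>rho a (x - r *\<^sub>R axis i 1) - rho a x\<bar> \<le> K1 * r" if "x \<in> D" for x i
      using lip[of x "x + r *\<^sub>R axis i 1"] lip[of x "x - r *\<^sub>R axis i 1"] nbr[OF that, of i] DR[OF that] r(1) by (simp add: t_def)
  qed (use M K1 in auto)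
  moreover have "barrier D r M (?wf f)" if f: "f \<in> F" for f
  proof (rule quadratic_barrier[OF f r(1,2) s(1) _ Ds[OF _ f]])
    show "snd f - inner (fst f) x \<le> B - 1" if "x \<in> D" for x
      using inner_le[OF f, of x] L[OF f] DR[OF that] by (simp add: B_def)
  qed (use M in auto)
  \<comment> \<open>One supersolution below all barriers: \<open>?w0\<close> gives decay
    proportional to \<open>t\<close>, and each \<open>?wf f\<close> gives smallness near its
    hyperplane.\<close>
  ultimately obtain w where w: "barrier D r M w" "\<And>x. w x \<le> ?w0 x" "\<And>f x. f \<in> F \<Longrightarrow> w x \<le> ?wf f x"
    using barrier_finite[OF finF, of D r M ?w0 ?wf] by blast
  obtain h where h: "h \<in> borel_measurable borel" "\<And>x. x \<notin> D \<Longrightarrow> h x = 0" "\<And>x. x \<in> D \<Longrightarrow> \<bar>h x\<bar> \<le> w x"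
    "\<And>x. x \<in> D \<Longrightarrow> 2 * n * h x = nbr_sum r h x + r^2 * \<theta> x"
    using lattice_solution[OF w(1) Db borel_measurable_continuous_onI[OF \<theta>(1)] M(2)] unfolding n_def by blast
  have h0: "\<bar>h x\<bar> \<le> ?w0 x" if "x \<in> D" for x using h(3)[OF that] w(2)[of x] by linarith
  have hb: "\<bar>h x\<bar> \<le> A * (1 + K1)" for x
  proof (cases "x \<in> D")
    case True
    have "K1 * r \<le> K1 * 1" using r K1 by (intro mult_left_mono) auto
    then have "t x + K1 * r \<le> 1 + K1" using rho_le[of a x] by (simp add: t_def)
    then have "?w0 x \<le> A * (1 + K1)" using A0 by (intro mult_left_mono) auto
    then show ?thesis using h0[OF True] by linarith
  qed (use h(2) A0 K1 in simp)
  have hR: "norm x \<le> R" if "h x \<noteq> 0" for x using h(2) DR that by blast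
  have hint: "integrable lborel h" by (rule integrable_bounded_support[OF h(1) hb hR])
  have hI: "(LBINT x. \<bar>h x\<bar>) \<le> (A * (1 + K1)) * V"
    unfolding V_def using hb hR hint by (intro integral_le_bounded_support) auto
  define q where "q = conv h k"
  have Cq: "C_diff j q" for j unfolding q_def by (rule C_diff_conv[OF hint Ck ks])
  \<comment> \<open>Where \<open>t x > \<delta>\<close> the whole mollification ball lies in
    \<open>D\<close>, so the difference equation holds at every point that enters the
    average.\<close>
  have ball_D: "y \<in> D" "t y \<le> t x + \<delta> / 4" "norm y \<le> R + 2" if "t x > \<delta>" "norm (x - y) < \<epsilon>" for x y
  proof -
    have xR: "norm x \<le> R" using that(1) \<delta> by (intro DR) (simp add: D_def)
    have yR: "norm y \<le> R + 2" using xR that(2) \<epsilon>(2) norm_triangle_ineq4[of x "x - y"] by simp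
    have "K1 * norm (y - x) \<le> K1 * \<epsilon>" using that(2) K1 by (intro mult_left_mono) (auto simp: norm_minus_commute)
    then have l: "\<bar>t y - t x\<bar> \<le> \<delta> / 4" using lip[OF _ yR, of x] xR \<epsilon>(4) by linarith
    then have "t y > 0" using that(1) \<delta> by linarith
    then show "y \<in> D" by (simp add: D_def)
    show "t y \<le> t x + \<delta> / 4" using l by linarith
    show "norm y \<le> R + 2" by fact
  qed
  have qA: "\<bar>q x\<bar> \<le> A' * t x" if "t x > \<delta>" for x
  proof -
    have "\<bar>q x - 0\<bar> \<le> A' * t x" unfolding q_def k_def
    proof (rule conv_kern_near[OF hint \<epsilon>(1)])
      fix y assume y: "norm (x - y) < \<epsilon>"
      have "?w0 y \<le> A * (2 * t x)" using ball_D(2)[OF that y] r(3) that \<delta> A0 by (intro mult_left_mono) auto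
      then show "\<bar>h y - 0\<bar> \<le> A' * t x" using h0[OF ball_D(1)[OF that y]] by (simp add: A'_def)
    qed
    then show ?thesis by simp
  qed
  have q3: "\<bar>pd i (pd i (pd i q)) x\<bar> \<le> B3" for i x
  proof -
    have "pd i (conv h k) = conv h (pd i k)" by (rule pderiv_dir_conv[OF hint Ck ks])
    moreover have "pd i (conv h (pd i k)) = conv h (pd i (pd i k))"
      by (rule pderiv_dir_conv[OF hint Ck1 k1s])
    moreover have "pd i (conv h (pd i (pd i k))) = conv h (?k3 i)"
      by (rule pderiv_dir_conv[OF hint Ck2 k2s])
    ultimately have "pd i (pd i (pd i q)) = conv h (?k3 i)" by (simp add: q_def)
    moreover have "\<bar>conv h (?k3 i) x\<bar> \<le> Bk * (LINT y|lborel. \<bar>h y\<bar>)"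
      unfolding conv_def
    proof (rule conv_uniform_bound[OF hint])
      show "integrable lborel (\<lambda>y. h y * ?k3 i (x - y))"
        by (rule conv_integrable[OF hint C_diff_continuous[OF Ck3] k3s])
    qed (rule Bk)
    moreover have "Bk * (LINT y|lborel. \<bar>h y\<bar>) \<le> B3" unfolding B3_def by (intro mult_left_mono hI Bk0)
    ultimately show ?thesis by simp
  qed
  have lapq: "\<bar>lap q x + \<theta> x\<bar> \<le> \<eta>1" if x: "t x > \<delta>" for x
  proof -
    have sh: "integrable lborel (\<lambda>y. h (y + v) * k (x - y))" for v
      by (rule conv_shift(2)[OF hint ck ks])
    have shv: "q (x + v) = (LINT y|lborel. h (y + v) * k (x - y))" for v
      unfolding q_def by (rule conv_shift(1)[OF hint ck ks])
    have "2 * n * q x - nbr_sum r q x = (LINT y|lborel. 2 * n * (h (y + 0) * k (x - y)) -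
        (\<Sum>i\<in>UNIV. h (y + r *\<^sub>R axis i 1) * k (x - y) + h (y + - (r *\<^sub>R axis i 1)) * k (x - y)))"
    proof -
      have "nbr_sum r q x = (\<Sum>i\<in>UNIV. (LINT y|lborel. h (y + r *\<^sub>R axis i 1) * k (x - y)) + (LINT y|lborel. h (y + - (r *\<^sub>R axis i 1)) * k (x - y)))"
        by (simp only: nbr_sum_def shv diff_conv_add_uminus[of x "r *\<^sub>R axis _ 1"])
      moreover have "q x = (LINT y|lborel. h (y + 0) * k (x - y))" by (simp add: q_def conv_def)
      moreover have "integrable lborel (\<lambda>y. h (y - v) * k (x - y))" for v using sh[of "- v"] by simp
      moreover have "integrable lborel (\<lambda>y. h y * k (x - y))" using sh[of 0] by simp
      ultimately show ?thesis using sh by simp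
    qed
    \<comment> \<open>The difference operator commutes with the mollification, so the equation for
      \<open>h\<close> is inserted under the integral.\<close>
    also have "\<dots> = (LINT y|lborel. r^2 * (\<theta> y * k (x - y)))"
    proof (rule Bochner_Integration.integral_cong[OF refl])
      fix y
      show "2 * n * (h (y + 0) * k (x - y)) - (\<Sum>i\<in>UNIV. h (y + r *\<^sub>R axis i 1) * k (x - y) + h (y + - (r *\<^sub>R axis i 1)) * k (x - y))
         = r^2 * (\<theta> y * k (x - y))"
      proof (cases "k (x - y) = 0")
        case False
        then have "y \<in> D" using ball_D(1)[OF x ks'] by blast
        then have "2 * n * h y - nbr_sum r h y = r^2 * \<theta> y" using h(4) by simp
        then have "(2 * n * h y - nbr_sum r h y) * k (x - y) = r^2 * \<theta> y * k (x - y)" by simp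
        then show ?thesis by (simp add: nbr_sum_def sum_distrib_left sum_distrib_right algebra_simps)
      qed simp
    qed
    also have "\<dots> = r^2 * conv \<theta> k x" by (simp add: conv_def)
    finally have eq: "2 * n * q x - nbr_sum r q x = r^2 * conv \<theta> k x" .
    have "\<bar>\<Sum>i\<in>UNIV. q (x + r *\<^sub>R axis i 1) + q (x - r *\<^sub>R axis i 1) - 2 * q x - r\<^sup>2 * pd i (pd i q) x\<bar> \<le> (\<Sum>i\<in>(UNIV::'n set). B3 * r^3)"
      by (rule order_trans[OF sum_abs sum_mono]) (rule second_difference_error[OF Cq q3 r(1)])
    moreover have "(\<Sum>i\<in>UNIV. q (x + r *\<^sub>R axis i 1) + q (x - r *\<^sub>R axis i 1) - 2 * q x - r\<^sup>2 * pd i (pd i q) x)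
       = nbr_sum r q x - 2 * n * q x - r\<^sup>2 * lap q x"
      by (simp add: nbr_sum_def lap_def n_def sum_subtractf sum_distrib_left)
    ultimately have "\<bar>nbr_sum r q x - 2 * n * q x - r\<^sup>2 * lap q x\<bar> \<le> n * (B3 * r^3)" by (simp add: n_def)
    moreover have "nbr_sum r q x - 2 * n * q x - r\<^sup>2 * lap q x = - (r^2 * (conv \<theta> k x + lap q x))"
      using eq by (simp add: algebra_simps)
    ultimately have "r^2 * \<bar>conv \<theta> k x + lap q x\<bar> \<le> r^2 * (n * B3 * r)"
      by (simp add: abs_mult power2_eq_square power3_eq_cube mult_ac)
    then have "\<bar>conv \<theta> k x + lap q x\<bar> \<le> n * B3 * r" using r(1) by simp
    moreover have "\<bar>conv \<theta> k x - \<theta> x\<bar> \<le> \<eta>1 / 2"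
      unfolding k_def
    proof (rule conv_kern_near[OF \<theta>int \<epsilon>(1)])
      fix y assume "norm (x - y) < \<epsilon>"
      then have "dist y x < du" using \<epsilon>(3) by (simp add: dist_norm norm_minus_commute)
      then show "\<bar>\<theta> y - \<theta> x\<bar> \<le> \<eta>1 / 2" using du(2) by fastforce
    qed
    ultimately show ?thesis using r(5) by linarith
  qed
  have t\<Omega>: "t x \<ge> 1/2" if "x \<in> closure \<Omega>" for x unfolding t_def by (rule rho_ge_half[OF that a(1)])
  \<comment> \<open>A boundary point lies on the hyperplane of some facet. On the mollification ball
    the barrier of that facet is at most the sum of the contributions of \<epsilon>,
    \<open>s\<close> and \<open>r\<close>, each at most \<eta> / 3.\<close>
  have bdry: "\<bar>q x\<bar> \<le> \<eta>" if x: "x \<in> closure \<Omega> - \<Omega>" for x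
  proof -
    obtain f where f: "f \<in> F" "inner (fst f) x = snd f"
      using x closure_le[of x] unfolding \<Omega> by force
    have xd: "t x > \<delta>" using t\<Omega>[of x] x \<delta>4 by auto
    have "\<bar>q x - 0\<bar> \<le> \<eta>" unfolding q_def k_def
    proof (rule conv_kern_near[OF hint \<epsilon>(1)])
      fix y assume y: "norm (x - y) < \<epsilon>"
      define l where "l = snd f - inner (fst f) y"
      have yD: "y \<in> D" by (rule ball_D(1)[OF xd y])
      have "l = inner (fst f) (x - y)" using f(2) by (simp add: l_def inner_diff_right)
      then have l: "\<bar>l\<bar> \<le> \<epsilon>" using inner_le[OF f(1), of "x - y"] y by simp
      have "h y \<le> w y" "- h y \<le> w y" using h(3)[OF yD] by auto
      moreover have "w y \<le> (M / 2) * (l + s + r) * (B - l)" using w(3)[OF f(1), of y] by (simp add: l_def)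
      moreover have "(M / 2) * (l + s + r) * (B - l) \<le> (M / 2) * (\<epsilon> + s + r) * (2 * B)"
        using l \<epsilon>(2) B M r s Ds[OF yD f(1)] by (intro mult_mono) (auto simp: l_def)
      moreover have "(M / 2) * (\<epsilon> + s + r) * (2 * B) = M * B * \<epsilon> + M * B * s + M * B * r" by (simp add: algebra_simps)
      ultimately show "\<bar>h y - 0\<bar> \<le> \<eta>" using \<epsilon>(5) s(3) r(4) by linarith
    qed
    then show ?thesis by simp
  qed
  interpret weighted_setting t R K h0 h1 h2 h3 b b1 \<delta> \<omega>
  proof unfold_locales
    show "lap t x * (\<Sum>i\<in>UNIV. (\<xi> i)^2) \<le> (\<Sum>i\<in>UNIV. \<Sum>j\<in>UNIV. pd j (pd i t) x * \<xi> i * \<xi> j)" for x \<xi>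
      unfolding t_def by (rule rho_concave)
    show "t x \<le> 1" for x unfolding t_def by (rule rho_le)
    show xR: "norm x \<le> R" if "t x > 0" for x using that by (intro DR) (simp add: D_def)
    show "\<bar>pd i t x\<bar> \<le> K" "\<bar>pd j (pd i t) x\<bar> \<le> K" if "t x > 0" for x i j
      using xR[OF that] by (intro K; simp)+
  qed (use adm Ct K(1) in \<open>auto simp: admissible_cutoff_def simp del: C_diff.simps\<close>)
  have lapM: "\<bar>lap q x\<bar> \<le> M'" if "t x > \<delta>" for x using lapq[OF that] M(2)[of x] \<eta>1(2) by (simp add: M'_def)
  let ?Q = "LBINT x. h0 (t x) * hess_sq q x"
  have est: "(1 - C * \<nu>) * ?Q \<le> (LBINT x. h0 (t x) * (lap q x)^2)
     + C * (\<omega> * n * K * V / (2 * \<nu>) + \<nu> * E0)"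
    using weighted_hessian_estimate[of q A' M' \<nu>] Cq qA lapM A0 M(1) \<nu>(1)
    unfolding C_def n_def V_def E0_def A'_def M'_def by simp
  have lap_int: "(LBINT x. h0 (t x) * (lap q x)^2) \<le> (LBINT x. (\<theta> x)^2) + \<mu>"
  proof -
    have iV: "integrable lborel (\<lambda>x. \<eta>1 * (2 * M + 1) * indicator (cball (0::real^'n) R) x)"
      using emeasure_lborel_cball_finite[of "0::real^'n" R] by simp
    have il: "integrable lborel (\<lambda>x. h0 (t x) * (lap q x)^2)"
    proof (rule continuous_bounded_support_integrable[where R = R])
      show "continuous_on UNIV (\<lambda>x. h0 (t x) * (lap q x)^2)"
        by (intro continuous_intros C_diff_continuous[OF C_compose(1)] C_diff_continuous[OF C_diff_lap[OF Cq[of "Suc (Suc 0)"]]])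
      show "norm x \<le> R" if "h0 (t x) * (lap q x)^2 \<noteq> 0" for x using that support(3)[of x] by simp
    qed
    have "(LBINT x. h0 (t x) * (lap q x)^2) \<le> (LBINT x. (\<theta> x)^2 + \<eta>1 * (2 * M + 1) * indicator (cball (0::real^'n) R) x)"
    proof (rule integral_mono[OF il Bochner_Integration.integrable_add[OF \<theta>sq iV]])
      fix x :: "real^'n"
      show "h0 (t x) * (lap q x)^2 \<le> (\<theta> x)^2 + \<eta>1 * (2 * M + 1) * indicator (cball 0 R) x"
      proof (cases "t x > \<delta>")
        case False
        then have "h0 (t x) = 0" using h_zero by simp
        then show ?thesis using \<eta>1(1) M(1) by (simp add: indicator_def)
      next
        case True
        then have xR: "norm x \<le> R" using \<delta> by (intro DR) (simp add: D_def)
        have "\<bar>lap q x\<bar> \<le> \<bar>\<theta> x\<bar> + \<eta>1" using lapq[OF True] by linarith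
        then have "(lap q x)^2 \<le> (\<bar>\<theta> x\<bar> + \<eta>1)^2" by (rule power2_mono_abs)
        also have "\<dots> = (\<theta> x)^2 + \<eta>1 * (2 * \<bar>\<theta> x\<bar> + \<eta>1)" by (simp add: power2_sum power2_eq_square algebra_simps)
        also have "\<dots> \<le> (\<theta> x)^2 + \<eta>1 * (2 * M + 1)"
          using \<eta>1 M(2)[of x] by (intro add_left_mono mult_left_mono) auto
        finally have "(lap q x)^2 \<le> (\<theta> x)^2 + \<eta>1 * (2 * M + 1)" .
        moreover have "h0 (t x) * (lap q x)^2 \<le> 1 * (lap q x)^2" by (intro mult_right_mono h_le(1) q_le) simp
        ultimately show ?thesis using xR by (simp add: indicator_def)
      qed
    qed
    also have "\<dots> = (LBINT x. (\<theta> x)^2) + \<eta>1 * (2 * M + 1) * V"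
      using \<theta>sq iV by (simp add: V_def)
    finally show ?thesis using \<eta>1(4) by linarith
  qed
  have Q0: "?Q \<ge> 0" by (intro integral_nonneg_AE AE_I2 mult_nonneg_nonneg h_nonneg(1) hess_sq_nonneg)
  have "C * (\<omega> * n * K * V / (2 * \<nu>) + \<nu> * E0) \<le> 2 * \<mu>" using \<omega>(2) \<nu>(3) by (simp add: distrib_left)
  then have "(1 - C * \<nu>) * ?Q \<le> (LBINT x. (\<theta> x)^2) + 3 * \<mu>" using est lap_int by linarith
  moreover have "(1/2) * ?Q \<le> (1 - C * \<nu>) * ?Q" using \<nu>(2) Q0 by (intro mult_right_mono) auto
  ultimately have Qb: "4096 * ?Q \<le> 8192 * (LBINT x. (\<theta> x)^2) + \<eta>" by (simp add: \<mu>_def)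
  have iQ: "integrable lborel (\<lambda>x. 4096 * (h0 (t x) * hess_sq q x))"
  proof -
    have "integrable lborel (\<lambda>x. h0 (t x) * hess_sq q x)"
    proof (rule continuous_bounded_support_integrable[where R = R])
      show "continuous_on UNIV (\<lambda>x. h0 (t x) * hess_sq q x)"
        by (intro continuous_intros C_diff_continuous[OF C_compose(1)] C_diff_continuous[OF C_diff_hess_sq[OF Cq[of "Suc (Suc 0)"]]])
      show "norm x \<le> R" if "h0 (t x) * hess_sq q x \<noteq> 0" for x using that support(3)[of x] by simp
    qed
    then show ?thesis by simp
  qed
  have "hess_sq q x \<le> 4096 * (h0 (t x) * hess_sq q x)" if "x \<in> \<Omega>" for x
  proof -
    have "1/4096 \<le> h0 (t x)" using closure_subset[of \<Omega>] that t\<Omega>[of x] by (intro hlow q_le) auto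
    then have "(1/4096) * hess_sq q x \<le> h0 (t x) * hess_sq q x" by (intro mult_right_mono hess_sq_nonneg)
    then show ?thesis by simp
  qed
  note ind = integral_indicator_le[OF iQ C_diff_measurable[OF C_diff_hess_sq[OF Cq[of "Suc (Suc 0)"]]] borel_open[OF open_\<Omega>] hess_sq_nonneg this]
  have ip: "0 \<le> 4096 * (h0 (t x) * hess_sq q x)" for x using h_nonneg(1) hess_sq_nonneg[of q x] by simp
  show ?thesis
  proof (intro exI[of _ q] conjI allI ballI)
    show "C_diff j q" for j by (rule Cq)
    show "\<bar>q x\<bar> \<le> \<eta>" if "x \<in> closure \<Omega> - \<Omega>" for x by (rule bdry[OF that])
    show "\<bar>lap q x + \<theta> x\<bar> \<le> \<eta>" if "x \<in> \<Omega>" for x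
      using lapq[of x] t\<Omega>[of x] closure_subset[of \<Omega>] that \<delta>4 \<eta>1(3) by force
    show "integrable lborel (\<lambda>x. indicator \<Omega> x * hess_sq q x)" by (rule ind(1)[OF _ ip])
    show "(LBINT x. indicator \<Omega> x * hess_sq q x) \<le> 8192 * (LBINT x. (\<theta> x)^2) + \<eta>"
      using ind(2)[OF _ ip] Qb by simp
  qed
qed

end

section \<open>Weak derivatives\<close>

lemma test_functionsD:
  assumes "p \<in> test_functions \<Omega>"
  shows "C_diff k p" "p x \<noteq> 0 \<Longrightarrow> x \<in> \<Omega>" "\<exists>R. \<forall>x. p x \<noteq> 0 \<longrightarrow> norm x \<le> R"
proof -
  show "C_diff k p" using assms by (simp add: test_functions_def)
  have c: "compact (closure {x. p x \<noteq> 0})" "closure {x. p x \<noteq> 0} \<subseteq> \<Omega>" using assms by (auto simp: test_functions_def)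
  show "p x \<noteq> 0 \<Longrightarrow> x \<in> \<Omega>" using c(2) closure_subset[of "{x. p x \<noteq> 0}"] by blast
  obtain R where R: "\<forall>x\<in>closure {x. p x \<noteq> 0}. norm x \<le> R" using compact_imp_bounded[OF c(1)] unfolding bounded_iff by blast
  have "norm x \<le> R" if "p x \<noteq> 0" for x using R that closure_subset[of "{x. p x \<noteq> 0}"] by blast
  then show "\<exists>R. \<forall>x. p x \<noteq> 0 \<longrightarrow> norm x \<le> R" by blast
qed

lemma test_functionsI:
  assumes "\<And>k. C_diff k p" "compact K" "K \<subseteq> \<Omega>" "\<And>x. p x \<noteq> 0 \<Longrightarrow> x \<in> K"
  shows "p \<in> test_functions \<Omega>"
proof -
  have s: "closure {x. p x \<noteq> 0} \<subseteq> K"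
    by (rule closure_minimal) (use assms compact_imp_closed in auto)
  then have "compact (closure {x. p x \<noteq> 0})"
    using compact_Int_closed[OF assms(2) closed_closure, of "{x. p x \<noteq> 0}"] by (simp add: Int_absorb1)
  then show ?thesis using assms s by (simp add: test_functions_def)
qed

lemma pderiv_dir_support:
  fixes p :: "real^'n \<Rightarrow> real"
  assumes "pd i p x \<noteq> 0"
  shows "x \<in> closure {x. p x \<noteq> 0}"
proof (rule ccontr)
  assume n: "x \<notin> closure {x. p x \<noteq> 0}"
  have "(p has_derivative (\<lambda>h. 0)) (at x)"
  proof (rule has_derivative_transform_within_open[of "\<lambda>x. 0"])
    show "open (- closure {x. p x \<noteq> 0})" by (rule open_Compl) simp
    show "x \<in> - closure {x. p x \<noteq> 0}" using n by simp
    show "0 = p y" if "y \<in> - closure {x. p x \<noteq> 0}" for y using that closure_subset[of "{x. p x \<noteq> 0}"] by auto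
  qed simp
  then have "pd i p x = 0" by (rule pderiv_dir_eqI)
  then show False using assms by simp
qed

lemma test_functions_pderiv:
  assumes "p \<in> test_functions \<Omega>"
  shows "pd i p \<in> test_functions \<Omega>"
proof (rule test_functionsI)
  show "C_diff k (pd i p)" for k using test_functionsD(1)[OF assms, of "Suc k"] by (rule C_diff_pderiv)
  show "compact (closure {x. p x \<noteq> 0})" "closure {x. p x \<noteq> 0} \<subseteq> \<Omega>" using assms by (auto simp: test_functions_def)
qed (rule pderiv_dir_support)

lemma test_functions_lincomb:
  assumes "p \<in> test_functions \<Omega>" "\<eta> \<in> test_functions \<Omega>"
  shows "(\<lambda>x. p x + c * \<eta> x) \<in> test_functions \<Omega>"
proof (rule test_functionsI)
  show "C_diff k (\<lambda>x. p x + c * \<eta> x)" for k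
    by (intro C_diff_add C_diff_cmult test_functionsD(1)[OF assms(1)] test_functionsD(1)[OF assms(2)])
  show "compact (closure {x. p x \<noteq> 0} \<union> closure {x. \<eta> x \<noteq> 0})" "closure {x. p x \<noteq> 0} \<union> closure {x. \<eta> x \<noteq> 0} \<subseteq> \<Omega>"
    using assms by (auto simp: test_functions_def)
  show "x \<in> closure {x. p x \<noteq> 0} \<union> closure {x. \<eta> x \<noteq> 0}" if "p x + c * \<eta> x \<noteq> 0" for x
    using that closure_subset[of "{x. p x \<noteq> 0}"] closure_subset[of "{x. \<eta> x \<noteq> 0}"] by (cases "p x = 0") auto
qed

lemma test_sq_integrable: "p \<in> test_functions \<Omega> \<Longrightarrow> sq_integrable p"
  using continuous_bounded_support_sq_integrable[of p] C_diff_continuous[OF test_functionsD(1)] test_functionsD(3) by metis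

lemma test_in_L2_on: "p \<in> test_functions \<Omega> \<Longrightarrow> abs_L2 p \<in> L2_on \<Omega>"
  using test_functionsD(2) by (intro abs_L2_in_L2_on test_sq_integrable) auto

lemma pderiv_test_lincomb:
  assumes "p \<in> test_functions \<Omega>" "\<eta> \<in> test_functions \<Omega>"
  shows "pd i (\<lambda>x. p x + c * \<eta> x) = (\<lambda>x. pd i p x + c * pd i \<eta> x)"
proof
  fix x
  have d: "p differentiable at x" "\<eta> differentiable at x"
    using C_diff_differentiable test_functionsD(1)[OF assms(1)] test_functionsD(1)[OF assms(2)] by blast+
  then show "pd i (\<lambda>x. p x + c * \<eta> x) x = pd i p x + c * pd i \<eta> x"
    by (simp add: pderiv_dir_add pderiv_dir_cmult differentiable_mult)
qed

lemma abs_test_lincomb: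
  assumes "p \<in> test_functions \<Omega>" "\<eta> \<in> test_functions \<Omega>"
  shows "abs_L2 (\<lambda>x. p x + c * \<eta> x) = abs_L2 p + c *\<^sub>R abs_L2 \<eta>"
  using test_sq_integrable[OF assms(1)] test_sq_integrable[OF assms(2)]
  by (simp add: plus_abs_L2 scaleR_abs_L2 sq_integrable_scale)

text \<open>The indicator of \<open>K\<close> is a dominated limit of test functions: mollified
  indicators of neighbourhoods of \<open>K\<close>, equal to 1 on \<open>K\<close> and eventually 0
  at each point off \<open>K\<close>.\<close>

lemma integral_over_compact_zero:
  fixes g :: "'n::finite L2"
  assumes \<Omega>: "open \<Omega>" "bounded \<Omega>" and g: "\<And>p. p \<in> test_functions \<Omega> \<Longrightarrow> inner g (abs_L2 p) = 0"
    and K: "compact K" "K \<subseteq> \<Omega>" "K \<noteq> {}"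
  shows "(LBINT x. rep_L2 g x * indicator K x) = 0"
proof -
  obtain e where e: "e > 0" "(\<Union>x\<in>K. ball x e) \<subseteq> \<Omega>"
    using compact_subset_open_imp_ball_epsilon_subset[OF K(1) \<Omega>(1) K(2)] by auto
  define \<epsilon> where "\<epsilon> = (\<lambda>n. e / (4 * real (Suc n)))"
  have \<epsilon>: "\<epsilon> n > 0" "\<epsilon> n \<le> e / 4" for n using e(1) by (auto simp: \<epsilon>_def field_simps)
  have \<epsilon>0: "\<epsilon> \<longlonglongrightarrow> 0"
  proof -
    have "(\<lambda>n. (e / 4) * (1 / real (Suc n))) \<longlonglongrightarrow> (e / 4) * 0"
      by (intro tendsto_mult tendsto_const) (use LIMSEQ_inverse_real_of_nat in \<open>simp add: inverse_eq_divide\<close>)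
    then show ?thesis by (simp add: \<epsilon>_def)
  qed
  define N where "N = (\<lambda>r. {x. infdist x K \<le> r})"
  have Ncl: "closed (N r)" for r
    unfolding N_def by (intro closed_Collect_le continuous_intros)
  have Nb: "\<exists>y\<in>K. dist x y \<le> r" if "x \<in> N r" for x r
  proof -
    obtain y where "y \<in> K" "infdist x K = dist x y"
      using infdist_attains_inf[OF compact_imp_closed[OF K(1)] K(3), of x] by blast
    then show ?thesis using that by (auto simp: N_def)
  qed
  have Nbd: "bounded (N r)" for r
  proof -
    obtain B where B: "\<And>y. y \<in> K \<Longrightarrow> norm y \<le> B" using compact_imp_bounded[OF K(1)] by (auto simp: bounded_iff)
    have "norm x \<le> B + r" if xN: "x \<in> N r" for x
    proof -
      obtain y where y: "y \<in> K" "dist x y \<le> r" using Nb[OF xN] by auto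
      have "norm x \<le> norm y + dist x y" by (simp add: dist_norm norm_triangle_sub)
      then show ?thesis using B[OF y(1)] y(2) by linarith
    qed
    then show ?thesis by (auto simp: bounded_iff)
  qed
  have Nc: "compact (N r)" for r using Ncl Nbd by (simp add: compact_eq_bounded_closed)
  define p where "p = (\<lambda>n. conv (indicator (N (\<epsilon> n))) (kern (\<epsilon> n)) :: real^'n \<Rightarrow> real)"
  have iN: "integrable lborel (indicator (N r) :: real^'n \<Rightarrow> real)" for r
    using emeasure_compact_finite[OF Nc[of r]] Ncl by (simp add: integrable_indicator_iff)
  have far: "infdist x K \<le> 2 * \<epsilon> n" if nz: "p n x \<noteq> 0" for n x
  proof -
    obtain y where y: "indicator (N (\<epsilon> n)) y \<noteq> (0::real)" "norm (x - y) < \<epsilon> n"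
      using conv_kern_support[OF nz[unfolded p_def] \<epsilon>(1)] by auto
    then have "infdist y K \<le> \<epsilon> n" by (auto simp: N_def indicator_def split: if_splits)
    then show ?thesis using infdist_triangle[of x K y] y(2) by (simp add: dist_norm)
  qed
  have near: "p n x = 1" if "x \<in> K" for n x
  proof -
    have "\<bar>p n x - 1\<bar> \<le> 0" unfolding p_def
    proof (rule conv_kern_near[OF iN \<epsilon>(1)])
      fix y assume y: "norm (x - y) < \<epsilon> n"
      have "infdist y K \<le> dist y x" by (rule infdist_le[OF that])
      then show "\<bar>indicator (N (\<epsilon> n)) y - 1\<bar> \<le> (0::real)" using y by (simp add: N_def dist_norm norm_minus_commute)
    qed
    then show ?thesis by simp
  qed
  have bnd: "\<bar>p n x\<bar> \<le> 1" for n x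
    using conv_kern_near[OF iN[of "\<epsilon> n"] \<epsilon>(1)[of n], of x 0 1] by (simp add: p_def indicator_def)
  have test: "p n \<in> test_functions \<Omega>" for n
  proof (rule test_functionsI)
    show "C_diff k (p n)" for k
      unfolding p_def by (rule C_diff_conv[OF iN C_diff_kern kern_support_le[OF \<epsilon>(1)]])
    show "compact (N (e / 2))" by (rule Nc)
    show "N (e / 2) \<subseteq> \<Omega>"
    proof
      fix x assume "x \<in> N (e / 2)"
      then obtain y where y: "y \<in> K" "dist x y \<le> e / 2" using Nb by blast
      have "x \<in> ball y e" using e(1) y(2) by (simp add: dist_commute)
      then have "x \<in> (\<Union>x\<in>K. ball x e)" using y(1) by blast
      then show "x \<in> \<Omega>" by (rule subsetD[OF e(2)])
    qed
    show "x \<in> N (e / 2)" if "p n x \<noteq> 0" for x using far[OF that] \<epsilon>(2)[of n] by (simp add: N_def)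
  qed
  have sqN: "sq_integrable (indicator (N (e / 2)) :: real^'n \<Rightarrow> real)"
    using iN[of "e/2"] Ncl[of "e / 2"] by (auto simp: sq_integrable_def power2_eq_square simp flip: indicator_inter_arith)
  have "(\<lambda>n. LBINT x. rep_L2 g x * p n x) \<longlonglongrightarrow> (LBINT x. rep_L2 g x * indicator K x)"
  proof (rule integral_dominated_convergence[where w = "\<lambda>x. \<bar>rep_L2 g x * indicator (N (e / 2)) x\<bar>"])
    show "(\<lambda>x. rep_L2 g x * indicator K x) \<in> borel_measurable lborel"
      using borel_compact[OF K(1)] by measurable
    show "(\<lambda>x. rep_L2 g x * p n x) \<in> borel_measurable lborel" for n
      using C_diff_measurable[OF test_functionsD(1)[OF test[of n], of 0]] by measurable
    show "integrable lborel (\<lambda>x. \<bar>rep_L2 g x * indicator (N (e / 2)) x\<bar>)"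
      by (intro integrable_abs sq_integrable_mult sq_integrable_rep sqN)
    show "AE x in lborel. (\<lambda>n. rep_L2 g x * p n x) \<longlonglongrightarrow> rep_L2 g x * indicator K x"
    proof (intro AE_I2 tendsto_mult tendsto_const)
      fix x
      show "(\<lambda>n. p n x) \<longlonglongrightarrow> indicator K x"
      proof (cases "x \<in> K")
        case False
        then have "infdist x K > 0"
          using in_closed_iff_infdist_zero[OF compact_imp_closed[OF K(1)] K(3)] infdist_nonneg[of x K] by force
        then have "\<forall>\<^sub>F n in sequentially. 2 * \<epsilon> n < infdist x K"
          using order_tendstoD(2)[OF tendsto_mult_left[OF \<epsilon>0, of 2], of "infdist x K"] by simp
        then have "\<forall>\<^sub>F n in sequentially. p n x = 0" by eventually_elim (use far in force)
        then show ?thesis using False by (simp add: tendsto_eventually)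
      qed (simp add: near)
    qed
    show "AE x in lborel. norm (rep_L2 g x * p n x) \<le> \<bar>rep_L2 g x * indicator (N (e / 2)) x\<bar>" for n
    proof (rule AE_I2)
      fix x
      have "\<bar>p n x\<bar> \<le> indicator (N (e / 2)) x"
        using bnd[of n x] far[of n x] \<epsilon>(2)[of n] by (cases "p n x = 0") (auto simp: N_def indicator_def)
      then show "norm (rep_L2 g x * p n x) \<le> \<bar>rep_L2 g x * indicator (N (e / 2)) x\<bar>"
        by (simp add: abs_mult mult_left_mono)
    qed
  qed
  moreover have "(LBINT x. rep_L2 g x * p n x) = 0" for n
    using g[OF test[of n]] inner_abs_right[OF test_sq_integrable[OF test[of n]]] by simp
  ultimately show ?thesis using LIMSEQ_unique[OF _ tendsto_const] by fastforce
qed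

text \<open>If \<open>f\<close> were positive on a set of positive measure, inner regularity would
  give a compact part of positive measure, on which a nonnegative function with integral 0 would
  have to vanish.\<close>

lemma AE_nonpos_of_compact_integrals:
  fixes f :: "real^'n \<Rightarrow> real"
  assumes f: "f \<in> borel_measurable borel" and \<Omega>: "open \<Omega>" "bounded \<Omega>"
    and int: "\<And>K. compact K \<Longrightarrow> K \<subseteq> \<Omega> \<Longrightarrow> integrable lborel (\<lambda>x. f x * indicator K x)"
    and zero: "\<And>K. compact K \<Longrightarrow> K \<subseteq> \<Omega> \<Longrightarrow> K \<noteq> {} \<Longrightarrow> (LBINT x. f x * indicator K x) = 0"
  shows "AE x in lborel. x \<in> \<Omega> \<longrightarrow> f x \<le> 0"
proof -
  define A where "A = {x \<in> \<Omega>. f x > 0}"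
  have A: "A \<in> sets borel"
  proof -
    have "A = \<Omega> \<inter> (f -` {0<..} \<inter> space borel)" by (auto simp: A_def)
    then show ?thesis using measurable_sets[OF f, of "{0<..}"] \<Omega>(1) by auto
  qed
  have fin: "emeasure lborel A < \<infinity>"
    using emeasure_bounded_finite[of A] bounded_subset[OF \<Omega>(2)] by (simp add: A_def less_top)
  have "emeasure lborel A = 0"
  proof (rule ccontr)
    assume pos: "emeasure lborel A \<noteq> 0"
    obtain a where a: "emeasure lborel A = ennreal a" "a > 0"
      using fin pos by (cases "emeasure lborel A") (auto simp: ennreal_eq_0_iff)
    have Al: "A \<in> sets lebesgue" using A by simp
    obtain T where T: "closed T" "T \<subseteq> A" "emeasure lebesgue (A - T) < ennreal a"
      by (rule sets_lebesgue_inner_closed[OF Al a(2)])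
    have cT: "compact T" using T(1,2) bounded_subset[OF \<Omega>(2)] by (auto simp: compact_eq_bounded_closed A_def)
    have T\<Omega>: "T \<subseteq> \<Omega>" using T(2) by (auto simp: A_def)
    have Tb: "T \<in> sets borel" using T(1) by simp
    have Tpos: "emeasure lborel T \<noteq> 0"
    proof
      assume z: "emeasure lborel T = 0"
      have "emeasure lborel A \<le> emeasure lborel (A - T) + emeasure lborel T"
        using emeasure_subadditive[of "A - T" lborel T] A Tb T(2) by (simp add: Un_absorb2)
      also have "\<dots> < ennreal a" using T(3) z A Tb by simp
      finally show False using a(1) by simp
    qed
    then have Tne: "T \<noteq> {}" by auto
    have "(LBINT x. f x * indicator T x) = 0" by (rule zero[OF cT T\<Omega> Tne])
    moreover have "AE x in lborel. 0 \<le> f x * indicator T x"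
      using T(2) by (intro AE_I2) (auto simp: indicator_def A_def)
    ultimately have "AE x in lborel. f x * indicator T x = 0"
      using integral_nonneg_eq_0_iff_AE[OF int[OF cT T\<Omega>]] by simp
    then have "AE x in lborel. x \<notin> T"
      by eventually_elim (use T(2) in \<open>auto simp: indicator_def A_def split: if_splits\<close>)
    then have "emeasure lborel T = 0"
      using Tb by (subst (asm) AE_iff_measurable[where N = T]) auto
    then show False using Tpos by simp
  qed
  then have "AE x in lborel. x \<notin> A"
    using A by (subst AE_iff_measurable[where N = A]) auto
  then show ?thesis by eventually_elim (auto simp: A_def)
qed

text \<open>The fundamental lemma of the calculus of variations: the sign criterion is applied to
  the representative and to its negative. It makes weak derivatives unique and so gives meaning to
  the description in \<open>weak_deriv\<close>.\<close>

lemma L2_test_functions_separate: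
  fixes g :: "'n::finite L2"
  assumes \<Omega>: "open \<Omega>" "bounded \<Omega>" and g\<Omega>: "g \<in> L2_on \<Omega>"
    and g: "\<And>p. p \<in> test_functions \<Omega> \<Longrightarrow> inner g (abs_L2 p) = 0"
  shows "g = 0"
proof -
  have int: "integrable lborel (\<lambda>x. rep_L2 g x * indicator K x)" if K: "compact K" for K
  proof (rule sq_integrable_mult[OF sq_integrable_rep])
    have "integrable lborel (indicator K :: real^'n \<Rightarrow> real)"
      using emeasure_compact_finite[OF K] borel_compact[OF K] by (simp add: integrable_indicator_iff)
    then show "sq_integrable (indicator K :: real^'n \<Rightarrow> real)"
      using borel_compact[OF K] by (auto simp: sq_integrable_def power2_eq_square simp flip: indicator_inter_arith)
  qed
  have z: "(LBINT x. rep_L2 g x * indicator K x) = 0" if "compact K" "K \<subseteq> \<Omega>" "K \<noteq> {}" for K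
    by (rule integral_over_compact_zero[OF \<Omega> g that])
  have "AE x in lborel. x \<in> \<Omega> \<longrightarrow> rep_L2 g x \<le> 0"
    by (rule AE_nonpos_of_compact_integrals[OF rep_L2_measurable \<Omega> int z])
  moreover have "AE x in lborel. x \<in> \<Omega> \<longrightarrow> - rep_L2 g x \<le> 0"
    by (rule AE_nonpos_of_compact_integrals[OF _ \<Omega>]) (use int z in auto)
  moreover have "AE x in lborel. x \<notin> \<Omega> \<longrightarrow> rep_L2 g x = 0" using g\<Omega> by (simp add: L2_on_def)
  ultimately have "AE x in lborel. rep_L2 g x = 0" by eventually_elim force
  then have "abs_L2 (rep_L2 g) = abs_L2 (\<lambda>x. 0)"
    by (intro abs_L2_cong sq_integrable_zero sq_integrable_rep)
  then show ?thesis by (simp add: zero_L2_def)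
qed

section \<open>Calculus of weak derivatives on a bounded open set\<close>

locale bounded_open =
  fixes \<Omega> :: "(real^'n::finite) set"
  assumes open\<Omega>: "open \<Omega>" and bounded\<Omega>: "bounded \<Omega>"
begin

lemma is_weak_deriv_unique:
  assumes "is_weak_deriv \<Omega> i u g" "is_weak_deriv \<Omega> i u g'"
  shows "g = g'"
proof -
  have "g - g' = 0"
  proof (rule L2_test_functions_separate[OF open\<Omega> bounded\<Omega>])
    show "g - g' \<in> L2_on \<Omega>" using assms L2_on_subspace subspace_diff by (auto simp: is_weak_deriv_def)
    show "inner (g - g') (abs_L2 p) = 0" if "p \<in> test_functions \<Omega>" for p
      using assms that by (simp add: is_weak_deriv_def inner_diff_left)
  qed
  then show ?thesis by simp
qed

lemma weak_deriv_eqI: "is_weak_deriv \<Omega> i u g \<Longrightarrow> weak_deriv \<Omega> i u = g"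
  unfolding weak_deriv_def by (rule the_equality) (auto intro: is_weak_deriv_unique)

lemma H1_weak_deriv: "u \<in> H1 \<Omega> \<Longrightarrow> is_weak_deriv \<Omega> i u (weak_deriv \<Omega> i u)"
  using weak_deriv_eqI by (fastforce simp: H1_def)

lemma H1_lincomb:
  assumes "u \<in> H1 \<Omega>" "w \<in> H1 \<Omega>"
  shows "u + c *\<^sub>R w \<in> H1 \<Omega>" "weak_deriv \<Omega> i (u + c *\<^sub>R w) = weak_deriv \<Omega> i u + c *\<^sub>R weak_deriv \<Omega> i w"
proof -
  have *: "is_weak_deriv \<Omega> i (u + c *\<^sub>R w) (weak_deriv \<Omega> i u + c *\<^sub>R weak_deriv \<Omega> i w)" for i
    using H1_weak_deriv[OF assms(1), of i] H1_weak_deriv[OF assms(2), of i] L2_on_subspace[of \<Omega>]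
    by (auto simp: is_weak_deriv_def inner_add_left subspace_add subspace_scale)
  then show "weak_deriv \<Omega> i (u + c *\<^sub>R w) = weak_deriv \<Omega> i u + c *\<^sub>R weak_deriv \<Omega> i w" by (rule weak_deriv_eqI)
  have "u + c *\<^sub>R w \<in> L2_on \<Omega>" using assms L2_on_subspace[of \<Omega>] by (auto simp: H1_def subspace_add subspace_scale)
  then show "u + c *\<^sub>R w \<in> H1 \<Omega>" using * by (auto simp: H1_def)
qed

lemma H1_diff:
  assumes "u \<in> H1 \<Omega>" "w \<in> H1 \<Omega>"
  shows "u - w \<in> H1 \<Omega>" "weak_deriv \<Omega> i (u - w) = weak_deriv \<Omega> i u - weak_deriv \<Omega> i w"
  using H1_lincomb[OF assms, where c = "-1"] by simp_all

lemma H1_test: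
  assumes "p \<in> test_functions \<Omega>"
  shows "abs_L2 p \<in> H1 \<Omega>" "weak_deriv \<Omega> i (abs_L2 p) = abs_L2 (pd i p)"
proof -
  have *: "is_weak_deriv \<Omega> i (abs_L2 p) (abs_L2 (pd i p))" for i
    unfolding is_weak_deriv_def
  proof (intro conjI ballI)
    show "abs_L2 (pd i p) \<in> L2_on \<Omega>" by (rule test_in_L2_on[OF test_functions_pderiv[OF assms]])
    fix \<eta> assume \<eta>: "\<eta> \<in> test_functions \<Omega>"
    obtain R where R: "\<And>x. p x \<noteq> 0 \<Longrightarrow> norm x \<le> R" using test_functionsD(3)[OF assms] by blast
    have "(LBINT x. p x * pd i \<eta> x) = - (LBINT x. pd i p x * \<eta> x)"
      by (rule integral_by_parts[OF test_functionsD(1)[OF assms] test_functionsD(1)[OF \<eta>]]) (use R in auto)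
    then show "inner (abs_L2 p) (abs_L2 (pd i \<eta>)) = - inner (abs_L2 (pd i p)) (abs_L2 \<eta>)"
      by (simp add: inner_abs_L2 test_sq_integrable[OF assms] test_sq_integrable[OF \<eta>]
          test_sq_integrable[OF test_functions_pderiv[OF assms]] test_sq_integrable[OF test_functions_pderiv[OF \<eta>]])
  qed
  then show "weak_deriv \<Omega> i (abs_L2 p) = abs_L2 (pd i p)" by (rule weak_deriv_eqI)
  show "abs_L2 p \<in> H1 \<Omega>" using * test_in_L2_on[OF assms] by (auto simp: H1_def)
qed

text \<open>The test vector is the part of \<open>u\<close> outside \<Omega>: it is orthogonal to
  every \<open>X n\<close>, hence to the limit, and its inner product with \<open>u\<close> is its
  own squared norm.\<close>

lemma L2_on_closed:
  assumes "\<And>n. X n \<in> L2_on \<Omega>" "X \<longlonglongrightarrow> u"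
  shows "u \<in> L2_on \<Omega>"
proof -
  define f where "f = (\<lambda>x. indicator (- \<Omega>) x * rep_L2 u x)"
  have m\<Omega>: "- \<Omega> \<in> sets borel" using open\<Omega> by simp
  have f: "sq_integrable f" unfolding sq_integrable_def
  proof
    show fm: "f \<in> borel_measurable lborel" unfolding f_def using m\<Omega> by measurable
    have "integrable lborel (\<lambda>x. (rep_L2 u x)^2)" using sq_integrable_rep[of u] by (simp add: sq_integrable_def)
    then show "integrable lborel (\<lambda>x. (f x)^2)"
      by (rule Bochner_Integration.integrable_bound) (use fm in \<open>auto simp: f_def indicator_def\<close>)
  qed
  have "inner (X n) (abs_L2 f) = 0" for n
  proof -
    have "AE x in lborel. rep_L2 (X n) x * f x = 0"
      using assms(1)[of n] unfolding L2_on_def mem_Collect_eq by eventually_elim (auto simp: f_def)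
    then show ?thesis unfolding inner_abs_right[OF f] by (rule integral_eq_zero_AE)
  qed
  moreover have "(\<lambda>n. inner (X n) (abs_L2 f)) \<longlonglongrightarrow> inner u (abs_L2 f)" by (intro tendsto_intros assms(2))
  ultimately have "inner u (abs_L2 f) = 0" using LIMSEQ_unique[OF _ tendsto_const] by fastforce
  then have "(LBINT x. (f x)^2) = 0"
  proof -
    have "(\<lambda>x. rep_L2 u x * f x) = (\<lambda>x. (f x)^2)"
    proof
      fix x
      show "rep_L2 u x * f x = (f x)^2" by (cases "x \<in> \<Omega>") (simp_all add: f_def power2_eq_square)
    qed
    then show ?thesis using \<open>inner u (abs_L2 f) = 0\<close> unfolding inner_abs_right[OF f] by simp
  qed
  then have "AE x in lborel. (f x)^2 = 0"
    using integral_nonneg_eq_0_iff_AE[of lborel "\<lambda>x. (f x)^2"] f by (simp add: sq_integrable_def)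
  then show ?thesis unfolding L2_on_def mem_Collect_eq by eventually_elim (auto simp: f_def)
qed

text \<open>With the converse \<open>H10_limit\<close>, membership becomes separate convergence of
  test functions and of their partial derivatives. Identities are proved for test functions and
  carried over by continuity of the inner product.\<close>

lemma H10_seq:
  assumes "u \<in> H10 \<Omega>"
  obtains p where "\<And>n. p n \<in> test_functions \<Omega>" "(\<lambda>n. abs_L2 (p n)) \<longlonglongrightarrow> u"
    "\<And>i. (\<lambda>n. abs_L2 (pd i (p n))) \<longlonglongrightarrow> weak_deriv \<Omega> i u"
proof -
  have u: "u \<in> H1 \<Omega>" using assms by (simp add: H10_def)
  have "\<exists>p\<in>test_functions \<Omega>. H1_norm \<Omega> (u - abs_L2 p) < 1 / real (Suc n)" for n
    using assms by (simp add: H10_def)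
  then obtain p where p: "\<And>n. p n \<in> test_functions \<Omega>" "\<And>n. H1_norm \<Omega> (u - abs_L2 (p n)) < 1 / real (Suc n)" by metis
  have lim: "(\<lambda>n. 1 / real (Suc n)) \<longlonglongrightarrow> 0" using LIMSEQ_inverse_real_of_nat by (simp add: inverse_eq_divide)
  have b1: "norm (u - abs_L2 (p n)) \<le> 1 / real (Suc n)" for n
  proof -
    have "norm (u - abs_L2 (p n)) \<le> H1_norm \<Omega> (u - abs_L2 (p n))"
      unfolding H1_norm_def by (rule real_le_rsqrt) (simp add: sum_nonneg)
    then show ?thesis using p(2)[of n] by linarith
  qed
  have b2: "norm (weak_deriv \<Omega> i u - abs_L2 (pd i (p n))) \<le> 1 / real (Suc n)" for i n
  proof -
    have "norm (weak_deriv \<Omega> i (u - abs_L2 (p n))) \<le> H1_norm \<Omega> (u - abs_L2 (p n))"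
      unfolding H1_norm_def
    proof (rule real_le_rsqrt)
      have "(norm (weak_deriv \<Omega> i (u - abs_L2 (p n))))^2 \<le> (\<Sum>i\<in>UNIV. (norm (weak_deriv \<Omega> i (u - abs_L2 (p n))))^2)"
        by (rule member_le_sum[of i UNIV "\<lambda>i. (norm (weak_deriv \<Omega> i (u - abs_L2 (p n))))^2"]) auto
      then show "(norm (weak_deriv \<Omega> i (u - abs_L2 (p n))))^2 \<le> (norm (u - abs_L2 (p n)))^2 + (\<Sum>i\<in>UNIV. (norm (weak_deriv \<Omega> i (u - abs_L2 (p n))))^2)"
        by (simp add: add_increasing)
    qed
    then show ?thesis using p(2)[of n] H1_diff(2)[OF u H1_test(1)[OF p(1)[of n]], of i] H1_test(2)[OF p(1)[of n], of i] by simp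
  qed
  show ?thesis
  proof (rule that[OF p(1)])
    show "(\<lambda>n. abs_L2 (p n)) \<longlonglongrightarrow> u"
      by (rule Lim_null[THEN iffD2], rule Lim_null_comparison[OF _ lim])
         (use b1 in \<open>simp add: norm_minus_commute\<close>)
    show "(\<lambda>n. abs_L2 (pd i (p n))) \<longlonglongrightarrow> weak_deriv \<Omega> i u" for i
      by (rule Lim_null[THEN iffD2], rule Lim_null_comparison[OF _ lim])
         (use b2 in \<open>simp add: norm_minus_commute\<close>)
  qed
qed

lemma H10_limit:
  assumes p: "\<And>n. p n \<in> test_functions \<Omega>" "(\<lambda>n. abs_L2 (p n)) \<longlonglongrightarrow> u"
    "\<And>i. (\<lambda>n. abs_L2 (pd i (p n))) \<longlonglongrightarrow> g i"
  shows "u \<in> H10 \<Omega>" "weak_deriv \<Omega> i u = g i"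
proof -
  have w: "is_weak_deriv \<Omega> i u (g i)" for i
    unfolding is_weak_deriv_def
  proof (intro conjI ballI)
    show "g i \<in> L2_on \<Omega>" by (rule L2_on_closed[OF _ p(3)]) (rule test_in_L2_on[OF test_functions_pderiv[OF p(1)]])
    fix \<eta> assume \<eta>: "\<eta> \<in> test_functions \<Omega>"
    have "inner (abs_L2 (p n)) (abs_L2 (pd i \<eta>)) = - inner (abs_L2 (pd i (p n))) (abs_L2 \<eta>)" for n
      using H1_weak_deriv[OF H1_test(1)[OF p(1)[of n]], of i] \<eta> by (simp add: is_weak_deriv_def H1_test(2)[OF p(1)])
    moreover have "(\<lambda>n. inner (abs_L2 (p n)) (abs_L2 (pd i \<eta>))) \<longlonglongrightarrow> inner u (abs_L2 (pd i \<eta>))"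
      by (intro tendsto_intros p(2))
    moreover have "(\<lambda>n. - inner (abs_L2 (pd i (p n))) (abs_L2 \<eta>)) \<longlonglongrightarrow> - inner (g i) (abs_L2 \<eta>)"
      by (intro tendsto_intros p(3))
    ultimately show "inner u (abs_L2 (pd i \<eta>)) = - inner (g i) (abs_L2 \<eta>)" using LIMSEQ_unique by simp
  qed
  then show eq: "weak_deriv \<Omega> i u = g i" for i by (rule weak_deriv_eqI)
  have uL: "u \<in> L2_on \<Omega>" by (rule L2_on_closed[OF _ p(2)]) (rule test_in_L2_on[OF p(1)])
  have u: "u \<in> H1 \<Omega>" using uL w by (auto simp: H1_def)
  have "(\<lambda>n. H1_norm \<Omega> (u - abs_L2 (p n))) \<longlonglongrightarrow> sqrt ((norm (u - u))^2 + (\<Sum>i\<in>UNIV. (norm (g i - g i))^2))"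
    unfolding H1_norm_def H1_diff(2)[OF u H1_test(1)[OF p(1)]] H1_test(2)[OF p(1)] eq
    by (intro tendsto_intros p(2,3))
  then have "(\<lambda>n. H1_norm \<Omega> (u - abs_L2 (p n))) \<longlonglongrightarrow> 0" by simp
  then have "\<exists>p\<in>test_functions \<Omega>. H1_norm \<Omega> (u - abs_L2 p) < \<epsilon>" if "\<epsilon> > 0" for \<epsilon>
    using order_tendstoD(2)[OF _ that] p(1) by (metis (no_types, lifting) eventually_sequentially order_refl)
  then show "u \<in> H10 \<Omega>" using u by (simp add: H10_def)
qed

lemma H10_H1: "u \<in> H10 \<Omega> \<Longrightarrow> u \<in> H1 \<Omega>" by (simp add: H10_def)

lemma H10_lincomb:
  assumes "u \<in> H10 \<Omega>" "w \<in> H10 \<Omega>"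
  shows "u + c *\<^sub>R w \<in> H10 \<Omega>"
proof -
  obtain p where p: "\<And>n. p n \<in> test_functions \<Omega>" "(\<lambda>n. abs_L2 (p n)) \<longlonglongrightarrow> u"
    "\<And>i. (\<lambda>n. abs_L2 (pd i (p n))) \<longlonglongrightarrow> weak_deriv \<Omega> i u" using H10_seq[OF assms(1)] by blast
  obtain \<eta> where \<eta>: "\<And>n. \<eta> n \<in> test_functions \<Omega>" "(\<lambda>n. abs_L2 (\<eta> n)) \<longlonglongrightarrow> w"
    "\<And>i. (\<lambda>n. abs_L2 (pd i (\<eta> n))) \<longlonglongrightarrow> weak_deriv \<Omega> i w" using H10_seq[OF assms(2)] by blast
  show ?thesis
  proof (rule H10_limit(1))
    show "(\<lambda>x. p n x + c * \<eta> n x) \<in> test_functions \<Omega>" for n by (rule test_functions_lincomb[OF p(1) \<eta>(1)])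
    show "(\<lambda>n. abs_L2 (\<lambda>x. p n x + c * \<eta> n x)) \<longlonglongrightarrow> u + c *\<^sub>R w"
      unfolding abs_test_lincomb[OF p(1) \<eta>(1)] by (intro tendsto_intros p(2) \<eta>(2))
    show "(\<lambda>n. abs_L2 (pd i (\<lambda>x. p n x + c * \<eta> n x))) \<longlonglongrightarrow> weak_deriv \<Omega> i u + c *\<^sub>R weak_deriv \<Omega> i w" for i
      unfolding pderiv_test_lincomb[OF p(1) \<eta>(1)] abs_test_lincomb[OF test_functions_pderiv[OF p(1)] test_functions_pderiv[OF \<eta>(1)]]
      by (intro tendsto_intros p(3) \<eta>(3))
  qed
qed

lemma H10_zero: "0 \<in> H10 \<Omega>"
proof -
  have z: "(\<lambda>x. 0) \<in> test_functions \<Omega>" by (rule test_functionsI[of _ "{}"]) auto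
  have e: "abs_L2 (\<lambda>x::real^'n. 0) = 0" by (simp add: zero_L2_def)
  show ?thesis by (rule H10_limit(1)[of "\<lambda>n x. 0" 0 "\<lambda>i. 0"]) (use z e in auto)
qed

lemma H10_subspace: "subspace (H10 \<Omega>)"
proof (rule subspaceI)
  show "u + w \<in> H10 \<Omega>" if "u \<in> H10 \<Omega>" "w \<in> H10 \<Omega>" for u w using H10_lincomb[OF that, where c = 1] by simp
  show "c *\<^sub>R u \<in> H10 \<Omega>" if "u \<in> H10 \<Omega>" for c u using H10_lincomb[OF H10_zero that, where c = c] by simp
qed (rule H10_zero)

lemma H2_lincomb:
  assumes "u \<in> H2 \<Omega>" "w \<in> H2 \<Omega>"
  shows "u + c *\<^sub>R w \<in> H2 \<Omega>" "laplacian \<Omega> (u + c *\<^sub>R w) = laplacian \<Omega> u + c *\<^sub>R laplacian \<Omega> w"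
  using assms H1_lincomb unfolding H2_def laplacian_def
  by (auto simp: sum.distrib scaleR_sum_right)

lemma Hdot2_diff:
  assumes "u \<in> Hdot2 \<Omega>" "w \<in> Hdot2 \<Omega>"
  shows "u - w \<in> Hdot2 \<Omega>" "laplacian \<Omega> (u - w) = laplacian \<Omega> u - laplacian \<Omega> w"
  using H2_lincomb[where u = u and w = w and c = "-1"] H10_lincomb[where u = u and w = w and c = "-1"] assms by (auto simp: Hdot2_def)

lemma Green:
  assumes "u \<in> H2 \<Omega>" "w \<in> H10 \<Omega>"
  shows "grad_inner \<Omega> u w = - inner (laplacian \<Omega> u) w"
proof -
  obtain p where p: "\<And>n. p n \<in> test_functions \<Omega>" "(\<lambda>n. abs_L2 (p n)) \<longlonglongrightarrow> w"
    "\<And>i. (\<lambda>n. abs_L2 (pd i (p n))) \<longlonglongrightarrow> weak_deriv \<Omega> i w" using H10_seq[OF assms(2)] by blast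
  have "inner (weak_deriv \<Omega> i u) (weak_deriv \<Omega> i w) = - inner (weak_deriv \<Omega> i (weak_deriv \<Omega> i u)) w" for i
  proof -
    have "weak_deriv \<Omega> i u \<in> H1 \<Omega>" using assms(1) by (simp add: H2_def)
    then have "inner (weak_deriv \<Omega> i u) (abs_L2 (pd i (p n))) = - inner (weak_deriv \<Omega> i (weak_deriv \<Omega> i u)) (abs_L2 (p n))" for n
      using H1_weak_deriv p(1) by (auto simp: is_weak_deriv_def)
    moreover have "(\<lambda>n. inner (weak_deriv \<Omega> i u) (abs_L2 (pd i (p n)))) \<longlonglongrightarrow> inner (weak_deriv \<Omega> i u) (weak_deriv \<Omega> i w)"
      by (intro tendsto_intros p(3))
    moreover have "(\<lambda>n. - inner (weak_deriv \<Omega> i (weak_deriv \<Omega> i u)) (abs_L2 (p n))) \<longlonglongrightarrow> - inner (weak_deriv \<Omega> i (weak_deriv \<Omega> i u)) w"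
      by (intro tendsto_intros p(2))
    ultimately show ?thesis using LIMSEQ_unique by simp
  qed
  then show ?thesis by (simp add: grad_inner_def laplacian_def inner_sum_left sum_negf)
qed

text \<open>For functions that are smooth on the whole space but do not vanish on the boundary:
  their classical derivatives are cut off one by one, in place of weak derivatives of the cut-off
  function.\<close>

definition cut :: "(real^'n \<Rightarrow> real) \<Rightarrow> 'n L2" where
  "cut f = abs_L2 (\<lambda>x. indicator \<Omega> x * f x)"

lemma cut_sq_integrable:
  assumes "continuous_on UNIV f"
  shows "sq_integrable (\<lambda>x. indicator \<Omega> x * f x)"
proof -
  obtain R where R: "\<And>x. x \<in> \<Omega> \<Longrightarrow> norm x \<le> R" using bounded\<Omega> by (auto simp: bounded_iff)
  obtain K where K: "\<And>x. norm x \<le> R \<Longrightarrow> \<bar>f x\<bar> \<le> K" using continuous_bounded_on_cball[OF assms] by blast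
  show ?thesis
  proof (rule sq_integrable_bounded_support[where B = "\<bar>K\<bar>" and R = R])
    show "(\<lambda>x. indicator \<Omega> x * f x) \<in> borel_measurable borel"
      using borel_measurable_continuous_onI[OF assms] borel_open[OF open\<Omega>]
      by (intro borel_measurable_times borel_measurable_indicator)
    show "\<bar>indicator \<Omega> x * f x\<bar> \<le> \<bar>K\<bar>" for x using K[OF R, of x] by (auto simp: indicator_def)
    show "norm x \<le> R" if "indicator \<Omega> x * f x \<noteq> 0" for x using that R by (auto simp: indicator_def split: if_splits)
  qed
qed

lemma inner_test_cut:
  assumes "\<theta> \<in> test_functions \<Omega>" "continuous_on UNIV f"
  shows "inner (abs_L2 \<theta>) (cut f) = (LBINT x. \<theta> x * f x)"
proof -
  have "(\<lambda>x. \<theta> x * (indicator \<Omega> x * f x)) = (\<lambda>x. \<theta> x * f x)"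
  proof
    fix x
    show "\<theta> x * (indicator \<Omega> x * f x) = \<theta> x * f x"
      using test_functionsD(2)[OF assms(1), of x] by (cases "\<theta> x = 0") auto
  qed
  then show ?thesis unfolding cut_def
    by (simp add: inner_abs_L2[OF test_sq_integrable[OF assms(1)] cut_sq_integrable[OF assms(2)]])
qed

text \<open>The boundary condition sits in \<open>w\<close>: its approximating test functions have
  compact support, which makes the classical integration by parts free of boundary terms.\<close>

lemma Green_smooth:
  assumes w: "w \<in> H10 \<Omega>" and \<psi>: "C_diff 2 \<psi>"
  shows "(\<Sum>i\<in>UNIV. inner (weak_deriv \<Omega> i w) (cut (pd i \<psi>))) = - inner w (cut (lap \<psi>))"
proof -
  have C: "C_diff (Suc (Suc 0)) \<psi>" using \<psi> by (simp only: numeral_2_eq_2)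
  have c1: "C_diff 1 (pd i \<psi>)" for i using C_diff_pderiv[OF C] by simp
  have c: "continuous_on UNIV (pd i \<psi>)" "continuous_on UNIV (pd i (pd i \<psi>))" "continuous_on UNIV (lap \<psi>)" for i
    using C_diff_continuous[OF c1] C_diff_pderiv[OF c1[unfolded One_nat_def]] C_diff_continuous[OF C_diff_lap[OF C]] by auto
  obtain p where p: "\<And>n. p n \<in> test_functions \<Omega>" "(\<lambda>n. abs_L2 (p n)) \<longlonglongrightarrow> w"
    "\<And>i. (\<lambda>n. abs_L2 (pd i (p n))) \<longlonglongrightarrow> weak_deriv \<Omega> i w" using H10_seq[OF w] by blast
  have "(\<Sum>i\<in>UNIV. inner (abs_L2 (pd i (p n))) (cut (pd i \<psi>))) = - inner (abs_L2 (p n)) (cut (lap \<psi>))" for n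
  proof -
    obtain R where R: "\<And>x. p n x \<noteq> 0 \<Longrightarrow> norm x \<le> R" using test_functionsD(3)[OF p(1)[of n]] by blast
    have "(LBINT x. p n x * pd i (pd i \<psi>) x) = - (LBINT x. pd i (p n) x * pd i \<psi> x)" for i
      by (rule integral_by_parts[OF test_functionsD(1)[OF p(1)] c1]) (use R in auto)
    moreover have "integrable lborel (\<lambda>x. p n x * pd i (pd i \<psi>) x)" for i
      by (rule continuous_bounded_support_integrable[where R = R])
         (use R c C_diff_continuous[OF test_functionsD(1)[OF p(1)]] in \<open>auto intro!: continuous_on_mult\<close>)
    ultimately show ?thesis
      unfolding inner_test_cut[OF p(1) c(3)] inner_test_cut[OF test_functions_pderiv[OF p(1)] c(1)]
      by (simp add: lap_def sum_distrib_left sum_negf)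
  qed
  moreover have "(\<lambda>n. \<Sum>i\<in>UNIV. inner (abs_L2 (pd i (p n))) (cut (pd i \<psi>))) \<longlonglongrightarrow> (\<Sum>i\<in>UNIV. inner (weak_deriv \<Omega> i w) (cut (pd i \<psi>)))"
    by (intro tendsto_intros p(3))
  moreover have "(\<lambda>n. - inner (abs_L2 (p n)) (cut (lap \<psi>))) \<longlonglongrightarrow> - inner w (cut (lap \<psi>))"
    by (intro tendsto_intros p(2))
  ultimately show ?thesis using LIMSEQ_unique by simp
qed

end

section \<open>Interpolation on a simplex\<close>

lemma nn_integral_lborel_affine:
  fixes f :: "'a::euclidean_space \<Rightarrow> ennreal"
  assumes "f \<in> borel_measurable borel" "c \<noteq> 0"
  shows "(\<integral>\<^sup>+x. f x \<partial>lborel) = ennreal (\<bar>c\<bar> ^ DIM('a)) * (\<integral>\<^sup>+x. f (t + c *\<^sub>R x) \<partial>lborel)"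
proof -
  have "(\<integral>\<^sup>+x. f x \<partial>lborel) = (\<integral>\<^sup>+x. f x \<partial>density (distr lborel borel (\<lambda>x. t + c *\<^sub>R x)) (\<lambda>_. \<bar>c\<bar>^DIM('a)))"
    using lborel_affine[OF assms(2), of t] by simp
  also have "\<dots> = ennreal (\<bar>c\<bar> ^ DIM('a)) * (\<integral>\<^sup>+x. f (t + c *\<^sub>R x) \<partial>lborel)"
    using assms(1) by (simp add: nn_integral_density nn_integral_distr nn_integral_cmult)
  finally show ?thesis .
qed

text \<open>Nonnegativity of the variance of \<open>f\<close> on the unit interval.\<close>

lemma square_integral_le:
  fixes f :: "real \<Rightarrow> real"
  assumes "continuous_on {0..1} f" "(f has_integral I) {0..1}"
  shows "I^2 \<le> integral {0..1} (\<lambda>s. (f s)^2)"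
proof -
  have i: "f integrable_on {0..1}" "(\<lambda>s. (f s)^2) integrable_on {0..1}"
    using assms(1) by (auto intro!: integrable_continuous_real continuous_intros)
  have e: "integral {0..1} f = I" using assms(2) by (rule integral_unique)
  have "0 \<le> integral {0..1} (\<lambda>s. (f s - I)^2)"
    by (rule integral_nonneg) (auto intro!: integrable_continuous_real continuous_intros assms(1))
  also have "integral {0..1} (\<lambda>s. (f s - I)^2) = integral {0..1} (\<lambda>s. (f s)^2 - 2 * I * f s + I^2)"
    by (simp add: power2_diff algebra_simps)
  also have "\<dots> = integral {0..1} (\<lambda>s. (f s)^2) - 2 * I * I + I^2"
  proof (rule integral_unique, intro has_integral_add has_integral_diff)
    show "((\<lambda>s. 2 * I * f s) has_integral 2 * I * I) {0..1}" by (rule has_integral_mult_right[OF assms(2)])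
    show "((\<lambda>s::real. I^2) has_integral I\<^sup>2) {0..1}" using has_integral_const_real[of "I^2" 0 1] by simp
  qed (rule integrable_integral[OF i(2)])
  finally show ?thesis by (simp add: power2_eq_square)
qed

lemma second_line_derivative:
  fixes q :: "real^'n \<Rightarrow> real"
  assumes "C_diff 2 q"
  shows "((\<lambda>t. q (v + t *\<^sub>R h)) has_real_derivative (\<Sum>i\<in>UNIV. h $ i * pd i q (v + t *\<^sub>R h))) (at t)"
    "((\<lambda>t. \<Sum>i\<in>UNIV. h $ i * pd i q (v + t *\<^sub>R h)) has_real_derivative
       (\<Sum>i\<in>UNIV. h $ i * (\<Sum>j\<in>UNIV. h $ j * pd j (pd i q) (v + t *\<^sub>R h)))) (at t)"
  using assms by (auto intro!: has_real_derivative_line DERIV_sum DERIV_cmult simp: numeral_2_eq_2)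

lemma second_line_derivative_bound:
  fixes q :: "real^'n \<Rightarrow> real"
  shows "(\<Sum>i\<in>UNIV. h $ i * (\<Sum>j\<in>UNIV. h $ j * pd j (pd i q) x))^2 \<le> (norm h)^4 * hess_sq q x"
proof -
  have nh: "(\<Sum>i\<in>UNIV. (h $ i)^2) = (norm h)^2" for h :: "real^'n"
    by (simp add: norm_vec_def L2_set_def sum_nonneg)
  have "(\<Sum>i\<in>UNIV. h $ i * (\<Sum>j\<in>UNIV. h $ j * pd j (pd i q) x))^2
     \<le> (norm h)^2 * (\<Sum>i\<in>UNIV. (\<Sum>j\<in>UNIV. h $ j * pd j (pd i q) x)^2)"
    unfolding nh[symmetric] by (rule Cauchy_Schwarz_ineq_sum)
  also have "(\<Sum>i\<in>UNIV. (\<Sum>j\<in>UNIV. h $ j * pd j (pd i q) x)^2)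
     \<le> (\<Sum>i\<in>UNIV. (norm h)^2 * (\<Sum>j\<in>UNIV. (pd j (pd i q) x)^2))"
    unfolding nh[symmetric] by (intro sum_mono Cauchy_Schwarz_ineq_sum)
  also have "(norm h)^2 * (\<Sum>i\<in>UNIV. (norm h)^2 * (\<Sum>j\<in>UNIV. (pd j (pd i q) x)^2)) = (norm h)^4 * hess_sq q x"
    unfolding hess_sq_def by (simp add: sum_distrib_left[symmetric] mult.assoc[symmetric] flip: power_add)
  finally show ?thesis by (simp add: mult_left_mono)
qed

text \<open>The expansion is centred at the variable point \<open>x\<close> and evaluated at
  \<open>v\<close>, later a vertex. The gradient is thus taken at \<open>x\<close>, where it is to
  be compared with that of the interpolant.\<close>

definition taylor_rem :: "(real^'n \<Rightarrow> real) \<Rightarrow> real^'n \<Rightarrow> real^'n \<Rightarrow> real" where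
  "taylor_rem q v x = q v - q x - (\<Sum>i\<in>UNIV. (v - x) $ i * pd i q x)"

text \<open>The substitution \<open>t = s^2\<close> in the integral remainder leaves the weight \<open>s\<^sup>6\<close>, which absorbs the
  Jacobian \<open>s powr (-2d)\<close> of the contraction towards the vertex exactly when \<open>d \<le> 3\<close>.\<close>

lemma taylor_rem_square:
  fixes q :: "real^'n \<Rightarrow> real"
  assumes q: "C_diff 2 q"
  shows "(taylor_rem q v x)^2 \<le> integral {0..1} (\<lambda>s. 4 * s^6 * ((norm (x - v))^4 * hess_sq q (v + s^2 *\<^sub>R (x - v))))"
proof -
  let ?h = "x - v"
  define G where "G = (\<lambda>t. q (v + t *\<^sub>R ?h))"
  define G1 where "G1 = (\<lambda>t. \<Sum>i\<in>UNIV. ?h $ i * pd i q (v + t *\<^sub>R ?h))"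
  define G2 where "G2 = (\<lambda>t. \<Sum>i\<in>UNIV. ?h $ i * (\<Sum>j\<in>UNIV. ?h $ j * pd j (pd i q) (v + t *\<^sub>R ?h)))"
  have dG: "(G has_real_derivative G1 t) (at t)" "(G1 has_real_derivative G2 t) (at t)" for t
    unfolding G_def G1_def G2_def by (rule second_line_derivative[OF q])+
  have cH: "continuous_on UNIV (pd j (pd i q))" for i j using q by (simp add: numeral_2_eq_2)
  have cG2: "continuous_on S (\<lambda>s. G2 (s^2))" for S
    unfolding G2_def by (intro continuous_intros continuous_on_compose2[OF cH]) auto
  \<comment> \<open>t G1 t - G t has derivative t G2 t; the substitution t = s^2 gives the integrand
    below, and the difference of the end values is the remainder.\<close>
  have "((\<lambda>s. s^2 * G1 (s^2) - G (s^2)) has_real_derivative 2 * s^3 * G2 (s^2)) (at s)" for s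
    by (auto intro!: derivative_eq_intros DERIV_chain2[OF dG(1)] DERIV_chain2[OF dG(2)] simp: power2_eq_square power3_eq_cube)
  then have "((\<lambda>s. 2 * s^3 * G2 (s^2)) has_integral (1^2 * G1 (1^2) - G (1^2)) - (0^2 * G1 (0^2) - G (0^2))) {0..1}"
    by (intro fundamental_theorem_of_calculus)
       (auto simp: has_real_derivative_iff_has_vector_derivative intro: has_vector_derivative_at_within)
  moreover have "(1^2 * G1 (1^2) - G (1^2)) - (0^2 * G1 (0^2) - G (0^2)) = taylor_rem q v x"
    unfolding taylor_rem_def G_def G1_def by (simp add: left_diff_distrib sum_subtractf)
  ultimately have "(taylor_rem q v x)^2 \<le> integral {0..1} (\<lambda>s. (2 * s^3 * G2 (s^2))^2)"
    by (intro square_integral_le) (auto intro!: continuous_intros cG2)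
  also have "\<dots> \<le> integral {0..1} (\<lambda>s. 4 * s^6 * ((norm ?h)^4 * hess_sq q (v + s^2 *\<^sub>R ?h)))"
  proof (rule integral_le)
    show "(\<lambda>s. (2 * s^3 * G2 (s^2))^2) integrable_on {0..1}"
      by (intro integrable_continuous_real continuous_intros cG2)
    have cHs: "continuous_on UNIV (hess_sq q)"
      using C_diff_continuous[OF C_diff_hess_sq[of 0 q]] q by (simp only: numeral_2_eq_2)
    show "(\<lambda>s. 4 * s^6 * ((norm ?h)^4 * hess_sq q (v + s^2 *\<^sub>R ?h))) integrable_on {0..1}"
      by (intro integrable_continuous_real continuous_intros continuous_on_compose2[OF cHs]) auto
    show "(2 * s^3 * G2 (s^2))^2 \<le> 4 * s^6 * ((norm ?h)^4 * hess_sq q (v + s^2 *\<^sub>R ?h))" for s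
    proof -
      have "(2 * s^3 * G2 (s^2))^2 = 4 * s^6 * (G2 (s^2))^2" by (simp add: power_mult_distrib flip: power_mult)
      also have "\<dots> \<le> 4 * s^6 * ((norm ?h)^4 * hess_sq q (v + s^2 *\<^sub>R ?h))"
        unfolding G2_def by (intro mult_left_mono second_line_derivative_bound) auto
      finally show ?thesis .
    qed
  qed
  finally show ?thesis .
qed

text \<open>The pointwise estimate is integrated over \<open>S\<close> and the integrals are
  exchanged. For fixed \<open>s\<close> the contraction towards \<open>v\<close> maps
  \<open>S\<close> into itself by convexity, so after the change of variables each inner integral is
  controlled by that of \<open>hess_sq q\<close> over the same set \<open>S\<close>.\<close>

lemma taylor_rem_L2:
  fixes q :: "real^'n \<Rightarrow> real"
  assumes q: "C_diff 2 q" and d: "CARD('n) \<le> 3" and S: "convex S" "compact S" "v \<in> S"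
    and D: "\<And>x. x \<in> S \<Longrightarrow> norm (x - v) \<le> D"
  shows "(LBINT x. indicator S x * (taylor_rem q v x)^2) \<le> 4 * D^4 * (LBINT x. indicator S x * hess_sq q x)"
proof -
  have Sb [measurable]: "S \<in> sets borel" using S(2) by (rule borel_compact)
  have D0: "D \<ge> 0" using D[OF S(3)] by simp
  have cH: "continuous_on UNIV (hess_sq q)"
    using C_diff_continuous[OF C_diff_hess_sq[of 0 q]] q by (simp only: numeral_2_eq_2)
  have [measurable]: "hess_sq q \<in> borel_measurable borel" by (rule borel_measurable_continuous_onI[OF cH])
  have cR: "continuous_on UNIV (taylor_rem q v)"
  proof -
    have "continuous_on UNIV (pd i q)" for i using C_diff_continuous[of 1 "pd i q"] q by (simp add: numeral_2_eq_2)
    then show ?thesis unfolding taylor_rem_def[abs_def] by (intro continuous_intros C_diff_continuous[OF q])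
  qed
  have intS: "integrable lborel (\<lambda>x. indicator S x * f x)" if f: "continuous_on UNIV f" for f :: "real^'n \<Rightarrow> real"
    using borel_integrable_compact[OF S(2) continuous_on_subset[OF f]] by (simp add: indicator_def if_distrib mult.commute cong: if_cong)
  let ?H = "\<lambda>x. ennreal (indicator S x * hess_sq q x)"
  let ?f = "\<lambda>(x, s). ennreal (indicator S x * indicator {0..1} s * (4 * s^6 * (D^4 * hess_sq q (v + s^2 *\<^sub>R (x - v)))))"
  have fm: "?f \<in> borel_measurable (lborel \<Otimes>\<^sub>M (lborel :: real measure))"
    by measurable
  have "(\<integral>\<^sup>+x. ennreal (indicator S x * (taylor_rem q v x)^2) \<partial>lborel) \<le> (\<integral>\<^sup>+x. (\<integral>\<^sup>+s. ?f (x, s) \<partial>lborel) \<partial>lborel)"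
  proof (rule nn_integral_mono)
    fix x
    show "ennreal (indicator S x * (taylor_rem q v x)^2) \<le> (\<integral>\<^sup>+s. ?f (x, s) \<partial>lborel)"
    proof (cases "x \<in> S")
      case True
      let ?g = "\<lambda>s. 4 * s^6 * ((norm (x - v))^4 * hess_sq q (v + s^2 *\<^sub>R (x - v)))"
      have cg: "continuous_on {0..1} ?g"
        by (intro continuous_intros continuous_on_compose2[OF cH]) auto
      have g0: "0 \<le> ?g s" for s by (intro mult_nonneg_nonneg hess_sq_nonneg) auto
      have "ennreal ((taylor_rem q v x)^2) \<le> ennreal (integral {0..1} ?g)"
        by (intro ennreal_leI taylor_rem_square[OF q])
      also have "\<dots> = (\<integral>\<^sup>+s. ennreal (indicator {0..1} s * ?g s) \<partial>lborel)"
        using nn_integral_has_integral_lebesgue[OF g0 integrable_integral[OF integrable_continuous_real[OF cg]]] by simp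
      also have "\<dots> \<le> (\<integral>\<^sup>+s. ?f (x, s) \<partial>lborel)"
        using True D[OF True] by (intro nn_integral_mono)
          (auto simp: indicator_def intro!: ennreal_leI mult_left_mono mult_right_mono power_mono hess_sq_nonneg)
      finally show ?thesis using True by simp
    qed simp
  qed
  also have "\<dots> = (\<integral>\<^sup>+s. (\<integral>\<^sup>+x. ?f (x, s) \<partial>lborel) \<partial>lborel)"
    using lborel_pair.Fubini[OF fm] by simp
  also have "\<dots> \<le> (\<integral>\<^sup>+s. indicator {0..1} s * (ennreal (4 * D^4) * (\<integral>\<^sup>+x. ?H x \<partial>lborel)) \<partial>(lborel :: real measure))"
  proof (rule nn_integral_mono_AE)
    have "AE s in (lborel :: real measure). s \<noteq> 0" by (rule AE_lborel_singleton)
    then show "AE s in (lborel :: real measure). (\<integral>\<^sup>+x. ?f (x, s) \<partial>lborel) \<le> indicator {0..1} s * (ennreal (4 * D^4) * (\<integral>\<^sup>+x. ?H x \<partial>lborel))"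
    proof eventually_elim
      case (elim s)
      show ?case
      proof (cases "0 < s \<and> s \<le> 1")
        case True
        then have s2: "0 < s^2" "s^2 \<le> 1" by (auto simp: power_le_one)
        let ?t = "v - s\<^sup>2 *\<^sub>R v"
        have arg: "v + s^2 *\<^sub>R (x - v) = ?t + s^2 *\<^sub>R x" for x by (simp add: algebra_simps)
        have inS: "?t + s^2 *\<^sub>R x \<in> S" if "x \<in> S" for x
        proof -
          have "(1 - s\<^sup>2) *\<^sub>R v + s^2 *\<^sub>R x \<in> S" using S(1,3) that s2 by (auto simp: convex_alt)
          then show ?thesis by (simp add: algebra_simps)
        qed
        have p: "s^6 \<le> (s^2) ^ CARD('n)"
        proof -
          have "s ^ 6 \<le> s ^ (2 * CARD('n))" using True d by (intro power_decreasing) auto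
          then show ?thesis by (simp add: power_mult)
        qed
        have "(\<integral>\<^sup>+x. ?f (x, s) \<partial>lborel) \<le> (\<integral>\<^sup>+x. ennreal (4 * D^4) * (ennreal ((s^2) ^ CARD('n)) * ?H (?t + s^2 *\<^sub>R x)) \<partial>lborel)"
        proof (rule nn_integral_mono)
          fix x
          have "indicator S x * indicator {0..1} s * (4 * s^6 * (D^4 * hess_sq q (v + s^2 *\<^sub>R (x - v))))
             \<le> 4 * D^4 * ((s^2) ^ CARD('n) * (indicator S (?t + s^2 *\<^sub>R x) * hess_sq q (?t + s^2 *\<^sub>R x)))"
          proof (cases "x \<in> S")
            case xS: True
            have "s^6 * (4 * D^4 * hess_sq q (?t + s^2 *\<^sub>R x)) \<le> (s^2) ^ CARD('n) * (4 * D^4 * hess_sq q (?t + s^2 *\<^sub>R x))"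
              by (intro mult_right_mono p mult_nonneg_nonneg hess_sq_nonneg) auto
            then show ?thesis unfolding arg using xS inS[OF xS] True by (simp add: mult_ac)
          qed (simp add: hess_sq_nonneg)
          then have "?f (x, s) \<le> ennreal (4 * D^4 * ((s^2) ^ CARD('n) * (indicator S (?t + s^2 *\<^sub>R x) * hess_sq q (?t + s^2 *\<^sub>R x))))"
            by (simp only: prod.case) (rule ennreal_leI)
          also have "\<dots> = ennreal (4 * D^4) * (ennreal ((s^2) ^ CARD('n)) * ?H (?t + s^2 *\<^sub>R x))"
            by (simp only: ennreal_mult' ennreal_mult'' zero_le_power zero_le_power2 zero_le_numeral mult_nonneg_nonneg zero_le_even_power even_numeral)
          finally show "?f (x, s) \<le> ennreal (4 * D^4) * (ennreal ((s^2) ^ CARD('n)) * ?H (?t + s^2 *\<^sub>R x))" .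
        qed
        also have "\<dots> = ennreal (4 * D^4) * (ennreal ((s^2) ^ CARD('n)) * (\<integral>\<^sup>+x. ?H (?t + s^2 *\<^sub>R x) \<partial>lborel))"
          by (simp add: nn_integral_cmult)
        also have "ennreal ((s^2) ^ CARD('n)) * (\<integral>\<^sup>+x. ?H (?t + s^2 *\<^sub>R x) \<partial>lborel) = (\<integral>\<^sup>+x. ?H x \<partial>lborel)"
          using nn_integral_lborel_affine[of ?H "s^2" ?t] s2 by simp
        finally show ?thesis using True by simp
      next
        case False
        then have "indicator {0..1} s = (0::real)" using elim by (auto simp: indicator_def)
        then show ?thesis by simp
      qed
    qed
  qed
  also have "\<dots> = ennreal (4 * D^4) * (\<integral>\<^sup>+x. ?H x \<partial>lborel)"
    by (simp add: nn_integral_multc)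
  finally have le: "(\<integral>\<^sup>+x. ennreal (indicator S x * (taylor_rem q v x)^2) \<partial>lborel) \<le> ennreal (4 * D^4) * (\<integral>\<^sup>+x. ?H x \<partial>lborel)" .
  have 1: "(\<integral>\<^sup>+x. ennreal (indicator S x * (taylor_rem q v x)^2) \<partial>lborel) = ennreal (LBINT x. indicator S x * (taylor_rem q v x)^2)"
    by (intro nn_integral_eq_integral intS continuous_intros cR) auto
  have 2: "(\<integral>\<^sup>+x. ?H x \<partial>lborel) = ennreal (LBINT x. indicator S x * hess_sq q x)"
    by (intro nn_integral_eq_integral intS cH AE_I2 mult_nonneg_nonneg hess_sq_nonneg) auto
  have 3: "0 \<le> (LBINT x. indicator S x * hess_sq q x)"
    by (intro integral_nonneg_AE AE_I2 mult_nonneg_nonneg hess_sq_nonneg) auto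
  have "ennreal (LBINT x. indicator S x * (taylor_rem q v x)^2) \<le> ennreal (4 * D^4 * (LBINT x. indicator S x * hess_sq q x))"
    using le unfolding 1 2 ennreal_mult''[OF 3, symmetric] .
  then show ?thesis using 3 D0 by (subst (asm) ennreal_le_iff) auto
qed

section \<open>Lipschitz functions in the Sobolev space\<close>

lemma abs_L2_tendsto:
  fixes f :: "nat \<Rightarrow> real^'n \<Rightarrow> real"
  assumes f: "\<And>n. f n \<in> borel_measurable borel" "\<And>n x. \<bar>f n x\<bar> \<le> B" "\<And>n x. f n x \<noteq> 0 \<Longrightarrow> norm x \<le> R"
    and g: "g \<in> borel_measurable borel" "\<And>x. \<bar>g x\<bar> \<le> B" "\<And>x. g x \<noteq> 0 \<Longrightarrow> norm x \<le> R"
    and lim: "AE x in lborel. (\<lambda>n. f n x) \<longlonglongrightarrow> g x"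
  shows "(\<lambda>n. abs_L2 (f n)) \<longlonglongrightarrow> abs_L2 g"
proof -
  have sf: "sq_integrable (f n)" for n by (rule sq_integrable_bounded_support[OF f])
  have sg: "sq_integrable g" by (rule sq_integrable_bounded_support[OF g])
  have "(\<lambda>n. LBINT x. (f n x - g x)^2) \<longlonglongrightarrow> (LINT x|(lborel::(real^'n) measure). (0::real))"
  proof (rule integral_dominated_convergence[where w = "\<lambda>x. (2 * B)^2 * indicator (cball (0::real^'n) R) x"])
    show "(\<lambda>x. (f n x - g x)^2) \<in> borel_measurable lborel" for n using f(1) g(1) by measurable
    show "integrable lborel (\<lambda>x. (2 * B)^2 * indicator (cball (0::real^'n) R) x)"
      using emeasure_lborel_cball_finite[of "0::real^'n" R] by simp
    show "AE x in lborel. (\<lambda>n. (f n x - g x)^2) \<longlonglongrightarrow> 0"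
      using lim
    proof eventually_elim
      case (elim x)
      then have "(\<lambda>n. (f n x - g x)^2) \<longlonglongrightarrow> (g x - g x)\<^sup>2" by (intro tendsto_intros)
      then show ?case by simp
    qed
    show "AE x in lborel. norm ((f n x - g x)^2) \<le> (2 * B)^2 * indicator (cball (0::real^'n) R) x" for n
    proof (rule AE_I2)
      fix x
      have "\<bar>f n x - g x\<bar> \<le> 2 * B" using f(2)[of n x] g(2)[of x] by linarith
      then have "(f n x - g x)^2 \<le> (2 * B)^2" by (rule power2_mono_abs)
      then show "norm ((f n x - g x)^2) \<le> (2 * B)^2 * indicator (cball (0::real^'n) R) x"
        using f(3)[of n x] g(3)[of x] by (cases "f n x = 0 \<and> g x = 0") (auto simp: indicator_def)
    qed
  qed auto
  then have "(\<lambda>n. (norm (abs_L2 (f n) - abs_L2 g))^2) \<longlonglongrightarrow> 0"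
    by (simp add: minus_abs_L2 sf sg norm_abs_L2 sq_integrable_diff)
  then have "(\<lambda>n. sqrt ((norm (abs_L2 (f n) - abs_L2 g))^2)) \<longlonglongrightarrow> sqrt 0" by (rule tendsto_real_sqrt)
  then have "(\<lambda>n. norm (abs_L2 (f n) - abs_L2 g)) \<longlonglongrightarrow> 0" by simp
  then show ?thesis by (rule LIM_zero_cancel[OF tendsto_norm_zero_cancel])
qed

lemma pderiv_dir_lipschitz_bound:
  fixes f :: "real^'n \<Rightarrow> real"
  assumes "f differentiable (at x)" "\<And>y. \<bar>f y - f x\<bar> \<le> L * norm (y - x)"
  shows "\<bar>pd i f x\<bar> \<le> L"
proof -
  have "((\<lambda>t. (f (x + t *\<^sub>R axis i 1) - f x) / t) \<longlongrightarrow> pd i f x) (at 0)"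
    using has_real_derivative_axis[where f = f and x = x and t = 0 and i = i] assms(1) by (simp add: DERIV_def)
  then have "((\<lambda>t. \<bar>(f (x + t *\<^sub>R axis i 1) - f x) / t\<bar>) \<longlongrightarrow> \<bar>pd i f x\<bar>) (at 0)"
    by (rule tendsto_rabs)
  moreover have "\<forall>\<^sub>F t in at 0. \<bar>(f (x + t *\<^sub>R axis i 1) - f x) / t\<bar> \<le> L"
  proof (rule eventually_at_topological[THEN iffD2], intro exI[of _ UNIV] conjI ballI impI open_UNIV UNIV_I)
    fix t :: real assume "t \<noteq> 0"
    then show "\<bar>(f (x + t *\<^sub>R axis i 1) - f x) / t\<bar> \<le> L"
      using assms(2)[of "x + t *\<^sub>R axis i 1"] by (simp add: divide_le_eq abs_divide)
  qed
  ultimately show ?thesis by (rule tendsto_upperbound) simp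
qed

text \<open>With \<open>e = 0\<close>, where \<open>p\<close> is affine, it computes increments of
  the mollification exactly; with \<open>c = 0\<close> it shows that Lipschitz constants are
  preserved.\<close>

lemma conv_kern_difference:
  fixes p :: "real^'n \<Rightarrow> real"
  assumes p: "integrable lborel p" and b: "b > 0"
    and "\<And>z. norm z < b \<Longrightarrow> \<bar>p (x - z) - p (y - z) - c\<bar> \<le> e"
  shows "\<bar>conv p (kern b) x - conv p (kern b) y - c\<bar> \<le> e"
proof -
  have i: "integrable lborel (\<lambda>z. p (x - z) * kern b z)" for x
    using conv_alt(1)[OF conv_kern_integrable[OF p b]] .
  have kint: "integrable lborel (kern b :: real^'n \<Rightarrow> real)" by (rule kern_integrable[OF b])
  have k1: "(LINT z|lborel. kern b (z::real^'n)) = 1" by (rule kern_integral[OF b])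
  have "conv p (kern b) x - conv p (kern b) y - c = (LINT z|lborel. p (x - z) * kern b z - p (y - z) * kern b z - c * kern b z)"
    using i kint k1 by (simp add: conv_alt(2)[OF conv_kern_integrable[OF p b]])
  also have "\<dots> = (LINT z|lborel. (p (x - z) - p (y - z) - c) * kern b z)"
    by (simp add: algebra_simps)
  finally have eq: "conv p (kern b) x - conv p (kern b) y - c = (LINT z|lborel. (p (x - z) - p (y - z) - c) * kern b z)" .
  have ii: "integrable lborel (\<lambda>z. (p (x - z) - p (y - z) - c) * kern b z)"
  proof -
    have "integrable lborel (\<lambda>z. p (x - z) * kern b z - p (y - z) * kern b z - c * kern b z)"
      using i kint by (intro Bochner_Integration.integrable_diff integrable_mult_right)
    then show ?thesis by (simp add: algebra_simps)
  qed
  have "\<bar>LINT z|lborel. (p (x - z) - p (y - z) - c) * kern b z\<bar> \<le> (LINT z|lborel. \<bar>(p (x - z) - p (y - z) - c) * kern b z\<bar>)"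
    by (rule integral_abs_bound)
  also have "\<dots> \<le> (LINT z|lborel. e * kern b (z::real^'n))"
  proof (rule integral_mono)
    show "integrable lborel (\<lambda>z. \<bar>(p (x - z) - p (y - z) - c) * kern b z\<bar>)" using ii by simp
    show "integrable lborel (\<lambda>z::real^'n. e * kern b z)" using kint by simp
    fix z :: "real^'n"
    show "\<bar>(p (x - z) - p (y - z) - c) * kern b z\<bar> \<le> e * kern b z"
      using assms(3)[of z] kern_support[OF b, of z] kern_nonneg[of b z]
      by (cases "kern b z = 0") (auto simp: abs_mult intro: mult_right_mono)
  qed
  finally show ?thesis unfolding eq using k1 by simp
qed

lemma continuous_on_of_lipschitz:
  fixes w :: "real^'n \<Rightarrow> real"
  assumes "0 \<le> M" "\<And>x y. \<bar>w x - w y\<bar> \<le> M * norm (x - y)"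
  shows "continuous_on UNIV w"
  using assms by (intro lipschitz_on_continuous_on[of M] lipschitz_onI) (auto simp: dist_norm)

context bounded_open
begin

text \<open>The approximating test functions are mollifications of the contracted function
  \<open>x \<mapsto> w (x\<^sub>0 + (1 + 1/(n+1)) (x - x\<^sub>0))\<close>, whose support is a compact subset of \<open>\<Omega>\<close>. At a point near
  which \<open>w\<close> is affine the gradients are eventually the exact ones.\<close>

lemma lipschitz_H10:
  fixes w :: "real^'n \<Rightarrow> real" and G :: "real^'n \<Rightarrow> real^'n"
  assumes convex: "convex \<Omega>" and x0: "x0 \<in> \<Omega>" and M: "\<And>x y. \<bar>w x - w y\<bar> \<le> M * norm (x - y)"
    and out: "\<And>x. x \<notin> \<Omega> \<Longrightarrow> w x = 0" and N: "AE x in lborel. x \<notin> N"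
    and loc: "\<And>x. x \<notin> N \<Longrightarrow> \<exists>r>0. \<exists>k. \<forall>y\<in>ball x r. w y = inner (G x) y + k"
    and Gm: "\<And>i. (\<lambda>x. G x $ i) \<in> borel_measurable borel"
    and Gb: "\<And>x i. \<bar>G x $ i\<bar> \<le> 2 * M" and Gout: "\<And>x i. G x $ i \<noteq> 0 \<Longrightarrow> x \<in> closure \<Omega>"
  shows "abs_L2 w \<in> H10 \<Omega>" "weak_deriv \<Omega> i (abs_L2 w) = abs_L2 (\<lambda>x. G x $ i)"
proof -
  have M0: "M \<ge> 0" using Gb[of 0 i] by linarith
  obtain R where R: "\<And>x. x \<in> closure \<Omega> \<Longrightarrow> norm x \<le> R"
    using bounded_closure[OF bounded\<Omega>] by (auto simp: bounded_iff)
  define t where "t = (\<lambda>n. 1 / real (Suc n))"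
  have t: "0 < t n" "t n \<le> 1" for n by (auto simp: t_def)
  have t0: "t \<longlonglongrightarrow> 0" unfolding t_def using LIMSEQ_inverse_real_of_nat by (simp add: inverse_eq_divide)
  define \<Lambda> where "\<Lambda> = (\<lambda>n x. x0 + (1 + t n) *\<^sub>R (x - x0))"
  define W where "W = (\<lambda>n x. w (\<Lambda> n x))"
  define K where "K = (\<lambda>n. (\<lambda>x. x0 + (1 / (1 + t n)) *\<^sub>R (x - x0)) ` closure \<Omega>)"
  have \<Lambda>diff: "\<Lambda> n x - \<Lambda> n y = (1 + t n) *\<^sub>R (x - y)" for n x y by (simp add: \<Lambda>_def algebra_simps)
  have cK: "compact (K n)" for n unfolding K_def
    by (intro compact_continuous_image continuous_intros) (simp add: compact_closure bounded\<Omega>)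
  have K\<Omega>: "K n \<subseteq> \<Omega>" for n
  proof
    fix y assume "y \<in> K n"
    then obtain x where x: "x \<in> closure \<Omega>" "y = x0 + (1 / (1 + t n)) *\<^sub>R (x - x0)" by (auto simp: K_def)
    define e where "e = t n / (1 + t n)"
    have e: "0 < e" "e \<le> 1" "1 / (1 + t n) = 1 - e" using t[of n] by (auto simp: e_def field_simps)
    have "x - e *\<^sub>R (x - x0) \<in> interior \<Omega>"
      by (rule mem_interior_closure_convex_shrink[OF convex _ x(1) e(1,2)]) (use x0 open\<Omega> in \<open>simp add: interior_open\<close>)
    moreover have "x - e *\<^sub>R (x - x0) = y" unfolding x(2) e(3) by (simp add: algebra_simps)
    ultimately show "y \<in> \<Omega>" using interior_subset by blast
  qed
  have WK: "x \<in> K n" if "W n x \<noteq> 0" for n x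
  proof -
    have "\<Lambda> n x \<in> closure \<Omega>" using out that closure_subset[of \<Omega>] by (auto simp: W_def)
    moreover have "x = x0 + (1 / (1 + t n)) *\<^sub>R (\<Lambda> n x - x0)" using t[of n] by (simp add: \<Lambda>_def)
    ultimately show ?thesis unfolding K_def by blast
  qed
  have "\<exists>e>0. (\<Union>x\<in>K n. ball x e) \<subseteq> \<Omega>" for n
    using compact_subset_open_imp_ball_epsilon_subset[OF cK open\<Omega> K\<Omega>] by metis
  then obtain e where e: "\<And>n. e n > 0" "\<And>n. (\<Union>x\<in>K n. ball x (e n)) \<subseteq> \<Omega>" by metis
  \<comment> \<open>Below the margin \<open>e n\<close>, so that the mollification stays supported
    in \<Omega>, and below \<open>t n\<close>, so that its effect disappears in the limit.\<close>
  define b where "b = (\<lambda>n. min (t n) (e n / 2))"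
  have b: "b n > 0" "b n \<le> t n" "b n \<le> e n / 2" for n using e(1) t by (auto simp: b_def)
  have Wlip: "\<bar>W n x - W n y\<bar> \<le> (2 * M) * norm (x - y)" for n x y
  proof -
    have "\<bar>W n x - W n y\<bar> \<le> M * norm (\<Lambda> n x - \<Lambda> n y)" unfolding W_def by (rule M)
    also have "\<dots> = M * (1 + t n) * norm (x - y)" using t[of n] by (simp add: \<Lambda>diff)
    also have "\<dots> \<le> M * 2 * norm (x - y)" using t[of n] M0 by (intro mult_right_mono mult_left_mono) auto
    finally show ?thesis by (simp add: mult_ac)
  qed
  have wc: "continuous_on UNIV w" by (rule continuous_on_of_lipschitz[OF M0 M])
  have Wc: "continuous_on UNIV (W n)" for n unfolding W_def \<Lambda>_def
    by (intro continuous_on_compose2[OF wc] continuous_intros) auto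
  have WR: "norm x \<le> R" if "W n x \<noteq> 0" for n x using WK[OF that] K\<Omega> closure_subset R by blast
  have Wint: "integrable lborel (W n)" for n by (rule continuous_bounded_support_integrable[OF Wc WR])
  define p where "p = (\<lambda>n. conv (W n) (kern (b n)))"
  have test: "p n \<in> test_functions \<Omega>" for n
  proof (rule test_functionsI)
    show "C_diff k (p n)" for k unfolding p_def by (rule C_diff_conv[OF Wint C_diff_kern kern_support_le[OF b(1)]])
    show "compact (\<Union>x\<in>K n. cball x (b n))" by (rule compact_minkowski_sum_cball[OF cK])
    show "(\<Union>x\<in>K n. cball x (b n)) \<subseteq> \<Omega>"
    proof -
      have "b n < e n" using b(3)[of n] e(1)[of n] by linarith
      then have "(\<Union>x\<in>K n. cball x (b n)) \<subseteq> (\<Union>x\<in>K n. ball x (e n))"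
        by (intro UN_mono order_refl) (simp add: cball_subset_ball_iff)
      then show ?thesis using e(2) by blast
    qed
    show "x \<in> (\<Union>x\<in>K n. cball x (b n))" if nz: "p n x \<noteq> 0" for x
    proof -
      obtain y where y: "W n y \<noteq> 0" "norm (x - y) < b n"
        using conv_kern_support[OF nz[unfolded p_def] b(1)] by blast
      have "x \<in> cball y (b n)" using y(2) by (simp add: dist_norm norm_minus_commute)
      then show ?thesis using WK[OF y(1)] by blast
    qed
  qed
  have pR: "norm x \<le> R" if "p n x \<noteq> 0" for n x
    using test_functionsD(2)[OF test that] closure_subset R by blast
  have pd: "p n differentiable (at x)" for n x using C_diff_differentiable test_functionsD(1)[OF test] by blast
  have plip: "\<bar>p n x - p n y\<bar> \<le> (2 * M) * norm (x - y)" for n x y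
  proof -
    have "\<bar>p n x - p n y - 0\<bar> \<le> (2 * M) * norm (x - y)"
      unfolding p_def
    proof (rule conv_kern_difference[OF Wint b(1)])
      show "\<bar>W n (x - z) - W n (y - z) - 0\<bar> \<le> (2 * M) * norm (x - y)" for z
        using Wlip[of n "x - z" "y - z"] by simp
    qed
    then show ?thesis by simp
  qed
  have \<Lambda>near: "norm (\<Lambda> n y - x) \<le> t n * (norm (x - x0) + 2 * c)" if y: "norm (y - x) \<le> c * t n" "1 \<le> c" for n x y c
  proof -
    have "\<Lambda> n y - x = (y - x) + t n *\<^sub>R (y - x0)" by (simp add: \<Lambda>_def algebra_simps)
    then have "norm (\<Lambda> n y - x) \<le> norm (y - x) + norm (t n *\<^sub>R (y - x0))" by (metis norm_triangle_ineq)
    also have "\<dots> \<le> c * t n + t n * (norm (x - x0) + c)"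
    proof -
      have "norm (y - x0) \<le> norm (y - x) + norm (x - x0)" using norm_triangle_ineq[of "y - x" "x - x0"] by simp
      moreover have "c * t n \<le> c * 1" using t[of n] y(2) by (intro mult_left_mono) auto
      ultimately have "norm (y - x0) \<le> norm (x - x0) + c" using y(1) by linarith
      then show ?thesis using y t[of n] by (simp add: add_mono mult_left_mono)
    qed
    finally show ?thesis by (simp add: algebra_simps)
  qed
  have near: "\<bar>p n x - w x\<bar> \<le> M * (t n * (norm (x - x0) + 2))" for n x
    unfolding p_def
  proof (rule conv_kern_near[OF Wint b(1)])
    fix y assume y: "norm (x - y) < b n"
    then have "norm (\<Lambda> n y - x) \<le> t n * (norm (x - x0) + 2)"
      using \<Lambda>near[of y x 1 n] b(2)[of n] t[of n] by (simp add: norm_minus_commute algebra_simps)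
    then have "M * norm (\<Lambda> n y - x) \<le> M * (t n * (norm (x - x0) + 2))" by (rule mult_left_mono[OF _ M0])
    then show "\<bar>W n y - w x\<bar> \<le> M * (t n * (norm (x - x0) + 2))" using M[of "\<Lambda> n y" x] by (simp add: W_def)
  qed
  have lim_w: "(\<lambda>n. p n x) \<longlonglongrightarrow> w x" for x
  proof (rule Lim_null[THEN iffD2], rule Lim_null_comparison)
    show "\<forall>\<^sub>F n in sequentially. norm (p n x - w x) \<le> M * (t n * (norm (x - x0) + 2))" using near by simp
    have "(\<lambda>n. M * (t n * (norm (x - x0) + 2))) \<longlonglongrightarrow> M * (0 * (norm (x - x0) + 2))" by (intro tendsto_intros t0)
    then show "(\<lambda>n. M * (t n * (norm (x - x0) + 2))) \<longlonglongrightarrow> 0" by simp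
  qed
  have lim_G: "(\<lambda>n. pd i (p n) x) \<longlonglongrightarrow> G x $ i" if x: "x \<notin> N" for x i
  proof -
    obtain r k where r: "r > 0" "\<And>y. y \<in> ball x r \<Longrightarrow> w y = inner (G x) y + k" using loc[OF x] by blast
    have "(\<lambda>n. t n * (norm (x - x0) + 6)) \<longlonglongrightarrow> 0 * (norm (x - x0) + 6)" by (intro tendsto_intros t0)
    then have "\<forall>\<^sub>F n in sequentially. t n * (norm (x - x0) + 6) < r" using order_tendstoD(2) r(1) by force
    \<comment> \<open>Once the points involved stay in the ball where \<open>w\<close> is affine,
      the mollification is affine near \<open>x\<close>, with gradient (1 + t n) G x.\<close>
    then have ev: "\<forall>\<^sub>F n in sequentially. pd i (p n) x = (1 + t n) * G x $ i"
    proof eventually_elim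
      case (elim n)
      have Win: "W n y = inner (G x) (\<Lambda> n y) + k" if y: "norm (y - x) < 2 * b n" for y
      proof -
        have "norm (\<Lambda> n y - x) \<le> t n * (norm (x - x0) + 4)"
          using \<Lambda>near[of y x 2 n] y b(2)[of n] t[of n] by (simp add: algebra_simps)
        also have "\<dots> < r" using elim t[of n] by (simp add: algebra_simps)
        finally have "\<Lambda> n y \<in> ball x r" by (simp add: dist_norm norm_minus_commute)
        then show ?thesis unfolding W_def by (rule r(2))
      qed
      have loc: "p n x + (1 + t n) * inner (G x) (y - x) = p n y" if y: "y \<in> ball x (b n)" for y
      proof -
        have "\<bar>p n y - p n x - (1 + t n) * inner (G x) (y - x)\<bar> \<le> 0"
          unfolding p_def
        proof (rule conv_kern_difference[OF Wint b(1)])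
          fix z :: "real^'n" assume z: "norm z < b n"
          have 1: "norm ((y - z) - x) < 2 * b n"
            using y z norm_triangle_ineq4[of "y - x" z] by (simp add: dist_norm norm_minus_commute algebra_simps)
          have 2: "norm ((x - z) - x) < 2 * b n" using z b(1)[of n] by simp
          have "W n (y - z) - W n (x - z) = inner (G x) (\<Lambda> n (y - z) - \<Lambda> n (x - z))"
            using Win[OF 1] Win[OF 2] by (simp add: inner_diff_right)
          also have "\<dots> = (1 + t n) * inner (G x) (y - x)" by (simp add: \<Lambda>diff)
          finally show "\<bar>W n (y - z) - W n (x - z) - (1 + t n) * inner (G x) (y - x)\<bar> \<le> 0" by simp
        qed
        then show ?thesis by simp
      qed
      have "((\<lambda>y. p n x + (1 + t n) * inner (G x) (y - x)) has_derivative (\<lambda>h. (1 + t n) * inner (G x) h)) (at x)"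
        by (auto intro!: derivative_eq_intros)
      then have "(p n has_derivative (\<lambda>h. (1 + t n) * inner (G x) h)) (at x)"
        by (rule has_derivative_transform_within_open[where s = "ball x (b n)"]) (use loc b(1) in auto)
      from pderiv_dir_eqI[OF this, of i] show ?case by (simp add: inner_axis)
    qed
    have "(\<lambda>n. (1 + t n) * G x $ i) \<longlonglongrightarrow> (1 + 0) * G x $ i" by (intro tendsto_intros t0)
    then show ?thesis unfolding tendsto_cong[OF ev] by simp
  qed
  have wR: "norm x \<le> R" if "w x \<noteq> 0" for x using out that closure_subset[of \<Omega>] R by blast
  obtain B where B: "\<And>x. \<bar>w x\<bar> \<le> B" using bounded_support_bound[OF wc wR] by blast
  obtain B' where B': "\<And>n x. \<bar>p n x\<bar> \<le> B'"
  proof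
    show "\<bar>p n x\<bar> \<le> B + M * (R + norm x0 + 2)" for n x
    proof (cases "p n x = 0")
      case True
      have "0 \<le> B" using B[of 0] by linarith
      moreover have "x0 \<in> closure \<Omega>" using x0 closure_subset by blast
      then have "0 \<le> R" using R[of x0] norm_ge_zero[of x0] by linarith
      ultimately show ?thesis using True M0 by simp
    next
      case False
      have "norm (x - x0) \<le> R + norm x0" using pR[OF False] norm_triangle_ineq4[of x x0] by linarith
      then have "t n * (norm (x - x0) + 2) \<le> 1 * (R + norm x0 + 2)" using t[of n] by (intro mult_mono) auto
      then have "M * (t n * (norm (x - x0) + 2)) \<le> M * (R + norm x0 + 2)" by (intro mult_left_mono M0) simp
      then show ?thesis using near[of n x] B[of x] by linarith
    qed
  qed
  have L1: "(\<lambda>n. abs_L2 (p n)) \<longlonglongrightarrow> abs_L2 w"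
  proof (rule abs_L2_tendsto[where B = "max B B'" and R = R])
    show "p n \<in> borel_measurable borel" for n using C_diff_measurable[OF test_functionsD(1)[OF test]] .
    show "w \<in> borel_measurable borel" by (rule borel_measurable_continuous_onI[OF wc])
    show "\<bar>p n x\<bar> \<le> max B B'" for n x using B'[of n x] by simp
    show "\<bar>w x\<bar> \<le> max B B'" for x using B[of x] by simp
    show "AE x in lborel. (\<lambda>n. p n x) \<longlonglongrightarrow> w x" using lim_w by simp
  qed (use pR wR in auto)
  have L2: "(\<lambda>n. abs_L2 (pd i (p n))) \<longlonglongrightarrow> abs_L2 (\<lambda>x. G x $ i)" for i
  proof (rule abs_L2_tendsto[where B = "2 * M" and R = R])
    show "pd i (p n) \<in> borel_measurable borel" for n
      using C_diff_measurable[OF test_functionsD(1)[OF test_functions_pderiv[OF test]]] .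
    show "\<bar>pd i (p n) x\<bar> \<le> 2 * M" for n x by (rule pderiv_dir_lipschitz_bound[OF pd plip])
    show "norm x \<le> R" if "pd i (p n) x \<noteq> 0" for n x by (rule pderiv_dir_zero_outside[OF pR that])
    show "AE x in lborel. (\<lambda>n. pd i (p n) x) \<longlonglongrightarrow> G x $ i"
      using N by eventually_elim (rule lim_G)
    show "norm x \<le> R" if "G x $ i \<noteq> 0" for x using Gout[OF that] by (rule R)
  qed (use Gm Gb in auto)
  show "abs_L2 w \<in> H10 \<Omega>" by (rule H10_limit(1)[OF test L1 L2])
  show "weak_deriv \<Omega> i (abs_L2 w) = abs_L2 (\<lambda>x. G x $ i)" by (rule H10_limit(2)[OF test L1 L2])
qed

end

section \<open>Finite element functions\<close>

lemma affine_interpolation: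
  fixes C :: "(real^'n) set" and c :: "real^'n \<Rightarrow> real"
  assumes "\<not> affine_dependent C"
  shows "\<exists>p. \<forall>v\<in>C. inner (fst p) v + snd p = c v"
proof (cases "C = {}")
  case False
  then obtain v0 where v0: "v0 \<in> C" by auto
  have "independent ((\<lambda>x. - v0 + x) ` (C - {v0}))"
    using assms affine_dependent_iff_dependent2[OF v0] by simp
  then obtain g :: "real^'n \<Rightarrow> real" where g: "linear g" "\<forall>x\<in>(\<lambda>x. - v0 + x) ` (C - {v0}). g x = c (v0 + x) - c v0"
    using linear_independent_extend[of _ "\<lambda>x. c (v0 + x) - c v0"] by blast
  define a where "a = (\<chi> i. g (axis i 1))"
  have ga: "g x = inner a x" for x
  proof -
    have "g x = g (\<Sum>i\<in>UNIV. x $ i *\<^sub>R axis i 1)"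
      by (metis (no_types, lifting) basis_expansion scalar_mult_eq_scaleR sum.cong)
    also have "\<dots> = (\<Sum>i\<in>UNIV. x $ i *\<^sub>R g (axis i 1))" using g(1) by (simp add: linear_sum linear_scale)
    finally show ?thesis by (simp add: a_def inner_vec_def mult.commute)
  qed
  have "inner a v + (c v0 - inner a v0) = c v" if v: "v \<in> C" for v
  proof (cases "v = v0")
    case False
    then have "g (- v0 + v) = c (v0 + (- v0 + v)) - c v0" using g(2) v by blast
    then show ?thesis by (simp add: ga inner_diff_right)
  qed simp
  then show ?thesis by (intro exI[of _ "(a, c v0 - inner a v0)"]) auto
qed auto

text \<open>A bound at the vertices holds on the hull. Comparing the two ends of a chord of length 2
  t through the centre of the ball, parallel to \<open>b\<close>, gives t * norm b \<le> m for every
  t below \<open>r\<close>.\<close>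

lemma affine_gradient_bound:
  fixes b z :: "real^'n"
  assumes S: "S = convex hull C" and C: "\<And>v. v \<in> C \<Longrightarrow> \<bar>inner b v + \<kappa>\<bar> \<le> m" and ball: "ball z r \<subseteq> S" and r: "r > 0"
  shows "r * norm b \<le> m"
proof -
  have "convex {y. \<bar>inner b y + \<kappa>\<bar> \<le> m}"
  proof -
    have "{y. \<bar>inner b y + \<kappa>\<bar> \<le> m} = {y. inner b y \<le> m - \<kappa>} \<inter> {y. inner b y \<ge> - m - \<kappa>}" by auto
    then show ?thesis by (simp add: convex_Int convex_halfspace_le convex_halfspace_ge)
  qed
  then have "S \<subseteq> {y. \<bar>inner b y + \<kappa>\<bar> \<le> m}" unfolding S by (intro hull_minimal) (use C in auto)
  then have L: "\<bar>inner b y + \<kappa>\<bar> \<le> m" if "y \<in> ball z r" for y using ball that by blast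
  have "t * norm b \<le> m" if t: "0 < t" "t < r" for t
  proof (cases "b = 0")
    case False
    define u where "u = (t / norm b) *\<^sub>R b"
    have u: "norm u = t" "inner b u = t * norm b" using False t by (auto simp: u_def dot_square_norm power2_eq_square)
    have "z + u \<in> ball z r" "z - u \<in> ball z r" using u t by (auto simp: dist_norm)
    from L[OF this(1)] L[OF this(2)] show ?thesis using u(2) by (simp add: inner_add_right inner_diff_right abs_le_iff)
  qed (use L[of z] r in simp)
  then have "\<forall>\<^sub>F t in at_left r. t * norm b \<le> m"
    using r unfolding eventually_at_left_field by blast
  moreover have "((\<lambda>t. t * norm b) \<longlongrightarrow> r * norm b) (at_left r)" by (intro tendsto_intros)
  ultimately show ?thesis by (intro tendsto_upperbound) auto
qed

section \<open>Continuous piecewise affine functions on a triangulation\<close>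

locale fe_mesh = polytope_domain F \<Omega> for F :: "((real^'n) \<times> real) set" and \<Omega> +
  fixes T :: "(real^'n) set set"
  assumes part: "simplicial_partition \<Omega> T"
begin

sublocale bounded_open \<Omega>
  by unfold_locales (rule open_\<Omega>, rule bnd\<Omega>)

definition V where "V S = (SOME C. \<not> affine_dependent C \<and> card C = CARD('n) + 1 \<and> S = convex hull C)"

lemma finT: "finite T" using part by (simp add: simplicial_partition_def triangulation_def)

lemma V:
  assumes "S \<in> T"
  shows "\<not> affine_dependent (V S)" "card (V S) = CARD('n) + 1" "S = convex hull (V S)" "finite (V S)" "V S \<subseteq> S"
proof -
  have "int CARD('n) simplex S" using part assms by (simp add: simplicial_partition_def)
  then have "\<exists>C. \<not> affine_dependent C \<and> card C = CARD('n) + 1 \<and> S = convex hull C"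
    unfolding simplex_def by (metis of_nat_1 of_nat_add of_nat_eq_iff)
  from someI_ex[OF this] show "\<not> affine_dependent (V S)" "card (V S) = CARD('n) + 1" and eq: "S = convex hull (V S)"
    by (auto simp: V_def)
  then show "finite (V S)" by (simp add: aff_independent_finite)
  show "V S \<subseteq> S" by (subst eq) (rule hull_subset)
qed

lemma simplex_props:
  assumes "S \<in> T"
  shows "compact S" "convex S" "closed S" "S \<subseteq> closure \<Omega>" "interior S \<subseteq> \<Omega>"
proof -
  show "compact S" "convex S" using V[OF assms] by (metis finite_imp_compact_convex_hull, metis convex_convex_hull)
  then show "closed S" by (simp add: compact_imp_closed)
  show "S \<subseteq> closure \<Omega>" using part assms by (auto simp: simplicial_partition_def)
  then have "interior S \<subseteq> interior (closure \<Omega>)" by (rule interior_mono)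
  then show "interior S \<subseteq> \<Omega>" by (simp add: convex_interior_closure[OF convex_\<Omega>] interior_open[OF open_\<Omega>])
qed

lemma cover: "closure \<Omega> = \<Union>T" using part by (simp add: simplicial_partition_def)

lemma face: "S \<in> T \<Longrightarrow> S' \<in> T \<Longrightarrow> (S \<inter> S') face_of S"
  using part by (auto simp: simplicial_partition_def triangulation_def)

text \<open>The intersection is a face of both simplices, and a face that meets the interior is the
  whole simplex; so both would coincide with the intersection.\<close>

lemma disjoint_interior:
  assumes "S \<in> T" "S' \<in> T" "S \<noteq> S'"
  shows "interior S \<inter> interior S' = {}"
proof (rule ccontr)
  assume "interior S \<inter> interior S' \<noteq> {}"
  then obtain x where x: "x \<in> interior S" "x \<in> interior S'" by auto
  then have xS: "x \<in> S \<inter> S'" using interior_subset by blast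
  have "S \<inter> S' = S" using face_of_disjoint_interior[OF face[OF assms(1,2)]] xS x(1) by blast
  moreover have "S' \<inter> S = S'" using face_of_disjoint_interior[OF face[OF assms(2,1)]] xS x(2) by blast
  ultimately show False using assms(3) by blast
qed

lemma sum_indicator_interior:
  assumes "S \<in> T" "x \<in> interior S"
  shows "(\<Sum>S'\<in>T. indicator (interior S') x * f S') = (f S :: real)"
proof -
  have "(\<Sum>S'\<in>T. indicator (interior S') x * f S') = (\<Sum>S'\<in>T. if S' = S then f S else 0)"
    using disjoint_interior assms by (intro sum.cong) (auto simp: indicator_def)
  then show ?thesis using finT assms(1) by simp
qed

definition coeff where "coeff c S = (SOME p. \<forall>v\<in>V S. inner (fst p) v + snd p = c v)"

lemma coeff: "S \<in> T \<Longrightarrow> v \<in> V S \<Longrightarrow> inner (fst (coeff c S)) v + snd (coeff c S) = c v"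
  using someI_ex[OF affine_interpolation[OF V(1), of S c]] unfolding coeff_def by blast

definition aff where "aff c S x = inner (fst (coeff c S)) x + snd (coeff c S)"

text \<open>The common face is the hull of a subset of the vertices of either simplex, and its
  extreme points identify the two subsets. The affine functions agree at these common vertices,
  hence on the face.\<close>

lemma aff_consistent:
  assumes "S \<in> T" "S' \<in> T" "x \<in> S" "x \<in> S'"
  shows "aff c S x = aff c S' x"
proof -
  obtain C1 where C1: "C1 \<subseteq> V S" "S \<inter> S' = convex hull C1"
    using face[OF assms(1,2)] V[OF assms(1)] face_of_convex_hull_affine_independent by metis
  obtain C2 where C2: "C2 \<subseteq> V S'" "S' \<inter> S = convex hull C2"
    using face[OF assms(2,1)] V[OF assms(2)] face_of_convex_hull_affine_independent by metis
  have "\<not> affine_dependent C1" "\<not> affine_dependent C2"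
    using V(1)[OF assms(1)] V(1)[OF assms(2)] C1(1) C2(1) affine_dependent_subset by blast+
  then have "v \<in> C1 \<longleftrightarrow> v \<in> C2" for v
    using extreme_point_of_convex_hull_affine_independent[of C1 v] extreme_point_of_convex_hull_affine_independent[of C2 v]
      C1(2) C2(2) by (metis Int_commute)
  then have C12: "C1 \<subseteq> V S'" using C2(1) by blast
  let ?H = "{y. inner (fst (coeff c S) - fst (coeff c S')) y = snd (coeff c S') - snd (coeff c S)}"
  have "convex hull C1 \<subseteq> ?H"
  proof (rule hull_minimal)
    show "C1 \<subseteq> ?H"
      using coeff[OF assms(1), of _ c] coeff[OF assms(2), of _ c] C1(1) C12
      by (fastforce simp: inner_diff_left)
    show "convex ?H" by (rule convex_hyperplane)
  qed
  then have "x \<in> ?H" using assms(3,4) C1(2) by blast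
  then show ?thesis by (simp add: aff_def inner_diff_left)
qed

definition fe where "fe c x = (if \<exists>S\<in>T. x \<in> S then aff c (SOME S. S \<in> T \<and> x \<in> S) x else 0)"

lemma fe_eq: "S \<in> T \<Longrightarrow> x \<in> S \<Longrightarrow> fe c x = aff c S x"
proof -
  assume S: "S \<in> T" "x \<in> S"
  then have ex: "\<exists>S. S \<in> T \<and> x \<in> S" by blast
  then have ch: "(SOME S. S \<in> T \<and> x \<in> S) \<in> T" "x \<in> (SOME S. S \<in> T \<and> x \<in> S)"
    using someI_ex[OF ex] by auto
  have "fe c x = aff c (SOME S. S \<in> T \<and> x \<in> S) x" using ex by (simp add: fe_def Bex_def)
  also have "\<dots> = aff c S x" by (rule aff_consistent[OF ch(1) S(1) ch(2) S(2)])
  finally show ?thesis .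
qed

lemma fe_outside: "x \<notin> closure \<Omega> \<Longrightarrow> fe c x = 0"
  unfolding fe_def cover by auto

text \<open>A boundary point lies on one of the hyperplanes. When it is written as a convex
  combination of vertices, only vertices on this hyperplane carry positive weight; they are outside
  \<Omega>, where the nodal values vanish.\<close>

lemma fe_zero:
  assumes c: "\<And>v. v \<notin> \<Omega> \<Longrightarrow> c v = 0" and x: "x \<notin> \<Omega>"
  shows "fe c x = 0"
proof (cases "x \<in> closure \<Omega>")
  case True
  then obtain S where S: "S \<in> T" "x \<in> S" unfolding cover by blast
  obtain f where f: "f \<in> F" "inner (fst f) x = snd f"
    using x closure_le[OF True] unfolding \<Omega> by force
  obtain u where u: "\<And>v. v \<in> V S \<Longrightarrow> 0 \<le> u v" "sum u (V S) = 1" "(\<Sum>v\<in>V S. u v *\<^sub>R v) = x"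
  proof -
    have "x \<in> convex hull (V S)" using S(2) V(3)[OF S(1)] by simp
    then have "\<exists>u. (\<forall>v\<in>V S. 0 \<le> u v) \<and> sum u (V S) = 1 \<and> (\<Sum>v\<in>V S. u v *\<^sub>R v) = x"
      unfolding convex_hull_finite[OF V(4)[OF S(1)]] by (rule CollectD)
    then show thesis using that by blast
  qed
  have nn: "0 \<le> u v * (snd f - inner (fst f) v)" if "v \<in> V S" for v
    using u(1)[OF that] closure_le[OF _ f(1), of v] V(5)[OF S(1)] simplex_props(4)[OF S(1)] that by auto
  have "(\<Sum>v\<in>V S. u v * (snd f - inner (fst f) v)) = snd f * sum u (V S) - inner (fst f) (\<Sum>v\<in>V S. u v *\<^sub>R v)"
    by (simp add: right_diff_distrib sum_subtractf inner_sum_right sum_distrib_left mult.commute)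
  also have "\<dots> = 0" using u f(2) by simp
  finally have "\<forall>v\<in>V S. u v * (snd f - inner (fst f) v) = 0"
    by (subst (asm) sum_nonneg_eq_0_iff[OF V(4)[OF S(1)]]) (use nn in auto)
  then have z: "u v * c v = 0" if "v \<in> V S" for v
  proof (cases "u v = 0")
    case False
    then have "v \<notin> \<Omega>" using \<open>\<forall>v\<in>V S. _\<close> that f(1) unfolding \<Omega> by force
    then show ?thesis using c by simp
  qed simp
  have "fe c x = aff c S x" by (rule fe_eq[OF S])
  also have "\<dots> = (\<Sum>v\<in>V S. u v * (inner (fst (coeff c S)) v + snd (coeff c S)))"
    unfolding aff_def u(3)[symmetric] using u(2)
    by (simp add: inner_sum_right distrib_left sum.distrib sum_distrib_right[symmetric])
  also have "\<dots> = (\<Sum>v\<in>V S. u v * c v)" by (intro sum.cong) (simp_all add: coeff[OF S(1)])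
  also have "\<dots> = 0" by (simp add: z)
  finally show ?thesis .
qed (rule fe_outside)

text \<open>A crude constant, a sum in place of a maximum: only its finiteness matters, for
  membership in \<open>H10 \<Omega>\<close>.\<close>

definition lip where "lip c = (\<Sum>S\<in>T. norm (fst (coeff c S)))"

lemma lip_nonneg: "lip c \<ge> 0" unfolding lip_def by (simp add: sum_nonneg)

lemma lip_ge: "S \<in> T \<Longrightarrow> norm (fst (coeff c S)) \<le> lip c"
  unfolding lip_def using finT by (intro member_le_sum) auto

text \<open>The simplices cut a segment into finitely many closed pieces on which the function is
  affine, and a common Lipschitz constant of such pieces is one for the whole segment.\<close>

lemma fe_lipschitz_closure:
  assumes "x \<in> closure \<Omega>" "y \<in> closure \<Omega>"
  shows "\<bar>fe c x - fe c y\<bar> \<le> lip c * norm (x - y)"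
proof -
  define l where "l = (\<lambda>t::real. (1 - t) *\<^sub>R y + t *\<^sub>R x)"
  have l: "continuous_on A l" for A unfolding l_def by (intro continuous_intros)
  have ldist: "norm (l s - l t) = \<bar>s - t\<bar> * norm (x - y)" for s t
  proof -
    have "l s - l t = (s - t) *\<^sub>R (x - y)" by (simp add: l_def algebra_simps)
    then show ?thesis by simp
  qed
  have "(lip c * norm (x - y))-lipschitz_on {0..1} (\<lambda>t. fe c (l t))"
  proof (rule lipschitz_on_closed_Union[where I = T and U = "\<lambda>S. l -` S"])
    show "(lip c * norm (x - y))-lipschitz_on (l -` S) (\<lambda>t. fe c (l t))" if S: "S \<in> T" for S
    proof (rule lipschitz_onI)
      fix s t assume "s \<in> l -` S" "t \<in> l -` S"
      then have "fe c (l s) - fe c (l t) = inner (fst (coeff c S)) (l s - l t)"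
        using fe_eq[OF S] by (simp add: aff_def inner_diff_right)
      then have "\<bar>fe c (l s) - fe c (l t)\<bar> \<le> norm (fst (coeff c S)) * norm (l s - l t)"
        using Cauchy_Schwarz_ineq2 by simp
      also have "\<dots> \<le> lip c * norm (l s - l t)" by (intro mult_right_mono lip_ge[OF S]) simp
      finally show "dist (fe c (l s)) (fe c (l t)) \<le> lip c * norm (x - y) * dist s t"
        by (simp add: dist_real_def ldist mult_ac)
    qed (simp add: lip_nonneg)
    show "closed (l -` S)" if "S \<in> T" for S
      using continuous_closed_vimage[OF simplex_props(3)[OF that], of l] l[of UNIV] by (simp add: continuous_on_eq_continuous_at)
    show "{0..1} \<subseteq> (\<Union>S\<in>T. l -` S)"
    proof
      fix t :: real assume "t \<in> {0..1}"
      then have "l t \<in> closure \<Omega>" using convex_closure[OF convex_\<Omega>] assms by (auto simp: l_def convex_alt)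
      then show "t \<in> (\<Union>S\<in>T. l -` S)" unfolding cover by auto
    qed
  qed (auto simp: finT lip_nonneg)
  from lipschitz_onD[OF this, of 1 0] show ?thesis by (simp add: l_def dist_real_def)
qed

text \<open>A segment that leaves the closure crosses its frontier, where the function is 0 just as
  it is outside.\<close>

lemma fe_lipschitz:
  assumes c: "\<And>v. v \<notin> \<Omega> \<Longrightarrow> c v = 0"
  shows "\<bar>fe c x - fe c y\<bar> \<le> lip c * norm (x - y)"
proof -
  have one: "\<bar>fe c x - fe c y\<bar> \<le> lip c * norm (x - y)" if x: "x \<in> closure \<Omega>" and y: "y \<notin> closure \<Omega>" for x y
  proof -
    have "closed_segment x y \<inter> frontier (closure \<Omega>) \<noteq> {}"
      by (rule connected_Int_frontier) (use x y in auto)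
    then obtain z where z: "z \<in> closed_segment x y" "z \<in> frontier (closure \<Omega>)" by auto
    have "z \<in> closure \<Omega>" "z \<notin> \<Omega>" using z(2) interior_open[OF open_\<Omega>] convex_interior_closure[OF convex_\<Omega>]
      by (auto simp: frontier_def)
    then have "\<bar>fe c x - fe c y\<bar> = \<bar>fe c x - fe c z\<bar>"
      using fe_zero[OF c] fe_outside[OF y] by simp
    also have "\<dots> \<le> lip c * norm (x - z)" by (rule fe_lipschitz_closure[OF x \<open>z \<in> closure \<Omega>\<close>])
    also have "\<dots> \<le> lip c * norm (x - y)"
      using dist_in_closed_segment[OF z(1)] by (intro mult_left_mono lip_nonneg) (auto simp: dist_norm norm_minus_commute)
    finally show ?thesis .
  qed
  consider "x \<in> closure \<Omega>" "y \<in> closure \<Omega>" | "x \<in> closure \<Omega>" "y \<notin> closure \<Omega>" | "x \<notin> closure \<Omega>" "y \<in> closure \<Omega>" | "x \<notin> closure \<Omega>" "y \<notin> closure \<Omega>" by blast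
  then show ?thesis
  proof cases
    case 3
    then show ?thesis using one[of y x] by (simp add: norm_minus_commute abs_minus_commute)
  next
    case 4
    then show ?thesis using lip_nonneg by (simp add: fe_outside)
  qed (use one fe_lipschitz_closure in auto)
qed

definition skel where "skel = (\<Union>S\<in>T. frontier S)"

lemma AE_skel: "AE x in lborel. x \<notin> skel"
proof -
  have "negligible skel" unfolding skel_def
    using finT simplex_props(2) by (intro negligible_Union) (auto intro: negligible_convex_frontier)
  then have "skel \<in> null_sets lebesgue" by (simp add: negligible_iff_null_sets)
  moreover have sb: "skel \<in> sets borel" unfolding skel_def
    using finT by (intro borel_closed closed_UN) auto
  ultimately have "skel \<in> null_sets lborel" by (auto simp: null_sets_def)
  then show ?thesis by (rule AE_not_in)
qed

lemma not_skel_cases: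
  assumes "x \<notin> skel"
  obtains "x \<notin> closure \<Omega>" | S where "S \<in> T" "x \<in> interior S"
proof (cases "x \<in> closure \<Omega>")
  case True
  then obtain S where "S \<in> T" "x \<in> S" unfolding cover by blast
  then have "x \<in> interior S" using assms closure_subset[of S] by (auto simp: skel_def frontier_def)
  then show ?thesis using that \<open>S \<in> T\<close> by blast
qed (use that in blast)

definition Gc where "Gc c x = (\<chi> i. \<Sum>S\<in>T. indicator (interior S) x * fst (coeff c S) $ i)"

lemma Gc_interior: "S \<in> T \<Longrightarrow> x \<in> interior S \<Longrightarrow> Gc c x = fst (coeff c S)"
  unfolding Gc_def vec_eq_iff by (auto simp: sum_indicator_interior)

lemma Gc_outside: "x \<notin> closure \<Omega> \<Longrightarrow> Gc c x = 0"
proof -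
  assume x: "x \<notin> closure \<Omega>"
  have "indicator (interior S) x = (0::real)" if "S \<in> T" for S
    using simplex_props(5)[OF that] closure_subset[of \<Omega>] x by (auto simp: indicator_def)
  then show ?thesis by (simp add: Gc_def vec_eq_iff)
qed

lemma Gc_bound: "\<bar>Gc c x $ i\<bar> \<le> lip c"
proof -
  have "\<bar>Gc c x $ i\<bar> \<le> (\<Sum>S\<in>T. \<bar>indicator (interior S) x * fst (coeff c S) $ i\<bar>)"
    unfolding Gc_def by (simp add: sum_abs)
  also have "\<dots> \<le> lip c" unfolding lip_def
  proof (rule sum_mono)
    fix S
    have "\<bar>indicator (interior S) x * fst (coeff c S) $ i\<bar> \<le> \<bar>fst (coeff c S) $ i\<bar>" by (simp add: indicator_def)
    also have "\<dots> \<le> norm (fst (coeff c S))" by (rule component_le_norm_cart)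
    finally show "\<bar>indicator (interior S) x * fst (coeff c S) $ i\<bar> \<le> norm (fst (coeff c S))" .
  qed
  finally show ?thesis .
qed

lemma Gc_measurable: "(\<lambda>x. Gc c x $ i) \<in> borel_measurable borel"
  unfolding Gc_def by (simp add: borel_measurable_sum borel_measurable_times borel_measurable_indicator borel_open)

text \<open>Off the null set \<open>skel\<close> the function is locally affine with gradient
  \<open>Gc c\<close>, and it vanishes off \<Omega>; these are the premises of
  \<open>lipschitz_H10\<close>.\<close>

lemma fe_in_fe_space:
  assumes c: "\<And>v. v \<notin> \<Omega> \<Longrightarrow> c v = 0"
  shows "abs_L2 (fe c) \<in> fe_space \<Omega> T" "weak_deriv \<Omega> i (abs_L2 (fe c)) = abs_L2 (\<lambda>x. Gc c x $ i)"
proof -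
  obtain x0 where x0: "x0 \<in> \<Omega>" using ne\<Omega> by auto
  have loc: "\<exists>r>0. \<exists>k. \<forall>y\<in>ball x r. fe c y = inner (Gc c x) y + k" if "x \<notin> skel" for x
    using that
  proof (cases rule: not_skel_cases)
    case 1
    then obtain r where r: "r > 0" "ball x r \<subseteq> - closure \<Omega>"
      using open_contains_ball[of "- closure \<Omega>"] by auto
    then have "fe c y = inner (Gc c x) y + 0" if "y \<in> ball x r" for y
      using that fe_outside[of y c] Gc_outside[OF 1] by auto
    then show ?thesis using r(1) by blast
  next
    case (2 S)
    then obtain r where r: "r > 0" "ball x r \<subseteq> S" using mem_interior by blast
    then have "fe c y = inner (Gc c x) y + snd (coeff c S)" if "y \<in> ball x r" for y
      using that fe_eq[OF 2(1), of y c] Gc_interior[OF 2, of c] by (auto simp: aff_def)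
    then show ?thesis using r(1) by blast
  qed
  have Gb: "\<bar>Gc c x $ i\<bar> \<le> 2 * lip c" for x i using Gc_bound[of c x i] lip_nonneg[of c] by linarith
  have Gout: "x \<in> closure \<Omega>" if "Gc c x $ i \<noteq> 0" for x i using Gc_outside[of x c] that by force
  have fz: "fe c x = 0" if "x \<notin> \<Omega>" for x by (rule fe_zero[OF _ that]) (rule c)
  have fl: "\<bar>fe c x - fe c y\<bar> \<le> lip c * norm (x - y)" for x y by (rule fe_lipschitz) (rule c)
  note L = lipschitz_H10[OF convex_\<Omega> x0 fl fz AE_skel loc Gc_measurable Gb Gout]
  show "weak_deriv \<Omega> i (abs_L2 (fe c)) = abs_L2 (\<lambda>x. Gc c x $ i)" by (rule L(2))
  have H: "abs_L2 (fe c) \<in> H10 \<Omega>" by (rule L(1))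
  have cont: "continuous_on UNIV (fe c)" by (rule continuous_on_of_lipschitz[OF lip_nonneg fl])
  obtain R where R: "\<And>x. x \<in> \<Omega> \<Longrightarrow> norm x \<le> R" using bnd\<Omega> by (auto simp: bounded_iff)
  have "sq_integrable (fe c)"
    by (rule continuous_bounded_support_sq_integrable[OF cont, of R]) (metis fz R)
  then have ae: "AE x in lborel. rep_L2 (abs_L2 (fe c)) x = fe c x" by (rule rep_abs_L2)
  have "AE x in lborel. x \<in> S \<longrightarrow> rep_L2 (abs_L2 (fe c)) x = inner (fst (coeff c S)) x + snd (coeff c S)" if "S \<in> T" for S
    using ae by eventually_elim (auto simp: fe_eq[OF that] aff_def)
  then show "abs_L2 (fe c) \<in> fe_space \<Omega> T" using H unfolding fe_space_def by blast
qed

text \<open>\<open>b\<close> and \<open>\<kappa>\<close> describe the interpolant minus the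
  first-order Taylor polynomial of \<open>q\<close> at \<open>x\<close>. At a vertex this affine
  function equals the Taylor remainder plus \<open>c v - q v\<close>, so
  \<open>affine_gradient_bound\<close> applies. \<eta> allows for boundary nodes whose values are
  reset to 0.\<close>

lemma interp_gradient_error:
  fixes \<eta> :: real
  assumes S: "S \<in> T" and x: "x \<in> S" and ball: "ball z r \<subseteq> S" and r: "r > 0" and \<eta>: "\<And>v. v \<in> V S \<Longrightarrow> \<bar>c v - q v\<bar> \<le> \<eta>"
  shows "r^2 * (\<Sum>i\<in>UNIV. (pd i q x - fst (coeff c S) $ i)^2) \<le> 2 * \<eta>^2 + 2 * (\<Sum>v\<in>V S. (taylor_rem q v x)^2)"
proof -
  define b where "b = (\<chi> i. fst (coeff c S) $ i - pd i q x)"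
  define \<kappa> where "\<kappa> = snd (coeff c S) - q x + (\<Sum>i\<in>UNIV. x $ i * pd i q x)"
  define B where "B = \<eta> + sqrt (\<Sum>v\<in>V S. (taylor_rem q v x)^2)"
  have ib: "inner b v + \<kappa> = (c v - q v) + taylor_rem q v x" if "v \<in> V S" for v
  proof -
    have "inner b v = inner (fst (coeff c S)) v - (\<Sum>i\<in>UNIV. v $ i * pd i q x)"
      unfolding b_def inner_vec_def by (simp add: algebra_simps sum_subtractf)
    moreover have "inner (fst (coeff c S)) v = c v - snd (coeff c S)" using coeff[OF S that, of c] by simp
    ultimately show ?thesis unfolding \<kappa>_def taylor_rem_def by (simp add: left_diff_distrib sum_subtractf)
  qed
  have "r * norm b \<le> B"
  proof (rule affine_gradient_bound[OF V(3)[OF S] _ ball r])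
    fix v assume v: "v \<in> V S"
    have "\<bar>taylor_rem q v x\<bar> \<le> sqrt (\<Sum>v\<in>V S. (taylor_rem q v x)^2)"
    proof (rule real_le_rsqrt)
      show "\<bar>taylor_rem q v x\<bar>\<^sup>2 \<le> (\<Sum>v\<in>V S. (taylor_rem q v x)^2)"
        using member_le_sum[OF v, of "\<lambda>v. (taylor_rem q v x)^2"] V(4)[OF S] by simp
    qed
    then show "\<bar>inner b v + \<kappa>\<bar> \<le> B" unfolding ib[OF v] B_def using \<eta>[OF v] by linarith
  qed
  then have "(r * norm b)^2 \<le> B^2" using r by (intro power_mono) auto
  also have "B^2 \<le> 2 * \<eta>^2 + 2 * (\<Sum>v\<in>V S. (taylor_rem q v x)^2)"
  proof -
    have "0 \<le> (\<Sum>v\<in>V S. (taylor_rem q v x)^2)" by (simp add: sum_nonneg)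
    then show ?thesis unfolding B_def
      using sum_squares_bound[of \<eta> "sqrt (\<Sum>v\<in>V S. (taylor_rem q v x)^2)"] by (simp add: power2_sum)
  qed
  finally have "(r * norm b)^2 \<le> 2 * \<eta>^2 + 2 * (\<Sum>v\<in>V S. (taylor_rem q v x)^2)" .
  moreover have "(norm b)^2 = (\<Sum>i\<in>UNIV. (pd i q x - fst (coeff c S) $ i)^2)"
    by (simp add: norm_vec_def L2_set_def sum_nonneg b_def power2_commute)
  ultimately show ?thesis by (simp add: power_mult_distrib)
qed

end

section \<open>Interpolation error and duality\<close>

lemma integrable_indicator_compact:
  fixes f :: "real^'n \<Rightarrow> real"
  assumes "compact S" "continuous_on UNIV f"
  shows "integrable lborel (\<lambda>x. indicator S x * f x)"
  using borel_integrable_compact[OF assms(1) continuous_on_subset[OF assms(2)]]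
  by (simp add: indicator_def if_distrib mult.commute cong: if_cong)

context fe_mesh
begin

lemma indicator_off_skel:
  assumes "x \<notin> skel" "S \<in> T"
  shows "indicator S x = (indicator (interior S) x :: real)"
  using assms simplex_props(3)[OF assms(2)] interior_subset[of S]
  by (auto simp: indicator_def skel_def frontier_def)

lemma sum_integral_simplices:
  assumes f: "continuous_on UNIV f" "\<And>x. 0 \<le> f x" and i: "integrable lborel (\<lambda>x. indicator \<Omega> x * f x)"
  shows "(\<Sum>S\<in>T. LBINT x. indicator S x * f x) \<le> (LBINT x. indicator \<Omega> x * (f x :: real))"
proof -
  have iS: "integrable lborel (\<lambda>x. indicator S x * f x)" if "S \<in> T" for S
    by (rule integrable_indicator_compact[OF simplex_props(1)[OF that] f(1)])
  have "(\<Sum>S\<in>T. LBINT x. indicator S x * f x) = (LBINT x. (\<Sum>S\<in>T. indicator S x * f x))"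
    by (rule Bochner_Integration.integral_sum[symmetric]) (rule iS)
  also have "\<dots> \<le> (LBINT x. indicator \<Omega> x * f x)"
  proof (rule integral_mono_AE)
    show "integrable lborel (\<lambda>x. \<Sum>S\<in>T. indicator S x * f x)" by (rule Bochner_Integration.integrable_sum) (rule iS)
    show "AE x in lborel. (\<Sum>S\<in>T. indicator S x * f x) \<le> indicator \<Omega> x * f x"
      using AE_skel
    proof eventually_elim
      case (elim x)
      have eq: "(\<Sum>S\<in>T. indicator S x * f x) = (\<Sum>S\<in>T. indicator (interior S) x * f x)"
        using indicator_off_skel[OF elim] by simp
      from elim show ?case
      proof (cases rule: not_skel_cases)
        case 1
        then have "x \<notin> interior S" if "S \<in> T" for S
          using simplex_props(5)[OF that] closure_subset[of \<Omega>] by blast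
        then show ?thesis unfolding eq using f(2) by (simp add: sum.neutral)
      next
        case (2 S)
        then show ?thesis unfolding eq sum_indicator_interior[OF 2] using simplex_props(5)[OF 2(1)] by auto
      qed
    qed
  qed (rule i)
  finally show ?thesis .
qed

lemma Gc_sq_integrable: "sq_integrable (\<lambda>x. Gc c x $ i)"
proof -
  obtain R where R: "\<And>x. x \<in> closure \<Omega> \<Longrightarrow> norm x \<le> R"
    using bounded_closure[OF bnd\<Omega>] by (auto simp: bounded_iff)
  show ?thesis
    by (rule sq_integrable_bounded_support[OF Gc_measurable Gc_bound, where R = R]) (use Gc_outside R in force)
qed

text \<open>32 = 2 * 4 * 4: the splitting of a square, at most four vertices per simplex, and the
  constant of \<open>taylor_rem_L2\<close>. The last sum depends on the mesh in an uncontrolled way;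
  this is harmless, because \<eta> will tend to 0 on a fixed mesh.\<close>

lemma interp_error:
  fixes \<sigma> h \<eta> :: real
  assumes y: "C_diff 2 y" and d: "CARD('n) \<le> 3" and \<sigma>: "\<sigma> > 0"
    and ball: "\<And>S. S \<in> T \<Longrightarrow> \<exists>z. ball z (\<sigma> * diameter S) \<subseteq> S"
    and diam: "\<And>S. S \<in> T \<Longrightarrow> 0 < diameter S" "\<And>S. S \<in> T \<Longrightarrow> diameter S \<le> h"
    and \<eta>: "\<And>x. x \<in> closure \<Omega> - \<Omega> \<Longrightarrow> \<bar>y x\<bar> \<le> \<eta>"
    and int: "integrable lborel (\<lambda>x. indicator \<Omega> x * hess_sq y x)"
  defines "c \<equiv> (\<lambda>v. if v \<in> \<Omega> then y v else 0)"
  shows "(\<Sum>i\<in>UNIV. (norm (cut (pd i y) - abs_L2 (\<lambda>x. Gc c x $ i)))^2)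
    \<le> 32 * h^2 / \<sigma>^2 * (LBINT x. indicator \<Omega> x * hess_sq y x) + \<eta>^2 * (\<Sum>S\<in>T. 2 / (\<sigma> * diameter S)^2 * (LBINT x. indicator S x))"
proof -
  have C: "C_diff (Suc (Suc 0)) y" using y by (simp only: numeral_2_eq_2)
  have c1: "continuous_on UNIV (pd i y)" for i
    using C_diff_continuous[OF C_diff_pderiv[OF C]] .
  have cH: "continuous_on UNIV (hess_sq y)" using C_diff_continuous[OF C_diff_hess_sq[OF C]] .
  have cR: "continuous_on UNIV (\<lambda>x. (taylor_rem y v x)^2)" for v
    unfolding taylor_rem_def[abs_def] by (intro continuous_intros C_diff_continuous[OF y] c1)
  define r where "r = (\<lambda>S::(real^'n) set. \<sigma> * diameter S)"
  have r: "r S > 0" if "S \<in> T" for S using \<sigma> diam(1)[OF that] by (simp add: r_def)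
  let ?g = "\<lambda>x. \<Sum>i\<in>UNIV. (indicator \<Omega> x * pd i y x - Gc c x $ i)^2"
  let ?q = "\<lambda>S x. 2 / (r S)^2 * (\<eta>^2 * indicator S x + (\<Sum>v\<in>V S. indicator S x * (taylor_rem y v x)^2))"
  have sq: "sq_integrable (\<lambda>x. indicator \<Omega> x * pd i y x - Gc c x $ i)" for i
    by (intro sq_integrable_diff cut_sq_integrable c1 Gc_sq_integrable)
  have i1: "integrable lborel (\<lambda>x. indicator S x :: real)" if "S \<in> T" for S
    using integrable_indicator_compact[OF simplex_props(1)[OF that], of "\<lambda>_. 1"] by simp
  have i2: "integrable lborel (\<lambda>x. indicator S x * (taylor_rem y v x)^2)" if "S \<in> T" for S v
    by (rule integrable_indicator_compact[OF simplex_props(1)[OF that] cR])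
  have iq: "integrable lborel (?q S)" if "S \<in> T" for S
    using i1[OF that] i2[OF that] by (intro integrable_mult_right Bochner_Integration.integrable_add Bochner_Integration.integrable_sum) auto
  have "(\<Sum>i\<in>UNIV. (norm (cut (pd i y) - abs_L2 (\<lambda>x. Gc c x $ i)))^2)
     = (\<Sum>i\<in>UNIV. LBINT x. (indicator \<Omega> x * pd i y x - Gc c x $ i)^2)"
    unfolding cut_def by (intro sum.cong refl)
      (simp add: minus_abs_L2[OF cut_sq_integrable[OF c1] Gc_sq_integrable] norm_abs_L2[OF sq])
  also have "\<dots> = (LBINT x. ?g x)"
    by (rule Bochner_Integration.integral_sum[symmetric]) (use sq in \<open>auto simp: sq_integrable_def\<close>)
  also have "\<dots> \<le> (LBINT x. (\<Sum>S\<in>T. ?q S x))"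
  proof (rule integral_mono_AE)
    show "integrable lborel ?g"
      by (rule Bochner_Integration.integrable_sum) (use sq in \<open>auto simp: sq_integrable_def\<close>)
    show "integrable lborel (\<lambda>x. \<Sum>S\<in>T. ?q S x)" by (rule Bochner_Integration.integrable_sum) (rule iq)
    have q0: "0 \<le> ?q S x" for S x by (intro mult_nonneg_nonneg add_nonneg_nonneg sum_nonneg) auto
    show "AE x in lborel. ?g x \<le> (\<Sum>S\<in>T. ?q S x)"
      using AE_skel
    proof eventually_elim
      case (elim x)
      then show ?case
      proof (cases rule: not_skel_cases)
        case 1
        then have "x \<notin> \<Omega>" using closure_subset[of \<Omega>] by blast
        then have "?g x = 0" using Gc_outside[OF 1, of c] by simp
        then show ?thesis using sum_nonneg[of T "\<lambda>S. ?q S x"] q0 by auto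
      next
        case (2 S)
        have xS: "x \<in> S" using 2(2) interior_subset by blast
        obtain z where z: "ball z (r S) \<subseteq> S" using ball[OF 2(1)] unfolding r_def by blast
        have "\<bar>c v - y v\<bar> \<le> \<eta>" if v: "v \<in> V S" for v
        proof (cases "v \<in> \<Omega>")
          case True
          obtain w where w: "w \<in> closure \<Omega> - \<Omega>"
          proof -
            have "closure \<Omega> \<noteq> \<Omega>"
              by (metis bnd\<Omega> bounded_closure closure_closed closed_closure clopen ne\<Omega> not_bounded_UNIV open_\<Omega>)
            then show thesis using closure_subset[of \<Omega>] that by blast
          qed
          have "0 \<le> \<eta>" using \<eta>[OF w] by linarith
          then show ?thesis using True by (simp add: c_def)
        next
          case False
          have "v \<in> closure \<Omega>" using V(5)[OF 2(1)] simplex_props(4)[OF 2(1)] v by blast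
          then show ?thesis using \<eta>[of v] False by (simp add: c_def)
        qed
        from interp_gradient_error[OF 2(1) xS z r[OF 2(1)] this]
        have "(r S)^2 * (\<Sum>i\<in>UNIV. (pd i y x - fst (coeff c S) $ i)^2) \<le> 2 * \<eta>^2 + 2 * (\<Sum>v\<in>V S. (taylor_rem y v x)^2)" .
        moreover have "?g x = (\<Sum>i\<in>UNIV. (pd i y x - fst (coeff c S) $ i)^2)"
          using simplex_props(5)[OF 2(1)] 2(2) Gc_interior[OF 2] by auto
        ultimately have "?g x \<le> ?q S x" using r[OF 2(1)] xS by (simp add: field_simps)
        also have "\<dots> \<le> (\<Sum>S\<in>T. ?q S x)"
          using member_le_sum[OF 2(1), of "\<lambda>S. ?q S x"] q0 finT by blast
        finally show ?thesis .
      qed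
    qed
  qed
  also have "\<dots> = (\<Sum>S\<in>T. LBINT x. ?q S x)"
    by (rule Bochner_Integration.integral_sum) (rule iq)
  also have "\<dots> \<le> (\<Sum>S\<in>T. 32 * h^2 / \<sigma>^2 * (LBINT x. indicator S x * hess_sq y x) + \<eta>^2 * (2 / (r S)^2 * (LBINT x. indicator S x)))"
  proof (rule sum_mono)
    fix S assume S: "S \<in> T"
    let ?I = "LBINT x. indicator S x * hess_sq y x"
    have I0: "0 \<le> ?I" by (intro Bochner_Integration.integral_nonneg) (simp add: hess_sq_nonneg)
    let ?D = "diameter S"
    have t: "(LBINT x. indicator S x * (taylor_rem y v x)^2) \<le> 4 * ?D^4 * ?I" if "v \<in> V S" for v
    proof (rule taylor_rem_L2[OF y d simplex_props(2)[OF S] simplex_props(1)[OF S]])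
      show "v \<in> S" using V(5)[OF S] that by blast
      then show "norm (x - v) \<le> ?D" if "x \<in> S" for x
        using diameter_bounded_bound[OF compact_imp_bounded[OF simplex_props(1)[OF S]] that] by (simp add: dist_norm)
    qed
    have "(\<Sum>v\<in>V S. LBINT x. indicator S x * (taylor_rem y v x)^2) \<le> (\<Sum>v\<in>V S. 4 * ?D^4 * ?I)"
      by (rule sum_mono) (rule t)
    also have "\<dots> = real (card (V S)) * (4 * ?D^4 * ?I)" by simp
    also have "\<dots> \<le> 4 * (4 * ?D^4 * ?I)"
      using V(2)[OF S] d I0 by (intro mult_right_mono) auto
    finally have s: "(\<Sum>v\<in>V S. LBINT x. indicator S x * (taylor_rem y v x)^2) \<le> 16 * ?D^4 * ?I" by simp
    have "(LBINT x. ?q S x) = 2 / (r S)^2 * (\<eta>^2 * (LBINT x. indicator S x) + (\<Sum>v\<in>V S. LBINT x. indicator S x * (taylor_rem y v x)^2))"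
    proof -
      have "(LBINT x. \<eta>^2 * indicator S x + (\<Sum>v\<in>V S. indicator S x * (taylor_rem y v x)^2))
        = (LBINT x. \<eta>^2 * indicator S x) + (LBINT x. (\<Sum>v\<in>V S. indicator S x * (taylor_rem y v x)^2))"
        by (rule Bochner_Integration.integral_add)
          (use i1[OF S] i2[OF S] in \<open>auto intro!: Bochner_Integration.integrable_sum integrable_mult_right\<close>)
      also have "(LBINT x. (\<Sum>v\<in>V S. indicator S x * (taylor_rem y v x)^2)) = (\<Sum>v\<in>V S. LBINT x. indicator S x * (taylor_rem y v x)^2)"
        by (rule Bochner_Integration.integral_sum) (rule i2[OF S])
      finally show ?thesis by (simp only: integral_mult_right_zero)
    qed
    also have "\<dots> \<le> 2 / (r S)^2 * (\<eta>^2 * (LBINT x. indicator S x) + 16 * ?D^4 * ?I)"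
      using s by (intro mult_left_mono add_left_mono) auto
    also have "\<dots> = 32 * ?D^2 / \<sigma>^2 * ?I + \<eta>^2 * (2 / (r S)^2 * (LBINT x. indicator S x))"
    proof -
      have "2 / (r S)^2 * (16 * ?D^4) = 32 * ?D^2 / \<sigma>^2"
        using diam(1)[OF S] \<sigma> unfolding r_def by (simp add: field_simps power2_eq_square power4_eq_xxxx)
      then have "2 / (r S)^2 * (16 * ?D^4) * ?I = 32 * ?D^2 / \<sigma>^2 * ?I" by simp
      then show ?thesis by (simp add: algebra_simps)
    qed
    also have "32 * ?D^2 / \<sigma>^2 * ?I \<le> 32 * h^2 / \<sigma>^2 * ?I"
      using diam[OF S] I0 by (intro mult_right_mono divide_right_mono mult_left_mono power_mono) auto
    finally show "(LBINT x. ?q S x) \<le> 32 * h^2 / \<sigma>^2 * ?I + \<eta>^2 * (2 / (r S)^2 * (LBINT x. indicator S x))"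
      by simp
  qed
  also have "\<dots> = 32 * h^2 / \<sigma>^2 * (\<Sum>S\<in>T. LBINT x. indicator S x * hess_sq y x) + \<eta>^2 * (\<Sum>S\<in>T. 2 / (r S)^2 * (LBINT x. indicator S x))"
    by (simp only: sum.distrib sum_distrib_left)
  also have "\<dots> \<le> 32 * h^2 / \<sigma>^2 * (LBINT x. indicator \<Omega> x * hess_sq y x) + \<eta>^2 * (\<Sum>S\<in>T. 2 / (r S)^2 * (LBINT x. indicator S x))"
    using sum_integral_simplices[OF cH hess_sq_nonneg int] by (intro add_right_mono mult_left_mono) auto
  finally show ?thesis unfolding r_def .
qed

text \<open>Let \<open>y\<close> be an approximate solution of - Laplace y = \<theta>. Up to an
  error that vanishes with \<eta>, Green's formula turns the pairing of \<rho> with \<theta> into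
  that of their gradients, and orthogonality allows subtracting the nodal interpolant of
  \<open>y\<close>. The interpolation and Hessian bounds then give 512^2 = 32 * 8192.\<close>

lemma duality_test:
  fixes \<sigma> h :: real
  assumes d: "CARD('n) \<le> 3" and \<sigma>: "\<sigma> > 0"
    and ball: "\<And>S. S \<in> T \<Longrightarrow> \<exists>z. ball z (\<sigma> * diameter S) \<subseteq> S"
    and diam: "\<And>S. S \<in> T \<Longrightarrow> 0 < diameter S" "\<And>S. S \<in> T \<Longrightarrow> diameter S \<le> h" and h: "h > 0"
    and \<rho>: "\<rho> \<in> H10 \<Omega>" "\<And>w. w \<in> fe_space \<Omega> T \<Longrightarrow> grad_inner \<Omega> \<rho> w = 0"
    and \<theta>: "\<theta> \<in> test_functions \<Omega>"
  shows "inner \<rho> (abs_L2 \<theta>) \<le> 512 * h / \<sigma> * sqrt (grad_inner \<Omega> \<rho> \<rho>) * norm (abs_L2 \<theta>)"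
proof -
  define X where "X = (\<Sum>S\<in>T. 2 / (\<sigma> * diameter S)^2 * (LBINT x. indicator S x))"
  define \<mu> where "\<mu> = (LBINT x. indicator \<Omega> x :: real)"
  \<comment> \<open>The whole estimate as a function of the accuracy. The mesh, and with it
    \<open>X\<close>, is fixed, so the limit from the right at 0 removes all error terms.\<close>
  define B where "B = (\<lambda>\<eta>. norm \<rho> * sqrt (\<eta>^2 * \<mu>) + sqrt (grad_inner \<Omega> \<rho> \<rho>) * sqrt (32 * h^2 / \<sigma>^2 * (8192 * (norm (abs_L2 \<theta>))^2 + \<eta>) + \<eta>^2 * X))"
  have c\<theta>: "continuous_on UNIV \<theta>" using C_diff_continuous[OF test_functionsD(1)[OF \<theta>]] .
  obtain R where R: "\<And>x. \<theta> x \<noteq> 0 \<Longrightarrow> norm x \<le> R" using test_functionsD(3)[OF \<theta>] by blast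
  have i\<Omega>: "integrable lborel (\<lambda>x. indicator \<Omega> x :: real)"
  proof -
    have "(\<lambda>x. (indicator \<Omega> x * 1)^2) = (\<lambda>x. indicator \<Omega> x :: real)" by (auto simp: indicator_def)
    then show ?thesis using cut_sq_integrable[of "\<lambda>_. 1"] by (simp add: sq_integrable_def)
  qed
  have s\<theta>: "sq_integrable \<theta>" by (rule test_sq_integrable[OF \<theta>])
  have le: "inner \<rho> (abs_L2 \<theta>) \<le> B \<eta>" if \<eta>: "\<eta> > 0" for \<eta>
  proof -
    obtain y where y: "\<And>k. C_diff k y" "\<And>x. x \<in> closure \<Omega> - \<Omega> \<Longrightarrow> \<bar>y x\<bar> \<le> \<eta>" "\<And>x. x \<in> \<Omega> \<Longrightarrow> \<bar>lap y x + \<theta> x\<bar> \<le> \<eta>"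
      "integrable lborel (\<lambda>x. indicator \<Omega> x * hess_sq y x)"
      "(LBINT x. indicator \<Omega> x * hess_sq y x) \<le> 8192 * (LBINT x. (\<theta> x)^2) + \<eta>"
      using approx_dirichlet[OF c\<theta> R \<eta>] by blast
    define c where "c = (\<lambda>v. if v \<in> \<Omega> then y v else 0)"
    have c0: "c v = 0" if "v \<notin> \<Omega>" for v using that by (simp add: c_def)
    define \<chi>' where "\<chi>' = abs_L2 (fe c)"
    have \<chi>: "\<chi>' \<in> fe_space \<Omega> T" "weak_deriv \<Omega> i \<chi>' = abs_L2 (\<lambda>x. Gc c x $ i)" for i
      unfolding \<chi>'_def using fe_in_fe_space[of c] c0 by auto
    have cl: "continuous_on UNIV (lap y)" using C_diff_continuous[OF C_diff_lap[OF y(1)]] .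
    let ?E = "\<lambda>i. cut (pd i y) - weak_deriv \<Omega> i \<chi>'"
    have E: "(\<Sum>i\<in>UNIV. (norm (?E i))^2) \<le> 32 * h^2 / \<sigma>^2 * (8192 * (norm (abs_L2 \<theta>))^2 + \<eta>) + \<eta>^2 * X"
    proof -
      have "(\<Sum>i\<in>UNIV. (norm (?E i))^2) \<le> 32 * h^2 / \<sigma>^2 * (LBINT x. indicator \<Omega> x * hess_sq y x) + \<eta>^2 * X"
        unfolding \<chi> X_def c_def by (rule interp_error[OF y(1) d \<sigma> ball diam y(2) y(4)])
      also have "\<dots> \<le> 32 * h^2 / \<sigma>^2 * (8192 * (norm (abs_L2 \<theta>))^2 + \<eta>) + \<eta>^2 * X"
        using y(5) unfolding norm_abs_L2[OF s\<theta>] by (intro add_right_mono mult_left_mono) auto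
      finally show ?thesis .
    qed
    have r1: "norm (abs_L2 \<theta> + cut (lap y)) \<le> sqrt (\<eta>^2 * \<mu>)"
    proof (rule real_le_rsqrt)
      have s: "sq_integrable (\<lambda>x. \<theta> x + indicator \<Omega> x * lap y x)"
        by (intro sq_integrable_add s\<theta> cut_sq_integrable cl)
      have "(norm (abs_L2 \<theta> + cut (lap y)))^2 = (LBINT x. (\<theta> x + indicator \<Omega> x * lap y x)^2)"
        unfolding cut_def plus_abs_L2[OF s\<theta> cut_sq_integrable[OF cl]] by (rule norm_abs_L2[OF s])
      also have "\<dots> \<le> (LBINT x. \<eta>^2 * indicator \<Omega> x)"
      proof (rule integral_mono)
        show "integrable lborel (\<lambda>x. (\<theta> x + indicator \<Omega> x * lap y x)^2)" using s by (simp add: sq_integrable_def)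
        show "integrable lborel (\<lambda>x. \<eta>^2 * indicator \<Omega> x)" using i\<Omega> by simp
        show "(\<theta> x + indicator \<Omega> x * lap y x)^2 \<le> \<eta>^2 * indicator \<Omega> x" for x
        proof (cases "x \<in> \<Omega>")
          case True
          then show ?thesis using power2_mono_abs[of "lap y x + \<theta> x" \<eta>] y(3)[OF True] by (simp add: add.commute)
        next
          case False
          then show ?thesis using test_functionsD(2)[OF \<theta>, of x] by auto
        qed
      qed
      finally show "(norm (abs_L2 \<theta> + cut (lap y)))^2 \<le> \<eta>^2 * \<mu>" by (simp add: \<mu>_def)
    qed
    have "inner \<rho> (abs_L2 \<theta>) = inner \<rho> (abs_L2 \<theta> + cut (lap y)) + (- inner \<rho> (cut (lap y)))"
      by (simp add: inner_add_right)
    also have "- inner \<rho> (cut (lap y)) = (\<Sum>i\<in>UNIV. inner (weak_deriv \<Omega> i \<rho>) (cut (pd i y)))"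
      by (rule Green_smooth[OF \<rho>(1) y(1), symmetric])
    also have "\<dots> = (\<Sum>i\<in>UNIV. inner (weak_deriv \<Omega> i \<rho>) (?E i))"
      using \<rho>(2)[OF \<chi>(1)] by (simp add: inner_diff_right sum_subtractf grad_inner_def)
    also have "\<dots> \<le> (\<Sum>i\<in>UNIV. norm (weak_deriv \<Omega> i \<rho>) * norm (?E i))"
      by (intro sum_mono) (rule norm_cauchy_schwarz)
    also have "\<dots> \<le> sqrt (grad_inner \<Omega> \<rho> \<rho>) * sqrt (\<Sum>i\<in>UNIV. (norm (?E i))^2)"
      using L2_set_mult_ineq[of "\<lambda>i. norm (weak_deriv \<Omega> i \<rho>)" "\<lambda>i. norm (?E i)" UNIV]
      by (simp add: L2_set_def grad_inner_def power2_norm_eq_inner)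
    also have "\<dots> \<le> sqrt (grad_inner \<Omega> \<rho> \<rho>) * sqrt (32 * h^2 / \<sigma>^2 * (8192 * (norm (abs_L2 \<theta>))^2 + \<eta>) + \<eta>^2 * X)"
      using E by (intro mult_left_mono real_sqrt_le_mono) (auto simp: grad_inner_def sum_nonneg)
    also have "inner \<rho> (abs_L2 \<theta> + cut (lap y)) \<le> norm \<rho> * sqrt (\<eta>^2 * \<mu>)"
      by (rule order_trans[OF norm_cauchy_schwarz]) (intro mult_left_mono r1, simp)
    finally show ?thesis unfolding B_def by simp
  qed
  have "(B \<longlongrightarrow> B 0) (at_right 0)" unfolding B_def by (intro tendsto_intros)
  then have "inner \<rho> (abs_L2 \<theta>) \<le> B 0"
    by (rule tendsto_lowerbound) (use le eventually_at_right_less[of "0::real"] in \<open>auto elim!: eventually_mono\<close>)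
  also have "B 0 = sqrt (grad_inner \<Omega> \<rho> \<rho>) * sqrt ((512 * h / \<sigma> * norm (abs_L2 \<theta>))^2)"
    unfolding B_def by (simp add: power_mult_distrib power_divide)
  also have "sqrt ((512 * h / \<sigma> * norm (abs_L2 \<theta>))^2) = 512 * h / \<sigma> * norm (abs_L2 \<theta>)"
    using h \<sigma> by (subst real_sqrt_abs) simp
  finally show ?thesis by (simp add: mult_ac)
qed

text \<open>\<rho> is paired with its own approximating test functions; one factor of its norm then
  cancels.\<close>

lemma duality_estimate:
  fixes \<sigma> h :: real
  assumes d: "CARD('n) \<le> 3" and \<sigma>: "\<sigma> > 0"
    and ball: "\<And>S. S \<in> T \<Longrightarrow> \<exists>z. ball z (\<sigma> * diameter S) \<subseteq> S"
    and diam: "\<And>S. S \<in> T \<Longrightarrow> 0 < diameter S" "\<And>S. S \<in> T \<Longrightarrow> diameter S \<le> h" and h: "h > 0"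
    and \<rho>: "\<rho> \<in> H10 \<Omega>" "\<And>w. w \<in> fe_space \<Omega> T \<Longrightarrow> grad_inner \<Omega> \<rho> w = 0"
  shows "norm \<rho> \<le> 512 * h / \<sigma> * sqrt (grad_inner \<Omega> \<rho> \<rho>)"
proof (cases "\<rho> = 0")
  case False
  let ?K = "512 * h / \<sigma> * sqrt (grad_inner \<Omega> \<rho> \<rho>)"
  obtain \<phi> where \<phi>: "\<And>n. \<phi> n \<in> test_functions \<Omega>" "(\<lambda>n. abs_L2 (\<phi> n)) \<longlonglongrightarrow> \<rho>"
    "\<And>i. (\<lambda>n. abs_L2 (pd i (\<phi> n))) \<longlonglongrightarrow> weak_deriv \<Omega> i \<rho>" using H10_seq[OF \<rho>(1)] by blast
  have le: "inner \<rho> (abs_L2 (\<phi> n)) \<le> ?K * norm (abs_L2 (\<phi> n))" for n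
    by (rule duality_test[OF d \<sigma> ball diam h \<rho> \<phi>(1)])
  have "inner \<rho> \<rho> \<le> ?K * norm \<rho>"
  proof (rule LIMSEQ_le)
    show "(\<lambda>n. inner \<rho> (abs_L2 (\<phi> n))) \<longlonglongrightarrow> inner \<rho> \<rho>" by (intro tendsto_intros \<phi>(2))
    show "(\<lambda>n. ?K * norm (abs_L2 (\<phi> n))) \<longlonglongrightarrow> ?K * norm \<rho>" by (intro tendsto_intros \<phi>(2))
    show "\<exists>N. \<forall>n\<ge>N. inner \<rho> (abs_L2 (\<phi> n)) \<le> ?K * norm (abs_L2 (\<phi> n))"
      using le by blast
  qed
  then have "norm \<rho> * norm \<rho> \<le> ?K * norm \<rho>" by (simp only: power2_norm_eq_inner[symmetric] power2_eq_square)
  then show ?thesis by (rule mult_right_le_imp_le) (use False in simp)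
next
  case True
  have "0 \<le> grad_inner \<Omega> \<rho> \<rho>" by (simp add: grad_inner_def sum_nonneg)
  then show ?thesis using True h \<sigma> by simp
qed

end

section \<open>The Ritz projection\<close>

context bounded_open
begin

lemma grad_inner_commute: "grad_inner \<Omega> u w = grad_inner \<Omega> w u"
  by (simp add: grad_inner_def inner_commute)

lemma grad_inner_lincomb:
  assumes "u \<in> H10 \<Omega>" "w \<in> H10 \<Omega>"
  shows "grad_inner \<Omega> (u + c *\<^sub>R w) z = grad_inner \<Omega> u z + c * grad_inner \<Omega> w z"
    "grad_inner \<Omega> z (u + c *\<^sub>R w) = grad_inner \<Omega> z u + c * grad_inner \<Omega> z w"
  using H1_lincomb(2)[OF H10_H1[OF assms(1)] H10_H1[OF assms(2)]]
  by (simp_all add: grad_inner_def inner_add_left inner_add_right sum.distrib sum_distrib_left)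

lemma grad_inner_diff:
  assumes "u \<in> H10 \<Omega>" "w \<in> H10 \<Omega>"
  shows "grad_inner \<Omega> (u - w) z = grad_inner \<Omega> u z - grad_inner \<Omega> w z"
    "grad_inner \<Omega> z (u - w) = grad_inner \<Omega> z u - grad_inner \<Omega> z w"
  using grad_inner_lincomb[OF assms, where c = "-1"] by simp_all

lemma grad_inner_null:
  assumes "grad_inner \<Omega> w w = 0"
  shows "grad_inner \<Omega> u w = 0"
proof -
  have "\<forall>i\<in>UNIV. inner (weak_deriv \<Omega> i w) (weak_deriv \<Omega> i w) = 0"
    using assms sum_nonneg_eq_0_iff[of UNIV "\<lambda>i. inner (weak_deriv \<Omega> i w) (weak_deriv \<Omega> i w)"]
    by (simp add: grad_inner_def)
  then show ?thesis by (simp add: grad_inner_def)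
qed

text \<open>Gram-Schmidt for the positive semidefinite form \<open>grad_inner \<Omega>\<close>: the
  new vector is first made orthogonal to the span of the old ones, then \<open>u\<close> is
  corrected along it.\<close>

lemma ritz_projection_span:
  assumes "finite B" "B \<subseteq> H10 \<Omega>" "u \<in> H10 \<Omega>"
  shows "\<exists>R\<in>span B. \<forall>w\<in>span B. grad_inner \<Omega> (u - R) w = 0"
  using assms
proof (induction B arbitrary: u rule: finite_induct)
  case empty
  have "grad_inner \<Omega> u 0 = 0"
    by (rule grad_inner_null) (use grad_inner_diff[OF H10_zero H10_zero] in simp)
  then show ?case by simp
next
  case (insert b B)
  have b: "b \<in> H10 \<Omega>" and sB: "span B \<subseteq> H10 \<Omega>"
    using insert.prems(1) span_minimal[OF _ H10_subspace, of B] by auto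
  obtain P where P: "P \<in> span B" "\<And>w. w \<in> span B \<Longrightarrow> grad_inner \<Omega> (b - P) w = 0"
    using insert.IH[OF _ b] insert.prems(1) by blast
  obtain Q where Q: "Q \<in> span B" "\<And>w. w \<in> span B \<Longrightarrow> grad_inner \<Omega> (u - Q) w = 0"
    using insert.IH[OF _ insert.prems(2)] insert.prems(1) by blast
  define b' where "b' = b - P"
  have H: "P \<in> H10 \<Omega>" "Q \<in> H10 \<Omega>" "b' \<in> H10 \<Omega>" "u - Q \<in> H10 \<Omega>"
    unfolding b'_def using P(1) Q(1) sB b insert.prems(2) by (auto intro!: subspace_diff[OF H10_subspace])
  \<comment> \<open>If the denominator is 0, division yields \<open>k = 0\<close>; the equation for
    \<open>k\<close> still holds, because the numerator then vanishes by
    \<open>grad_inner_null\<close>.\<close>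
  define k where "k = grad_inner \<Omega> (u - Q) b' / grad_inner \<Omega> b' b'"
  have kb: "k * grad_inner \<Omega> b' b' = grad_inner \<Omega> (u - Q) b'"
    using grad_inner_null[of b' "u - Q"] by (auto simp: k_def)
  let ?R = "Q + k *\<^sub>R b'"
  have ib: "span B \<subseteq> span (insert b B)" by (intro span_mono) auto
  have b': "b' \<in> span (insert b B)" unfolding b'_def using P(1) ib by (intro span_diff) (auto intro: span_base)
  show ?case
  proof (intro bexI ballI)
    show "?R \<in> span (insert b B)" using Q(1) ib b' by (intro span_add span_scale) auto
    fix w assume "w \<in> span (insert b B)"
    then obtain t where t: "w - t *\<^sub>R b \<in> span B" unfolding span_breakdown_eq by blast
    define s where "s = (w - t *\<^sub>R b) + t *\<^sub>R P"
    have s: "s \<in> span B" unfolding s_def using t P(1) by (intro span_add span_scale)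
    then have sH: "s \<in> H10 \<Omega>" using sB by blast
    have w: "w = s + t *\<^sub>R b'" by (simp add: s_def b'_def algebra_simps)
    have uR: "u - ?R = (u - Q) + (- k) *\<^sub>R b'" by simp
    have "grad_inner \<Omega> (u - ?R) w = grad_inner \<Omega> ((u - Q) + (- k) *\<^sub>R b') (s + t *\<^sub>R b')"
      unfolding w uR ..
    also have "\<dots> = 0"
      unfolding grad_inner_lincomb(1)[OF H(4) H(3)] grad_inner_lincomb(2)[OF sH H(3)]
      using Q(2)[OF s] P(2)[OF s] kb by (simp add: b'_def[symmetric])
    finally show "grad_inner \<Omega> (u - ?R) w = 0" .
  qed
qed

end

context fe_mesh
begin

lemma fe_space_subspace: "subspace (fe_space \<Omega> T)"
proof (rule subspaceI)
  show "0 \<in> fe_space \<Omega> T"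
  proof -
    have "AE x in lborel. rep_L2 (0 :: 'n L2) x = 0"
      using rep_abs_L2[OF sq_integrable_zero[where 'n='n]] by (simp add: zero_L2_def)
    then have "AE x in lborel. x \<in> S \<longrightarrow> rep_L2 (0 :: 'n L2) x = inner 0 x + 0" for S :: "(real^'n) set"
      by eventually_elim simp
    then show ?thesis unfolding fe_space_def using H10_zero by blast
  qed
  show "u + w \<in> fe_space \<Omega> T" if u: "u \<in> fe_space \<Omega> T" and w: "w \<in> fe_space \<Omega> T" for u w
  proof -
    have "\<exists>a c. AE x in lborel. x \<in> S \<longrightarrow> rep_L2 (u + w) x = inner a x + c" if S: "S \<in> T" for S
    proof -
      obtain a c where "AE x in lborel. x \<in> S \<longrightarrow> rep_L2 u x = inner a x + c"
        using u S unfolding fe_space_def by blast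
      moreover obtain a' c' where "AE x in lborel. x \<in> S \<longrightarrow> rep_L2 w x = inner a' x + c'"
        using w S unfolding fe_space_def by blast
      ultimately have "AE x in lborel. x \<in> S \<longrightarrow> rep_L2 (u + w) x = inner (a + a') x + (c + c')"
        using rep_plus_L2[of u w] by eventually_elim (auto simp: inner_add_left)
      then show ?thesis by blast
    qed
    then show ?thesis using u w H10_subspace by (auto simp: fe_space_def subspace_add)
  qed
  show "k *\<^sub>R u \<in> fe_space \<Omega> T" if u: "u \<in> fe_space \<Omega> T" for k u
  proof -
    have "\<exists>a c. AE x in lborel. x \<in> S \<longrightarrow> rep_L2 (k *\<^sub>R u) x = inner a x + c" if S: "S \<in> T" for S
    proof -
      obtain a c where "AE x in lborel. x \<in> S \<longrightarrow> rep_L2 u x = inner a x + c"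
        using u S unfolding fe_space_def by blast
      then have "AE x in lborel. x \<in> S \<longrightarrow> rep_L2 (k *\<^sub>R u) x = inner (k *\<^sub>R a) x + k * c"
        using rep_scaleR_L2[of k u] by eventually_elim (auto simp: algebra_simps)
      then show ?thesis by blast
    qed
    then show ?thesis using u H10_subspace by (auto simp: fe_space_def subspace_scale)
  qed
qed

text \<open>Coordinates and constants restricted to single simplices span a space that contains the
  finite element space, although they are themselves discontinuous in general. A finite basis inside
  the space is extracted from this in \<open>ritz_projection\<close>.\<close>

lemma fe_space_finite_dim: "\<exists>B. finite B \<and> fe_space \<Omega> T \<subseteq> span B"
proof -
  let ?x = "\<lambda>S (i::'n). abs_L2 (\<lambda>x. indicator S x * x $ i)"
  let ?k = "\<lambda>S. abs_L2 (\<lambda>x::real^'n. indicator S x)"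
  let ?B = "(\<Union>S\<in>T. range (?x S)) \<union> ?k ` T"
  have sx: "sq_integrable (\<lambda>x. indicator S x * x $ i)" and sk: "sq_integrable (\<lambda>x. indicator S x)" if S: "S \<in> T" for S i
  proof -
    have c: "continuous_on UNIV (\<lambda>x::real^'n. x $ i)" by (intro continuous_intros)
    have 1: "integrable lborel (\<lambda>x. indicator S x * (x $ i)^2)" "integrable lborel (\<lambda>x. indicator S x * (x $ i))"
       "integrable lborel (\<lambda>x. indicator S x :: real)"
      using integrable_indicator_compact[OF simplex_props(1)[OF S] continuous_on_power[OF c, of 2]]
        integrable_indicator_compact[OF simplex_props(1)[OF S] c]
        integrable_indicator_compact[OF simplex_props(1)[OF S], of "\<lambda>x. 1"] by auto
    have 2: "(\<lambda>x. (indicator S x * x $ i)^2) = (\<lambda>x. indicator S x * (x $ i)^2)" "(\<lambda>x::real^'n. (indicator S x :: real)^2) = indicator S"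
      by (auto simp: fun_eq_iff indicator_def)
    show "sq_integrable (\<lambda>x. indicator S x * x $ i)" "sq_integrable (\<lambda>x. indicator S x)"
      unfolding sq_integrable_def 2 using 1 borel_measurable_integrable by auto
  qed
  have "u \<in> span ?B" if u: "u \<in> fe_space \<Omega> T" for u
  proof -
    have "\<exists>p. AE x in lborel. x \<in> S \<longrightarrow> rep_L2 u x = inner (fst p) x + snd p" if S: "S \<in> T" for S
    proof -
      obtain a c where "AE x in lborel. x \<in> S \<longrightarrow> rep_L2 u x = inner a x + c"
        using u S unfolding fe_space_def by blast
      then show ?thesis by (intro exI[of _ "(a, c)"]) simp
    qed
    then have "\<forall>S\<in>T. \<exists>p. AE x in lborel. x \<in> S \<longrightarrow> rep_L2 u x = inner (fst p) x + snd p" by blast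
    from bchoice[OF this] obtain p where
      p: "\<And>S. S \<in> T \<Longrightarrow> AE x in lborel. x \<in> S \<longrightarrow> rep_L2 u x = inner (fst (p S)) x + snd (p S)"
      by blast
    let ?f = "\<lambda>S x. (\<Sum>i\<in>UNIV. fst (p S) $ i * (indicator S x * x $ i)) + snd (p S) * indicator S x"
    have sf: "sq_integrable (?f S)" if "S \<in> T" for S
      by (intro sq_integrable_add sq_integrable_sum sq_integrable_scale sx[OF that] sk[OF that])
    have f: "?f S x = indicator S x * (inner (fst (p S)) x + snd (p S))" for S x
      by (simp add: inner_vec_def sum_distrib_left algebra_simps)
    have uL: "AE x in lborel. x \<notin> \<Omega> \<longrightarrow> rep_L2 u x = 0"
      using u by (auto simp: fe_space_def H10_def H1_def L2_on_def)
    have "AE x in lborel. \<forall>S\<in>T. x \<in> S \<longrightarrow> rep_L2 u x = inner (fst (p S)) x + snd (p S)"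
      by (rule AE_finite_allI[OF finT]) (rule p)
    with uL AE_skel have "AE x in lborel. rep_L2 u x = (\<Sum>S\<in>T. ?f S x)"
    proof eventually_elim
      case (elim x)
      have eq: "(\<Sum>S\<in>T. ?f S x) = (\<Sum>S\<in>T. indicator (interior S) x * (inner (fst (p S)) x + snd (p S)))"
        unfolding f using indicator_off_skel[OF elim(2)] by simp
      from elim(2) show ?case
      proof (cases rule: not_skel_cases)
        case 1
        then have "x \<notin> interior S" if "S \<in> T" for S
          using simplex_props(5)[OF that] closure_subset[of \<Omega>] by blast
        moreover have "rep_L2 u x = 0" using elim(1) 1 closure_subset[of \<Omega>] by blast
        ultimately show ?thesis unfolding eq by (simp add: sum.neutral)
      next
        case (2 S)
        then show ?thesis unfolding eq sum_indicator_interior[OF 2] using elim(3) interior_subset by blast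
      qed
    qed
    then have "abs_L2 (rep_L2 u) = abs_L2 (\<lambda>x. \<Sum>S\<in>T. ?f S x)"
      by (intro abs_L2_cong sq_integrable_sum sf) simp_all
    also have "\<dots> = (\<Sum>S\<in>T. abs_L2 (?f S))" by (rule sum_abs_L2[symmetric]) (rule sf)
    also have "\<dots> = (\<Sum>S\<in>T. (\<Sum>i\<in>UNIV. fst (p S) $ i *\<^sub>R ?x S i) + snd (p S) *\<^sub>R ?k S)"
    proof (rule sum.cong)
      fix S assume S: "S \<in> T"
      have "(\<Sum>i\<in>UNIV. fst (p S) $ i *\<^sub>R ?x S i) = abs_L2 (\<lambda>x. \<Sum>i\<in>UNIV. fst (p S) $ i * (indicator S x * x $ i))"
        unfolding scaleR_abs_L2[OF sx[OF S]] by (rule sum_abs_L2) (intro sq_integrable_scale sx[OF S])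
      then show "abs_L2 (?f S) = (\<Sum>i\<in>UNIV. fst (p S) $ i *\<^sub>R ?x S i) + snd (p S) *\<^sub>R ?k S"
        unfolding scaleR_abs_L2[OF sk[OF S]]
        by (simp add: plus_abs_L2 sq_integrable_sum sq_integrable_scale sx[OF S] sk[OF S])
    qed simp
    also have "\<dots> \<in> span ?B"
      by (intro span_sum span_add span_scale span_base) auto
    finally show ?thesis by simp
  qed
  moreover have "finite ?B" using finT by auto
  ultimately show ?thesis by blast
qed

lemma ritz_projection:
  assumes "u \<in> H10 \<Omega>"
  shows "\<exists>R\<in>fe_space \<Omega> T. \<forall>w\<in>fe_space \<Omega> T. grad_inner \<Omega> (u - R) w = 0"
proof -
  obtain B where B: "finite B" "fe_space \<Omega> T \<subseteq> span B" using fe_space_finite_dim by blast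
  obtain B' where B': "B' \<subseteq> fe_space \<Omega> T" "independent B'" "fe_space \<Omega> T \<subseteq> span B'"
    using maximal_independent_subset by blast
  have "finite B'" using independent_span_bound[OF B(1) B'(2)] B'(1) B(2) by blast
  moreover have "B' \<subseteq> H10 \<Omega>" using B'(1) by (auto simp: fe_space_def)
  moreover have "span B' = fe_space \<Omega> T"
    using B'(3) span_minimal[OF B'(1) fe_space_subspace] by blast
  ultimately show ?thesis using ritz_projection_span[of B' u] assms by simp
qed

text \<open>Orthogonality and Green's formula express the squared gradient of u - R as the pairing
  of - Laplace u with u - R itself. Inserted into the squared duality estimate, this leaves one
  factor norm (u - R) to cancel, and the order h becomes h^2.\<close>

lemma ritz_error:
  fixes \<sigma> h :: real
  assumes d: "CARD('n) \<le> 3" and \<sigma>: "\<sigma> > 0"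
    and ball: "\<And>S. S \<in> T \<Longrightarrow> \<exists>z. ball z (\<sigma> * diameter S) \<subseteq> S"
    and diam: "\<And>S. S \<in> T \<Longrightarrow> 0 < diameter S" "\<And>S. S \<in> T \<Longrightarrow> diameter S \<le> h" and h: "h > 0"
    and u: "u \<in> Hdot2 \<Omega>" and R: "R \<in> fe_space \<Omega> T" "\<And>w. w \<in> fe_space \<Omega> T \<Longrightarrow> grad_inner \<Omega> (u - R) w = 0"
  shows "norm (u - R) \<le> (512 / \<sigma>)^2 * h^2 * Hdot2_norm \<Omega> u"
proof (cases "u = R")
  case False
  have uH: "u \<in> H2 \<Omega>" "u \<in> H10 \<Omega>" "R \<in> H10 \<Omega>" using u R(1) by (auto simp: Hdot2_def fe_space_def)
  then have \<rho>: "u - R \<in> H10 \<Omega>" using H10_subspace by (simp add: subspace_diff)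
  have "grad_inner \<Omega> (u - R) (u - R) = grad_inner \<Omega> u (u - R)"
    using grad_inner_diff(2)[OF uH(2,3), of "u - R"] R(2)[OF R(1)] grad_inner_commute by simp
  also have "\<dots> = - inner (laplacian \<Omega> u) (u - R)" by (rule Green[OF uH(1) \<rho>])
  also have "\<dots> \<le> Hdot2_norm \<Omega> u * norm (u - R)"
    using Cauchy_Schwarz_ineq2[of "laplacian \<Omega> u" "u - R"] by (simp add: Hdot2_norm_def)
  finally have g: "grad_inner \<Omega> (u - R) (u - R) \<le> Hdot2_norm \<Omega> u * norm (u - R)" .
  have "norm (u - R) \<le> 512 * h / \<sigma> * sqrt (grad_inner \<Omega> (u - R) (u - R))"
    by (rule duality_estimate[OF d \<sigma> ball diam h \<rho> R(2)])
  then have "(norm (u - R))^2 \<le> (512 * h / \<sigma> * sqrt (grad_inner \<Omega> (u - R) (u - R)))^2"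
    by (intro power_mono) auto
  also have "\<dots> = (512 / \<sigma>)^2 * h^2 * grad_inner \<Omega> (u - R) (u - R)"
  proof -
    have "0 \<le> grad_inner \<Omega> (u - R) (u - R)" by (simp add: grad_inner_def sum_nonneg)
    then show ?thesis by (simp add: power_mult_distrib power_divide)
  qed
  also have "\<dots> \<le> (512 / \<sigma>)^2 * h^2 * (Hdot2_norm \<Omega> u * norm (u - R))"
    using g by (intro mult_left_mono) auto
  finally have "norm (u - R) * norm (u - R) \<le> ((512 / \<sigma>)^2 * h^2 * Hdot2_norm \<Omega> u) * norm (u - R)"
    by (simp add: power2_eq_square mult_ac)
  then show ?thesis by (rule mult_right_le_imp_le) (use False in simp)
qed (simp add: Hdot2_norm_def)

end

section \<open>The coefficients of the scheme\<close>

text \<open>By the mean value theorem, consecutive coefficients lie on different sides of the same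
  number, the derivative of x powr (1 - a) at j + 1. Monotonicity in \<open>j\<close> and the lower
  bound for the weights both follow.\<close>

lemma d_coeff_bounds:
  assumes a: "0 < a" "a < 1"
  shows "(1 - a) * (real j + 1) powr (- a) \<le> d_coeff a j" "d_coeff a (Suc j) \<le> (1 - a) * (real j + 1) powr (- a)"
proof -
  have mvt: "\<exists>\<xi>>x. \<xi> < x + 1 \<and> (x + 1) powr (1 - a) - x powr (1 - a) = (1 - a) * \<xi> powr (- a)" if x: "x > 0" for x :: real
  proof -
    have "\<exists>\<xi>>x. \<xi> < x + 1 \<and> (x + 1) powr (1 - a) - x powr (1 - a) = (x + 1 - x) * ((1 - a) * \<xi> powr (1 - a - 1))"
      by (rule MVT2) (use x in \<open>auto intro!: derivative_eq_intros\<close>)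
    then show ?thesis by simp
  qed
  show "(1 - a) * (real j + 1) powr (- a) \<le> d_coeff a j"
  proof (cases "j = 0")
    case False
    then obtain \<xi> where \<xi>: "\<xi> > real j" "\<xi> < real j + 1" "d_coeff a j = (1 - a) * \<xi> powr (- a)"
      using mvt[of "real j"] unfolding d_coeff_def by auto
    then show ?thesis using a by (auto intro!: mult_left_mono powr_mono2')
  qed (use a in \<open>simp add: d_coeff_def\<close>)
  obtain \<xi> where \<xi>: "\<xi> > real (Suc j)" "d_coeff a (Suc j) = (1 - a) * \<xi> powr (- a)"
    using mvt[of "real (Suc j)"] unfolding d_coeff_def by auto
  then show "d_coeff a (Suc j) \<le> (1 - a) * (real j + 1) powr (- a)"
    using a by (auto intro!: mult_left_mono powr_mono2')
qed

lemma d_coeff_decreasing: "0 < a \<Longrightarrow> a < 1 \<Longrightarrow> d_coeff a (Suc j) \<le> d_coeff a j"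
  using d_coeff_bounds[of a j] by linarith

lemma d_coeff_pos: "0 < a \<Longrightarrow> a < 1 \<Longrightarrow> 0 < d_coeff a j"
  by (rule less_le_trans[OF _ d_coeff_bounds(1)]) auto

lemma sum_d_coeff: "a < 1 \<Longrightarrow> (\<Sum>j<n. d_coeff a j) = real n powr (1 - a)"
  by (induction n) (simp_all add: d_coeff_def add.commute)

locale fractional =
  fixes \<alpha> :: real and m :: nat and a b :: "nat \<Rightarrow> real"
  assumes params: "order_params \<alpha> m a b"
begin

lemma \<alpha>: "0 < \<alpha>" "\<alpha> < 1"
  and ab: "i \<in> {1..m} \<Longrightarrow> 0 < a i" "i \<in> {1..m} \<Longrightarrow> a i < \<alpha>" "i \<in> {1..m} \<Longrightarrow> a i < 1" "i \<in> {1..m} \<Longrightarrow> 0 < b i"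
  using params by (auto simp: order_params_def intro: less_trans)

definition w where "w i = Gamma (2 - \<alpha>) * b i / Gamma (2 - a i)"

lemma w_nonneg: "i \<in> {1..m} \<Longrightarrow> 0 \<le> w i"
  using \<alpha> ab[of i] Gamma_real_pos[of "2 - \<alpha>"] Gamma_real_pos[of "2 - a i"] by (simp add: w_def)

lemma P_coeff_eq: "P_coeff \<alpha> m a b \<tau> j = d_coeff \<alpha> j + (\<Sum>i=1..m. w i * \<tau> powr (\<alpha> - a i) * d_coeff (a i) j)"
  unfolding P_coeff_def w_def by (simp add: mult_ac)

lemma P_coeff_decreasing: "P_coeff \<alpha> m a b \<tau> (Suc j) \<le> P_coeff \<alpha> m a b \<tau> j"
  unfolding P_coeff_eq using \<alpha> ab w_nonneg
  by (intro add_mono sum_mono mult_left_mono d_coeff_decreasing mult_nonneg_nonneg) auto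

lemma P_coeff_ge: "d_coeff \<alpha> j \<le> P_coeff \<alpha> m a b \<tau> j"
  unfolding P_coeff_eq using \<alpha> ab w_nonneg
  by (auto intro!: sum_nonneg mult_nonneg_nonneg less_imp_le[OF d_coeff_pos])

lemma P_coeff_pos: "0 < P_coeff \<alpha> m a b \<tau> j"
  using d_coeff_pos[OF \<alpha>] P_coeff_ge by (rule less_le_trans)

lemma P_coeff_antimono: "i \<le> j \<Longrightarrow> P_coeff \<alpha> m a b \<tau> j \<le> P_coeff \<alpha> m a b \<tau> i"
  by (rule lift_Suc_antimono_le) (rule P_coeff_decreasing)

lemma P_coeff_0_le:
  assumes "0 < \<tau>" "\<tau> \<le> T"
  shows "P_coeff \<alpha> m a b \<tau> 0 \<le> 1 + (\<Sum>i=1..m. w i * T powr (\<alpha> - a i))"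
proof -
  have "d_coeff h 0 = 1" for h by (simp add: d_coeff_def)
  moreover have "(\<Sum>i=1..m. w i * \<tau> powr (\<alpha> - a i)) \<le> (\<Sum>i=1..m. w i * T powr (\<alpha> - a i))"
    using assms ab w_nonneg by (intro sum_mono mult_left_mono powr_mono2) (auto intro: less_imp_le)
  ultimately show ?thesis unfolding P_coeff_eq by simp
qed

text \<open>For the Ritz part of the residual: its increments over one step are of order \<tau> and
  are weighted by all coefficients. The sums of \<open>d_coeff\<close> telescope, and the resulting
  power \<tau> powr \<alpha> is cancelled by the stability factor.\<close>

lemma sum_P_coeff_le:
  assumes "0 < \<tau>" "real n * \<tau> \<le> T"
  shows "\<tau> * (\<Sum>j<n. P_coeff \<alpha> m a b \<tau> j) \<le> \<tau> powr \<alpha> * (T powr (1 - \<alpha>) + (\<Sum>i=1..m. w i * T powr (1 - a i)))"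
proof -
  have t: "\<tau> = \<tau> powr h * \<tau> powr (1 - h)" for h using assms(1) by (simp add: powr_add[symmetric])
  have s: "\<tau> powr (1 - h) * real n powr (1 - h) \<le> T powr (1 - h)" if "h < 1" for h
    using assms that by (simp add: powr_mult[symmetric] mult.commute powr_mono2)
  have "(\<Sum>j<n. P_coeff \<alpha> m a b \<tau> j) = (\<Sum>j<n. d_coeff \<alpha> j) + (\<Sum>i=1..m. w i * \<tau> powr (\<alpha> - a i) * (\<Sum>j<n. d_coeff (a i) j))"
    unfolding P_coeff_eq sum.distrib sum_distrib_left by (subst sum.swap) simp
  also have "\<dots> = real n powr (1 - \<alpha>) + (\<Sum>i=1..m. w i * \<tau> powr (\<alpha> - a i) * real n powr (1 - a i))"
    using \<alpha> ab by (simp add: sum_d_coeff)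
  finally have "\<tau> * (\<Sum>j<n. P_coeff \<alpha> m a b \<tau> j) = \<tau> * real n powr (1 - \<alpha>) + (\<Sum>i=1..m. w i * (\<tau> * \<tau> powr (\<alpha> - a i) * real n powr (1 - a i)))"
    by (simp add: distrib_left sum_distrib_left mult_ac)
  also have "\<dots> = \<tau> powr \<alpha> * (\<tau> powr (1 - \<alpha>) * real n powr (1 - \<alpha>)) + (\<Sum>i=1..m. w i * (\<tau> powr \<alpha> * (\<tau> powr (1 - a i) * real n powr (1 - a i))))"
  proof -
    have "\<tau> * \<tau> powr (\<alpha> - a i) = \<tau> powr \<alpha> * \<tau> powr (1 - a i)" for i
    proof -
      have "\<tau> * \<tau> powr (\<alpha> - a i) = \<tau> powr 1 * \<tau> powr (\<alpha> - a i)" using assms(1) by simp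
      also have "\<dots> = \<tau> powr \<alpha> * \<tau> powr (1 - a i)" unfolding powr_add[symmetric] by (simp add: algebra_simps)
      finally show ?thesis .
    qed
    then show ?thesis using t[of \<alpha>] by (simp add: mult.assoc[symmetric])
  qed
  also have "\<dots> \<le> \<tau> powr \<alpha> * T powr (1 - \<alpha>) + (\<Sum>i=1..m. w i * (\<tau> powr \<alpha> * T powr (1 - a i)))"
    using \<alpha> ab w_nonneg by (intro add_mono mult_left_mono s sum_mono) auto
  also have "\<dots> = \<tau> powr \<alpha> * (T powr (1 - \<alpha>) + (\<Sum>i=1..m. w i * T powr (1 - a i)))"
    by (simp add: distrib_left sum_distrib_left mult_ac)
  finally show ?thesis .
qed

lemma P_coeff_lower:
  assumes "0 < \<tau>" "real (Suc n) * \<tau> \<le> T"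
  shows "(1 - \<alpha>) * T powr (- \<alpha>) * \<tau> powr \<alpha> \<le> P_coeff \<alpha> m a b \<tau> n"
proof -
  have "T powr (- \<alpha>) \<le> (real (Suc n) * \<tau>) powr (- \<alpha>)"
    using assms \<alpha> by (intro powr_mono2') auto
  then have "(1 - \<alpha>) * T powr (- \<alpha>) * \<tau> powr \<alpha> \<le> (1 - \<alpha>) * (real (Suc n) * \<tau>) powr (- \<alpha>) * \<tau> powr \<alpha>"
    using \<alpha> by (intro mult_right_mono mult_left_mono) auto
  also have "\<dots> = (1 - \<alpha>) * (real n + 1) powr (- \<alpha>)"
    using assms(1) by (simp add: powr_mult powr_minus add.commute)
  also have "\<dots> \<le> P_coeff \<alpha> m a b \<tau> n" using d_coeff_bounds(1)[OF \<alpha>, of n] P_coeff_ge[of n \<tau>] by linarith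
  finally show ?thesis .
qed

text \<open>The weights on the right add up to the weight on the left, so each step averages earlier
  values and adds \<open>R\<close>. As the coefficients decrease, the hypotheses for earlier indices
  hold with \<open>P_coeff \<alpha> m a b \<tau> n\<close> as common divisor; the telescoping
  weights leave a deficit of exactly \<open>R\<close>.\<close>

lemma stability:
  fixes x :: "nat \<Rightarrow> real"
  assumes rec: "\<And>n. n < K \<Longrightarrow> P_coeff \<alpha> m a b \<tau> 0 * x (Suc n)
      \<le> (\<Sum>j<n. (P_coeff \<alpha> m a b \<tau> j - P_coeff \<alpha> m a b \<tau> (j + 1)) * x (n - j)) + P_coeff \<alpha> m a b \<tau> n * x 0 + R"
    and R: "0 \<le> R" and n: "n < K"
  shows "x (Suc n) \<le> x 0 + R / P_coeff \<alpha> m a b \<tau> n"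
  using n
proof (induction n rule: less_induct)
  case (less n)
  let ?P = "P_coeff \<alpha> m a b \<tau>"
  have le: "x (n - j) \<le> x 0 + R / ?P n" if j: "j < n" for j
  proof -
    obtain i where i: "n - j = Suc i" "i < n" using j by (metis Suc_diff_Suc diff_less less_imp_Suc_add zero_less_Suc diff_Suc_less Suc_lessD diff_less_Suc not_less_eq)
    have "x (n - j) \<le> x 0 + R / ?P i" using less.IH[OF i(2)] less.prems i by simp
    also have "R / ?P i \<le> R / ?P n"
      using R i P_coeff_antimono[of i n \<tau>] P_coeff_pos[of \<tau> n] by (intro divide_left_mono mult_pos_pos P_coeff_pos) auto
    finally show ?thesis by simp
  qed
  have "?P 0 * x (Suc n) \<le> (\<Sum>j<n. (?P j - ?P (j + 1)) * x (n - j)) + ?P n * x 0 + R" by (rule rec[OF less.prems])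
  also have "(\<Sum>j<n. (?P j - ?P (j + 1)) * x (n - j)) \<le> (\<Sum>j<n. (?P j - ?P (j + 1)) * (x 0 + R / ?P n))"
    using le P_coeff_decreasing by (intro sum_mono mult_left_mono) auto
  also have "\<dots> = (?P 0 - ?P n) * (x 0 + R / ?P n)"
    unfolding sum_distrib_right[symmetric] using sum_lessThan_telescope'[of ?P n] by simp
  also have "\<dots> + ?P n * x 0 + R = ?P 0 * (x 0 + R / ?P n)"
    using P_coeff_pos[of \<tau> n] by (simp add: field_simps)
  finally show ?case using P_coeff_pos[of \<tau> 0] by simp
qed

end

text \<open>Summation by parts: the left side is the discretised fractional derivative up to a
  factor, the right side the arrangement in which the scheme is stated.\<close>

lemma abel_difference:
  fixes P :: "nat \<Rightarrow> real" and V :: "nat \<Rightarrow> 'b::real_vector"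
  shows "(\<Sum>j<Suc n. P j *\<^sub>R (V (Suc n - j) - V (n - j))) = P 0 *\<^sub>R V (Suc n) - (\<Sum>j<n. (P j - P (j + 1)) *\<^sub>R V (n - j)) - P n *\<^sub>R V 0"
proof -
  have "(\<Sum>j<Suc n. P j *\<^sub>R V (Suc n - j)) = P 0 *\<^sub>R V (Suc n) + (\<Sum>j<n. P (Suc j) *\<^sub>R V (n - j))"
    by (subst sum.lessThan_Suc_shift) simp
  then show ?thesis by (simp add: scaleR_diff_right scaleR_diff_left sum_subtractf)
qed

section \<open>Truncation error of the L1 scheme\<close>

lemma powr_has_integral:
  fixes s p q h :: real
  assumes "p \<le> q" "q \<le> s" "h < 1"
  shows "((\<lambda>r. (s - r) powr (- h)) has_integral ((s - p) powr (1 - h) - (s - q) powr (1 - h)) / (1 - h)) {p..q}"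
proof -
  let ?F = "\<lambda>r. - ((s - r) powr (1 - h) / (1 - h))"
  have "((\<lambda>r. (s - r) powr (- h)) has_integral (?F q - ?F p)) {p..q}"
  proof (rule fundamental_theorem_of_calculus_interior[OF assms(1)])
    show "continuous_on {p..q} ?F"
      using assms by (intro continuous_intros continuous_on_powr') auto
    show "(?F has_vector_derivative (s - x) powr (- h)) (at x)" if "x \<in> {p<..<q}" for x
      using that assms by (auto intro!: derivative_eq_intros simp: has_real_derivative_iff_has_vector_derivative[symmetric])
  qed
  then show ?thesis by (simp add: diff_divide_distrib)
qed

lemma norm_diff_le_of_derivative_bound:
  fixes f :: "real \<Rightarrow> 'b::real_normed_vector"
  assumes "x \<le> y" "continuous_on {x..y} f" "\<And>r. x < r \<Longrightarrow> r < y \<Longrightarrow> (f has_vector_derivative f' r) (at r)"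
    and "\<And>r. x < r \<Longrightarrow> r < y \<Longrightarrow> norm (f' r) \<le> B"
  shows "norm (f y - f x) \<le> B * (y - x)"
proof (cases "x = y")
  case False
  have "norm (f y - f x) \<le> B * y - B * x"
    by (rule differentiable_bound_general[where f' = f' and \<phi>' = "\<lambda>_. B"])
      (use False assms in \<open>auto intro!: continuous_intros derivative_eq_intros
        simp: has_real_derivative_iff_has_vector_derivative[symmetric]\<close>)
  then show ?thesis by (simp add: algebra_simps)
qed simp

text \<open>\<open>g\<close> stands for the derivative of \<open>u\<close>, which is given only in
  the interior; its Lipschitz bound there extends it to the closed interval.\<close>

locale L1_interval =
  fixes u g :: "real \<Rightarrow> 'b::banach" and s M :: real
  assumes cu: "continuous_on {0..s} u" and lg: "M-lipschitz_on {0..s} g"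
    and du: "\<And>x. x \<in> {0<..<s} \<Longrightarrow> (u has_vector_derivative g x) (at x)"
begin

lemma cg: "continuous_on {0..s} g" using lg by (rule lipschitz_on_continuous_on)

lemma M0: "0 \<le> M" using lg by (rule lipschitz_on_nonneg)

lemma difference_quotient:
  assumes "0 \<le> p" "q \<le> s" "p < q" "x \<in> {p..q}" "e \<in> {p..q}"
  shows "norm (u e - u p - (e - p) *\<^sub>R g x) \<le> M * (q - p) * (e - p)"
proof -
  have "norm ((u e - e *\<^sub>R g x) - (u p - p *\<^sub>R g x)) \<le> M * (q - p) * (e - p)"
  proof (rule norm_diff_le_of_derivative_bound[where f' = "\<lambda>r. g r - g x"])
    show "p \<le> e" using assms by simp
    show "continuous_on {p..e} (\<lambda>e. u e - e *\<^sub>R g x)"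
      using assms by (intro continuous_intros continuous_on_subset[OF cu]) auto
    fix r assume r: "p < r" "r < e"
    show "((\<lambda>e. u e - e *\<^sub>R g x) has_vector_derivative g r - g x) (at r)"
      using du[of r] r assms by (auto intro!: derivative_eq_intros)
    have "norm (g r - g x) \<le> M * \<bar>r - x\<bar>"
      using lipschitz_onD[OF lg, of r x] r assms by (auto simp: dist_norm)
    also have "\<dots> \<le> M * (q - p)" using r assms M0 by (intro mult_left_mono) auto
    finally show "norm (g r - g x) \<le> M * (q - p)" .
  qed
  then show ?thesis by (simp add: algebra_simps)
qed

lemma slope_bound:
  assumes "0 \<le> p" "q \<le> s" "p < q" "x \<in> {p..q}"
  shows "norm (g x - (1 / (q - p)) *\<^sub>R (u q - u p)) \<le> M * (q - p)"
proof -
  have "norm (u q - u p - (q - p) *\<^sub>R g x) \<le> M * (q - p) * (q - p)"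
    using difference_quotient[OF assms, of q] assms by auto
  moreover have "u q - u p - (q - p) *\<^sub>R g x = (p - q) *\<^sub>R (g x - (1 / (q - p)) *\<^sub>R (u q - u p))"
  proof -
    have "(p - q) *\<^sub>R ((1 / (q - p)) *\<^sub>R (u q - u p)) = - (u q - u p)"
    proof -
      have "(p - q) * (1 / (q - p)) = - 1" using assms by (simp add: field_simps)
      then show ?thesis by (simp only: scaleR_scaleR scaleR_minus_left scaleR_one)
    qed
    then show ?thesis by (simp add: scaleR_diff_right scaleR_diff_left)
  qed
  ultimately have "(q - p) * norm (g x - (1 / (q - p)) *\<^sub>R (u q - u p)) \<le> (q - p) * (M * (q - p))"
    using assms by (simp add: mult_ac)
  then show ?thesis using assms by simp
qed

text \<open>\<open>E\<close> is the error of linear interpolation of \<open>u\<close>. It vanishes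
  at both ends, so integration by parts leaves no boundary terms, and the derivative of the kernel
  is positive, so its integral is the increment of the kernel.\<close>

lemma interior_interval:
  assumes "0 \<le> p" "q < s" "p < q" and h: "0 < h"
  shows "norm (integral {p..q} (\<lambda>r. (s - r) powr (- h) *\<^sub>R (g r - (1 / (q - p)) *\<^sub>R (u q - u p))))
    \<le> M * (q - p)^2 * ((s - q) powr (- h) - (s - p) powr (- h))"
proof -
  define \<delta> where "\<delta> = (1 / (q - p)) *\<^sub>R (u q - u p)"
  define E where "E = (\<lambda>r. u r - u p - (r - p) *\<^sub>R \<delta>)"
  have cE: "continuous_on {p..q} E" unfolding E_def
    using assms by (intro continuous_intros continuous_on_subset[OF cu]) auto
  have E0: "E p = 0" "E q = 0" using assms by (auto simp: E_def \<delta>_def)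
  have Eb: "norm (E r) \<le> M * (q - p)^2" if r: "r \<in> {p..q}" for r
  proof -
    have "norm (E r - E p) \<le> M * (q - p) * (r - p)"
    proof (rule norm_diff_le_of_derivative_bound[where f' = "\<lambda>r. g r - \<delta>"])
      show "p \<le> r" using r by auto
      show "continuous_on {p..r} E" by (rule continuous_on_subset[OF cE]) (use r in auto)
      fix x assume x: "p < x" "x < r"
      show "(E has_vector_derivative g x - \<delta>) (at x)"
        unfolding E_def using du[of x] x r assms by (auto intro!: derivative_eq_intros)
      show "norm (g x - \<delta>) \<le> M * (q - p)"
        unfolding \<delta>_def using x r assms by (intro slope_bound) auto
    qed
    also have "\<dots> \<le> M * (q - p) * (q - p)" using r assms M0 by (intro mult_left_mono) auto
    finally show ?thesis using E0 by (simp add: power2_eq_square mult_ac)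
  qed
  have ck: "continuous_on {p..q} (\<lambda>r. (s - r) powr e)" for e
    using assms by (intro continuous_intros) auto
  let ?k = "\<lambda>r. h * (s - r) powr (- h - 1)"
  have dk: "((\<lambda>r. (s - r) powr (- h)) has_real_derivative ?k x) (at x)" if "x < s" for x
    using that by (auto intro!: derivative_eq_intros)
  have cg': "continuous_on {p..q} (\<lambda>r. g r - \<delta>)"
    using assms by (intro continuous_intros continuous_on_subset[OF cg]) auto
  have i1: "(\<lambda>r. (s - r) powr (- h) *\<^sub>R (g r - \<delta>)) integrable_on {p..q}"
    by (intro integrable_continuous_real continuous_on_scaleR ck cg')
  have i2: "(\<lambda>r. ?k r *\<^sub>R E r) integrable_on {p..q}"
    by (intro integrable_continuous_real continuous_on_scaleR continuous_on_mult continuous_on_const ck cE)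
  let ?F = "\<lambda>r. (s - r) powr (- h) *\<^sub>R E r"
  have "((\<lambda>r. (s - r) powr (- h) *\<^sub>R (g r - \<delta>) + ?k r *\<^sub>R E r) has_integral (?F q - ?F p)) {p..q}"
  proof (rule fundamental_theorem_of_calculus_interior)
    show "continuous_on {p..q} ?F" by (intro continuous_on_scaleR ck cE)
    fix x assume x: "x \<in> {p<..<q}"
    have "(E has_vector_derivative g x - \<delta>) (at x)"
      unfolding E_def using du[of x] x assms by (auto intro!: derivative_eq_intros)
    from has_vector_derivative_scaleR[OF dk this] x assms
    show "(?F has_vector_derivative (s - x) powr (- h) *\<^sub>R (g x - \<delta>) + ?k x *\<^sub>R E x) (at x)" by simp
  qed (use assms in simp)
  then have "integral {p..q} (\<lambda>r. (s - r) powr (- h) *\<^sub>R (g r - \<delta>) + ?k r *\<^sub>R E r) = 0"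
    using E0 by (simp add: integral_unique)
  then have "integral {p..q} (\<lambda>r. (s - r) powr (- h) *\<^sub>R (g r - \<delta>)) = - integral {p..q} (\<lambda>r. ?k r *\<^sub>R E r)"
    using integral_add[OF i1 i2] by (simp add: eq_neg_iff_add_eq_0)
  then have "norm (integral {p..q} (\<lambda>r. (s - r) powr (- h) *\<^sub>R (g r - \<delta>))) = norm (integral {p..q} (\<lambda>r. ?k r *\<^sub>R E r))" by simp
  also have "\<dots> \<le> integral {p..q} (\<lambda>r. M * (q - p)^2 * ?k r)"
  proof (rule integral_norm_bound_integral[OF i2])
    show "(\<lambda>r. M * (q - p)^2 * ?k r) integrable_on {p..q}"
      by (intro integrable_continuous_real continuous_on_mult continuous_on_const ck)
    show "norm (?k r *\<^sub>R E r) \<le> M * (q - p)^2 * ?k r" if "r \<in> {p..q}" for r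
      using mult_left_mono[OF Eb[OF that], of "?k r"] h by (simp add: abs_mult mult_ac)
  qed
  also have "\<dots> = M * (q - p)^2 * ((s - q) powr (- h) - (s - p) powr (- h))"
  proof -
    have "(?k has_integral ((s - q) powr (- h) - (s - p) powr (- h))) {p..q}"
      using dk assms by (intro fundamental_theorem_of_calculus_interior ck)
        (auto simp: has_real_derivative_iff_has_vector_derivative[symmetric])
    then show ?thesis by (intro integral_unique has_integral_mult_right)
  qed
  finally show ?thesis unfolding \<delta>_def .
qed

text \<open>The derivative of the kernel is not integrable up to \<open>s\<close>. Here the slope
  error, at most M (s - p), is integrated against the kernel itself.\<close>

lemma last_interval:
  assumes "0 \<le> p" "p < s" and h: "0 < h" "h < 1"
    and int: "(\<lambda>r. (s - r) powr (- h) *\<^sub>R g r) integrable_on {p..s}"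
  shows "norm (integral {p..s} (\<lambda>r. (s - r) powr (- h) *\<^sub>R (g r - (1 / (s - p)) *\<^sub>R (u s - u p))))
    \<le> M * (s - p) powr (2 - h) / (1 - h)"
proof -
  define \<delta> where "\<delta> = (1 / (s - p)) *\<^sub>R (u s - u p)"
  have k: "((\<lambda>r. (s - r) powr (- h)) has_integral (s - p) powr (1 - h) / (1 - h)) {p..s}"
    using powr_has_integral[of p s s h] assms by simp
  have i: "(\<lambda>r. (s - r) powr (- h) *\<^sub>R (g r - \<delta>)) integrable_on {p..s}"
    using integrable_diff[OF int has_integral_integrable[OF has_integral_scaleR_left[OF k, of \<delta>]]]
    by (simp add: scaleR_diff_right)
  have "norm (integral {p..s} (\<lambda>r. (s - r) powr (- h) *\<^sub>R (g r - \<delta>))) \<le> integral {p..s} (\<lambda>r. M * (s - p) * (s - r) powr (- h))"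
  proof (rule integral_norm_bound_integral[OF i])
    show "(\<lambda>r. M * (s - p) * (s - r) powr (- h)) integrable_on {p..s}"
      using has_integral_mult_right[OF k] by blast
    show "norm ((s - r) powr (- h) *\<^sub>R (g r - \<delta>)) \<le> M * (s - p) * (s - r) powr (- h)" if "r \<in> {p..s}" for r
      using mult_left_mono[OF slope_bound[of p s r], of "(s - r) powr (- h)"] assms that by (simp add: \<delta>_def mult_ac)
  qed
  also have "\<dots> = M * (s - p) * ((s - p) powr (1 - h) / (1 - h))"
    using has_integral_mult_right[OF k] by (rule integral_unique)
  also have "\<dots> = M * (s - p) powr (2 - h) / (1 - h)"
  proof -
    have "(s - p) * (s - p) powr (1 - h) = (s - p) powr 1 * (s - p) powr (1 - h)" using assms by simp
    also have "\<dots> = (s - p) powr (2 - h)" unfolding powr_add[symmetric] by simp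
    finally show ?thesis by simp
  qed
  finally show ?thesis unfolding \<delta>_def .
qed

lemma L1_error:
  assumes s: "s = real N * \<tau>" and \<tau>: "0 < \<tau>" and N: "0 < N" and h: "0 < h" "h < 1"
    and int: "(\<lambda>r. (s - r) powr (- h) *\<^sub>R g r) integrable_on {0..s}"
  shows "norm (integral {0..s} (\<lambda>r. (s - r) powr (- h) *\<^sub>R g r)
     - (\<tau> powr (- h) / (1 - h)) *\<^sub>R (\<Sum>j<N. d_coeff h j *\<^sub>R (u (real (N - j) * \<tau>) - u (real (N - 1 - j) * \<tau>))))
    \<le> 2 * M * \<tau> powr (2 - h) / (1 - h)"
proof -
  define t where "t = (\<lambda>j. real j * \<tau>)"
  have tS: "t (Suc j) = t j + \<tau>" for j by (simp add: t_def algebra_simps)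
  define \<delta> where "\<delta> = (\<lambda>j. (1 / \<tau>) *\<^sub>R (u (t (Suc j)) - u (t j)))"
  let ?K = "\<lambda>r. (s - r) powr (- h)"
  have tj: "0 \<le> t j" "t j < t (Suc j)" for j using \<tau> by (auto simp: t_def)
  have ts: "t (Suc j) \<le> s" if "j < N" for j using that \<tau> unfolding t_def s by (intro mult_right_mono) auto
  have intj: "(\<lambda>r. ?K r *\<^sub>R g r) integrable_on {t i..t j}" if "j \<le> N" for i j
  proof (rule integrable_subinterval_real[OF int])
    have "t j \<le> s" using that \<tau> unfolding t_def s by (intro mult_right_mono) auto
    then show "{t i..t j} \<subseteq> {0..s}" using tj(1)[of i] by auto
  qed
  have kj: "((\<lambda>r. ?K r *\<^sub>R \<delta> j) has_integral (\<tau> powr (1 - h) / (1 - h) * d_coeff h (N - 1 - j)) *\<^sub>R \<delta> j) {t j..t (Suc j)}" if j: "j < N" for j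
  proof -
    have "s - t j = real (N - j) * \<tau>" "s - t (Suc j) = real (N - 1 - j) * \<tau>"
      using j unfolding t_def s by (auto simp: of_nat_diff algebra_simps)
    moreover have "real (N - j) = real (N - 1 - j) + 1" using j by (simp add: of_nat_diff)
    ultimately have "(s - t j) powr (1 - h) - (s - t (Suc j)) powr (1 - h) = \<tau> powr (1 - h) * d_coeff h (N - 1 - j)"
      using \<tau> unfolding d_coeff_def by (simp only: powr_mult of_nat_0_le_iff less_imp_le) (simp add: algebra_simps)
    then show ?thesis
      using has_integral_scaleR_left[OF powr_has_integral[of "t j" "t (Suc j)" s h], of "\<delta> j"] tj(2)[of j] ts[OF j] h by simp
  qed
  have split: "integral {0..t n} (\<lambda>r. ?K r *\<^sub>R g r) = (\<Sum>j<n. integral {t j..t (Suc j)} (\<lambda>r. ?K r *\<^sub>R g r))" if "n \<le> N" for n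
    using that
  proof (induction n)
    case (Suc n)
    have "integral {0..t n} (\<lambda>r. ?K r *\<^sub>R g r) + integral {t n..t (Suc n)} (\<lambda>r. ?K r *\<^sub>R g r) = integral {0..t (Suc n)} (\<lambda>r. ?K r *\<^sub>R g r)"
      using tj[of n] intj[of "Suc n" 0] Suc.prems by (intro Henstock_Kurzweil_Integration.integral_combine) (auto simp: t_def)
    then show ?case using Suc by simp
  qed (simp add: t_def)
  define I where "I = (\<lambda>j. integral {t j..t (Suc j)} (\<lambda>r. ?K r *\<^sub>R (g r - \<delta> j)))"
  have I: "I j = integral {t j..t (Suc j)} (\<lambda>r. ?K r *\<^sub>R g r) - (\<tau> powr (1 - h) / (1 - h) * d_coeff h (N - 1 - j)) *\<^sub>R \<delta> j" if j: "j < N" for j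
  proof -
    have "I j = integral {t j..t (Suc j)} (\<lambda>r. ?K r *\<^sub>R g r - ?K r *\<^sub>R \<delta> j)" by (simp add: I_def scaleR_diff_right)
    also have "\<dots> = integral {t j..t (Suc j)} (\<lambda>r. ?K r *\<^sub>R g r) - integral {t j..t (Suc j)} (\<lambda>r. ?K r *\<^sub>R \<delta> j)"
      by (rule integral_diff[OF intj has_integral_integrable[OF kj[OF j]]]) (use j in simp)
    finally show ?thesis using integral_unique[OF kj[OF j]] by simp
  qed
  have disc: "(\<Sum>j<N. (\<tau> powr (1 - h) / (1 - h) * d_coeff h (N - 1 - j)) *\<^sub>R \<delta> j)
    = (\<tau> powr (- h) / (1 - h)) *\<^sub>R (\<Sum>j<N. d_coeff h j *\<^sub>R (u (real (N - j) * \<tau>) - u (real (N - 1 - j) * \<tau>)))"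
  proof -
    have c: "\<tau> powr (1 - h) / (1 - h) * d * (1 / \<tau>) = \<tau> powr (- h) / (1 - h) * d" for d
    proof -
      have "\<tau> powr (1 - h) = \<tau> powr (- h) * \<tau>" using \<tau> powr_add[of \<tau> "- h" 1] by simp
      then show ?thesis using \<tau> by simp
    qed
    have "(\<Sum>j<N. (\<tau> powr (1 - h) / (1 - h) * d_coeff h (N - 1 - j)) *\<^sub>R \<delta> j)
      = (\<Sum>j<N. (\<tau> powr (- h) / (1 - h) * d_coeff h (N - 1 - j)) *\<^sub>R (u (t (Suc j)) - u (t j)))"
      unfolding \<delta>_def scaleR_scaleR c ..
    \<comment> \<open>The scheme counts intervals backwards from the current time, hence the
      reversal of the index.\<close>
    also have "\<dots> = (\<Sum>j<N. (\<tau> powr (- h) / (1 - h) * d_coeff h j) *\<^sub>R (u (t (N - j)) - u (t (N - 1 - j))))"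
      by (subst sum.nat_diff_reindex[symmetric]) (auto intro!: sum.cong simp: Suc_diff_Suc)
    finally show ?thesis by (simp add: scaleR_sum_right t_def)
  qed
  have split': "integral {0..s} (\<lambda>r. ?K r *\<^sub>R g r) = (\<Sum>j<N. integral {t j..t (Suc j)} (\<lambda>r. ?K r *\<^sub>R g r))"
    using split[of N] by (simp add: t_def s)
  have "norm (integral {0..s} (\<lambda>r. ?K r *\<^sub>R g r)
     - (\<tau> powr (- h) / (1 - h)) *\<^sub>R (\<Sum>j<N. d_coeff h j *\<^sub>R (u (real (N - j) * \<tau>) - u (real (N - 1 - j) * \<tau>))))
    = norm (\<Sum>j<N. I j)"
    unfolding split' disc[symmetric] by (simp add: I sum_subtractf)
  also have "\<dots> \<le> (\<Sum>j<N. norm (I j))" by (rule norm_sum)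
  also have "\<dots> = (\<Sum>j<N - 1. norm (I j)) + norm (I (N - 1))"
    using N by (cases N) auto
  also have "\<dots> \<le> M * \<tau>^2 * \<tau> powr (- h) + M * \<tau> powr (2 - h) / (1 - h)"
  proof (rule add_mono)
    have "(\<Sum>j<N - 1. norm (I j)) \<le> (\<Sum>j<N - 1. M * \<tau>^2 * ((s - t (Suc j)) powr (- h) - (s - t j) powr (- h)))"
    proof (rule sum_mono)
      fix j assume "j \<in> {..<N - 1}"
      then have j: "Suc j < N" by auto
      have "t (Suc j) < s" using ts[OF j] tj(2)[of "Suc j"] by linarith
      from interior_interval[OF tj(1) this tj(2) h(1)]
      show "norm (I j) \<le> M * \<tau>^2 * ((s - t (Suc j)) powr (- h) - (s - t j) powr (- h))"
        unfolding I_def \<delta>_def by (simp add: tS)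
    qed
    also have "\<dots> = M * \<tau>^2 * ((s - t (N - 1)) powr (- h) - (s - t 0) powr (- h))"
      unfolding sum_distrib_left[symmetric] using sum_lessThan_telescope[of "\<lambda>j. (s - t j) powr (- h)" "N - 1"] by simp
    also have "s - t (N - 1) = \<tau>" using N by (simp add: s t_def of_nat_diff algebra_simps)
    also have "M * \<tau>^2 * (\<tau> powr (- h) - (s - t 0) powr (- h)) \<le> M * \<tau>^2 * \<tau> powr (- h)"
      using M0 by (intro mult_left_mono) auto
    finally show "(\<Sum>j<N - 1. norm (I j)) \<le> M * \<tau>^2 * \<tau> powr (- h)" .
    have e: "t (Suc (N - 1)) = s" "s - t (N - 1) = \<tau>" "t (N - 1) < s"
      using N \<tau> by (auto simp: s t_def of_nat_diff algebra_simps)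
    have "(\<lambda>r. ?K r *\<^sub>R g r) integrable_on {t (N - 1)..s}" using intj[of N "N - 1"] by (simp add: t_def s)
    from last_interval[OF tj(1) e(3) h this]
    show "norm (I (N - 1)) \<le> M * \<tau> powr (2 - h) / (1 - h)" unfolding I_def \<delta>_def e by simp
  qed
  also have "M * \<tau>^2 * \<tau> powr (- h) = M * \<tau> powr (2 - h)"
  proof -
    have "\<tau>^2 * \<tau> powr (- h) = \<tau> powr 2 * \<tau> powr (- h)" using \<tau> by (simp add: powr_numeral)
    also have "\<dots> = \<tau> powr (2 - h)" unfolding powr_add[symmetric] by simp
    finally show ?thesis by simp
  qed
  also have "M * \<tau> powr (2 - h) + M * \<tau> powr (2 - h) / (1 - h) \<le> 2 * M * \<tau> powr (2 - h) / (1 - h)"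
  proof -
    have "M * \<tau> powr (2 - h) * (1 - h) \<le> M * \<tau> powr (2 - h) * 1" using M0 h by (intro mult_left_mono mult_nonneg_nonneg) auto
    then have "M * \<tau> powr (2 - h) \<le> M * \<tau> powr (2 - h) / (1 - h)" using h by (simp add: pos_le_divide_eq)
    then show ?thesis by simp
  qed
  finally show ?thesis by simp
qed

end

lemma caputo_L1_error:
  fixes u u' u'' :: "real \<Rightarrow> 'b::banach"
  assumes s: "s = real N * \<tau>" "s \<le> T" and \<tau>: "0 < \<tau>" and N: "0 < N"
    and cu: "continuous_on {0..T} u"
    and d1: "\<And>t. t \<in> {0<..T} \<Longrightarrow> (u has_vector_derivative u' t) (at t within {0..T})"
    and d2: "\<And>t. t \<in> {0<..T} \<Longrightarrow> (u' has_vector_derivative u'' t) (at t within {0..T})"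
    and c2: "continuous_on {0<..T} u''" and M: "\<And>t. t \<in> {0<..s} \<Longrightarrow> norm (u'' t) \<le> M"
    and h: "0 < h" "h < 1"
  shows "norm (caputo h u s - (\<tau> powr (- h) / Gamma (2 - h)) *\<^sub>R (\<Sum>j<N. d_coeff h j *\<^sub>R (u (real (N - j) * \<tau>) - u (real (N - 1 - j) * \<tau>))))
    \<le> 2 * M * \<tau> powr (2 - h) / Gamma (2 - h)"
proof -
  have s0: "0 < s" using s \<tau> N by simp
  have M0: "0 \<le> M" using order_trans[OF norm_ge_zero M[of s]] s0 by simp
  have at: "at t within {0..T} = at t" if "t \<in> {0<..<s}" for t
    by (rule at_within_interior) (use that s in auto)
  have lip: "norm (u' y - u' x) \<le> M * (y - x)" if xy: "0 < x" "x \<le> y" "y \<le> s" for x y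
  proof (rule norm_diff_le_of_derivative_bound[where f' = u''])
    show "continuous_on {x..y} u'"
      unfolding continuous_on_eq_continuous_within
    proof
      fix r assume r: "r \<in> {x..y}"
      have "(u' has_vector_derivative u'' r) (at r within {x..y})"
        by (rule has_vector_derivative_within_subset[OF d2]) (use r xy s in auto)
      then show "continuous (at r within {x..y}) u'" by (rule has_vector_derivative_continuous)
    qed
    fix r assume r: "x < r" "r < y"
    show "(u' has_vector_derivative u'' r) (at r)" using d2[of r] at[of r] r xy s by simp
    show "norm (u'' r) \<le> M" by (rule M) (use r xy in auto)
  qed (rule xy)
  have "M-lipschitz_on {0<..s} u'"
  proof (rule lipschitz_onI[OF _ M0])
    fix x y assume xy: "x \<in> {0<..s}" "y \<in> {0<..s}"
    show "dist (u' x) (u' y) \<le> M * dist x y"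
    proof (cases "x \<le> y")
      case True
      then show ?thesis using lip[of x y] xy by (simp add: dist_norm norm_minus_commute)
    next
      case False
      then show ?thesis using lip[of y x] xy by (simp add: dist_norm)
    qed
  qed
  then obtain g where g: "M-lipschitz_on {0..s} g" "\<And>x. x \<in> {0<..s} \<Longrightarrow> g x = u' x"
    using lipschitz_extend_closure s0 by (metis closure_greaterThanAtMost)
  have du: "(u has_vector_derivative g x) (at x)" if "x \<in> {0<..<s}" for x
    using d1[of x] at[OF that] that s g(2)[of x] by simp
  interpret L1_interval u g s M
    by unfold_locales (use continuous_on_subset[OF cu] s g(1) du in auto)
  let ?K = "\<lambda>r. (s - r) powr (- h)"
  \<comment> \<open>On the first half the kernel is continuous. On the second half the fundamental
    theorem is applied to the product of \<open>g\<close> with a primitive of the kernel that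
    vanishes at \<open>s\<close>: its derivative is the integrand, up to sign, plus a continuous
    term with \<open>u''\<close>.\<close>
  have int: "(\<lambda>r. ?K r *\<^sub>R g r) integrable_on {0..s}"
  proof (rule Henstock_Kurzweil_Integration.integrable_combine)
    show "0 \<le> s / 2" "s / 2 \<le> s" using s0 by auto
    show "(\<lambda>r. ?K r *\<^sub>R g r) integrable_on {0..s / 2}"
    proof (intro integrable_continuous_real continuous_on_scaleR)
      show "continuous_on {0..s / 2} ?K" using s0 by (intro continuous_intros) auto
      show "continuous_on {0..s / 2} g" by (rule continuous_on_subset[OF cg]) (use s0 in auto)
    qed
    let ?k = "\<lambda>r. (s - r) powr (1 - h) / (1 - h)"
    have ck: "continuous_on {s / 2..s} ?k"
      using h by (intro continuous_intros continuous_on_powr') auto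
    have dk: "(?k has_real_derivative - ?K x) (at x)" if "x < s" for x
      using that h by (auto intro!: derivative_eq_intros)
    have dg: "(g has_vector_derivative u'' x) (at x)" if x: "x \<in> {0<..<s}" for x
    proof (rule has_vector_derivative_transform_within_open[of u' _ _ "{0<..<s}"])
      show "(u' has_vector_derivative u'' x) (at x)" using d2[of x] at[OF x] x s by simp
    qed (use x g(2) in auto)
    have "((\<lambda>r. - ?K r *\<^sub>R g r + ?k r *\<^sub>R u'' r) has_integral (?k s *\<^sub>R g s - ?k (s / 2) *\<^sub>R g (s / 2))) {s / 2..s}"
    proof (rule fundamental_theorem_of_calculus_interior)
      show "continuous_on {s / 2..s} (\<lambda>r. ?k r *\<^sub>R g r)"
        by (intro continuous_on_scaleR ck continuous_on_subset[OF cg]) (use s0 in auto)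
      fix x assume "x \<in> {s / 2<..<s}"
      then have x: "x \<in> {0<..<s}" using s0 by auto
      show "((\<lambda>r. ?k r *\<^sub>R g r) has_vector_derivative - ?K x *\<^sub>R g x + ?k x *\<^sub>R u'' x) (at x)"
        using has_vector_derivative_scaleR[OF dk[of x] dg[OF x]] x by (simp add: add.commute)
    qed (use s0 in auto)
    moreover have "(\<lambda>r. ?k r *\<^sub>R u'' r) integrable_on {s / 2..s}"
      by (intro integrable_continuous_real continuous_on_scaleR ck continuous_on_subset[OF c2]) (use s0 s in auto)
    ultimately have "(\<lambda>r. ?k r *\<^sub>R u'' r - (- ?K r *\<^sub>R g r + ?k r *\<^sub>R u'' r)) integrable_on {s / 2..s}"
      by (intro integrable_diff) auto
    then show "(\<lambda>r. ?K r *\<^sub>R g r) integrable_on {s / 2..s}" by simp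
  qed
  \<comment> \<open>At the two end points the two-sided derivative of \<open>u\<close> need not
    agree with \<open>g\<close>; they form a negligible set.\<close>
  have "integral {0..s} (\<lambda>r. ?K r *\<^sub>R vector_derivative u (at r)) = integral {0..s} (\<lambda>r. ?K r *\<^sub>R g r)"
  proof (rule integral_spike)
    show "negligible {0, s}" by simp
    show "?K r *\<^sub>R g r = ?K r *\<^sub>R vector_derivative u (at r)" if "r \<in> {0..s} - {0, s}" for r
      using vector_derivative_at[OF du, of r] that by auto
  qed
  then have cap: "caputo h u s = (1 / Gamma (1 - h)) *\<^sub>R integral {0..s} (\<lambda>r. ?K r *\<^sub>R g r)"
    by (simp add: caputo_def)
  have G0: "0 < Gamma (1 - h)" using h by (intro Gamma_real_pos) simp
  have G: "Gamma (2 - h) = (1 - h) * Gamma (1 - h)"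
  proof -
    have "1 - h \<notin> \<int>\<^sub>\<le>\<^sub>0" using h nonpos_Ints_nonpos[of "1 - h"] by auto
    from Gamma_plus1[OF this] show ?thesis by (simp add: algebra_simps)
  qed
  let ?D = "\<Sum>j<N. d_coeff h j *\<^sub>R (u (real (N - j) * \<tau>) - u (real (N - 1 - j) * \<tau>))"
  let ?X = "integral {0..s} (\<lambda>r. ?K r *\<^sub>R g r) - (\<tau> powr (- h) / (1 - h)) *\<^sub>R ?D"
  have "caputo h u s - (\<tau> powr (- h) / Gamma (2 - h)) *\<^sub>R ?D = (1 / Gamma (1 - h)) *\<^sub>R ?X"
    unfolding cap G using h by (simp add: scaleR_diff_right)
  then have "norm (caputo h u s - (\<tau> powr (- h) / Gamma (2 - h)) *\<^sub>R ?D) = norm ?X / Gamma (1 - h)"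
    using G0 by simp
  also have "\<dots> \<le> (2 * M * \<tau> powr (2 - h) / (1 - h)) / Gamma (1 - h)"
    by (rule divide_right_mono[OF L1_error[OF s(1) \<tau> N h int]]) (use G0 in simp)
  also have "\<dots> = 2 * M * \<tau> powr (2 - h) / Gamma (2 - h)" by (simp add: G)
  finally show ?thesis .
qed

text \<open>After multiplication by \<open>gamma_coeff \<alpha> \<tau>\<close>, an error of order
  \<tau> powr (2 - a i) becomes \<tau>^2 times \<open>w i * \<tau> powr (\<alpha> - a i)\<close>. As
  \<open>d_coeff h 0 = 1\<close>, these weights add up to the coefficient of index 0.\<close>

lemma (in fractional) multi_caputo_L1_error:
  fixes u u' u'' :: "real \<Rightarrow> 'b::banach"
  assumes s: "s = real N * \<tau>" "s \<le> T" and \<tau>: "0 < \<tau>" and N: "0 < N"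
    and cu: "continuous_on {0..T} u"
    and d1: "\<And>t. t \<in> {0<..T} \<Longrightarrow> (u has_vector_derivative u' t) (at t within {0..T})"
    and d2: "\<And>t. t \<in> {0<..T} \<Longrightarrow> (u' has_vector_derivative u'' t) (at t within {0..T})"
    and c2: "continuous_on {0<..T} u''" and M: "\<And>t. t \<in> {0<..s} \<Longrightarrow> norm (u'' t) \<le> M"
  shows "norm (gamma_coeff \<alpha> \<tau> *\<^sub>R multi_caputo \<alpha> m a b u s
      - (\<Sum>j<N. P_coeff \<alpha> m a b \<tau> j *\<^sub>R (u (real (N - j) * \<tau>) - u (real (N - 1 - j) * \<tau>))))
    \<le> 2 * M * \<tau>^2 * P_coeff \<alpha> m a b \<tau> 0"
proof -
  define \<Delta> where "\<Delta> = (\<lambda>j. u (real (N - j) * \<tau>) - u (real (N - 1 - j) * \<tau>))"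
  define D where "D = (\<lambda>h. \<Sum>j<N. d_coeff h j *\<^sub>R \<Delta> j)"
  define c where "c = (\<lambda>h. caputo h u s - (\<tau> powr (- h) / Gamma (2 - h)) *\<^sub>R D h)"
  let ?\<gamma> = "gamma_coeff \<alpha> \<tau>"
  have G: "0 < Gamma (2 - h)" if "h < 1" for h :: real using that by (intro Gamma_real_pos) simp
  have c: "norm (c h) \<le> 2 * M * \<tau> powr (2 - h) / Gamma (2 - h)" if "0 < h" "h < 1" for h
    unfolding c_def D_def \<Delta>_def by (rule caputo_L1_error[OF s \<tau> N cu d1 d2 c2 M that])
  have p: "\<tau> powr x * \<tau> powr y = \<tau> powr (x + y)" for x y by (simp add: powr_add)
  have g: "?\<gamma> * (\<tau> powr (- h) / Gamma (2 - h)) = Gamma (2 - \<alpha>) / Gamma (2 - h) * \<tau> powr (\<alpha> - h)" for h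
    using p[of \<alpha> "- h"] by (simp add: gamma_coeff_def mult_ac)
  have g2: "?\<gamma> * (2 * M * \<tau> powr (2 - h) / Gamma (2 - h)) = 2 * M * \<tau>^2 * (Gamma (2 - \<alpha>) / Gamma (2 - h) * \<tau> powr (\<alpha> - h))" for h
  proof -
    have "\<tau> powr \<alpha> * \<tau> powr (2 - h) = \<tau> powr 2 * \<tau> powr (\<alpha> - h)" unfolding p by (simp add: algebra_simps)
    also have "\<tau> powr 2 = \<tau>^2" using \<tau> by (simp add: powr_numeral)
    finally show ?thesis by (simp add: gamma_coeff_def mult_ac)
  qed
  have \<gamma>0: "0 \<le> ?\<gamma>" using G[OF \<alpha>(2)] by (simp add: gamma_coeff_def)
  have "(\<Sum>j<N. P_coeff \<alpha> m a b \<tau> j *\<^sub>R \<Delta> j) = D \<alpha> + (\<Sum>i=1..m. (w i * \<tau> powr (\<alpha> - a i)) *\<^sub>R D (a i))"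
    unfolding P_coeff_eq D_def scaleR_add_left sum.distrib scaleR_sum_left scaleR_sum_right scaleR_scaleR
    by (subst sum.swap) simp
  moreover have "?\<gamma> *\<^sub>R multi_caputo \<alpha> m a b u s = ?\<gamma> *\<^sub>R caputo \<alpha> u s + (\<Sum>i=1..m. (?\<gamma> * b i) *\<^sub>R caputo (a i) u s)"
    by (simp add: multi_caputo_def scaleR_add_right scaleR_sum_right)
  moreover have "?\<gamma> *\<^sub>R c \<alpha> = ?\<gamma> *\<^sub>R caputo \<alpha> u s - D \<alpha>"
  proof -
    have "?\<gamma> * (\<tau> powr (- \<alpha>) / Gamma (2 - \<alpha>)) = 1" unfolding g using G[OF \<alpha>(2)] \<tau> by simp
    then show ?thesis by (simp only: c_def scaleR_diff_right scaleR_scaleR scaleR_one)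
  qed
  moreover have "(?\<gamma> * b i) *\<^sub>R c (a i) = (?\<gamma> * b i) *\<^sub>R caputo (a i) u s - (w i * \<tau> powr (\<alpha> - a i)) *\<^sub>R D (a i)" if "i \<in> {1..m}" for i
  proof -
    have "?\<gamma> * b i * (\<tau> powr (- a i) / Gamma (2 - a i)) = b i * (?\<gamma> * (\<tau> powr (- a i) / Gamma (2 - a i)))" by (simp only: mult_ac)
    also have "\<dots> = w i * \<tau> powr (\<alpha> - a i)" unfolding g w_def by simp
    finally show ?thesis by (simp only: c_def scaleR_diff_right scaleR_scaleR)
  qed
  ultimately have "?\<gamma> *\<^sub>R multi_caputo \<alpha> m a b u s - (\<Sum>j<N. P_coeff \<alpha> m a b \<tau> j *\<^sub>R \<Delta> j)
      = ?\<gamma> *\<^sub>R c \<alpha> + (\<Sum>i=1..m. (?\<gamma> * b i) *\<^sub>R c (a i))"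
    by (simp add: sum_subtractf)
  also have "norm \<dots> \<le> ?\<gamma> * norm (c \<alpha>) + (\<Sum>i=1..m. ?\<gamma> * b i * norm (c (a i)))"
  proof (rule order_trans[OF norm_triangle_ineq], rule add_mono)
    show "norm (?\<gamma> *\<^sub>R c \<alpha>) \<le> ?\<gamma> * norm (c \<alpha>)" using \<gamma>0 by simp
    have "norm (\<Sum>i=1..m. (?\<gamma> * b i) *\<^sub>R c (a i)) \<le> (\<Sum>i=1..m. norm ((?\<gamma> * b i) *\<^sub>R c (a i)))" by (rule norm_sum)
    also have "\<dots> = (\<Sum>i=1..m. ?\<gamma> * b i * norm (c (a i)))" using \<gamma>0 less_imp_le[OF ab(4)] by (intro sum.cong) (auto simp: abs_mult)
    finally show "norm (\<Sum>i=1..m. (?\<gamma> * b i) *\<^sub>R c (a i)) \<le> (\<Sum>i=1..m. ?\<gamma> * b i * norm (c (a i)))" .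
  qed
  also have "\<dots> \<le> 2 * M * \<tau>^2 * 1 + (\<Sum>i=1..m. 2 * M * \<tau>^2 * (w i * \<tau> powr (\<alpha> - a i)))"
  proof (intro add_mono sum_mono)
    have "?\<gamma> * norm (c \<alpha>) \<le> ?\<gamma> * (2 * M * \<tau> powr (2 - \<alpha>) / Gamma (2 - \<alpha>))" by (intro mult_left_mono c \<alpha> \<gamma>0)
    also have "\<dots> = 2 * M * \<tau>^2 * 1" unfolding g2 using G[OF \<alpha>(2)] \<tau> by simp
    finally show "?\<gamma> * norm (c \<alpha>) \<le> 2 * M * \<tau>^2 * 1" .
    fix i assume i: "i \<in> {1..m}"
    have "?\<gamma> * b i * norm (c (a i)) = b i * (?\<gamma> * norm (c (a i)))" by (simp only: mult_ac)
    also have "\<dots> \<le> b i * (?\<gamma> * (2 * M * \<tau> powr (2 - a i) / Gamma (2 - a i)))"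
      using ab[OF i] \<gamma>0 by (intro mult_left_mono c) auto
    also have "\<dots> = 2 * M * \<tau>^2 * (w i * \<tau> powr (\<alpha> - a i))" unfolding g2 w_def by simp
    finally show "?\<gamma> * b i * norm (c (a i)) \<le> 2 * M * \<tau>^2 * (w i * \<tau> powr (\<alpha> - a i))" .
  qed
  also have "\<dots> = 2 * M * \<tau>^2 * P_coeff \<alpha> m a b \<tau> 0"
  proof -
    have "d_coeff h 0 = 1" for h by (simp add: d_coeff_def)
    then show ?thesis unfolding P_coeff_eq by (simp add: sum_distrib_left distrib_left)
  qed
  finally show ?thesis unfolding \<Delta>_def .
qed

section \<open>The fully discrete error estimate\<close>

text \<open>The polytope supplies closed half spaces for the closure. An open convex set is the
  interior of its closure, so the inequalities become strict; the normals are scaled to unit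
  length.\<close>

lemma convex_polyhedral_domain_imp_polytope_domain:
  fixes \<Omega> :: "(real^'n) set"
  assumes "convex_polyhedral_domain \<Omega>"
  shows "\<exists>F. polytope_domain F \<Omega>"
proof -
  have o: "open \<Omega>" "\<Omega> \<noteq> {}" "convex \<Omega>" "bounded \<Omega>" "polytope (closure \<Omega>)"
    using assms by (auto simp: convex_polyhedral_domain_def)
  then obtain G where G: "finite G" "closure \<Omega> = \<Inter>G" "\<forall>h\<in>G. \<exists>a b. a \<noteq> 0 \<and> h = {x. inner a x \<le> b}"
    using polytope_imp_polyhedron[OF o(5)] unfolding polyhedron_def by metis
  have "\<exists>p. norm (fst p) = 1 \<and> h = {x. inner (fst p) x \<le> snd p}" if h: "h \<in> G" for h
  proof -
    obtain a b where ab: "a \<noteq> 0" "h = {x. inner a x \<le> b}" using G(3) h by blast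
    then have "h = {x. inner ((1 / norm a) *\<^sub>R a) x \<le> b / norm a}" by (auto simp: divide_right_mono field_simps)
    then show ?thesis using ab(1) by (intro exI[of _ "((1 / norm a) *\<^sub>R a, b / norm a)"]) auto
  qed
  then have "\<forall>h\<in>G. \<exists>p. norm (fst p) = 1 \<and> h = {x. inner (fst p) x \<le> snd p}" by blast
  from bchoice[OF this] obtain p where p: "\<And>h. h \<in> G \<Longrightarrow> norm (fst (p h)) = 1"
    "\<And>h. h \<in> G \<Longrightarrow> h = {x. inner (fst (p h)) x \<le> snd (p h)}" by blast
  define F where "F = p ` G"
  have unit: "norm (fst f) = 1" if "f \<in> F" for f using that p(1) by (auto simp: F_def)
  have cl: "closure \<Omega> = {x. \<forall>f\<in>F. inner (fst f) x \<le> snd f}"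
    unfolding G(2) F_def using p(2) by auto
  have "\<Omega> = interior (closure \<Omega>)"
    using convex_interior_closure[OF o(3)] interior_open[OF o(1)] by simp
  also have "\<dots> = {x. \<forall>f\<in>F. inner (fst f) x < snd f}"
  proof
    show "interior (closure \<Omega>) \<subseteq> {x. \<forall>f\<in>F. inner (fst f) x < snd f}"
    proof clarify
      fix x a b assume x: "x \<in> interior (closure \<Omega>)" and f: "(a, b) \<in> F"
      have "closure \<Omega> \<subseteq> {x. inner a x \<le> b}" unfolding cl using f by auto
      then have "interior (closure \<Omega>) \<subseteq> interior {x. inner a x \<le> b}" by (rule interior_mono)
      moreover have "a \<noteq> 0" using unit[OF f] by auto
      ultimately show "inner (fst (a, b)) x < snd (a, b)" using x by auto
    qed
    have "{x. \<forall>f\<in>F. inner (fst f) x < snd f} = (\<Inter>f\<in>F. {x. inner (fst f) x < snd f})" by auto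
    then have "open {x. \<forall>f\<in>F. inner (fst f) x < snd f}"
      using G(1) by (simp add: F_def open_INT open_halfspace_lt)
    then show "{x. \<forall>f\<in>F. inner (fst f) x < snd f} \<subseteq> interior (closure \<Omega>)"
      unfolding cl by (intro interior_maximal) (auto intro: less_imp_le)
  qed
  finally have \<Omega>: "\<Omega> = {x. \<forall>f\<in>F. inner (fst f) x < snd f}" .
  moreover have "F \<noteq> {}"
  proof
    assume "F = {}"
    then have "\<Omega> = UNIV" using \<Omega> by auto
    then show False using o(4) not_bounded_UNIV by simp
  qed
  ultimately have "polytope_domain F \<Omega>"
    using G(1) o unit by unfold_locales (auto simp: F_def)
  then show ?thesis by blast
qed

lemma Hdot2_norm_le_H2_norm: "Hdot2_norm \<Omega> u \<le> real CARD('n) * H2_norm \<Omega> (u :: 'n::finite L2)"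
proof -
  have "norm (weak_deriv \<Omega> i (weak_deriv \<Omega> i u)) \<le> H2_norm \<Omega> u" for i
    unfolding H2_norm_def
  proof (rule real_le_rsqrt)
    let ?D = "\<lambda>i j. (norm (weak_deriv \<Omega> j (weak_deriv \<Omega> i u)))\<^sup>2"
    have "?D i i \<le> (\<Sum>j\<in>UNIV. ?D i j)" by (rule member_le_sum) auto
    also have "\<dots> \<le> (\<Sum>i\<in>UNIV. \<Sum>j\<in>UNIV. ?D i j)"
      by (rule member_le_sum[where f = "\<lambda>i. \<Sum>j\<in>UNIV. ?D i j"]) (auto simp: sum_nonneg)
    also have "\<dots> \<le> (norm u)\<^sup>2 + (\<Sum>i\<in>UNIV. (norm (weak_deriv \<Omega> i u))\<^sup>2) + (\<Sum>i\<in>UNIV. \<Sum>j\<in>UNIV. ?D i j)"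
      by (simp add: sum_nonneg)
    finally show "?D i i \<le> \<dots>" .
  qed
  then have "(\<Sum>i\<in>UNIV. norm (weak_deriv \<Omega> i (weak_deriv \<Omega> i u))) \<le> (\<Sum>i::'n\<in>UNIV. H2_norm \<Omega> u)"
    by (intro sum_mono)
  then show ?thesis unfolding Hdot2_norm_def laplacian_def
    using norm_sum[of "\<lambda>i. weak_deriv \<Omega> i (weak_deriv \<Omega> i u)" UNIV] by simp
qed

text \<open>What the argument in time needs from space: a subspace with Ritz projections and a bound
  for their error. \<open>\<kappa>\<close> will be a fixed multiple of h^2.\<close>

locale galerkin = bounded_open \<Omega> + fractional \<alpha> m a b
  for \<Omega> :: "(real^'n) set" and \<alpha> :: real and m :: nat and a b :: "nat \<Rightarrow> real" +
  fixes \<T> :: "(real^'n) set set" and \<kappa> T :: real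
  assumes fe_subspace: "subspace (fe_space \<Omega> \<T>)"
    and ritz_exists: "\<And>u. u \<in> H10 \<Omega> \<Longrightarrow> \<exists>R\<in>fe_space \<Omega> \<T>. \<forall>w\<in>fe_space \<Omega> \<T>. grad_inner \<Omega> (u - R) w = 0"
    and ritz_bound: "\<And>u R. u \<in> Hdot2 \<Omega> \<Longrightarrow> R \<in> fe_space \<Omega> \<T> \<Longrightarrow>
      (\<And>w. w \<in> fe_space \<Omega> \<T> \<Longrightarrow> grad_inner \<Omega> (u - R) w = 0) \<Longrightarrow> norm (u - R) \<le> \<kappa> * Hdot2_norm \<Omega> u"
    and \<kappa>: "0 \<le> \<kappa>" and T: "0 < T"
begin

lemma fe_H10: "x \<in> fe_space \<Omega> \<T> \<Longrightarrow> x \<in> H10 \<Omega>" by (simp add: fe_space_def)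

definition ritz where "ritz u = (SOME R. R \<in> fe_space \<Omega> \<T> \<and> (\<forall>x\<in>fe_space \<Omega> \<T>. grad_inner \<Omega> (u - R) x = 0))"

lemma ritz:
  assumes "u \<in> H10 \<Omega>"
  shows "ritz u \<in> fe_space \<Omega> \<T>" "x \<in> fe_space \<Omega> \<T> \<Longrightarrow> grad_inner \<Omega> (u - ritz u) x = 0"
  using someI_ex[of "\<lambda>R. R \<in> fe_space \<Omega> \<T> \<and> (\<forall>x\<in>fe_space \<Omega> \<T>. grad_inner \<Omega> (u - R) x = 0)"] ritz_exists[OF assms]
  unfolding ritz_def by blast+

text \<open>\<open>ritz\<close> is a choice, so linearity is not part of its definition; but the
  difference of two projections satisfies the orthogonality required by \<open>ritz_bound\<close>
  for the difference of the arguments. It is applied to increments in time.\<close>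

lemma ritz_diff_bound:
  assumes u: "u \<in> Hdot2 \<Omega>" "u' \<in> Hdot2 \<Omega>"
  shows "norm ((u - ritz u) - (u' - ritz u')) \<le> \<kappa> * norm (laplacian \<Omega> u - laplacian \<Omega> u')"
proof -
  have H: "u \<in> H10 \<Omega>" "u' \<in> H10 \<Omega>" using u by (auto simp: Hdot2_def)
  note R = ritz(1)[OF H(1)] ritz(1)[OF H(2)]
  have "norm ((u - u') - (ritz u - ritz u')) \<le> \<kappa> * Hdot2_norm \<Omega> (u - u')"
  proof (rule ritz_bound[OF Hdot2_diff(1)[OF u] subspace_diff[OF fe_subspace R]])
    fix x assume x: "x \<in> fe_space \<Omega> \<T>"
    have "u - u' - (ritz u - ritz u') = (u - ritz u) - (u' - ritz u')" by simp
    moreover have "grad_inner \<Omega> ((u - ritz u) - (u' - ritz u')) x = 0"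
      using ritz(2)[OF H(1) x] ritz(2)[OF H(2) x]
      by (subst grad_inner_diff(1)) (simp_all add: subspace_diff[OF H10_subspace] H fe_H10[OF R(1)] fe_H10[OF R(2)])
    ultimately show "grad_inner \<Omega> (u - u' - (ritz u - ritz u')) x = 0" by (simp only:)
  qed
  then show ?thesis using Hdot2_diff(2)[OF u] by (simp add: Hdot2_norm_def algebra_simps)
qed

text \<open>The error is split at the Ritz projection of the exact solution: \<rho> is the
  projection error, \<theta> lies in the finite element space and satisfies the scheme with a
  residual. Since \<open>U 0\<close> is a general approximation of \<open>v\<close>, the start value
  of \<theta> is estimated through \<open>U 0 - v\<close> and \<open>\<rho> 0\<close>.\<close>

lemma error_estimate:
  fixes u :: "real \<Rightarrow> 'n L2" and U :: "nat \<Rightarrow> 'n L2"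
  assumes \<tau>: "0 < \<tau>" and K: "\<tau> = T / real K" and N: "0 < N" "N \<le> K"
    and sol: "is_solution \<Omega> T \<alpha> m a b v f u" and smooth: "sufficiently_smooth \<Omega> T u"
    and disc: "is_discrete_solution \<Omega> \<T> \<alpha> m a b \<tau> K f U"
    and M1: "\<And>t. t \<in> {0<..real N * \<tau>} \<Longrightarrow> Hdot2_norm \<Omega> (time_deriv T u t) \<le> M1"
    and M2: "\<And>t. t \<in> {0<..real N * \<tau>} \<Longrightarrow> norm (time_deriv T (time_deriv T u) t) \<le> M2"
  shows "norm (u (real N * \<tau>) - U N) \<le> norm (U 0 - v) + \<kappa> * (2 * Hdot2_norm \<Omega> v + T * M1)
    + (\<kappa> * M1 * \<tau> powr \<alpha> * (T powr (1 - \<alpha>) + (\<Sum>i=1..m. w i * T powr (1 - a i)))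
       + 2 * M2 * \<tau>\<^sup>2 * (1 + (\<Sum>i=1..m. w i * T powr (\<alpha> - a i)))) * (T powr \<alpha> * \<tau> powr (- \<alpha>) / (1 - \<alpha>))"
proof -
  define t where "t = (\<lambda>k. real k * \<tau>)"
  define s where "s = real N * \<tau>"
  define P where "P = P_coeff \<alpha> m a b \<tau>"
  let ?\<gamma> = "gamma_coeff \<alpha> \<tau>"
  have K0: "0 < K" using N by simp
  have sT: "s \<le> T"
  proof -
    have "real N * \<tau> \<le> real K * \<tau>" using N \<tau> by (intro mult_right_mono) auto
    then show ?thesis using K K0 by (simp add: s_def)
  qed
  have s0: "0 < s" using N \<tau> by (simp add: s_def)
  have tk: "0 \<le> t k" "k \<le> N \<Longrightarrow> t k \<le> s" for k using \<tau> by (auto simp: t_def s_def)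
  have Hu: "u x \<in> Hdot2 \<Omega>" if "0 \<le> x" "x \<le> T" for x using smooth that by (auto simp: sufficiently_smooth_def)
  have u0: "u 0 = v" using sol by (simp add: is_solution_def)
  have M0: "0 \<le> M1" "0 \<le> M2"
    using order_trans[OF norm_ge_zero M1[of s, unfolded Hdot2_norm_def]] order_trans[OF norm_ge_zero M2[of s]] s0
    by (simp_all add: s_def)
  have lap: "norm (laplacian \<Omega> (u y) - laplacian \<Omega> (u x)) \<le> M1 * (y - x)" if xy: "0 \<le> x" "x \<le> y" "y \<le> s" for x y
  proof (rule norm_diff_le_of_derivative_bound[where f' = "\<lambda>r. laplacian \<Omega> (time_deriv T u r)"])
    show "continuous_on {x..y} (\<lambda>r. laplacian \<Omega> (u r))"
      by (rule continuous_on_subset[of "{0..T}"]) (use smooth xy sT in \<open>auto simp: sufficiently_smooth_def\<close>)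
    fix r assume r: "x < r" "r < y"
    have "at r within {0..T} = at r" by (rule at_within_interior) (use r xy sT in auto)
    moreover have "r \<in> {0<..T}" using r xy sT by auto
    ultimately show "((\<lambda>r. laplacian \<Omega> (u r)) has_vector_derivative laplacian \<Omega> (time_deriv T u r)) (at r)"
      using smooth unfolding sufficiently_smooth_def by metis
    show "norm (laplacian \<Omega> (time_deriv T u r)) \<le> M1"
      using M1[of r] r xy by (simp add: Hdot2_norm_def s_def)
  qed (rule xy)
  define \<rho> where "\<rho> = (\<lambda>k. u (t k) - ritz (u (t k)))"
  define \<theta> where "\<theta> = (\<lambda>k. ritz (u (t k)) - U k)"
  have ut: "u (t k) \<in> Hdot2 \<Omega>" if "k \<le> N" for k using Hu tk[of k] that sT by auto
  have utH: "u (t k) \<in> H10 \<Omega>" "u (t k) \<in> H2 \<Omega>" if "k \<le> N" for k using ut[OF that] by (auto simp: Hdot2_def)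
  have Ufe: "U k \<in> fe_space \<Omega> \<T>" if "k \<le> N" for k using disc that N by (simp add: is_discrete_solution_def)
  have \<theta>fe: "\<theta> k \<in> fe_space \<Omega> \<T>" if "k \<le> N" for k
    unfolding \<theta>_def by (intro subspace_diff[OF fe_subspace] ritz(1) utH Ufe that)
  have \<rho>b: "norm (\<rho> k) \<le> \<kappa> * Hdot2_norm \<Omega> (u (t k))" if "k \<le> N" for k
    unfolding \<rho>_def by (rule ritz_bound[OF ut ritz(1) ritz(2)]) (use utH that in auto)
  define E where "E = \<kappa> * M1 * \<tau> powr \<alpha> * (T powr (1 - \<alpha>) + (\<Sum>i=1..m. w i * T powr (1 - a i)))
       + 2 * M2 * \<tau>\<^sup>2 * (1 + (\<Sum>i=1..m. w i * T powr (\<alpha> - a i)))"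
  have E0: "0 \<le> E" unfolding E_def using M0 \<kappa> w_nonneg
    by (intro add_nonneg_nonneg mult_nonneg_nonneg sum_nonneg) auto
  have rec: "P 0 * norm (\<theta> (Suc n)) \<le> (\<Sum>j<n. (P j - P (j + 1)) * norm (\<theta> (n - j))) + P n * norm (\<theta> 0) + E"
    if n: "n < N" for n
  proof -
    have nN: "Suc n \<le> N" using n by simp
    define L where "L = (\<lambda>V::nat \<Rightarrow> 'n L2. \<Sum>j<Suc n. P j *\<^sub>R (V (Suc n - j) - V (n - j)))"
    let ?mc = "multi_caputo \<alpha> m a b u (t (Suc n))"
    define r where "r = L (\<lambda>k. ritz (u (t k))) - ?\<gamma> *\<^sub>R ?mc"
    have rb: "norm r \<le> E"
    proof -
      \<comment> \<open>Writing the projection as u - \<rho> splits the residual into the truncation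
        error of the exact solution and the discrete derivative of \<rho>.\<close>
      have "r = - (?\<gamma> *\<^sub>R ?mc - L (\<lambda>k. u (t k))) - L \<rho>"
        unfolding r_def L_def \<rho>_def by (simp add: sum_subtractf scaleR_diff_right)
      then have "norm r \<le> norm (?\<gamma> *\<^sub>R ?mc - L (\<lambda>k. u (t k))) + norm (L \<rho>)"
        by (metis norm_minus_cancel norm_triangle_ineq4)
      also have "norm (?\<gamma> *\<^sub>R ?mc - L (\<lambda>k. u (t k))) \<le> 2 * M2 * \<tau>\<^sup>2 * P 0"
      proof -
        have "norm (?\<gamma> *\<^sub>R ?mc - (\<Sum>j<Suc n. P j *\<^sub>R (u (real (Suc n - j) * \<tau>) - u (real (Suc n - 1 - j) * \<tau>)))) \<le> 2 * M2 * \<tau>\<^sup>2 * P 0"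
          unfolding P_def
        proof (rule multi_caputo_L1_error[where T = T and u' = "time_deriv T u" and u'' = "time_deriv T (time_deriv T u)"])
          show "t (Suc n) = real (Suc n) * \<tau>" by (simp add: t_def)
          show "t (Suc n) \<le> T" using tk(2)[OF nN] sT by simp
          show "norm (time_deriv T (time_deriv T u) x) \<le> M2" if "x \<in> {0<..t (Suc n)}" for x
            using M2[of x] that tk(2)[OF nN] by (simp add: s_def)
        qed (use \<tau> smooth in \<open>auto simp: sufficiently_smooth_def\<close>)
        then show ?thesis by (simp add: L_def t_def)
      qed
      also have "2 * M2 * \<tau>\<^sup>2 * P 0 \<le> 2 * M2 * \<tau>\<^sup>2 * (1 + (\<Sum>i=1..m. w i * T powr (\<alpha> - a i)))"
      proof -
        have "T * 1 \<le> T * real K" using K0 T by (intro mult_left_mono) auto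
        then have "\<tau> \<le> T" using K K0 by (simp add: divide_le_eq)
        then show ?thesis unfolding P_def using M0 \<tau> by (intro mult_left_mono P_coeff_0_le) auto
      qed
      also have "norm (L \<rho>) \<le> \<kappa> * M1 * \<tau> powr \<alpha> * (T powr (1 - \<alpha>) + (\<Sum>i=1..m. w i * T powr (1 - a i)))"
      proof -
        have "norm (L \<rho>) \<le> (\<Sum>j<Suc n. P j * (\<kappa> * (M1 * \<tau>)))"
          unfolding L_def
        proof (rule order_trans[OF norm_sum], rule sum_mono)
          fix j assume "j \<in> {..<Suc n}"
          then have j: "Suc n - j = Suc (n - j)" "Suc (n - j) \<le> N" "n - j \<le> N" using n by auto
          have tt: "t (Suc (n - j)) - t (n - j) = \<tau>" by (simp add: t_def algebra_simps)
          have "norm (\<rho> (Suc n - j) - \<rho> (n - j)) \<le> \<kappa> * norm (laplacian \<Omega> (u (t (Suc (n - j)))) - laplacian \<Omega> (u (t (n - j))))"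
            unfolding \<rho>_def j(1) by (rule ritz_diff_bound[OF ut[OF j(2)] ut[OF j(3)]])
          also have "\<dots> \<le> \<kappa> * (M1 * \<tau>)"
            using lap[of "t (n - j)" "t (Suc (n - j))"] tk[of "n - j"] tk(2)[OF j(2)] tt \<tau> \<kappa>
            by (intro mult_left_mono) auto
          finally show "norm (P j *\<^sub>R (\<rho> (Suc n - j) - \<rho> (n - j))) \<le> P j * (\<kappa> * (M1 * \<tau>))"
            using P_coeff_pos[of \<tau> j] by (simp add: P_def mult_left_mono)
        qed
        also have "\<dots> = \<kappa> * M1 * (\<tau> * (\<Sum>j<Suc n. P j))"
          unfolding sum_distrib_right[symmetric] by (simp add: mult_ac)
        also have "\<dots> \<le> \<kappa> * M1 * (\<tau> powr \<alpha> * (T powr (1 - \<alpha>) + (\<Sum>i=1..m. w i * T powr (1 - a i))))"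
          unfolding P_def using M0 \<kappa> \<tau> tk(2)[OF nN] sT
          by (intro mult_left_mono sum_P_coeff_le) (auto simp: t_def)
        finally show ?thesis by (simp add: mult_ac)
      qed
      finally show ?thesis by (simp add: E_def)
    qed
    let ?x = "\<theta> (Suc n)"
    have x: "?x \<in> fe_space \<Omega> \<T>" by (rule \<theta>fe[OF nN])
    have xH: "?x \<in> H10 \<Omega>" by (rule fe_H10[OF x])
    have tpos: "t (Suc n) \<in> {0<..T}" using tk(2)[OF nN] sT \<tau> by (auto simp: t_def)
    have feq: "f (t (Suc n)) = ?mc - laplacian \<Omega> (u (t (Suc n)))"
      using sol tpos by (simp add: is_solution_def)
    \<comment> \<open>Ritz orthogonality exchanges the exact solution for its projection in the
      gradient form, so that the residual contains no gradient term.\<close>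
    have gu: "grad_inner \<Omega> (u (t (Suc n))) ?x = grad_inner \<Omega> (ritz (u (t (Suc n)))) ?x"
      using ritz(2)[OF utH(1)[OF nN] x] grad_inner_diff(1)[OF utH(1)[OF nN] fe_H10[OF ritz(1)[OF utH(1)[OF nN]]]] by simp
    have gf: "inner (f (t (Suc n))) ?x = inner ?mc ?x + grad_inner \<Omega> (ritz (u (t (Suc n)))) ?x"
      unfolding feq inner_diff_left using Green[OF utH(2)[OF nN] xH] gu by simp
    have eqU: "P 0 * inner (U (Suc n)) ?x + ?\<gamma> * grad_inner \<Omega> (U (Suc n)) ?x
        = (\<Sum>j<n. (P j - P (j + 1)) * inner (U (n - j)) ?x) + P n * inner (U 0) ?x + ?\<gamma> * inner (f (t (Suc n))) ?x"
      using disc n N x unfolding is_discrete_solution_def P_def t_def by auto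
    have g\<theta>: "grad_inner \<Omega> ?x ?x = grad_inner \<Omega> (ritz (u (t (Suc n)))) ?x - grad_inner \<Omega> (U (Suc n)) ?x"
      unfolding \<theta>_def[THEN fun_cong, of "Suc n"]
      by (rule grad_inner_diff(1)) (intro fe_H10 ritz(1) utH Ufe nN)+
    have rR: "inner r ?x = P 0 * inner (ritz (u (t (Suc n)))) ?x - (\<Sum>j<n. (P j - P (j + 1)) * inner (ritz (u (t (n - j)))) ?x)
        - P n * inner (ritz (u (t 0))) ?x - ?\<gamma> * inner ?mc ?x"
      unfolding r_def L_def abel_difference by (simp add: inner_diff_left inner_sum_left)
    \<comment> \<open>The error equation tested with its own newest value. The gradient term has a
      favourable sign and is dropped in the estimate that follows.\<close>
    have "P 0 * inner ?x ?x = (\<Sum>j<n. (P j - P (j + 1)) * inner (\<theta> (n - j)) ?x) + P n * inner (\<theta> 0) ?x + inner r ?x - ?\<gamma> * grad_inner \<Omega> ?x ?x"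
    proof -
      have i: "inner (\<theta> k) ?x = inner (ritz (u (t k))) ?x - inner (U k) ?x" for k
        by (subst \<theta>_def) (simp add: inner_diff_left)
      have S: "(\<Sum>j<n. (P j - P (j + 1)) * inner (\<theta> (n - j)) ?x) = (\<Sum>j<n. (P j - P (j + 1)) * inner (ritz (u (t (n - j)))) ?x) - (\<Sum>j<n. (P j - P (j + 1)) * inner (U (n - j)) ?x)"
        unfolding i right_diff_distrib sum_subtractf ..
      show ?thesis
        unfolding S i[of 0] i[of "Suc n"] g\<theta> rR using eqU unfolding gf by (simp add: algebra_simps)
    qed
    also have "\<dots> \<le> (\<Sum>j<n. (P j - P (j + 1)) * (norm (\<theta> (n - j)) * norm ?x)) + P n * (norm (\<theta> 0) * norm ?x) + E * norm ?x"
    proof -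
      have "0 \<le> ?\<gamma> * grad_inner \<Omega> ?x ?x"
        using \<alpha> Gamma_real_pos[of "2 - \<alpha>"] by (auto simp: gamma_coeff_def grad_inner_def intro!: mult_nonneg_nonneg sum_nonneg)
      moreover have "inner r ?x \<le> E * norm ?x"
        by (rule order_trans[OF norm_cauchy_schwarz]) (intro mult_right_mono rb norm_ge_zero)
      moreover have "(\<Sum>j<n. (P j - P (j + 1)) * inner (\<theta> (n - j)) ?x) \<le> (\<Sum>j<n. (P j - P (j + 1)) * (norm (\<theta> (n - j)) * norm ?x))"
        using P_coeff_decreasing[of \<tau>] by (intro sum_mono mult_left_mono norm_cauchy_schwarz) (simp add: P_def)
      moreover have "P n * inner (\<theta> 0) ?x \<le> P n * (norm (\<theta> 0) * norm ?x)"
        using P_coeff_pos[of \<tau> n] by (intro mult_left_mono norm_cauchy_schwarz) (simp add: P_def)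
      ultimately show ?thesis by linarith
    qed
    finally have "(P 0 * norm ?x) * norm ?x \<le> ((\<Sum>j<n. (P j - P (j + 1)) * norm (\<theta> (n - j))) + P n * norm (\<theta> 0) + E) * norm ?x"
      by (simp only: power2_norm_eq_inner[symmetric] power2_eq_square distrib_right sum_distrib_right mult.assoc)
    moreover have "0 \<le> (\<Sum>j<n. (P j - P (j + 1)) * norm (\<theta> (n - j))) + P n * norm (\<theta> 0) + E"
      using P_coeff_decreasing[of \<tau>] P_coeff_pos[of \<tau> n] E0
      by (intro add_nonneg_nonneg sum_nonneg mult_nonneg_nonneg) (auto simp: P_def less_imp_le)
    ultimately show ?thesis
      by (cases "?x = 0") (auto dest: mult_right_le_imp_le)
  qed
  obtain N' where N': "N = Suc N'" using N by (cases N) auto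
  have "norm (\<theta> N) \<le> norm (\<theta> 0) + E / P N'"
    using stability[of N \<tau> "\<lambda>k. norm (\<theta> k)" E N'] rec E0 N' unfolding P_def by auto
  also have "norm (\<theta> 0) \<le> norm (U 0 - v) + \<kappa> * Hdot2_norm \<Omega> v"
  proof -
    have "\<theta> 0 = - (U 0 - v) - \<rho> 0" by (simp add: \<theta>_def \<rho>_def t_def u0)
    then have "norm (\<theta> 0) \<le> norm (U 0 - v) + norm (\<rho> 0)" by (metis norm_minus_cancel norm_triangle_ineq4)
    then show ?thesis using \<rho>b[of 0] by (simp add: t_def u0)
  qed
  also have "E / P N' \<le> E * (T powr \<alpha> * \<tau> powr (- \<alpha>) / (1 - \<alpha>))"
  proof -
    have "(1 - \<alpha>) * T powr (- \<alpha>) * \<tau> powr \<alpha> \<le> P N'"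
      unfolding P_def by (rule P_coeff_lower[OF \<tau>]) (use sT in \<open>simp add: s_def N'\<close>)
    moreover have "0 < (1 - \<alpha>) * T powr (- \<alpha>) * \<tau> powr \<alpha>" using \<alpha> T \<tau> by simp
    ultimately have "E / P N' \<le> E / ((1 - \<alpha>) * T powr (- \<alpha>) * \<tau> powr \<alpha>)"
      using E0 by (intro divide_left_mono) (auto intro: mult_pos_pos less_le_trans)
    also have "\<dots> = E * (T powr \<alpha> * \<tau> powr (- \<alpha>) / (1 - \<alpha>))"
      using T \<tau> by (simp add: powr_minus field_simps)
    finally show ?thesis .
  qed
  finally have \<theta>N: "norm (\<theta> N) \<le> norm (U 0 - v) + \<kappa> * Hdot2_norm \<Omega> v + E * (T powr \<alpha> * \<tau> powr (- \<alpha>) / (1 - \<alpha>))" by simp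
  have "norm (\<rho> N) \<le> \<kappa> * (Hdot2_norm \<Omega> v + T * M1)"
  proof -
    have "norm (laplacian \<Omega> (u s)) \<le> norm (laplacian \<Omega> (u 0)) + norm (laplacian \<Omega> (u s) - laplacian \<Omega> (u 0))"
      by (metis add.commute diff_add_cancel norm_triangle_ineq)
    also have "norm (laplacian \<Omega> (u s) - laplacian \<Omega> (u 0)) \<le> M1 * s" using lap[of 0 s] s0 by simp
    also have "M1 * s \<le> T * M1" using mult_left_mono[OF sT M0(1)] by (simp add: mult.commute)
    finally have "Hdot2_norm \<Omega> (u (t N)) \<le> Hdot2_norm \<Omega> v + T * M1"
      by (simp add: Hdot2_norm_def u0 t_def s_def)
    then show ?thesis using \<rho>b[of N] \<kappa> by (meson le_refl mult_left_mono order_trans)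
  qed
  moreover have "norm (u (real N * \<tau>) - U N) \<le> norm (\<rho> N) + norm (\<theta> N)"
    using norm_triangle_ineq[of "\<rho> N" "\<theta> N"] by (simp add: \<rho>_def \<theta>_def t_def)
  ultimately have "norm (u (real N * \<tau>) - U N) \<le> norm (U 0 - v) + \<kappa> * (2 * Hdot2_norm \<Omega> v + T * M1) + E * (T powr \<alpha> * \<tau> powr (- \<alpha>) / (1 - \<alpha>))"
    using \<theta>N by (simp add: distrib_left)
  then show ?thesis unfolding E_def .
qed

end

theorem theorem4p1:
  fixes \<Omega> :: "(real^'d) set"
    and H :: "real set"
    and \<T> :: "real \<Rightarrow> (real^'d) set set"
    and T \<alpha> C\<^sub>0 :: real
    and m :: nat
    and a b :: "nat \<Rightarrow> real"
  assumes "CARD('d) \<in> {1, 2, 3}"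
    and "convex_polyhedral_domain \<Omega>"
    and "T > 0"
    and "order_params \<alpha> m a b"
    and "mesh_family \<Omega> H \<T>"
  shows "\<exists>C>0. \<forall>h\<in>H. \<forall>K::nat. \<forall>\<tau>::real. \<forall>v f u U.
    K \<ge> 1 \<longrightarrow> \<tau> = T / real K \<longrightarrow>
    is_solution \<Omega> T \<alpha> m a b v f u \<longrightarrow>
    sufficiently_smooth \<Omega> T u \<longrightarrow>
    is_discrete_solution \<Omega> (\<T> h) \<alpha> m a b \<tau> K f U \<longrightarrow>
    norm (U 0 - v) \<le> C\<^sub>0 * h\<^sup>2 * Hdot2_norm \<Omega> v \<longrightarrow>
    (\<forall>n\<in>{1..K}.
      ennreal (norm (u (real n * \<tau>) - U n)) \<le> ennreal C *
        (ennreal (h\<^sup>2) *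
           (ennreal (H2_norm \<Omega> v) + Linf_L2_norm T f +
            (SUP t\<in>{0<..real n * \<tau>}. ennreal (Hdot2_norm \<Omega> (time_deriv T u t)))) +
         ennreal (\<tau> powr (2 - \<alpha>)) *
           (SUP t\<in>{0<..real n * \<tau>}. ennreal (norm (time_deriv T (time_deriv T u) t)))))"
proof -
  have d: "CARD('d) \<le> 3" using assms(1) by auto
  obtain F where "polytope_domain F \<Omega>" using convex_polyhedral_domain_imp_polytope_domain[OF assms(2)] by blast
  then interpret dom: polytope_domain F \<Omega> .
  interpret frac: fractional \<alpha> m a b by unfold_locales (rule assms(4))
  have H: "H \<subseteq> {0<..<1}" and mesh: "h \<in> H \<Longrightarrow> simplicial_partition \<Omega> (\<T> h)" "h \<in> H \<Longrightarrow> Max (diameter ` \<T> h) = h" for h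
    using assms(5) by (auto simp: mesh_family_def)
  obtain \<sigma> where \<sigma>: "\<sigma> > 0" "\<And>h S. h \<in> H \<Longrightarrow> S \<in> \<T> h \<Longrightarrow> \<exists>x. ball x (\<sigma> * diameter S) \<subseteq> S"
    using assms(5) unfolding mesh_family_def shape_regular_def by blast
  obtain c where c: "c > 0" "\<And>h S. h \<in> H \<Longrightarrow> S \<in> \<T> h \<Longrightarrow> c * h \<le> diameter S"
    using assms(5) unfolding mesh_family_def quasi_uniform_def by blast
  define \<kappa> where "\<kappa> = (512 / \<sigma>)\<^sup>2"
  define Q where "Q = T powr (1 - \<alpha>) + (\<Sum>i=1..m. frac.w i * T powr (1 - a i))"
  define Pb where "Pb = 1 + (\<Sum>i=1..m. frac.w i * T powr (\<alpha> - a i))"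
  define G where "G = T powr \<alpha> / (1 - \<alpha>)"
  define d' where "d' = real CARD('d)"
  \<comment> \<open>The sum of the coefficients that arise at the norms of \<open>v\<close>, of u_t
    and of u_tt, so that it dominates each of them; the factor \<open>d'\<close> comes from
    \<open>Hdot2_norm_le_H2_norm\<close>, and the 1 ensures positivity.\<close>
  define C where "C = d' * (\<bar>C\<^sub>0\<bar> + 2 * \<kappa>) + \<kappa> * T + \<kappa> * Q * G + 2 * Pb * G + 1"
  have nn: "0 \<le> \<kappa>" "0 \<le> Q" "0 \<le> Pb" "0 \<le> G" "0 \<le> d'"
    using frac.\<alpha> frac.w_nonneg unfolding \<kappa>_def Q_def Pb_def G_def d'_def
    by (auto intro!: add_nonneg_nonneg sum_nonneg mult_nonneg_nonneg)
  have parts: "d' * (\<bar>C\<^sub>0\<bar> + 2 * \<kappa>) \<le> C" "\<kappa> * T + \<kappa> * Q * G \<le> C" "2 * Pb * G \<le> C" "0 < C"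
    using nn assms(3) unfolding C_def by (auto intro!: add_nonneg_nonneg mult_nonneg_nonneg add_nonneg_pos)
  show ?thesis
  proof (intro exI[of _ C] conjI ballI allI impI parts(4))
    fix h and K :: nat and \<tau> and v f u U n
    assume h: "h \<in> H" and K: "1 \<le> K" "\<tau> = T / real K" and sol: "is_solution \<Omega> T \<alpha> m a b v f u"
      and smooth: "sufficiently_smooth \<Omega> T u" and disc: "is_discrete_solution \<Omega> (\<T> h) \<alpha> m a b \<tau> K f U"
      and U0: "norm (U 0 - v) \<le> C\<^sub>0 * h\<^sup>2 * Hdot2_norm \<Omega> v" and n: "n \<in> {1..K}"
    have h0: "h > 0" using h H by auto
    have \<tau>: "\<tau> > 0" using K assms(3) by simp
    interpret mesh: fe_mesh F \<Omega> "\<T> h" by unfold_locales (rule mesh(1)[OF h])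
    have diam: "0 < diameter S" "diameter S \<le> h" if "S \<in> \<T> h" for S
    proof -
      show "0 < diameter S" using less_le_trans[OF _ c(2)[OF h that]] c(1) h0 by simp
      have "diameter S \<le> Max (diameter ` \<T> h)" using that mesh.finT by (intro Max_ge) auto
      then show "diameter S \<le> h" using mesh(2)[OF h] by simp
    qed
    interpret gal: galerkin \<Omega> \<alpha> m a b "\<T> h" "\<kappa> * h\<^sup>2" T
    proof unfold_locales
      show "subspace (fe_space \<Omega> (\<T> h))" by (rule mesh.fe_space_subspace)
      show "\<exists>R\<in>fe_space \<Omega> (\<T> h). \<forall>w\<in>fe_space \<Omega> (\<T> h). grad_inner \<Omega> (u - R) w = 0" if "u \<in> H10 \<Omega>" for u
        by (rule mesh.ritz_projection[OF that])
      show "norm (u - R) \<le> \<kappa> * h\<^sup>2 * Hdot2_norm \<Omega> u"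
        if "u \<in> Hdot2 \<Omega>" "R \<in> fe_space \<Omega> (\<T> h)" "\<And>w. w \<in> fe_space \<Omega> (\<T> h) \<Longrightarrow> grad_inner \<Omega> (u - R) w = 0" for u R
        unfolding \<kappa>_def by (rule mesh.ritz_error[OF d \<sigma>(1) \<sigma>(2)[OF h] diam h0 that])
    qed (use nn assms(3) in auto)
    let ?S1 = "SUP t\<in>{0<..real n * \<tau>}. ennreal (Hdot2_norm \<Omega> (time_deriv T u t))"
    let ?S2 = "SUP t\<in>{0<..real n * \<tau>}. ennreal (norm (time_deriv T (time_deriv T u) t))"
    let ?V = "H2_norm \<Omega> v"
    let ?p = "\<tau> powr (2 - \<alpha>)"
    let ?R = "ennreal C * (ennreal (h\<^sup>2) * (ennreal ?V + Linf_L2_norm T f + ?S1) + ennreal ?p * ?S2)"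
    have V0: "0 \<le> ?V" unfolding H2_norm_def by (intro real_sqrt_ge_zero add_nonneg_nonneg sum_nonneg) auto
    show "ennreal (norm (u (real n * \<tau>) - U n)) \<le> ?R"
    \<comment> \<open>If a supremum is infinite, so is the right side, because the factors
      \<open>C\<close>, h^2 and the power of \<tau> are positive. Otherwise the suprema are real
      numbers and the estimate takes place in the reals.\<close>
    proof (cases "?S1 = top \<or> ?S2 = top")
      case True
      have "?R = top"
        using True parts(4) h0 \<tau> by (auto simp: ennreal_mult_eq_top_iff ennreal_add_eq_top)
      then show ?thesis by (simp only: top_greatest)
    next
      case False
      then obtain M1 M2 where M: "0 \<le> M1" "?S1 = ennreal M1" "0 \<le> M2" "?S2 = ennreal M2"
        by (metis ennreal_cases)
      have M1: "Hdot2_norm \<Omega> (time_deriv T u t) \<le> M1" if "t \<in> {0<..real n * \<tau>}" for t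
        using SUP_upper[OF that, of "\<lambda>t. ennreal (Hdot2_norm \<Omega> (time_deriv T u t))"] M(1,2) by simp
      have M2: "norm (time_deriv T (time_deriv T u) t) \<le> M2" if "t \<in> {0<..real n * \<tau>}" for t
        using SUP_upper[OF that, of "\<lambda>t. ennreal (norm (time_deriv T (time_deriv T u) t))"] M(3,4) by simp
      have n': "0 < n" "n \<le> K" using n by auto
      have Vd: "Hdot2_norm \<Omega> v \<le> d' * ?V" unfolding d'_def by (rule Hdot2_norm_le_H2_norm)
      have D0: "0 \<le> Hdot2_norm \<Omega> v" by (simp add: Hdot2_norm_def)
      have init: "norm (U 0 - v) \<le> \<bar>C\<^sub>0\<bar> * h\<^sup>2 * (d' * ?V)"
      proof -
        have "C\<^sub>0 * h\<^sup>2 * Hdot2_norm \<Omega> v \<le> \<bar>C\<^sub>0\<bar> * h\<^sup>2 * Hdot2_norm \<Omega> v"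
          using D0 by (intro mult_right_mono) auto
        also have "\<dots> \<le> \<bar>C\<^sub>0\<bar> * h\<^sup>2 * (d' * ?V)" using Vd by (intro mult_left_mono) auto
        finally show ?thesis using U0 by linarith
      qed
      have ritz0: "\<kappa> * h\<^sup>2 * (2 * Hdot2_norm \<Omega> v + T * M1) \<le> \<kappa> * h\<^sup>2 * (2 * (d' * ?V) + T * M1)"
        using Vd nn by (intro mult_left_mono) auto
      have "norm (u (real n * \<tau>) - U n) \<le> norm (U 0 - v) + \<kappa> * h\<^sup>2 * (2 * Hdot2_norm \<Omega> v + T * M1)
        + (\<kappa> * h\<^sup>2 * M1 * \<tau> powr \<alpha> * Q + 2 * M2 * \<tau>\<^sup>2 * Pb) * (T powr \<alpha> * \<tau> powr (- \<alpha>) / (1 - \<alpha>))"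
        unfolding Q_def Pb_def by (rule gal.error_estimate[OF \<tau> K(2) n' sol smooth disc M1 M2])
      also have "(\<kappa> * h\<^sup>2 * M1 * \<tau> powr \<alpha> * Q + 2 * M2 * \<tau>\<^sup>2 * Pb) * (T powr \<alpha> * \<tau> powr (- \<alpha>) / (1 - \<alpha>))
        = h\<^sup>2 * M1 * (\<kappa> * Q * G) + ?p * M2 * (2 * Pb * G)"
      proof -
        have 1: "\<tau> powr \<alpha> * \<tau> powr (- \<alpha>) = 1" using \<tau> by (simp add: powr_minus)
        have 2: "\<tau>\<^sup>2 * \<tau> powr (- \<alpha>) = ?p"
          using \<tau> powr_add[of \<tau> 2 "- \<alpha>"] by (simp add: powr_numeral)
        have "(\<kappa> * h\<^sup>2 * M1 * \<tau> powr \<alpha> * Q + 2 * M2 * \<tau>\<^sup>2 * Pb) * (T powr \<alpha> * \<tau> powr (- \<alpha>) / (1 - \<alpha>))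
          = h\<^sup>2 * M1 * (\<kappa> * Q * G) * (\<tau> powr \<alpha> * \<tau> powr (- \<alpha>)) + (\<tau>\<^sup>2 * \<tau> powr (- \<alpha>)) * M2 * (2 * Pb * G)"
          by (simp add: G_def algebra_simps add_divide_distrib)
        then show ?thesis unfolding 1 2 by simp
      qed
      also have "norm (U 0 - v) + \<kappa> * h\<^sup>2 * (2 * Hdot2_norm \<Omega> v + T * M1) + (h\<^sup>2 * M1 * (\<kappa> * Q * G) + ?p * M2 * (2 * Pb * G))
        \<le> \<bar>C\<^sub>0\<bar> * h\<^sup>2 * (d' * ?V) + \<kappa> * h\<^sup>2 * (2 * (d' * ?V) + T * M1) + (h\<^sup>2 * M1 * (\<kappa> * Q * G) + ?p * M2 * (2 * Pb * G))"
        by (intro add_mono init ritz0 order_refl)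
      also have "\<bar>C\<^sub>0\<bar> * h\<^sup>2 * (d' * ?V) + \<kappa> * h\<^sup>2 * (2 * (d' * ?V) + T * M1)
          + (h\<^sup>2 * M1 * (\<kappa> * Q * G) + ?p * M2 * (2 * Pb * G))
        = h\<^sup>2 * ?V * (d' * (\<bar>C\<^sub>0\<bar> + 2 * \<kappa>)) + h\<^sup>2 * M1 * (\<kappa> * T + \<kappa> * Q * G) + ?p * M2 * (2 * Pb * G)"
        by (simp add: algebra_simps)
      also have "\<dots> \<le> h\<^sup>2 * ?V * C + h\<^sup>2 * M1 * C + ?p * M2 * C"
        using V0 M by (intro add_mono mult_left_mono parts mult_nonneg_nonneg) auto
      also have "\<dots> = C * (h\<^sup>2 * (?V + M1) + ?p * M2)" by (simp add: algebra_simps)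
      finally have "ennreal (norm (u (real n * \<tau>) - U n)) \<le> ennreal (C * (h\<^sup>2 * (?V + M1) + ?p * M2))"
        by (rule ennreal_leI)
      also have "\<dots> = ennreal C * (ennreal (h\<^sup>2) * (ennreal ?V + 0 + ennreal M1) + ennreal ?p * ennreal M2)"
        using V0 M parts(4) by (simp add: ennreal_mult ennreal_plus)
      also have "\<dots> \<le> ?R" unfolding M(2,4)
        by (intro mult_left_mono add_mono order_refl) auto
      finally show ?thesis .
    qed
  qed
qed

end
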